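(* Assume the standing setting described in the context. Let $\Theta_{\min}=\operatorname{argmin}_{\theta\in\Theta}V(\theta)$. Then for any open set $U\subset\Theta$ containing $\Theta_{\min}$, for $\nu$-almost every $y\in\mathcal{Y}$, \[ \lim_{n\to\infty}\pi_n(\Theta\setminus U\mid y)=0. \]
   Context: Observed system: $\mathcal{Y}$ is a complete separable metric space with its Borel $\sigma$-algebra, $T:\mathcal{Y}\to\mathcal{Y}$ is Borel measurable, and $\nu$ is a $T$-invariant ergodic Borel probability measure on $\mathcal{Y}$. Model system: $\mathcal{X}\subset\mathcal{A}^{\mathbb{Z}}$ ($\mathcal{A}$ a finite alphabet) is a mixing shift of finite type. That is, $\mathcal{X}$ is the set of sequences avoiding a fixed finite set of forbidden words, and for any two words $u,v$ occurring in $\mathcal{X}$ there is $N$ such that for all $m\ge N$ some word $w$ of length $m$ makes $uwv$ occur in $\mathcal{X}$. The map $S$ is the left shift $(Sx)_i=x_{i+1}$. The metric is $d_{\mathcal{X}}(x,y)=2^{-n(x,y)}$ with $n(x,y)=\inf\{|m|:x_m\ne y_m\}$. $C^r(\mathcal{X})$ denotes the $r$-Hölder functions with norm $\|f\|_r=\sup|f|+\sup_{x\ne y}|f(x)-f(y)|/d_{\mathcal{X}}(x,y)^r$. Parameter family: $\Theta$ is a compact metric space (metric $d_\Theta$). $\{f_\theta\}_{\theta\in\Theta}$ is a regular family: for some $r>0$ all $f_\theta\in C^r(\mathcal{X})$ and $\theta\mapsto f_\theta$ is $\|\cdot\|_r$-continuous. $\mu_\theta$ is the unique $S$-invariant Gibbs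 measure of $f_\theta$: there are $K>0$ and the pressure $\mathcal{P}(f_\theta)$ with \[ K^{-1}\le\mu_\theta(x[0,m-1])\big/\exp\bigl(-m\mathcal{P}(f_\theta)+\textstyle\sum_{k<m}f_\theta(S^kx)\bigr)\le K \] for all $x$ and $m\ge1$. Here $x[0,m-1]$ is the cylinder $\{z:z_i=x_i,0\le i<m\}$, and $\mathcal{P}(f)=\sup\{\int f\,d\mu+h(\mu)\}$ over $S$-invariant probability measures $\mu$, with $h$ the Kolmogorov–Sinai entropy. Loss: $\ell:\Theta\times\mathcal{X}\times\mathcal{Y}\to\mathbb{R}$ satisfies the following. - (i) $\ell$ is continuous. - (ii) There is a measurable $\ell^*$ with $\sup_{\theta,x}|\ell(\theta,x,y)|\le\ell^*(y)$ and $\int\ell^*d\nu<\infty$. - (iii) For each $\delta>0$ there is a measurable $\rho_\delta:\mathcal{Y}\to(0,\infty)$ bounding $|\ell(\theta,x,y)-\ell(\theta',x',y)|$ whenever $\max(d_\Theta(\theta,\theta'),d_{\mathcal{X}}(x,x'))\le\delta$, with $\int\rho_\delta d\nu\to0$ as $\delta\to0^+$. Set $\ell_n(\theta,x,y)=\sum_{k=0}^{n-1}\ell(\theta,S^kx,T^ky)$. Gibbs posterior: $\pi_0$ is a fully supported Borel probability measure on $\Theta$, and $P_0(E)=\int\int\mathbf{1}_E(\theta,x)\,d\mu_\theta(x)\,d\pi_0(\theta)$. Let $Z_n(y)=\int e^{-\ell_n(\theta,x,y)}dP_0$ and $P_n(E\mid y)=Z_n(y)^{-1}\int_E e^{-\ell_n(\theta,x,y)}dP_0(\theta,x)$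 for Borel $E\subset\Theta\times\mathcal{X}$. The Gibbs posterior on $\Theta$ is $\pi_n(E\mid y)=P_n(E\times\mathcal{X}\mid y)$. Rate function: $\mathcal{J}(S:\nu)$ is the set of $S\times T$-invariant Borel probability measures on $\mathcal{X}\times\mathcal{Y}$ with $\mathcal{Y}$-marginal $\nu$. Each $\lambda$ in it disintegrates as $\lambda=\int\lambda_y\otimes\delta_y\,d\nu(y)$. For a finite measurable partition $\alpha$ of $\mathcal{X}$, let $H(\eta,\alpha)=-\sum_{C\in\alpha}\eta(C)\log\eta(C)$, $\alpha_n=\bigvee_{k<n}S^{-k}\alpha$, and $h^\nu(\lambda,\alpha)=\lim_n\frac1n\int H(\lambda_y,\alpha_n)d\nu(y)$. The fiber entropy is $h^\nu(\lambda)=\sup_\alpha h^\nu(\lambda,\alpha)$. Define $D(\lambda:\mu_\theta)=\mathcal{P}(f_\theta)-h^\nu(\lambda)-\int f_\theta\,d\lambda$ and \[ V(\theta)=\inf\Bigl\{\int\ell(\theta,x,y)\,d\lambda(x,y)+D(\lambda:\mu_\theta):\lambda\in\mathcal{J}(S:\nu)\Bigr\}. \] *)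

theory Defs
  imports "HOL-Probability.Probability"
begin

definition shift :: "(int \<Rightarrow> 'a) \<Rightarrow> (int \<Rightarrow> 'a)" where
  "shift x = (\<lambda>i. x (i + 1))"

definition dX :: "(int \<Rightarrow> 'a) \<Rightarrow> (int \<Rightarrow> 'a) \<Rightarrow> real" where
  "dX x y = (if x = y then 0 else (1/2) ^ (LEAST n. \<exists>i. nat \<bar>i\<bar> = n \<and> x i \<noteq> y i))"

definition occurs_in :: "'a list \<Rightarrow> (int \<Rightarrow> 'a) \<Rightarrow> bool" where
  "occurs_in w x \<longleftrightarrow> (\<exists>i. \<forall>j<length w. x (i + int j) = w ! j)"

definition mixing_SFT :: "(int \<Rightarrow> 'a::finite) set \<Rightarrow> bool" where
  "mixing_SFT X \<longleftrightarrow>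
     (\<exists>F :: 'a list set. finite F \<and> X = {x. \<forall>w\<in>F. \<not> occurs_in w x}) \<and>
     (\<forall>u v. (\<exists>x\<in>X. occurs_in u x) \<and> (\<exists>x\<in>X. occurs_in v x) \<longrightarrow>
        (\<exists>N. \<forall>m\<ge>N. \<exists>w. length w = m \<and> (\<exists>x\<in>X. occurs_in (u @ w @ v) x)))"

text \<open>Borel sigma-algebra of X for the metric dX: generated by the cylinder sets.\<close>
definition Xmeas :: "(int \<Rightarrow> 'a) set \<Rightarrow> (int \<Rightarrow> 'a) measure" where
  "Xmeas X = sigma X {X \<inter> {z. \<forall>i\<in>{a..b}. z i = w i} | a b w. True}"

definition cyl :: "(int \<Rightarrow> 'a) set \<Rightarrow> (int \<Rightarrow> 'a) \<Rightarrow> nat \<Rightarrow> (int \<Rightarrow> 'a) set" where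
  "cyl X x m = {z\<in>X. \<forall>i. 0 \<le> i \<and> i < int m \<longrightarrow> z i = x i}"

definition holder :: "real \<Rightarrow> (int \<Rightarrow> 'a) set \<Rightarrow> ((int \<Rightarrow> 'a) \<Rightarrow> real) \<Rightarrow> bool" where
  "holder r X f \<longleftrightarrow> (\<exists>B. \<forall>x\<in>X. \<bar>f x\<bar> \<le> B) \<and>
     (\<exists>C. \<forall>x\<in>X. \<forall>y\<in>X. \<bar>f x - f y\<bar> \<le> C * dX x y powr r)"

definition holder_norm :: "real \<Rightarrow> (int \<Rightarrow> 'a) set \<Rightarrow> ((int \<Rightarrow> 'a) \<Rightarrow> real) \<Rightarrow> real" where
  "holder_norm r X f = (SUP x\<in>X. \<bar>f x\<bar>) +
     (SUP p\<in>{(x,y). x\<in>X \<and> y\<in>X \<and> x \<noteq> y}. \<bar>f (fst p) - f (snd p)\<bar> / dX (fst p) (snd p) powr r)"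

definition regular_family :: "real \<Rightarrow> (int \<Rightarrow> 'a) set \<Rightarrow> ('p::metric_space \<Rightarrow> (int \<Rightarrow> 'a) \<Rightarrow> real) \<Rightarrow> bool" where
  "regular_family r X f \<longleftrightarrow> r > 0 \<and> (\<forall>\<theta>. holder r X (f \<theta>)) \<and>
     (\<forall>\<theta>. ((\<lambda>\<theta>'. holder_norm r X (\<lambda>x. f \<theta>' x - f \<theta> x)) \<longlongrightarrow> 0) (at \<theta>))"

definition fin_partition :: "(int \<Rightarrow> 'a) set \<Rightarrow> (int \<Rightarrow> 'a) set set \<Rightarrow> bool" where
  "fin_partition X \<alpha> \<longleftrightarrow> finite \<alpha> \<and> \<alpha> \<subseteq> sets (Xmeas X) \<and> \<Union>\<alpha> = X \<and>
     (\<forall>C\<in>\<alpha>. \<forall>D\<in>\<alpha>. C \<noteq> D \<longrightarrow> C \<inter> D = {})"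

definition join_n :: "(int \<Rightarrow> 'a) set \<Rightarrow> (int \<Rightarrow> 'a) set set \<Rightarrow> nat \<Rightarrow> (int \<Rightarrow> 'a) set set" where
  "join_n X \<alpha> n = {X \<inter> (\<Inter>k<n. (shift ^^ k) -` c k) | c. \<forall>k<n. c k \<in> \<alpha>}"

definition Hpart :: "'b measure \<Rightarrow> 'b set set \<Rightarrow> real" where
  "Hpart \<eta> \<alpha> = - (\<Sum>C\<in>\<alpha>. (if measure \<eta> C = 0 then 0 else measure \<eta> C * ln (measure \<eta> C)))"

definition fin_partitions :: "(int \<Rightarrow> 'a) set \<Rightarrow> (int \<Rightarrow> 'a) set set set" where
  "fin_partitions X = {\<alpha>. fin_partition X \<alpha>}"

definition KS_entropy :: "(int \<Rightarrow> 'a) set \<Rightarrow> (int \<Rightarrow> 'a) measure \<Rightarrow> real" where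
  "KS_entropy X \<mu> = (SUP \<alpha>\<in>fin_partitions X. lim (\<lambda>n. Hpart \<mu> (join_n X \<alpha> n) / real n))"

definition shift_inv_probs :: "(int \<Rightarrow> 'a) set \<Rightarrow> (int \<Rightarrow> 'a) measure set" where
  "shift_inv_probs X = {\<mu>. prob_space \<mu> \<and> sets \<mu> = sets (Xmeas X) \<and>
      (\<forall>A\<in>sets (Xmeas X). measure \<mu> (shift -` A \<inter> X) = measure \<mu> A)}"

definition pressure :: "(int \<Rightarrow> 'a) set \<Rightarrow> ((int \<Rightarrow> 'a) \<Rightarrow> real) \<Rightarrow> real" where
  "pressure X f = (SUP \<mu>\<in>shift_inv_probs X. (\<integral>x. f x \<partial>\<mu>) + KS_entropy X \<mu>)"

definition gibbs_measure :: "(int \<Rightarrow> 'a) set \<Rightarrow> ((int \<Rightarrow> 'a) \<Rightarrow> real) \<Rightarrow> (int \<Rightarrow> 'a) measure \<Rightarrow> bool" where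
  "gibbs_measure X f \<mu> \<longleftrightarrow> \<mu> \<in> shift_inv_probs X \<and>
     (\<exists>K>0. \<forall>x\<in>X. \<forall>m\<ge>1.
        inverse K \<le> measure \<mu> (cyl X x m) / exp (- real m * pressure X f + (\<Sum>k<m. f ((shift ^^ k) x))) \<and>
        measure \<mu> (cyl X x m) / exp (- real m * pressure X f + (\<Sum>k<m. f ((shift ^^ k) x))) \<le> K)"

definition joinings :: "(int \<Rightarrow> 'a) set \<Rightarrow> ('y::topological_space) measure \<Rightarrow> ('y \<Rightarrow> 'y)
     \<Rightarrow> ((int \<Rightarrow> 'a) \<times> 'y) measure set" where
  "joinings X \<nu> T = {jn. prob_space jn \<and> sets jn = sets (Xmeas X \<Otimes>\<^sub>M borel) \<and>
      (\<forall>A\<in>sets jn. measure jn ((\<lambda>(x,y). (shift x, T y)) -` A \<inter> space jn) = measure jn A) \<and>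
      distr jn borel snd = \<nu>}"

definition disintegration :: "(int \<Rightarrow> 'a) set \<Rightarrow> ('y::topological_space) measure
     \<Rightarrow> ((int \<Rightarrow> 'a) \<times> 'y) measure \<Rightarrow> ('y \<Rightarrow> (int \<Rightarrow> 'a) measure) \<Rightarrow> bool" where
  "disintegration X \<nu> jn \<kappa> \<longleftrightarrow>
     (\<forall>y. prob_space (\<kappa> y) \<and> sets (\<kappa> y) = sets (Xmeas X)) \<and>
     (\<forall>A\<in>sets (Xmeas X). (\<lambda>y. measure (\<kappa> y) A) \<in> borel_measurable borel) \<and>
     (\<forall>A\<in>sets (Xmeas X). \<forall>B\<in>sets borel.
        measure jn (A \<times> B) = (\<integral>y. indicator B y * measure (\<kappa> y) A \<partial>\<nu>))"

definition fiber_entropy :: "(int \<Rightarrow> 'a) set \<Rightarrow> 'y measure \<Rightarrow> ('y \<Rightarrow> (int \<Rightarrow> 'a) measure) \<Rightarrow> real" where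
  "fiber_entropy X \<nu> \<kappa> = (SUP \<alpha>\<in>fin_partitions X.
       lim (\<lambda>n. (\<integral>y. Hpart (\<kappa> y) (join_n X \<alpha> n) \<partial>\<nu>) / real n))"

text \<open>Rate function V(theta); the fiber entropy is computed from a disintegration of lambda
  (which is unique nu-a.e., so h^nu(lambda) does not depend on the choice).\<close>
definition rate_V :: "(int \<Rightarrow> 'a) set \<Rightarrow> ('y::topological_space) measure \<Rightarrow> ('y \<Rightarrow> 'y)
     \<Rightarrow> ('p \<Rightarrow> (int \<Rightarrow> 'a) \<Rightarrow> real) \<Rightarrow> ('p \<Rightarrow> (int \<Rightarrow> 'a) \<Rightarrow> 'y \<Rightarrow> real) \<Rightarrow> 'p \<Rightarrow> real" where
  "rate_V X \<nu> T f L \<theta> = (INF p\<in>{(jn, \<kappa>). jn \<in> joinings X \<nu> T \<and> disintegration X \<nu> jn \<kappa>}.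
      (\<integral>z. L \<theta> (fst z) (snd z) \<partial>(fst p))
      + (pressure X (f \<theta>) - fiber_entropy X \<nu> (snd p) - (\<integral>z. f \<theta> (fst z) \<partial>(fst p))))"

definition loss_n :: "('p \<Rightarrow> (int \<Rightarrow> 'a) \<Rightarrow> 'y \<Rightarrow> real) \<Rightarrow> ('y \<Rightarrow> 'y) \<Rightarrow> nat \<Rightarrow> 'p \<Rightarrow> (int \<Rightarrow> 'a) \<Rightarrow> 'y \<Rightarrow> real" where
  "loss_n L T n \<theta> x y = (\<Sum>k<n. L \<theta> ((shift ^^ k) x) ((T ^^ k) y))"

text \<open>Z_n(y) = int exp(-l_n) dP_0, with P_0 = int mu_theta d pi_0(theta).\<close>
definition Zn :: "'p measure \<Rightarrow> ('p \<Rightarrow> (int \<Rightarrow> 'a) measure) \<Rightarrow> ('p \<Rightarrow> (int \<Rightarrow> 'a) \<Rightarrow> 'y \<Rightarrow> real)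
    \<Rightarrow> ('y \<Rightarrow> 'y) \<Rightarrow> nat \<Rightarrow> 'y \<Rightarrow> real" where
  "Zn \<pi>0 \<mu> L T n y = (\<integral>\<theta>. (\<integral>x. exp (- loss_n L T n \<theta> x y) \<partial>\<mu> \<theta>) \<partial>\<pi>0)"

text \<open>pi_n(E | y) = P_n(E x X | y).\<close>
definition posterior :: "'p measure \<Rightarrow> ('p \<Rightarrow> (int \<Rightarrow> 'a) measure) \<Rightarrow> ('p \<Rightarrow> (int \<Rightarrow> 'a) \<Rightarrow> 'y \<Rightarrow> real)
    \<Rightarrow> ('y \<Rightarrow> 'y) \<Rightarrow> nat \<Rightarrow> 'p set \<Rightarrow> 'y \<Rightarrow> real" where
  "posterior \<pi>0 \<mu> L T n E y =
     (\<integral>\<theta>. indicator E \<theta> * (\<integral>x. exp (- loss_n L T n \<theta> x y) \<partial>\<mu> \<theta>) \<partial>\<pi>0) / Zn \<pi>0 \<mu> L T n y"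

end

theory Submission
  imports Defs
begin

text \<open>Put \<open>G\<^sub>\<theta> = f\<^sub>\<theta> - P(f\<^sub>\<theta>) - L\<^sub>\<theta>\<close>. By the Gibbs property the integral of \<open>exp (- \<ell>\<^sub>n)\<close> against \<open>\<mu>\<^sub>\<theta>\<close> is, up to a
  constant, the partition sum over words \<open>w\<close> of length \<open>n\<close> of \<open>exp\<close> of the sum of \<open>G\<^sub>\<theta>\<close> along the orbit
  of a point of the cylinder of \<open>w\<close> and of \<open>y\<close>. The logarithm of this sum is subadditive over \<open>(\<nu>, T)\<close> up to
  errors that vanish after division by \<open>n\<close>, and superadditive because words can be glued with a bounded gap, so it
  grows like \<open>n p(\<theta>)\<close> for \<open>\<nu>\<close>-almost every \<open>y\<close>. A variational principle for the fiber entropy gives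
  \<open>p(\<theta>) = - V(\<theta>)\<close>: the upper bound follows from Gibbs' inequality, and a subsequential (filter) limit of the empirical
  averages of the weights is an optimal joining.

  The constant in the Gibbs property can be chosen uniformly in \<open>\<theta>\<close>, since by the Hoelder bounds the
  normalised potential admits a Gibbs measure with an explicit constant, and two Gibbs measures of the same
  potential coincide. Since \<open>p\<close> is continuous and \<open>\<Theta>\<close> is compact, finitely many
  small balls cover the complement of \<open>U\<close>, on which the likelihood is exponentially smaller than near a minimiser
  of \<open>V\<close>, which has positive prior mass.\<close>


section \<open>Birkhoff sums over an ergodic system\<close>

text \<open>Two obstacles shape the proof. The loss is controlled only by an integrable envelope and
  the modulus \<open>\<rho>\<close>, so there is no bounded distortion on fibers: along two points
  of one cylinder the sums may differ by an error linear in \<open>n\<close>, whose slope is small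
  only on average and for a large window radius \<open>M\<close>. Hence estimates carry a free
  \<open>M\<close> that is sent to infinity after \<open>n\<close>. Moreover the observation space
  need not be compact and the loss need not be bounded, so empirical measures on the product have no
  ready weak limits. Instead all bounded sequences converge along one filter; the limit functional
  still has marginal \<nu>, and this domination yields Radon-Nikodym densities of cylinders and from
  them a kernel. Optimality of the limit is recorded by inequalities with fixed test weights, which
  pass to the limit where the entropy might not; the entropy returns on inserting the smoothed fiber
  laws of the limit itself. Finally, no regularity of \<open>\<mu> \<theta>\<close> in \<theta> is
  assumed, so the posterior is bounded by pointwise likelihood estimates valid on small balls of
  parameters.\<close>

definition birkhoff_sum :: "('y \<Rightarrow> 'y) \<Rightarrow> ('y \<Rightarrow> real) \<Rightarrow> nat \<Rightarrow> 'y \<Rightarrow> real" where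
  "birkhoff_sum T u n y = (\<Sum>k<n. u ((T ^^ k) y))"

lemma birkhoff_sum_0 [simp]: "birkhoff_sum T u 0 y = 0"
  by (simp add: birkhoff_sum_def)

lemma birkhoff_sum_Suc': "birkhoff_sum T u (Suc n) y = u y + birkhoff_sum T u n (T y)"
  by (simp only: birkhoff_sum_def sum.lessThan_Suc_shift) (simp add: funpow_swap1)

lemma birkhoff_sum_diff: "m \<le> n \<Longrightarrow> birkhoff_sum T u n y - birkhoff_sum T u m y = (\<Sum>k=m..<n. u ((T ^^ k) y))"
  unfolding birkhoff_sum_def by (metis atLeast0LessThan diff_add_cancel sum_diff_nat_ivl zero_le)

lemma tendsto_div_diff_const:
  fixes a :: "nat \<Rightarrow> real"
  assumes "(\<lambda>n. a n / real n) \<longlonglongrightarrow> c"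
  shows "(\<lambda>n. a (n - k) / real n) \<longlonglongrightarrow> c"
proof -
  have "filterlim (\<lambda>n. real n) at_top sequentially" by (rule filterlim_real_sequentially)
  then have "(\<lambda>n. real k / real n) \<longlonglongrightarrow> 0"
    by (intro tendsto_divide_0[OF tendsto_const] filterlim_at_top_imp_at_infinity)
  then have "(\<lambda>n. 1 / (1 + real k / real n)) \<longlonglongrightarrow> 1 / (1 + 0)"
    by (intro tendsto_intros) auto
  from tendsto_mult[OF assms this]
  have "(\<lambda>n. a n / real n * (1 / (1 + real k / real n))) \<longlonglongrightarrow> c" by simp
  moreover have "eventually (\<lambda>n. a n / real n * (1 / (1 + real k / real n)) = a n / real (n + k)) sequentially"
    using eventually_gt_at_top[of 0] by eventually_elim (simp add: divide_simps)
  ultimately have "(\<lambda>n. a n / real (n + k)) \<longlonglongrightarrow> c"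
    by (rule Lim_transform_eventually)
  then have "(\<lambda>n. a (n + k - k) / real (n + k)) \<longlonglongrightarrow> c" by simp
  then show ?thesis by (rule LIMSEQ_offset[where k = k and f = "\<lambda>n. a (n - k) / real n"])
qed

text \<open>For each phase \<open>s < L\<close>, cut the integers from \<open>s\<close> on into
  consecutive blocks of length \<open>L\<close>. Blocks cost \<open>\<phi>\<close>; the single steps
  before the first and after the last block cost \<open>b\<close>. Summing over all phases uses
  every block start exactly once, which is why a plain sum of \<open>\<phi>\<close> appears. It
  serves both the pressure (\<open>block_limsup\<close>) and the entropy of empirical weights
  (\<open>weight_entropy_blocks\<close>).\<close>

lemma block_sum_bound:
  fixes u :: "nat \<Rightarrow> real" and \<phi> b :: "nat \<Rightarrow> real"
  assumes L: "L > 0" and b: "\<And>k. 0 \<le> b k" and u0: "u 0 \<le> 0"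
    and u1: "\<And>n. u (Suc n) \<le> u n + b n" and uL: "\<And>n. u (n + L) \<le> u n + \<phi> n"
  shows "L * u n \<le> (\<Sum>k<n - (L - 1). \<phi> k) + L * ((\<Sum>k<L. b k) + (\<Sum>k=n-L..<n. b k))"
proof -
  let ?B1 = "\<Sum>k<L. b k" and ?B2 = "\<Sum>k=n-L..<n. b k"
  have ub: "u (m + t) \<le> u m + (\<Sum>k=m..<m+t. b k)" for m t
  proof (induction t)
    case (Suc t)
    have "(\<Sum>k=m..<m + Suc t. b k) = (\<Sum>k=m..<m + t. b k) + b (m + t)" by simp
    moreover have "u (m + Suc t) \<le> u (m + t) + b (m + t)" unfolding add_Suc_right by (rule u1)
    ultimately show ?case using Suc by linarith
  qed simp
  have uj: "u (s + j * L) \<le> u s + (\<Sum>i<j. \<phi> (s + i * L))" for s j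
  proof (induction j)
    case (Suc j)
    have "u (s + Suc j * L) \<le> u (s + j * L) + \<phi> (s + j * L)" using uL[of "s + j * L"] by (simp add: algebra_simps)
    then show ?case using Suc by simp
  qed simp
  have part: "u n \<le> (\<Sum>i<(n - s) div L. \<phi> (s + i * L)) + (?B1 + ?B2)" if s: "s < L" for s
  proof (cases "s \<le> n")
    case True
    let ?j = "(n - s) div L"
    let ?m = "s + ?j * L"
    have mn: "?m \<le> n" using True div_times_less_eq_dividend[of "n - s" L] by linarith
    have md: "(n - s) mod L < L" using L by simp
    have "?j * L + (n - s) mod L = n - s" by simp
    then have mL: "n - L \<le> ?m" using md True by linarith
    have "u n \<le> u ?m + (\<Sum>k=?m..<n. b k)" using ub[of ?m "n - ?m"] mn by simp
    also have "(\<Sum>k=?m..<n. b k) \<le> ?B2" by (rule sum_mono2) (use mL b in auto)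
    also have "u ?m \<le> u s + (\<Sum>i<?j. \<phi> (s + i * L))" by (rule uj)
    also have "u s \<le> (\<Sum>k=0..<s. b k)" using ub[of 0 s] u0 by simp
    also have "\<dots> \<le> ?B1" by (rule sum_mono2) (use s b in auto)
    finally show ?thesis by simp
  next
    case False
    have "u n \<le> (\<Sum>k=0..<n. b k)" using ub[of 0 n] u0 by simp
    also have "\<dots> \<le> ?B1" by (rule sum_mono2) (use s b False in auto)
    also have "\<dots> \<le> ?B1 + ?B2" using sum_nonneg[of "{n-L..<n}" b] b by simp
    finally show ?thesis using False by simp
  qed
  have "L * u n = (\<Sum>s<L. u n)" by simp
  also have "\<dots> \<le> (\<Sum>s<L. (\<Sum>i<(n - s) div L. \<phi> (s + i * L)) + (?B1 + ?B2))"
    by (intro sum_mono part) simp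
  also have "\<dots> = (\<Sum>s<L. \<Sum>i<(n - s) div L. \<phi> (s + i * L)) + L * (?B1 + ?B2)"
    by (simp add: sum.distrib)
  also have "(\<Sum>s<L. \<Sum>i<(n - s) div L. \<phi> (s + i * L)) =
      (\<Sum>(s, i)\<in>Sigma {..<L} (\<lambda>s. {..<(n - s) div L}). \<phi> (s + i * L))"
    by (subst sum.Sigma) auto
  \<comment> \<open>Division with remainder is a bijection between pairs of phase and block index
    and block starts; a block starting at \<open>k\<close> fits below \<open>n\<close> iff
    \<open>k + L \<le> n\<close>, that is \<open>k < n - (L - 1)\<close>, also with truncated
    subtraction.\<close>
  also have "\<dots> = (\<Sum>k<n - (L - 1). \<phi> k)"
  proof (rule sum.reindex_bij_witness[where i = "\<lambda>k. (k mod L, k div L)" and j = "\<lambda>(s, i). s + i * L"])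
    fix a assume "a \<in> Sigma {..<L} (\<lambda>s. {..<(n - s) div L})"
    then obtain s i where a: "a = (s, i)" "s < L" "i < (n - s) div L" by auto
    then have "Suc i * L \<le> (n - s) div L * L" by (intro mult_le_mono1) simp
    also have "\<dots> \<le> n - s" by simp
    finally have "s + i * L < n - (L - 1)" using a(2) L by (simp only: mult_Suc)
    then show "(case a of (s, i) \<Rightarrow> s + i * L) \<in> {..<n - (L - 1)}" using a by simp
    show "((case a of (s, i) \<Rightarrow> s + i * L) mod L, (case a of (s, i) \<Rightarrow> s + i * L) div L) = a"
      using a L by auto
  next
    fix k assume "k \<in> {..<n - (L - 1)}"
    then have k: "k + L \<le> n" using L by auto
    have "k mod L + k div L * L = k" by simp
    then have "Suc (k div L) * L \<le> n - k mod L" using k by (simp only: mult_Suc)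
    then have "Suc (k div L) \<le> (n - k mod L) div L" using div_le_mono[of "Suc (k div L) * L" _ L] L by (metis nonzero_mult_div_cancel_right less_not_refl2)
    then show "(k mod L, k div L) \<in> Sigma {..<L} (\<lambda>s. {..<(n - s) div L})" using L by auto
  qed auto
  finally show ?thesis .
qed

locale ergodic_system = prob_space \<nu> for \<nu> :: "'y::topological_space measure" +
  fixes T :: "'y \<Rightarrow> 'y"
  assumes sets_nu: "sets \<nu> = sets borel"
    and T_borel: "T \<in> borel_measurable borel"
    and T_invariant: "\<And>A. A \<in> sets borel \<Longrightarrow> measure \<nu> (T -` A) = measure \<nu> A"
    and T_ergodic: "\<And>A. A \<in> sets borel \<Longrightarrow> T -` A = A \<Longrightarrow> measure \<nu> A = 0 \<or> measure \<nu> A = 1"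
begin

lemma space_nu [simp]: "space \<nu> = UNIV"
  using sets_eq_imp_space_eq[OF sets_nu] by simp

lemma T_measurable [measurable]: "T \<in> measurable \<nu> \<nu>"
  using T_borel by (simp cong: measurable_cong_sets add: sets_nu)

lemma funpow_measurable [measurable]: "(T ^^ k) \<in> measurable \<nu> \<nu>"
  by (induction k) (simp_all add: measurable_compose[OF _ T_measurable] comp_def)

lemma distr_T: "distr \<nu> \<nu> T = \<nu>"
proof (rule measure_eqI)
  fix A assume "A \<in> sets (distr \<nu> \<nu> T)"
  then have A: "A \<in> sets \<nu>" by simp
  then have "emeasure (distr \<nu> \<nu> T) A = emeasure \<nu> (T -` A)" by (simp add: emeasure_distr)
  also have "\<dots> = emeasure \<nu> A"
    using T_invariant[of A] A by (simp add: emeasure_eq_measure sets_nu)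
  finally show "emeasure (distr \<nu> \<nu> T) A = emeasure \<nu> A" .
qed simp

lemma distr_funpow: "distr \<nu> \<nu> (T ^^ k) = \<nu>"
proof (induction k)
  case 0
  then show ?case by (simp add: distr_id2 id_def)
next
  case (Suc k)
  have "distr \<nu> \<nu> (T ^^ Suc k) = distr (distr \<nu> \<nu> (T ^^ k)) \<nu> T"
    by (subst distr_distr) auto
  then show ?case by (simp only: Suc distr_T)
qed

lemma integrable_funpow [simp, intro]:
  fixes u :: "'y \<Rightarrow> real"
  assumes "integrable \<nu> u" shows "integrable \<nu> (\<lambda>y. u ((T ^^ k) y))"
  using integrable_distr_eq[of "T ^^ k" \<nu> \<nu> u] assms distr_funpow[of k] by (auto dest: borel_measurable_integrable)

lemma integral_funpow:
  fixes u :: "'y \<Rightarrow> real"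
  assumes "u \<in> borel_measurable \<nu>" shows "(\<integral>y. u ((T ^^ k) y) \<partial>\<nu>) = (\<integral>y. u y \<partial>\<nu>)"
  using integral_distr[of "T ^^ k" \<nu> \<nu> u] assms distr_funpow[of k] by auto

lemma integrable_birkhoff_sum [simp, intro]:
  assumes "integrable \<nu> u" shows "integrable \<nu> (birkhoff_sum T u n)"
  unfolding birkhoff_sum_def using assms by auto

lemma integral_birkhoff_sum:
  assumes "integrable \<nu> u" shows "(\<integral>y. birkhoff_sum T u n y \<partial>\<nu>) = n * (\<integral>y. u y \<partial>\<nu>)"
  unfolding birkhoff_sum_def using assms
  by (subst Bochner_Integration.integral_sum) (auto simp: integral_funpow)

text \<open>The running maximum \<open>M\<^sub>n\<close> of the Birkhoff sums satisfies \<open>M\<^sub>n\<^sub>+\<^sub>1 = max 0 (u + M\<^sub>n \<circ> T)\<close>;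
  where the sums are unbounded, \<open>M\<^sub>n\<^sub>+\<^sub>1 - M\<^sub>n \<circ> T\<close> decreases to \<open>u\<close> while its integral is nonnegative.\<close>

primrec running_max :: "('y \<Rightarrow> real) \<Rightarrow> nat \<Rightarrow> 'y \<Rightarrow> real" where
  "running_max u 0 y = 0"
| "running_max u (Suc n) y = max 0 (u y + running_max u n (T y))"

lemma running_max_nonneg: "0 \<le> running_max u n y"
  by (cases n) auto

lemma running_max_ge: "k \<le> n \<Longrightarrow> birkhoff_sum T u k y \<le> running_max u n y"
proof (induction n arbitrary: k y)
  case (Suc n)
  show ?case
  proof (cases k)
    case (Suc j)
    then have "birkhoff_sum T u j (T y) \<le> running_max u n (T y)" using Suc.IH Suc.prems by simp
    then show ?thesis using Suc by (simp add: birkhoff_sum_Suc')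
  qed (simp add: running_max_nonneg)
qed simp

lemma running_max_mono: "running_max u n y \<le> running_max u (Suc n) y"
proof (induction n arbitrary: y)
  case (Suc n)
  have "running_max u n (T y) \<le> running_max u (Suc n) (T y)" using Suc .
  then show ?case by (simp del: running_max.simps(2) add: running_max.simps(2)[of u n y] running_max.simps(2)[of u "Suc n" y])
qed simp

lemma integrable_running_max:
  assumes "integrable \<nu> u" shows "integrable \<nu> (running_max u n)"
proof (induction n)
  case (Suc n)
  then have "integrable \<nu> (\<lambda>y. running_max u n ((T ^^ 1) y))" by (rule integrable_funpow)
  then have "integrable \<nu> (\<lambda>y. max 0 (u y + running_max u n (T y)))" using assms by simp
  then show ?case by (simp cong: integrable_cong)
qed simp

text \<open>The set where the sums are unbounded above is strictly invariant, since passing to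
  \<open>T y\<close> changes them by the fixed amount \<open>u y\<close>. By ergodicity it is null
  or full; if it were full, the running maximum would force the mean of \<open>u\<close> to be
  nonnegative.\<close>

lemma birkhoff_sum_bounded:
  assumes u: "integrable \<nu> u" and neg: "(\<integral>y. u y \<partial>\<nu>) < 0"
  shows "AE y in \<nu>. \<exists>C. \<forall>n. birkhoff_sum T u n y \<le> C"
proof -
  have [measurable]: "u \<in> borel_measurable \<nu>" using u by auto
  have bm [measurable]: "birkhoff_sum T u n \<in> borel_measurable \<nu>" for n
    using integrable_birkhoff_sum[OF u] by auto
  \<comment> \<open>Unboundedness is quantified over natural constants to keep \<open>A\<close>
    measurable; \<open>Aiff\<close> then restores real constants.\<close>
  define A where "A = {y \<in> space \<nu>. \<forall>C::nat. \<exists>n. birkhoff_sum T u n y > real C}"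
  have A_meas: "A \<in> sets \<nu>" unfolding A_def by measurable
  have Aiff: "y \<in> A \<longleftrightarrow> (\<forall>C::real. \<exists>n. birkhoff_sum T u n y > C)" for y
  proof
    assume y: "y \<in> A"
    show "\<forall>C::real. \<exists>n. birkhoff_sum T u n y > C"
    proof
      fix C :: real
      obtain m :: nat where "C \<le> m" using real_arch_simple by blast
      moreover obtain n where "birkhoff_sum T u n y > m" using y unfolding A_def by blast
      ultimately show "\<exists>n. birkhoff_sum T u n y > C" by (intro exI[of _ n]) linarith
    qed
  qed (simp add: A_def)
  have inv: "T -` A = A"
  proof (intro set_eqI iffI)
    fix y assume "y \<in> T -` A"
    then have *: "\<exists>n. birkhoff_sum T u n (T y) > C" for C using Aiff[of "T y"] by auto
    show "y \<in> A" unfolding Aiff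
    proof
      fix C from *[of "C - u y"] obtain n where "birkhoff_sum T u n (T y) > C - u y" by auto
      then have "birkhoff_sum T u (Suc n) y > C" by (simp add: birkhoff_sum_Suc')
      then show "\<exists>n. birkhoff_sum T u n y > C" by blast
    qed
  next
    fix y assume "y \<in> A"
    then have *: "\<exists>n. birkhoff_sum T u n y > C" for C using Aiff[of y] by auto
    have "T y \<in> A" unfolding Aiff
    proof
      fix C from *[of "max 0 (C + u y)"] obtain n where n: "birkhoff_sum T u n y > max 0 (C + u y)" by auto
      then obtain m where "n = Suc m" by (cases n) auto
      then have "birkhoff_sum T u m (T y) > C" using n by (simp add: birkhoff_sum_Suc')
      then show "\<exists>n. birkhoff_sum T u n (T y) > C" by blast
    qed
    then show "y \<in> T -` A" by simp
  qed
  have "measure \<nu> A = 0"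
  proof (rule ccontr)
    assume "measure \<nu> A \<noteq> 0"
    then have "measure \<nu> A = 1" using T_ergodic[OF _ inv] A_meas sets_nu by auto
    then have AE_A: "AE y in \<nu>. y \<in> A" using prob_eq_1[OF A_meas] by simp
    \<comment> \<open>This is \<open>running_max u (Suc n) y - running_max u n (T y)\<close> with
      the maximum simplified; once the running maximum at \<open>T y\<close> exceeds
      \<open>- u y\<close>, it equals \<open>u y\<close>.\<close>
    let ?d = "\<lambda>n y. max (- running_max u n (T y)) (u y)"
    have rm: "integrable \<nu> (running_max u n)" for n using integrable_running_max[OF u] .
    have rmT: "integrable \<nu> (\<lambda>y. running_max u n (T y))" for n
      using integrable_funpow[OF rm, of n 1] by (simp del: integrable_max)
    have lim: "(\<lambda>n. \<integral>y. ?d n y \<partial>\<nu>) \<longlonglongrightarrow> (\<integral>y. u y \<partial>\<nu>)"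
    proof (rule integral_dominated_convergence[where w = "\<lambda>y. \<bar>u y\<bar>"])
      show "AE y in \<nu>. (\<lambda>n. ?d n y) \<longlonglongrightarrow> u y"
        using AE_A
      proof eventually_elim
        case (elim y)
        then have "T y \<in> A" using inv by auto
        then obtain k where k: "birkhoff_sum T u k (T y) > - u y" using Aiff[of "T y"] by blast
        have "eventually (\<lambda>n. ?d n y = u y) sequentially"
          using eventually_ge_at_top[of k]
        proof eventually_elim
          case (elim n)
          then have "birkhoff_sum T u k (T y) \<le> running_max u n (T y)" by (rule running_max_ge)
          then show ?case using k by simp
        qed
        then show ?case by (rule tendsto_eventually)
      qed
      show "AE y in \<nu>. norm (?d n y) \<le> \<bar>u y\<bar>" for n
      proof (intro AE_I2)
        fix y show "norm (?d n y) \<le> \<bar>u y\<bar>"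
          using running_max_nonneg[of u n "T y"] by (auto simp: max_def abs_if not_le)
      qed
      show "?d n \<in> borel_measurable \<nu>" for n using rmT[of n] by measurable
    qed (use u in auto)
    have "0 \<le> (\<integral>y. ?d n y \<partial>\<nu>)" for n
    proof -
      have "?d n y = running_max u (Suc n) y - running_max u n (T y)" for y by (auto simp: max_def)
      then have "(\<integral>y. ?d n y \<partial>\<nu>) = (\<integral>y. running_max u (Suc n) y \<partial>\<nu>) - (\<integral>y. running_max u n (T y) \<partial>\<nu>)"
        using rm[of "Suc n"] rmT[of n] by (simp del: running_max.simps)
      also have "(\<integral>y. running_max u n (T y) \<partial>\<nu>) = (\<integral>y. running_max u n y \<partial>\<nu>)"
        using integral_funpow[of "running_max u n" 1] rm[of n] by auto
      also have "(\<integral>y. running_max u (Suc n) y \<partial>\<nu>) - (\<integral>y. running_max u n y \<partial>\<nu>) \<ge> 0"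
        using integral_mono[OF rm[of n] rm[of "Suc n"] running_max_mono] by simp
      finally show ?thesis .
    qed
    then have "0 \<le> (\<integral>y. u y \<partial>\<nu>)" using lim by (intro LIMSEQ_le_const[OF lim]) auto
    then show False using neg by simp
  qed
  then have "AE y in \<nu>. y \<notin> A" using A_meas prob_eq_0[OF A_meas] by simp
  then show ?thesis
    by eventually_elim (use Aiff in \<open>meson not_le\<close>)
qed

text \<open>Subtracting slightly more than the mean from \<open>v\<close> leaves a negative mean, so
  \<open>birkhoff_sum_bounded\<close> bounds the centred sums by a constant plus
  \<open>n / Suc j\<close>. Taking \<open>v = u\<close> and \<open>v = - u\<close> for all
  \<open>j\<close> gives both sides of the limit.\<close>

theorem birkhoff:
  assumes u: "integrable \<nu> u"
  shows "AE y in \<nu>. (\<lambda>n. birkhoff_sum T u n y / n) \<longlonglongrightarrow> (\<integral>y. u y \<partial>\<nu>)"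
proof -
  have half: "AE y in \<nu>. \<forall>j::nat. \<exists>C. \<forall>n. birkhoff_sum T v n y \<le> C + n * ((\<integral>y. v y \<partial>\<nu>) + 1 / Suc j)"
    if v: "integrable \<nu> v" for v
  proof (subst AE_all_countable, intro allI)
    fix j :: nat
    let ?w = "\<lambda>y. v y - ((\<integral>y. v y \<partial>\<nu>) + 1 / Suc j)"
    have s: "birkhoff_sum T ?w n y = birkhoff_sum T v n y - n * ((\<integral>y. v y \<partial>\<nu>) + 1 / Suc j)" for n y
      by (simp add: birkhoff_sum_def sum_subtractf)
    have "integrable \<nu> ?w" using v by simp
    moreover have "(\<integral>y. ?w y \<partial>\<nu>) < 0" using v prob_space by simp
    ultimately have "AE y in \<nu>. \<exists>C. \<forall>n. birkhoff_sum T ?w n y \<le> C" by (rule birkhoff_sum_bounded)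
    then show "AE y in \<nu>. \<exists>C. \<forall>n. birkhoff_sum T v n y \<le> C + n * ((\<integral>y. v y \<partial>\<nu>) + 1 / Suc j)"
      by eventually_elim (simp only: s diff_le_eq)
  qed
  have neg: "birkhoff_sum T (\<lambda>y. - u y) n y = - birkhoff_sum T u n y" for n y
    by (simp add: birkhoff_sum_def sum_negf)
  have u': "integrable \<nu> (\<lambda>y. - u y)" using u by simp
  show ?thesis using half[OF u] half[OF u']
  proof eventually_elim
    case (elim y)
    let ?I = "\<integral>y. u y \<partial>\<nu>"
    show ?case
    proof (rule LIMSEQ_I)
      fix r :: real assume r: "r > 0"
      then obtain j :: nat where j: "1 / Suc j < r / 2" using reals_Archimedean[of "r/2"] by (auto simp: inverse_eq_divide)
      obtain C1 where C1: "\<And>n. birkhoff_sum T u n y \<le> C1 + n * (?I + 1 / Suc j)" using elim(1) by blast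
      obtain C2 where C2: "\<And>n. - birkhoff_sum T u n y \<le> C2 + n * (- ?I + 1 / Suc j)"
        using elim(2) by (auto simp: neg)
      obtain N :: nat where N: "real N > 2 * (\<bar>C1\<bar> + \<bar>C2\<bar>) / r" using reals_Archimedean2 by blast
      show "\<exists>no. \<forall>n\<ge>no. norm (birkhoff_sum T u n y / n - ?I) < r"
      proof (intro exI[of _ "max N 1"] allI impI)
        fix n assume n: "max N 1 \<le> n"
        then have n0: "real n > 0" by simp
        have "2 * (\<bar>C1\<bar> + \<bar>C2\<bar>) / r < real n" using N n by linarith
        then have c: "2 * (\<bar>C1\<bar> + \<bar>C2\<bar>) < r * real n" using r by (simp add: field_simps)
        have j': "n * (1 / Suc j) < n * (r / 2)" using j n0 by (rule mult_strict_left_mono)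
        have "birkhoff_sum T u n y - n * ?I < r * n"
          using C1[of n] c j' distrib_left[of "real n" ?I "1 / Suc j"] by argo
        moreover have "- (birkhoff_sum T u n y - n * ?I) < r * n"
          using C2[of n] c j' distrib_left[of "real n" "- ?I" "1 / Suc j"] by argo
        ultimately have "\<bar>birkhoff_sum T u n y - n * ?I\<bar> < r * n" by linarith
        moreover have "birkhoff_sum T u n y / n - ?I = (birkhoff_sum T u n y - n * ?I) / n"
          using n0 by (simp add: field_simps)
        ultimately show "norm (birkhoff_sum T u n y / n - ?I) < r"
          using n0 by (simp add: abs_divide divide_less_eq)
      qed
    qed
  qed
qed

lemma birkhoff_tail:
  assumes u: "integrable \<nu> u"
  shows "AE y in \<nu>. (\<lambda>n. (birkhoff_sum T u n y - birkhoff_sum T u (n - k) y) / n) \<longlonglongrightarrow> 0"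
  using birkhoff[OF u]
proof eventually_elim
  case (elim y)
  from tendsto_diff[OF elim tendsto_div_diff_const[OF elim, of k]]
  show ?case by (simp add: diff_divide_distrib)
qed

text \<open>\<open>block_sum_bound\<close> along the orbit, divided by \<open>L * n\<close>: the
  block costs average to the mean of \<open>\<phi>\<close>, the first \<open>L\<close> values of
  \<open>b\<close> are a fixed number, and the last \<open>L\<close> are handled by
  \<open>birkhoff_tail\<close>. Integrability is asked of \<open>\<phi>\<close> and
  \<open>b\<close>, while \<open>u\<close> will be built from suprema over cylinders.\<close>

lemma block_limsup:
  assumes L: "L > 0" and b: "integrable \<nu> b" "\<And>y. 0 \<le> b y" and \<phi>: "integrable \<nu> \<phi>"
    and u0: "\<And>y. u 0 y \<le> 0"
    and u1: "\<And>n y. u (Suc n) y \<le> u n y + b ((T ^^ n) y)"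
    and uL: "\<And>n y. u (n + L) y \<le> u n y + \<phi> ((T ^^ n) y)"
  shows "AE y in \<nu>. \<forall>\<epsilon>>0. eventually (\<lambda>n. u n y / n \<le> (\<integral>y. \<phi> y \<partial>\<nu>) / L + \<epsilon>) sequentially"
  using birkhoff[OF \<phi>] birkhoff_tail[OF b(1), of L]
proof eventually_elim
  case (elim y)
  define g where "g n = birkhoff_sum T \<phi> (n - (L - 1)) y / n / L + (birkhoff_sum T b L y / n +
    (birkhoff_sum T b n y - birkhoff_sum T b (n - L) y) / n)" for n :: nat
  have "(\<lambda>n. birkhoff_sum T b L y / real n) \<longlonglongrightarrow> 0"
    by (intro tendsto_divide_0[OF tendsto_const] filterlim_at_top_imp_at_infinity filterlim_real_sequentially)
  then have "g \<longlonglongrightarrow> (\<integral>y. \<phi> y \<partial>\<nu>) / L + (0 + 0)"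
    unfolding g_def using tendsto_div_diff_const[OF elim(1), of "L - 1"] elim(2) L
    by (intro tendsto_add tendsto_divide tendsto_const) auto
  then have g: "g \<longlonglongrightarrow> (\<integral>y. \<phi> y \<partial>\<nu>) / L" by simp
  show ?case
  proof (intro allI impI)
    fix \<epsilon> :: real assume "\<epsilon> > 0"
    then have "eventually (\<lambda>n. g n < (\<integral>y. \<phi> y \<partial>\<nu>) / L + \<epsilon>) sequentially"
      by (intro order_tendstoD(2)[OF g]) simp
    then show "eventually (\<lambda>n. u n y / n \<le> (\<integral>y. \<phi> y \<partial>\<nu>) / L + \<epsilon>) sequentially"
      using eventually_gt_at_top[of 0]
    proof eventually_elim
      case (elim n)
      have "L * u n y \<le> (\<Sum>k<n - (L - 1). \<phi> ((T ^^ k) y)) +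
          L * ((\<Sum>k<L. b ((T ^^ k) y)) + (\<Sum>k=n-L..<n. b ((T ^^ k) y)))"
        by (rule block_sum_bound) (use L b u0 u1 uL in auto)
      then have "L * u n y \<le> birkhoff_sum T \<phi> (n - (L - 1)) y +
          L * (birkhoff_sum T b L y + (birkhoff_sum T b n y - birkhoff_sum T b (n - L) y))"
        by (simp add: birkhoff_sum_diff) (simp add: birkhoff_sum_def)
      then have "L * u n y / (L * n) \<le> (birkhoff_sum T \<phi> (n - (L - 1)) y +
          L * (birkhoff_sum T b L y + (birkhoff_sum T b n y - birkhoff_sum T b (n - L) y))) / (L * n)"
        using L by (intro divide_right_mono) auto
      also have "\<dots> = g n" using L elim by (simp add: g_def field_simps)
      finally show ?case using L elim by simp
    qed
  qed
qed

end

section \<open>Compactness and subadditivity\<close>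

text \<open>Tychonoff on a cube with one factor for each real sequence: the points
  \<open>Z n\<close> have a cluster point, and \<open>F\<close> is the trace of its neighbourhoods
  on the tail filter. All bounded sequences converge along this one filter, so limits of uncountably
  many quantities are taken at once, where a diagonal subsequence would not suffice.\<close>

lemma bounded_sequences_converge_filter:
  "\<exists>F :: nat filter. F \<noteq> bot \<and> F \<le> sequentially \<and>
     (\<forall>g :: nat \<Rightarrow> real. Bseq g \<longrightarrow> (\<exists>l. (g \<longlongrightarrow> l) F))"
proof -
  \<comment> \<open>Clipping to \<open>[-1, 1]\<close> places \<open>Z n\<close> in the cube also at
    unbounded sequences \<open>g\<close>; a bounded \<open>g\<close> is divided by its bound
    \<open>K\<close> first, and then clipping has no effect.\<close>
  define Z :: "nat \<Rightarrow> (nat \<Rightarrow> real) \<Rightarrow> real" where "Z n = (\<lambda>g. max (-1) (min 1 (g n)))" for n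
  have "compactin (product_topology (\<lambda>g::nat \<Rightarrow> real. euclidean) UNIV) (PiE UNIV (\<lambda>g. {-1..1::real}))"
    unfolding compactin_PiE by (simp add: compactin_euclidean_iff)
  then have comp: "compact (PiE UNIV (\<lambda>g::nat \<Rightarrow> real. {-1..1::real}))"
    by (simp add: euclidean_product_topology compactin_euclidean_iff)
  have ev: "eventually (\<lambda>x. x \<in> PiE UNIV (\<lambda>g. {-1..1})) (filtermap Z sequentially)"
    unfolding eventually_filtermap by (rule always_eventually) (auto simp: Z_def)
  obtain x where x: "inf (nhds x) (filtermap Z sequentially) \<noteq> bot"
    using comp[unfolded compact_filter, rule_format, OF _ ev] by (auto simp: filtermap_bot_iff)
  define F where "F = inf (filtercomap Z (nhds x)) sequentially"
  have F: "F \<noteq> bot"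
  proof
    assume "F = bot"
    then have "eventually (\<lambda>_. False) F" by simp
    then obtain P Q where PQ: "eventually P (filtercomap Z (nhds x))" "eventually Q sequentially"
      "\<And>n. P n \<Longrightarrow> Q n \<Longrightarrow> False" unfolding F_def eventually_inf by auto
    then obtain P' where P': "eventually P' (nhds x)" "\<And>n. P' (Z n) \<Longrightarrow> P n"
      unfolding eventually_filtercomap by auto
    have "eventually (\<lambda>z. \<exists>n. z = Z n \<and> Q n) (filtermap Z sequentially)"
      unfolding eventually_filtermap using PQ(2) by eventually_elim auto
    then have "eventually (\<lambda>_. False) (inf (nhds x) (filtermap Z sequentially))"
      unfolding eventually_inf using P' PQ(3) by blast
    then show False using x by (simp add: trivial_limit_def)
  qed
  have lim: "((\<lambda>n. Z n g) \<longlongrightarrow> x g) F" for g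
  proof -
    have "filterlim Z (nhds x) F"
      unfolding filterlim_def F_def by (simp add: filtermap_filtercomap le_infI1 filtermap_le_iff_le_filtercomap)
    then show ?thesis
      by (rule continuous_on_tendsto_compose[OF continuous_on_product_coordinates]) auto
  qed
  have "\<exists>l. (g \<longlongrightarrow> l) F" if g: "Bseq g" for g :: "nat \<Rightarrow> real"
  proof -
    obtain K where K: "K > 0" "\<And>n. \<bar>g n\<bar> \<le> K" using g by (auto simp: Bseq_def)
    have "Z n (\<lambda>n. g n / K) = g n / K" for n
      using K(2)[of n] K(1) by (auto simp: Z_def max_def min_def abs_le_iff field_simps)
    then have "((\<lambda>n. g n / K) \<longlongrightarrow> x (\<lambda>n. g n / K)) F" using lim[of "\<lambda>n. g n / K"] by simp
    then have "((\<lambda>n. K * (g n / K)) \<longlongrightarrow> K * x (\<lambda>n. g n / K)) F" by (intro tendsto_intros)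
    then show ?thesis using K(1) by auto
  qed
  moreover have "F \<le> sequentially" by (simp add: F_def)
  ultimately show ?thesis using F by blast
qed

lemma fekete:
  fixes a :: "nat \<Rightarrow> real"
  assumes sub: "\<And>m n. a (m + n) \<le> a m + a n" and lower: "\<And>n. 0 \<le> a n"
  shows "convergent (\<lambda>n. a n / n)"
proof -
  define l where "l = (INF n\<in>{1..}. a n / real n)"
  have bdd: "bdd_below ((\<lambda>n. a n / real n) ` {1..})" by (rule bdd_belowI2[where m = 0]) (use lower in auto)
  have "(\<lambda>n. a n / n) \<longlonglongrightarrow> l"
  proof (rule LIMSEQ_I)
    fix r :: real assume r: "r > 0"
    obtain k where k: "k \<ge> 1" "a k / real k < l + r / 2"
      using cINF_less_iff[OF _ bdd, of "l + r/2"] r unfolding l_def by auto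
    have mult: "a (j * k) \<le> j * a k + a 0" for j
    proof (induction j)
      case (Suc j)
      have "a (Suc j * k) \<le> a k + a (j * k)" using sub[of k "j * k"] by simp
      then show ?case using Suc by (simp add: algebra_simps)
    qed simp
    define C where "C = a 0 + Max (a ` {..k})"
    have C: "a 0 + a t \<le> C" if "t \<le> k" for t unfolding C_def using that by (intro add_left_mono Max_ge) auto
    have C0: "0 \<le> C" using C[of 0] lower[of 0] by linarith
    obtain N :: nat where N: "real N > 2 * C / r" using reals_Archimedean2 by blast
    show "\<exists>no. \<forall>n\<ge>no. norm (a n / n - l) < r"
    proof (intro exI[of _ "max N 1"] allI impI)
      fix n assume n: "max N 1 \<le> n"
      then have n0: "real n > 0" by simp
      have l: "l \<le> a n / n" unfolding l_def by (rule cINF_lower[OF bdd]) (use n in auto)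
      have "a n = a (n div k * k + n mod k)" by simp
      also have "\<dots> \<le> a (n div k * k) + a (n mod k)" by (rule sub)
      also have "\<dots> \<le> n div k * a k + C"
        using mult[of "n div k"] C[of "n mod k"] k(1) by (simp add: less_imp_le)
      also have "real (n div k) * a k \<le> real n / real k * a k"
      proof (intro mult_right_mono lower)
        have "real (n div k * k) \<le> real n" by (subst of_nat_le_iff) simp
        then show "real (n div k) \<le> real n / real k" using k(1) by (simp add: pos_le_divide_eq)
      qed
      finally have "a n / n \<le> (real n / real k * a k + C) / n" using n0 by (simp add: divide_right_mono)
      also have "\<dots> = a k / k + C / n" using n0 by (simp add: field_simps)
      also have "\<dots> < l + r / 2 + r / 2"
      proof -
        have "2 * C / r < real n" using N n by linarith
        then have "C / n < r / 2" using r n0 by (simp add: field_simps)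
        then show ?thesis using k(2) by linarith
      qed
      finally show "norm (a n / n - l) < r" using l by simp
    qed
  qed
  then show ?thesis by (auto simp: convergent_def)
qed

text \<open>Nonnegativity of relative entropy, from \<open>ln t \<le> t - 1\<close>. The test
  weights \<open>q\<close> may have total mass below one, as happens when weights on a larger index
  set are restricted.\<close>

lemma gibbs_inequality:
  fixes p q :: "'i \<Rightarrow> real"
  assumes fin: "finite I" and p: "\<And>i. i \<in> I \<Longrightarrow> 0 \<le> p i" "sum p I = 1"
    and q: "\<And>i. i \<in> I \<Longrightarrow> 0 < q i" "sum q I \<le> 1"
  shows "(\<Sum>i\<in>I. - p i * ln (p i)) \<le> (\<Sum>i\<in>I. - p i * ln (q i))"
proof -
  have "- p i * ln (p i) + p i * ln (q i) \<le> q i - p i" if i: "i \<in> I" for i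
  proof (cases "p i = 0")
    case False
    then have pos: "p i > 0" using p(1)[OF i] by simp
    have "ln (q i / p i) \<le> q i / p i - 1" using q(1)[OF i] pos by (intro ln_le_minus_one) simp
    then have "p i * ln (q i / p i) \<le> p i * (q i / p i - 1)" using pos by (intro mult_left_mono) auto
    then show ?thesis using q(1)[OF i] pos by (simp add: ln_div algebra_simps)
  qed (use q(1)[OF i] in auto)
  then have "(\<Sum>i\<in>I. - p i * ln (p i) + p i * ln (q i)) \<le> (\<Sum>i\<in>I. q i - p i)" by (rule sum_mono)
  also have "\<dots> \<le> 0" using p(2) q(2) by (simp add: sum_subtractf)
  finally show ?thesis by (simp add: sum_subtractf sum_negf)
qed

section \<open>Subshifts of finite type\<close>

text \<open>The shift by any integer, so that a window may begin left of the origin.\<close>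

definition shZ :: "int \<Rightarrow> (int \<Rightarrow> 'a) \<Rightarrow> int \<Rightarrow> 'a" where
  "shZ j x = (\<lambda>i. x (i + j))"

definition pre :: "nat \<Rightarrow> (int \<Rightarrow> 'a) \<Rightarrow> 'a list" where
  "pre n x = map (\<lambda>i. x (int i)) [0..<n]"

text \<open>The letters at positions \<open>-n\<close> to \<open>n\<close>: equality of these
  windows means closeness in \<open>dX\<close>, whereas \<open>pre\<close> describes the one-sided
  cylinders of the Gibbs property.\<close>

definition cen :: "nat \<Rightarrow> (int \<Rightarrow> 'a) \<Rightarrow> 'a list" where
  "cen n x = pre (2 * n + 1) (shZ (- int n) x)"

lemma shZ_apply [simp]: "shZ j x i = x (i + j)"
  by (simp add: shZ_def)

lemma shZ_0 [simp]: "shZ 0 x = x"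
  by (simp add: shZ_def)

lemma shZ_shZ [simp]: "shZ i (shZ j x) = shZ (i + j) x"
  by (simp add: shZ_def add.assoc)

lemma shift_eq_shZ: "shift = shZ 1"
  by (simp add: fun_eq_iff shift_def)

lemma funpow_shift: "(shift ^^ k) x = shZ (int k) x"
  by (induction k) (simp_all add: shift_eq_shZ algebra_simps)

lemma length_pre [simp]: "length (pre n x) = n"
  by (simp add: pre_def)

lemma nth_pre [simp]: "i < n \<Longrightarrow> pre n x ! i = x (int i)"
  by (simp add: pre_def)

lemma pre_eq_iff: "pre n x = pre n y \<longleftrightarrow> (\<forall>i<n. x (int i) = y (int i))"
  by (auto simp: list_eq_iff_nth_eq)

lemma pre_eqI: "length w = n \<Longrightarrow> (\<And>i. i < n \<Longrightarrow> x (int i) = w ! i) \<Longrightarrow> pre n x = w"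
  by (auto simp: list_eq_iff_nth_eq)

lemma pre_append: "pre (n + m) x = pre n x @ pre m (shZ (int n) x)"
  by (rule nth_equalityI) (auto simp: nth_append)

lemma take_drop_pre: "a + b \<le> n \<Longrightarrow> take a (drop b (pre n x)) = pre a (shZ (int b) x)"
  by (rule nth_equalityI) (auto simp: add.commute)

lemma length_cen [simp]: "length (cen n x) = 2 * n + 1"
  by (simp add: cen_def)

lemma cen_eq_iff: "cen n x = cen n y \<longleftrightarrow> (\<forall>i. \<bar>i\<bar> \<le> int n \<longrightarrow> x i = y i)"
proof
  assume eq: "cen n x = cen n y"
  show "\<forall>i. \<bar>i\<bar> \<le> int n \<longrightarrow> x i = y i"
  proof (intro allI impI)
    fix i :: int assume i: "\<bar>i\<bar> \<le> int n"
    then have "nat (i + int n) < 2 * n + 1" by linarith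
    then have "shZ (- int n) x (int (nat (i + int n))) = shZ (- int n) y (int (nat (i + int n)))"
      using eq unfolding cen_def pre_eq_iff by blast
    moreover have "int (nat (i + int n)) = i + int n" using i by simp
    ultimately show "x i = y i" by simp
  qed
qed (auto simp: cen_def pre_eq_iff)

lemma cen_coarsen: "n \<le> m \<Longrightarrow> cen n x = take (2 * n + 1) (drop (m - n) (cen m x))"
  unfolding cen_def by (subst take_drop_pre) (auto simp: of_nat_diff)

lemma pre_from_cen: "pre q x = take q (drop q (cen q x))"
  unfolding cen_def by (subst take_drop_pre) auto

lemma cen_from_pre: "M \<le> k \<Longrightarrow> k + M < n \<Longrightarrow> cen M (shZ (int k) x) = take (2 * M + 1) (drop (k - M) (pre n x))"
  unfolding cen_def by (subst take_drop_pre) (auto simp: of_nat_diff add.commute)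

lemma occurs_in_iff: "occurs_in w x \<longleftrightarrow> (\<exists>i. pre (length w) (shZ i x) = w)"
  unfolding occurs_in_def list_eq_iff_nth_eq by (auto simp: add.commute)

lemma finite_words: "finite {w :: 'a::finite list. length w = n}"
  using finite_lists_length_eq[of "UNIV :: 'a set" n] by simp

lemma card_words: "card {w :: 'a::finite list. length w = n} = CARD('a) ^ n"
  using card_lists_length_eq[of "UNIV :: 'a set" n] by simp

locale sft =
  fixes X :: "(int \<Rightarrow> 'a::finite) set"
  assumes mixing: "mixing_SFT X" and X_ne: "X \<noteq> {}"
begin

lemma shZ_X [simp]: "shZ j x \<in> X \<longleftrightarrow> x \<in> X"
proof -
  have *: "shZ j x \<in> X" if "x \<in> X" for j x
    using mixing that unfolding mixing_SFT_def occurs_in_iff by auto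
  show ?thesis using *[of x j] *[of "shZ j x" "- j"] by auto
qed

lemma shift_X [simp]: "(shift ^^ k) x \<in> X \<longleftrightarrow> x \<in> X" "shift x \<in> X \<longleftrightarrow> x \<in> X"
  by (simp add: funpow_shift) (simp add: shift_eq_shZ)

text \<open>An occurrence of a forbidden word takes up finitely many positions, so a point of
  \<open>X\<close> agreeing with \<open>x\<close> on a large window would show it too.\<close>

lemma X_closed:
  assumes "\<And>n. \<exists>z\<in>X. cen n z = cen n x" shows "x \<in> X"
proof -
  obtain F where X: "X = {x. \<forall>w\<in>F. \<not> occurs_in w x}" using mixing unfolding mixing_SFT_def by blast
  have "\<not> occurs_in w x" if w: "w \<in> F" for w
  proof
    assume "occurs_in w x"
    then obtain i where i: "pre (length w) (shZ i x) = w" unfolding occurs_in_iff by blast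
    obtain z where z: "z \<in> X" "cen (nat \<bar>i\<bar> + length w) z = cen (nat \<bar>i\<bar> + length w) x" using assms by blast
    have "pre (length w) (shZ i z) = pre (length w) (shZ i x)"
      using z(2) unfolding cen_eq_iff pre_eq_iff by auto
    then show False using i z(1) w X unfolding occurs_in_iff by auto
  qed
  then show ?thesis using X by simp
qed

definition W :: "nat \<Rightarrow> 'a list set" where "W n = pre n ` X"

definition rep :: "'a list \<Rightarrow> int \<Rightarrow> 'a" where
  "rep w = (SOME x. x \<in> X \<and> pre (length w) x = w)"

lemma W_length: "w \<in> W n \<Longrightarrow> length w = n"
  by (auto simp: W_def)

lemma finite_W [simp]: "finite (W n)"
  by (rule finite_subset[OF _ finite_words[of n]]) (auto simp: W_length)

lemma card_W: "card (W n) \<le> CARD('a) ^ n"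
  unfolding card_words[symmetric] by (rule card_mono[OF finite_words]) (auto simp: W_length)

lemma W_ne [simp]: "W n \<noteq> {}"
  using X_ne by (simp add: W_def)

lemma pre_W [simp]: "x \<in> X \<Longrightarrow> pre n x \<in> W n"
  by (simp add: W_def)

lemma rep:
  assumes "w \<in> W n" shows "rep w \<in> X" "pre n (rep w) = w"
proof -
  obtain x where "x \<in> X" "pre (length w) x = w" using assms by (auto simp: W_def)
  then have "rep w \<in> X \<and> pre (length w) (rep w) = w" unfolding rep_def by (metis (mono_tags, lifting) someI)
  then show "rep w \<in> X" "pre n (rep w) = w" using W_length[OF assms] by auto
qed

lemma W_take_drop:
  assumes "w \<in> W (n + m)" shows "take n w \<in> W n" "drop n w \<in> W m"
proof -
  obtain x where "x \<in> X" "w = pre n x @ pre m (shZ (int n) x)" using assms by (auto simp: W_def pre_append)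
  then show "take n w \<in> W n" "drop n w \<in> W m" by auto
qed

lemma W_extend_right: "u \<in> W n \<Longrightarrow> \<exists>v. u @ v \<in> W (n + m)"
  using rep[of u n] pre_W[of "rep u" "n + m"] by (auto simp: pre_append)

text \<open>Mixing yields a gap length that depends on the two words. When no forbidden word is
  longer than \<open>L\<close>, only the last \<open>L\<close> letters of the left word and the
  first \<open>L\<close> of the right one matter, and there are finitely many such pairs, so one gap
  length serves all words.\<close>

lemma uniform_gap: "\<exists>g. \<forall>n m. \<forall>u\<in>W n. \<forall>v\<in>W m. \<exists>c. length c = g \<and> u @ c @ v \<in> W (n + g + m)"
proof -
  obtain F where F: "finite F" and X: "X = {x. \<forall>w\<in>F. \<not> occurs_in w x}"
    using conjunct1[OF mixing[unfolded mixing_SFT_def]] by blast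
  have mix: "\<exists>N. \<forall>m\<ge>N. \<exists>w. length w = m \<and> (\<exists>x\<in>X. occurs_in (u @ w @ v) x)"
    if "\<exists>x\<in>X. occurs_in u x" "\<exists>x\<in>X. occurs_in v x" for u v
    using conjunct2[OF mixing[unfolded mixing_SFT_def]] conjI[OF that] by (elim allE) (rule mp)
  define L where "L = Max (insert 0 (length ` F))"
  have L: "length w \<le> L" if "w \<in> F" for w unfolding L_def using F that by (intro Max_ge) auto
  have occ: "\<exists>x\<in>X. occurs_in u x" if "u \<in> W n" for u n
    using that unfolding W_def occurs_in_iff by (force intro: exI[of _ 0])
  define N where "N u v = (SOME N. \<forall>m\<ge>N. \<exists>w. length w = m \<and> (\<exists>x\<in>X. occurs_in (u @ w @ v) x))" for u v
  have N: "\<exists>w. length w = m \<and> (\<exists>x\<in>X. occurs_in (u @ w @ v) x)" if "u \<in> W n" "v \<in> W k" "m \<ge> N u v" for u v m n k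
  proof -
    have "\<forall>m\<ge>N u v. \<exists>w. length w = m \<and> (\<exists>x\<in>X. occurs_in (u @ w @ v) x)"
      unfolding N_def by (rule someI_ex) (intro mix occ[OF that(1)] occ[OF that(2)])
    then show ?thesis using that(3) by blast
  qed
  define g where "g = Max ((\<lambda>(u, v). N u v) ` (W L \<times> W L))"
  have g: "N u v \<le> g" if "u \<in> W L" "v \<in> W L" for u v
    unfolding g_def by (intro Max_ge) (use that in auto)
  show ?thesis
  proof (intro exI[of _ g] allI ballI)
    fix n m u v assume u: "u \<in> W n" and v: "v \<in> W m"
    \<comment> \<open>The representative is a bi-infinite point, so a window of length
      \<open>L\<close> ending just before position \<open>n\<close> exists even if
      \<open>n < L\<close>.\<close>
    define a where "a = pre L (shZ (int n - int L) (rep u))"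
    define b where "b = pre L (rep v)"
    have ab: "a \<in> W L" "b \<in> W L" unfolding a_def b_def using rep[OF u] rep[OF v] by auto
    obtain c t0 where c: "length c = g" and t0: "t0 \<in> X" "occurs_in (a @ c @ b) t0"
      using N[OF ab g[OF ab]] by blast
    obtain j where j: "pre (length (a @ c @ b)) (shZ j t0) = a @ c @ b" using t0(2) unfolding occurs_in_iff by blast
    define t where "t = shZ (j - (int n - int L)) t0"
    have t: "t \<in> X" using t0 by (simp add: t_def)
    have la: "length a = L" "length b = L" using ab W_length by auto
    have tj: "shZ j t0 (int i) = (a @ c @ b) ! i" if "i < L + g + L" for i
      using arg_cong[OF j, of "\<lambda>w. w ! i"] that la c by (simp del: shZ_apply)
    have t1: "t i = rep u i" if "int n - int L \<le> i" "i < int n" for i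
    proof -
      let ?k = "nat (i - (int n - int L))"
      have k: "?k < L" using that by linarith
      have "shZ j t0 (int ?k) = a ! ?k" using tj[of ?k] k la by (simp add: nth_append del: shZ_apply)
      then show ?thesis using that k by (simp add: t_def a_def algebra_simps)
    qed
    have t2: "t (int n + int i) = c ! i" if "i < g" for i
    proof -
      have "shZ j t0 (int (L + i)) = c ! i" using tj[of "L + i"] that la c by (simp add: nth_append del: shZ_apply)
      then show ?thesis by (simp add: t_def algebra_simps)
    qed
    have t3: "t (int n + int g + int i) = rep v (int i)" if "i < L" for i
    proof -
      have "shZ j t0 (int (L + g + i)) = b ! i" using tj[of "L + g + i"] that la c by (simp add: nth_append del: shZ_apply)
      then show ?thesis using that by (simp add: t_def b_def algebra_simps)
    qed
    \<comment> \<open>The splice of \<open>rep u\<close>, the connecting part of \<open>t\<close>,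
      and the shifted \<open>rep v\<close>. Since \<open>t\<close> agrees with both neighbours on
      overlaps of length \<open>L\<close>, a forbidden word inside \<open>s\<close> would lie
      entirely in \<open>rep u\<close>, in \<open>rep v\<close> or in \<open>t\<close>.\<close>
    define s where "s i = (if i < int n then rep u i else if i < int n + int g then t i else rep v (i - int n - int g))" for i
    have "s \<in> X"
    proof -
      have "\<not> occurs_in w s" if w: "w \<in> F" for w
      proof
        assume "occurs_in w s"
        then obtain i where i: "pre (length w) (shZ i s) = w" unfolding occurs_in_iff by blast
        have no: False if "z \<in> X" "\<And>k. k < length w \<Longrightarrow> z (int k) = s (int k + i)" for z
        proof -
          have "pre (length w) (shZ 0 z) = pre (length w) (shZ i s)" using that(2) unfolding pre_eq_iff by simp
          then have "occurs_in w z" using i unfolding occurs_in_iff by (intro exI[of _ 0]) simp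
          then show False using that(1) w X by auto
        qed
        note lw = L[OF w]
        show False
        proof (cases "i + int (length w) \<le> int n")
          case True
          show False by (rule no[of "shZ i (rep u)"]) (use True rep[OF u] in \<open>auto simp: s_def\<close>)
        next
          case False
          show False
          proof (cases "i \<ge> int n + int g")
            case True
            show False by (rule no[of "shZ (i - int n - int g) (rep v)"]) (use True rep[OF v] in \<open>auto simp: s_def algebra_simps\<close>)
          next
            case F2: False
            show False
            proof (rule no[of "shZ i t"])
              fix k assume k: "k < length w"
              let ?p = "int k + i"
              consider "?p < int n" | "int n \<le> ?p" "?p < int n + int g" | "int n + int g \<le> ?p" by linarith
              then show "shZ i t (int k) = s ?p"
              proof cases
                case 1
                have "int n - int L \<le> ?p" using False lw by linarith
                then show ?thesis using t1[of ?p] 1 by (simp add: s_def)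
              next
                case 2
                then show ?thesis by (simp add: s_def)
              next
                case 3
                let ?q = "nat (?p - int n - int g)"
                have "?q < L" using F2 k lw 3 by linarith
                then show ?thesis using t3[of ?q] 3 by (simp add: s_def)
              qed
            qed (use t in simp)
          qed
        qed
      qed
      then show ?thesis using X by simp
    qed
    moreover have "pre (n + g + m) s = u @ c @ v"
    proof -
      have "pre n s = pre n (rep u)" unfolding pre_eq_iff by (simp add: s_def)
      moreover have "pre g (shZ (int n) s) = c" by (rule pre_eqI) (use c t2 in \<open>auto simp: s_def add.commute\<close>)
      moreover have "pre m (shZ (int (n + g)) s) = pre m (rep v)" unfolding pre_eq_iff by (auto simp: s_def)
      ultimately show ?thesis using rep(2)[OF u] rep(2)[OF v] by (simp add: pre_append)
    qed
    ultimately have "u @ c @ v \<in> W (n + g + m)" using pre_W[of s "n + g + m"] by simp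
    then show "\<exists>c. length c = g \<and> u @ c @ v \<in> W (n + g + m)" using c by blast
  qed
qed

section \<open>Measurability on the shift space and the algebra of clopen sets\<close>

abbreviation XM :: "(int \<Rightarrow> 'a) measure" where "XM \<equiv> Xmeas X"

lemma gen_Pow: "{X \<inter> {z. \<forall>i\<in>{a..b}. z i = w i} | a b w. True} \<subseteq> Pow X"
  by auto

lemma space_XM [simp]: "space XM = X"
  unfolding Xmeas_def using gen_Pow by (rule space_measure_of)

lemma sets_XM: "sets XM = sigma_sets X {X \<inter> {z. \<forall>i\<in>{a..b}. z i = w i} | a b w. True}"
  unfolding Xmeas_def using gen_Pow by (rule sets_measure_of)

lemma cylinder_sets [measurable]: "{x \<in> X. pre m (shZ j x) = w} \<in> sets XM"
proof (cases "length w = m")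
  case True
  have "{x \<in> X. pre m (shZ j x) = w} = X \<inter> {z. \<forall>i\<in>{j..j + int m - 1}. z i = w ! nat (i - j)}" (is "?A = ?B")
  proof (intro set_eqI iffI)
    fix x assume x: "x \<in> ?A"
    have "x i = w ! nat (i - j)" if "i \<in> {j..j + int m - 1}" for i
    proof -
      have "nat (i - j) < m" using that by auto
      then have "w ! nat (i - j) = shZ j x (int (nat (i - j)))" using x by auto
      then show ?thesis using that by simp
    qed
    then show "x \<in> ?B" using x by auto
  next
    fix x assume x: "x \<in> ?B"
    then show "x \<in> ?A" using True by (auto intro!: pre_eqI)
  qed
  then have "{x \<in> X. pre m (shZ j x) = w} \<in> {X \<inter> {z. \<forall>i\<in>{a..b}. z i = w i} | a b w. True}"
    by (intro CollectI exI[of _ j] exI[of _ "j + int m - 1"] exI[of _ "\<lambda>i. w ! nat (i - j)"]) simp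
  then show ?thesis unfolding sets_XM by (rule sigma_sets.Basic)
next
  case False
  then have "{x \<in> X. pre m (shZ j x) = w} = {}" by auto
  then show ?thesis by (metis sets.empty_sets)
qed

lemma window_measurable [measurable]: "(\<lambda>x. pre m (shZ j x)) \<in> measurable XM (count_space UNIV)"
proof (subst measurable_count_space_eq_countable)
  show "countable (UNIV :: 'a list set)" by simp
  have "(\<lambda>x. pre m (shZ j x)) -` {w} \<inter> space XM = {x \<in> X. pre m (shZ j x) = w}" for w by auto
  then show "(\<lambda>x. pre m (shZ j x)) \<in> space XM \<rightarrow> UNIV \<and>
     (\<forall>a\<in>UNIV. (\<lambda>x. pre m (shZ j x)) -` {a} \<inter> space XM \<in> sets XM)"
    using cylinder_sets by auto
qed

lemma cen_measurable [measurable]: "cen m \<in> measurable XM (count_space UNIV)"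
  unfolding cen_def by measurable

lemma shZ_measurable [measurable]: "shZ j \<in> measurable XM XM"
proof (rule measurable_sigma_sets[OF sets_XM gen_Pow])
  show "shZ j \<in> space XM \<rightarrow> X" by simp
  fix A assume "A \<in> {X \<inter> {z. \<forall>i\<in>{a..b}. z i = w i} | a b w. True}"
  then obtain a b w where A: "A = X \<inter> {z. \<forall>i\<in>{a..b}. z i = w i}" by blast
  have "shZ j -` A \<inter> space XM = X \<inter> {z. \<forall>i\<in>{a + j..b + j}. z i = w (i - j)}"
  proof -
    have "(\<forall>i\<in>{a..b}. x (i + j) = w i) \<longleftrightarrow> (\<forall>i\<in>{a + j..b + j}. x i = w (i - j))" for x
    proof (intro iffI ballI)
      fix i assume *: "\<forall>i\<in>{a..b}. x (i + j) = w i" and "i \<in> {a + j..b + j}"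
      then show "x i = w (i - j)" using *[rule_format, of "i - j"] by simp
    next
      fix i assume *: "\<forall>i\<in>{a + j..b + j}. x i = w (i - j)" and "i \<in> {a..b}"
      then show "x (i + j) = w i" using *[rule_format, of "i + j"] by simp
    qed
    then show ?thesis unfolding A by auto
  qed
  then have "shZ j -` A \<inter> space XM \<in> {X \<inter> {z. \<forall>i\<in>{a..b}. z i = w i} | a b w. True}"
    by (intro CollectI exI[of _ "a + j"] exI[of _ "b + j"] exI[of _ "\<lambda>i. w (i - j)"]) simp
  then show "shZ j -` A \<inter> space XM \<in> sets XM" unfolding sets_XM by (rule sigma_sets.Basic)
qed

lemma funpow_shift_measurable [measurable]: "(shift ^^ k) \<in> measurable XM XM"
  unfolding funpow_shift[abs_def, of k] using shZ_measurable[of "int k"] by (simp add: fun_eq_iff funpow_shift cong: measurable_cong)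

lemma shift_measurable [measurable]: "shift \<in> measurable XM XM"
  unfolding shift_eq_shZ by measurable

text \<open>The clopen subsets of \<open>X\<close>, those decided by finitely many coordinates. They
  generate the Borel sets, and compactness will turn finite additivity on them into countable
  additivity.\<close>

definition Alg :: "(int \<Rightarrow> 'a) set set" where
  "Alg = {X \<inter> cen n -` Q | n Q. True}"

lemma Alg_level:
  assumes "n \<le> m" shows "\<exists>R. X \<inter> cen n -` Q = X \<inter> cen m -` R"
  by (rule exI[of _ "{w. take (2 * n + 1) (drop (m - n) w) \<in> Q}"]) (auto simp: cen_coarsen[OF assms])

lemma Alg_eq_level:
  assumes "A \<in> Alg" shows "\<exists>n. \<forall>m\<ge>n. A = X \<inter> cen m -` (cen m ` A)"
proof -
  obtain n Q where A: "A = X \<inter> cen n -` Q" using assms unfolding Alg_def by blast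
  have "A = X \<inter> cen m -` (cen m ` A)" if "m \<ge> n" for m
  proof
    show "X \<inter> cen m -` (cen m ` A) \<subseteq> A"
    proof
      fix x assume x: "x \<in> X \<inter> cen m -` (cen m ` A)"
      then obtain a where "a \<in> A" "cen m x = cen m a" by auto
      then have "cen n x = cen n a" "cen n a \<in> Q" using cen_coarsen[OF that, of x] cen_coarsen[OF that, of a] A by auto
      then show "x \<in> A" using x A by auto
    qed
  qed (use A in auto)
  then show ?thesis by blast
qed

lemma algebra_Alg: "algebra X Alg"
  unfolding algebra_iff_Un
proof (intro conjI ballI)
  show "Alg \<subseteq> Pow X" "{} \<in> Alg" unfolding Alg_def by auto
  fix a assume "a \<in> Alg"
  then obtain n Q where a: "a = X \<inter> cen n -` Q" unfolding Alg_def by blast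
  have "X - a = X \<inter> cen n -` (- Q)" unfolding a by auto
  then show "X - a \<in> Alg" unfolding Alg_def by blast
  fix b assume "b \<in> Alg"
  then obtain m R where b: "b = X \<inter> cen m -` R" unfolding Alg_def by blast
  obtain Q' where Q': "a = X \<inter> cen (max n m) -` Q'" using Alg_level[of n "max n m" Q] a by auto
  obtain R' where R': "b = X \<inter> cen (max n m) -` R'" using Alg_level[of m "max n m" R] b by auto
  have "a \<union> b = X \<inter> cen (max n m) -` (Q' \<union> R')" unfolding Q' R' by auto
  then show "a \<union> b \<in> Alg" unfolding Alg_def by blast
qed

lemma sets_XM_Alg: "sets XM = sigma_sets X Alg"
proof
  show "sets XM \<subseteq> sigma_sets X Alg"
    unfolding sets_XM
  proof (rule sigma_sets_mono', rule subsetI)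
    fix A assume "A \<in> {X \<inter> {z. \<forall>i\<in>{a..b}. z i = w i} | a b w. True}"
    then obtain a b w where A: "A = X \<inter> {z. \<forall>i\<in>{a..b}. z i = w i}" by blast
    let ?n = "nat (max \<bar>a\<bar> \<bar>b\<bar>)"
    have "A = X \<inter> cen ?n -` (cen ?n ` A)"
    proof
      show "X \<inter> cen ?n -` (cen ?n ` A) \<subseteq> A"
      proof
        fix x assume x: "x \<in> X \<inter> cen ?n -` (cen ?n ` A)"
        then obtain z where z: "z \<in> A" "cen ?n x = cen ?n z" by auto
        have "x i = w i" if "i \<in> {a..b}" for i
        proof -
          have "\<bar>i\<bar> \<le> int ?n" using that by auto
          then have "x i = z i" using z(2) unfolding cen_eq_iff by blast
          then show ?thesis using z(1) that A by auto
        qed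
        then show "x \<in> A" using x A by auto
      qed
    qed (use A in auto)
    then show "A \<in> Alg" unfolding Alg_def by blast
  qed
next
  show "sigma_sets X Alg \<subseteq> sets XM"
  proof (rule sets.sigma_sets_subset[of Alg XM, simplified])
    show "Alg \<subseteq> sets XM"
    proof
      fix A assume "A \<in> Alg"
      then obtain n Q where A: "A = X \<inter> cen n -` Q" unfolding Alg_def by blast
      have "cen n -` Q \<inter> space XM \<in> sets XM" by (rule measurable_sets[OF cen_measurable]) simp
      then show "A \<in> sets XM" unfolding A by (simp add: Int_commute)
    qed
  qed
qed

lemma Alg_sets: "A \<in> Alg \<Longrightarrow> A \<in> sets XM"
  unfolding sets_XM_Alg by (rule sigma_sets.Basic)

lemma Int_stable_Alg: "Int_stable Alg"
  using algebra_Alg by (simp add: algebra_iff_Int Int_stable_def algebra.axioms(1) ring_of_sets.axioms semiring_of_sets.Int)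

text \<open>The sets that are approximable in measure by clopen ones are closed under complement and
  countable union, so they include all Borel sets.\<close>

lemma sets_approx:
  assumes "finite_measure \<mu>" and sets: "sets \<mu> = sets XM" and A: "A \<in> sets XM" and e: "e > 0"
  shows "\<exists>C\<in>Alg. measure \<mu> ((A - C) \<union> (C - A)) < e"
proof -
  interpret finite_measure \<mu> by fact
  interpret Al: algebra X Alg by (rule algebra_Alg)
  have sp: "space \<mu> = X" using sets_eq_imp_space_eq[OF sets] by simp
  have CS: "C \<in> Alg \<Longrightarrow> C \<in> sets \<mu>" for C using Alg_sets sets by simp
  have "A \<in> sigma_sets X Alg" using A sets_XM_Alg by simp
  then show ?thesis using e
  proof (induction arbitrary: e rule: sigma_sets.induct)
    case (Basic a)
    then show ?case by (intro bexI[of _ a]) auto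
  next
    case Empty
    then show ?case by (intro bexI[of _ "{}"]) auto
  next
    case (Compl a)
    obtain C where C: "C \<in> Alg" "measure \<mu> ((a - C) \<union> (C - a)) < e" using Compl.IH[OF Compl.prems] by blast
    have aX: "a \<subseteq> X" using Compl.hyps sets_XM_Alg sets.sets_into_space[of a XM] by auto
    have "(X - a - (X - C)) \<union> (X - C - (X - a)) = (a - C) \<union> (C - a)" using aX Al.sets_into_space[OF C(1)] by auto
    then show ?case using C by (intro bexI[of _ "X - C"]) auto
  next
    case (Union a)
    have aS: "a i \<in> sets \<mu>" for i using Union.hyps sets sets_XM_Alg by simp
    have "(\<lambda>n. measure \<mu> (\<Union>i<n. a i)) \<longlonglongrightarrow> measure \<mu> (\<Union>n. \<Union>i<n. a i)"
    proof (rule finite_Lim_measure_incseq)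
      show "incseq (\<lambda>n. \<Union>i<n. a i)" by (rule incseq_SucI) (auto simp: lessThan_Suc)
    qed (use aS in auto)
    moreover have "(\<Union>n. \<Union>i<n. a i) = (\<Union>i. a i)" by auto
    ultimately have "eventually (\<lambda>n. measure \<mu> (\<Union>i. a i) - e / 2 < measure \<mu> (\<Union>i<n. a i)) sequentially"
      using Union.prems by (intro order_tendstoD(1)[where y = "measure \<mu> (\<Union>i. a i)"]) auto
    then obtain N where N: "measure \<mu> (\<Union>i. a i) - e / 2 < measure \<mu> (\<Union>i<N. a i)"
      using eventually_happens'[OF trivial_limit_sequentially] by blast
    \<comment> \<open>Half of \<open>e\<close> pays for truncating the union at \<open>N\<close>,
      the other half is spread over the first \<open>N\<close> sets; \<open>N + 1\<close> avoids
      dividing by zero.\<close>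
    have e': "e / (2 * (N + 1)) > 0" using Union.prems by simp
    have "\<forall>i. \<exists>C. C \<in> Alg \<and> measure \<mu> ((a i - C) \<union> (C - a i)) < e / (2 * (N + 1))"
      using Union.IH[OF e'] by blast
    from choice[OF this] obtain C
      where C: "\<And>i. C i \<in> Alg" "\<And>i. measure \<mu> ((a i - C i) \<union> (C i - a i)) < e / (2 * (N + 1))" by blast
    let ?C = "\<Union>i<N. C i"
    have CA: "?C \<in> Alg" using C(1) by (intro Al.finite_UN) auto
    have "measure \<mu> (((\<Union>i. a i) - ?C) \<union> (?C - (\<Union>i. a i))) \<le>
       measure \<mu> (((\<Union>i. a i) - (\<Union>i<N. a i)) \<union> (\<Union>i<N. (a i - C i) \<union> (C i - a i)))"
      using aS CS[OF C(1)] CS[OF CA] by (intro finite_measure_mono) (auto intro!: sets.Un sets.Diff sets.countable_UN)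
    also have "\<dots> \<le> measure \<mu> ((\<Union>i. a i) - (\<Union>i<N. a i)) + measure \<mu> (\<Union>i<N. (a i - C i) \<union> (C i - a i))"
      using aS CS[OF C(1)] by (intro measure_Un_le) auto
    also have "measure \<mu> ((\<Union>i. a i) - (\<Union>i<N. a i)) = measure \<mu> (\<Union>i. a i) - measure \<mu> (\<Union>i<N. a i)"
      using aS by (intro finite_measure_Diff) auto
    also have "measure \<mu> (\<Union>i<N. (a i - C i) \<union> (C i - a i)) \<le> (\<Sum>i<N. measure \<mu> ((a i - C i) \<union> (C i - a i)))"
      using aS CS[OF C(1)] by (intro finite_measure_subadditive_finite) auto
    also have "\<dots> \<le> (\<Sum>i<N. e / (2 * (N + 1)))" using C(2) by (intro sum_mono less_imp_le)
    also have "\<dots> \<le> e / 2" using Union.prems by (simp add: field_simps)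
    finally have "measure \<mu> (((\<Union>i. a i) - ?C) \<union> (?C - (\<Union>i. a i))) < e" using N by linarith
    then show ?case using CA by blast
  qed
qed

end

section \<open>A uniform Gibbs constant\<close>

abbreviation words :: "nat \<Rightarrow> 'a list set" where "words n \<equiv> {w. length w = n}"

lemma sum_words_append:
  fixes f :: "'a::finite list \<Rightarrow> 'b::comm_monoid_add"
  shows "(\<Sum>w\<in>words (n + m). f w) = (\<Sum>u\<in>words n. \<Sum>v\<in>words m. f (u @ v))"
proof -
  have "(\<Sum>u\<in>words n. \<Sum>v\<in>words m. f (u @ v)) = (\<Sum>(u, v)\<in>words n \<times> words m. f (u @ v))"
    by (simp add: sum.cartesian_product)
  also have "\<dots> = (\<Sum>w\<in>words (n + m). f w)"
    by (rule sum.reindex_bij_witness[where i = "\<lambda>w. (take n w, drop n w)" and j = "\<lambda>(u, v). u @ v"]) auto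
  finally show ?thesis ..
qed

text \<open>Second moments \<open>A n\<close> of the density \<open>m / \<psi>\<close> on words of length \<open>n\<close> increase to a finite limit. By
  stationarity both the prefix and the suffix of length \<open>n\<close> of a word of length \<open>2 n + g\<close> give a density
  that is close in \<open>L\<^sup>2\<close> to the density of the whole word, while they are almost independent; so the
  density has no variance.\<close>

lemma dominated_by_mixing_unique:
  fixes \<psi> m :: "'a::finite list \<Rightarrow> real"
  assumes psi0: "\<And>w. 0 \<le> \<psi> w" and m0: "\<And>w. 0 \<le> m w" and nil: "\<psi> [] = 1" "m [] = 1"
    and psi_r: "\<And>w k. (\<Sum>v\<in>words k. \<psi> (w @ v)) = \<psi> w" and psi_l: "\<And>w k. (\<Sum>v\<in>words k. \<psi> (v @ w)) = \<psi> w"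
    and m_r: "\<And>w k. (\<Sum>v\<in>words k. m (w @ v)) = m w" and m_l: "\<And>w k. (\<Sum>v\<in>words k. m (v @ w)) = m w"
    and dom: "\<And>w. m w \<le> K * \<psi> w"
    and c: "c > 0" and mixing: "\<And>u v. c * \<psi> u * \<psi> v \<le> (\<Sum>z\<in>words g. \<psi> (u @ z @ v))"
  shows "m w = \<psi> w"
proof -
  \<comment> \<open>Where \<open>\<psi> w = 0\<close> the quotient is \<open>0\<close> by
    convention, and domination gives \<open>m w = 0\<close> as well, so
    \<open>m = \<psi> * h\<close> holds everywhere.\<close>
  define h where "h w = m w / \<psi> w" for w
  have mh: "m w = \<psi> w * h w" for w
    using dom[of w] m0[of w] by (cases "\<psi> w = 0") (auto simp: h_def)
  have h0: "0 \<le> h w" for w using psi0 m0 by (simp add: h_def)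
  have K0: "K \<ge> 0" using dom[of "[]"] nil by simp
  have hK: "h w \<le> K" for w
    using dom[of w] psi0[of w] K0 by (cases "\<psi> w = 0") (auto simp: h_def divide_le_eq)
  define A where "A n = (\<Sum>w\<in>words n. \<psi> w * (h w)\<^sup>2)" for n
  have psi1: "(\<Sum>w\<in>words n. \<psi> w) = 1" for n using psi_r[of "[]" n] nil by simp
  have m1: "(\<Sum>w\<in>words n. \<psi> w * h w) = 1" for n using m_r[of "[]" n] nil mh by simp
  have AK: "A n \<le> K\<^sup>2" for n
  proof -
    have "A n \<le> (\<Sum>w\<in>words n. \<psi> w * K\<^sup>2)" unfolding A_def
      by (intro sum_mono mult_left_mono power_mono hK h0 psi0)
    then show ?thesis using psi1[of n] by (simp add: sum_distrib_right[symmetric])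
  qed
  have expand: "\<psi> W * (h W - x)\<^sup>2 = \<psi> W * (h W)\<^sup>2 - 2 * (m W * x) + \<psi> W * x\<^sup>2" for W x
    by (simp add: mh power2_eq_square algebra_simps)
  \<comment> \<open>Under \<psi>, \<open>h u\<close> is the conditional expectation of
    \<open>h (u @ v)\<close> given the prefix, so the squared distance is a difference of second
    moments. \<open>left\<close> is the mirror image for suffixes, by stationarity.\<close>
  have right: "(\<Sum>u\<in>words n. \<Sum>v\<in>words k. \<psi> (u @ v) * (h (u @ v) - h u)\<^sup>2) = A (n + k) - A n" for n k
  proof -
    have "(\<Sum>v\<in>words k. \<psi> (u @ v) * (h (u @ v) - h u)\<^sup>2) =
        (\<Sum>v\<in>words k. \<psi> (u @ v) * (h (u @ v))\<^sup>2) - \<psi> u * (h u)\<^sup>2" for u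
    proof -
      have "(\<Sum>v\<in>words k. \<psi> (u @ v) * (h (u @ v) - h u)\<^sup>2) =
        (\<Sum>v\<in>words k. \<psi> (u @ v) * (h (u @ v))\<^sup>2) - 2 * ((\<Sum>v\<in>words k. m (u @ v)) * h u) + (\<Sum>v\<in>words k. \<psi> (u @ v)) * (h u)\<^sup>2"
        unfolding expand by (simp add: sum.distrib sum_subtractf sum_distrib_left sum_distrib_right)
      then show ?thesis unfolding m_r psi_r by (simp add: mh power2_eq_square)
    qed
    then show ?thesis unfolding A_def sum_words_append by (simp add: sum_subtractf)
  qed
  have left: "(\<Sum>u\<in>words n. \<Sum>v\<in>words k. \<psi> (u @ v) * (h (u @ v) - h v)\<^sup>2) = A (n + k) - A k" for n k
  proof -
    have "(\<Sum>u\<in>words n. \<psi> (u @ v) * (h (u @ v) - h v)\<^sup>2) =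
        (\<Sum>u\<in>words n. \<psi> (u @ v) * (h (u @ v))\<^sup>2) - \<psi> v * (h v)\<^sup>2" for v
    proof -
      have "(\<Sum>u\<in>words n. \<psi> (u @ v) * (h (u @ v) - h v)\<^sup>2) =
        (\<Sum>u\<in>words n. \<psi> (u @ v) * (h (u @ v))\<^sup>2) - 2 * ((\<Sum>u\<in>words n. m (u @ v)) * h v) + (\<Sum>u\<in>words n. \<psi> (u @ v)) * (h v)\<^sup>2"
        unfolding expand by (simp add: sum.distrib sum_subtractf sum_distrib_left sum_distrib_right)
      then show ?thesis unfolding m_l psi_l by (simp add: mh power2_eq_square)
    qed
    then have "(\<Sum>v\<in>words k. \<Sum>u\<in>words n. \<psi> (u @ v) * (h (u @ v) - h v)\<^sup>2) =
        (\<Sum>v\<in>words k. \<Sum>u\<in>words n. \<psi> (u @ v) * (h (u @ v))\<^sup>2) - A k"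
      by (simp add: sum_subtractf A_def)
    moreover have "A (n + k) = (\<Sum>v\<in>words k. \<Sum>u\<in>words n. \<psi> (u @ v) * (h (u @ v))\<^sup>2)"
      unfolding A_def sum_words_append by (rule sum.swap)
    ultimately show ?thesis by (subst sum.swap) simp
  qed
  have A_mono: "A n \<le> A (n + k)" for n k
  proof -
    have "0 \<le> (\<Sum>u\<in>words n. \<Sum>v\<in>words k. \<psi> (u @ v) * (h (u @ v) - h u)\<^sup>2)"
      by (intro sum_nonneg mult_nonneg_nonneg psi0) auto
    then show ?thesis using right[where n = n and k = k] by simp
  qed
  \<comment> \<open>The variance \<open>A n - 1\<close> is half the mean of
    \<open>(h u - h v)^2\<close> for independent \<open>u\<close> and \<open>v\<close>. Mixing
    replaces the independent pair by prefix and suffix of one long word, and both are compared with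
    the value of \<open>h\<close> on that word.\<close>
  have key: "c * (A n - 1) \<le> 2 * (A (n + g + n) - A n)" for n
  proof -
    have "2 * c * (A n - 1) = c * (\<Sum>u\<in>words n. \<Sum>v\<in>words n. \<psi> u * \<psi> v * (h u - h v)\<^sup>2)"
    proof -
      have "(\<Sum>u\<in>words n. \<Sum>v\<in>words n. \<psi> u * \<psi> v * (h u - h v)\<^sup>2) =
        (\<Sum>u\<in>words n. \<Sum>v\<in>words n. (\<psi> u * (h u)\<^sup>2) * \<psi> v - 2 * ((\<psi> u * h u) * (\<psi> v * h v)) + \<psi> u * (\<psi> v * (h v)\<^sup>2))"
        by (intro sum.cong refl) (simp add: power2_eq_square algebra_simps)
      also have "\<dots> = A n * 1 - 2 * (1 * 1) + 1 * A n"
        by (simp add: sum.distrib sum_subtractf sum_distrib_left[symmetric] sum_distrib_right[symmetric] psi1 m1 A_def)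
      finally show ?thesis by simp
    qed
    also have "\<dots> = (\<Sum>u\<in>words n. \<Sum>v\<in>words n. (c * \<psi> u * \<psi> v) * (h u - h v)\<^sup>2)"
      by (simp add: sum_distrib_left mult.assoc)
    also have "\<dots> \<le> (\<Sum>u\<in>words n. \<Sum>v\<in>words n. (\<Sum>z\<in>words g. \<psi> (u @ z @ v)) * (h u - h v)\<^sup>2)"
      by (intro sum_mono mult_right_mono mixing) auto
    also have "\<dots> = (\<Sum>u\<in>words n. \<Sum>z\<in>words g. \<Sum>v\<in>words n. \<psi> (u @ z @ v) * (h u - h v)\<^sup>2)"
      by (subst sum.swap) (simp add: sum_distrib_right)
    also have "\<dots> \<le> (\<Sum>u\<in>words n. \<Sum>z\<in>words g. \<Sum>v\<in>words n.
       2 * (\<psi> (u @ z @ v) * (h (u @ z @ v) - h u)\<^sup>2) + 2 * (\<psi> (u @ z @ v) * (h (u @ z @ v) - h v)\<^sup>2))"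
    proof (intro sum_mono)
      fix u z v
      let ?H = "h (u @ z @ v)"
      have "(h u - h v)\<^sup>2 \<le> 2 * (?H - h u)\<^sup>2 + 2 * (?H - h v)\<^sup>2"
        using zero_le_power2[of "(?H - h u) + (?H - h v)"] by (simp add: power2_eq_square algebra_simps)
      then have "\<psi> (u @ z @ v) * (h u - h v)\<^sup>2 \<le> \<psi> (u @ z @ v) * (2 * (?H - h u)\<^sup>2 + 2 * (?H - h v)\<^sup>2)"
        by (intro mult_left_mono psi0)
      then show "\<psi> (u @ z @ v) * (h u - h v)\<^sup>2 \<le> 2 * (\<psi> (u @ z @ v) * (?H - h u)\<^sup>2) + 2 * (\<psi> (u @ z @ v) * (?H - h v)\<^sup>2)"
        by (simp add: algebra_simps)
    qed
    also have "\<dots> = 2 * (\<Sum>u\<in>words n. \<Sum>v\<in>words (g + n). \<psi> (u @ v) * (h (u @ v) - h u)\<^sup>2) +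
       2 * (\<Sum>u\<in>words (n + g). \<Sum>v\<in>words n. \<psi> (u @ v) * (h (u @ v) - h v)\<^sup>2)"
      by (simp add: sum_words_append sum.distrib sum_distrib_left)
    also have "\<dots> = 4 * (A (n + g + n) - A n)"
      unfolding right left by (simp add: add.assoc)
    finally show ?thesis by simp
  qed
  have "incseq A" by (rule incseq_SucI) (use A_mono[of _ 1] in simp)
  then obtain l where l: "A \<longlonglongrightarrow> l" "\<And>n. A n \<le> l"
    using incseq_convergent[of A "K\<^sup>2"] AK by blast
  have "(\<lambda>n. A (n + g + n)) \<longlonglongrightarrow> l"
  proof (rule filterlim_compose[OF l(1)])
    show "filterlim (\<lambda>n. n + g + n) sequentially sequentially"
      by (rule filterlim_at_top_mono[OF filterlim_ident]) auto
  qed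
  then have "(\<lambda>n. 2 * (A (n + g + n) - A n)) \<longlonglongrightarrow> 2 * (l - l)" by (intro tendsto_intros l)
  moreover have "(\<lambda>n. c * (A n - 1)) \<longlonglongrightarrow> c * (l - 1)" by (intro tendsto_intros l)
  ultimately have "c * (l - 1) \<le> 2 * (l - l)" by (intro LIMSEQ_le) (use key in auto)
  then have "l \<le> 1" using c by (simp add: mult_le_0_iff)
  then have A1: "A n \<le> 1" for n using l(2) order_trans by blast
  have "(\<Sum>v\<in>words (length w). \<psi> v * (h v - 1)\<^sup>2) \<le> 0"
  proof -
    have "(\<Sum>v\<in>words (length w). \<psi> v * (h v - 1)\<^sup>2) = A (length w) - 2 * 1 + 1"
      unfolding expand using m_r[of "[]" "length w"] nil
      by (simp add: sum.distrib sum_subtractf sum_distrib_left[symmetric] psi1 A_def)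
    then show ?thesis using A1[of "length w"] by simp
  qed
  moreover have "0 \<le> \<psi> v * (h v - 1)\<^sup>2" for v using psi0 by simp
  ultimately have "(\<Sum>v\<in>words (length w). \<psi> v * (h v - 1)\<^sup>2) = 0" by (intro antisym sum_nonneg)
  then have "\<forall>v\<in>words (length w). \<psi> v * (h v - 1)\<^sup>2 = 0"
    by (subst (asm) sum_nonneg_eq_0_iff[OF finite_words]) (use psi0 in auto)
  then have "\<psi> w * (h w - 1)\<^sup>2 = 0" by blast
  then show ?thesis using mh[of w] by auto
qed


definition ergodic_sum :: "((int \<Rightarrow> 'a) \<Rightarrow> real) \<Rightarrow> nat \<Rightarrow> (int \<Rightarrow> 'a) \<Rightarrow> real" where
  "ergodic_sum F n x = (\<Sum>k<n. F ((shift ^^ k) x))"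

lemma ergodic_sum_add: "ergodic_sum F (n + m) x = ergodic_sum F n x + ergodic_sum F m ((shift ^^ n) x)"
proof (induction m)
  case (Suc m)
  have "(shift ^^ (n + m)) x = (shift ^^ m) ((shift ^^ n) x)" by (simp add: funpow_add add.commute[of n])
  then show ?case using Suc by (simp add: ergodic_sum_def del: funpow.simps)
qed (simp add: ergodic_sum_def)

lemma window_shift_avg:
  fixes a :: "nat \<Rightarrow> real"
  assumes "\<And>j. 0 \<le> a j" "\<And>j. a j \<le> 1"
  shows "\<bar>(\<Sum>j<N. a (j + m)) - (\<Sum>j<N. a j)\<bar> \<le> m"
proof (induction m)
  case (Suc m)
  have "(\<Sum>j<N. a (j + Suc m)) = (\<Sum>j<N. a (j + m)) + a (N + m) - a m"
    by (induction N) (auto simp: algebra_simps)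
  then show ?case using Suc assms(1)[of m] assms(2)[of m] assms(1)[of "N + m"] assms(2)[of "N + m"] by linarith
qed simp

text \<open>\<open>B\<close> bounds the potential, \<open>D\<close> its distortion on cylinders, and
  \<open>g\<close> is a common gap. The constant \<open>E\<close> is built from these three numbers
  only; this makes the Gibbs constant uniform as soon as they are uniform in the parameter.\<close>

locale sft_potential = sft X for X :: "(int \<Rightarrow> 'a::finite) set" +
  fixes F :: "(int \<Rightarrow> 'a) \<Rightarrow> real" and B D :: real and g :: nat
  assumes F_bound: "x \<in> X \<Longrightarrow> \<bar>F x\<bar> \<le> B"
    and F_distortion: "x \<in> X \<Longrightarrow> z \<in> X \<Longrightarrow> pre n x = pre n z \<Longrightarrow> \<bar>ergodic_sum F n x - ergodic_sum F n z\<bar> \<le> D"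
    and gap: "u \<in> W n \<Longrightarrow> v \<in> W m \<Longrightarrow> \<exists>c. length c = g \<and> u @ c @ v \<in> W (n + g + m)"
begin

definition wt :: "'a list \<Rightarrow> real" where
  "wt w = exp (ergodic_sum F (length w) (rep w))"

text \<open>Gluing two words across a gap makes two cuts, each costing \<open>2 * D\<close>, and
  inserts a gap word whose sum is at most \<open>g * B\<close> in absolute value.\<close>

definition E :: real where "E = exp (4 * D + g * B)"

definition Z :: "nat \<Rightarrow> real" where "Z n = (\<Sum>w\<in>W n. wt w)"

lemma B0: "0 \<le> B" and D0: "0 \<le> D"
proof -
  obtain x where x: "x \<in> X" using X_ne by blast
  show "0 \<le> B" using F_bound[OF x] by linarith
  show "0 \<le> D" using F_distortion[OF x x refl, of 0] by simp
qed

lemma E1: "1 \<le> E" using B0 D0 by (simp add: E_def)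

lemma E0: "0 < E" using E1 by linarith

lemma wt_pos [simp]: "0 < wt w" by (simp add: wt_def)

lemma Z_pos [simp]: "0 < Z n" unfolding Z_def by (intro sum_pos) auto

lemma wt_close:
  assumes "x \<in> X" "pre n x = w"
  shows "\<bar>ergodic_sum F n x - ln (wt w)\<bar> \<le> D"
proof -
  have w: "w \<in> W n" "length w = n" using assms by auto
  show ?thesis using F_distortion[OF assms(1) rep(1)[OF w(1)], of n] rep(2)[OF w(1)] assms(2) w(2) by (simp add: wt_def)
qed

lemma ergodic_sum_bound: "x \<in> X \<Longrightarrow> \<bar>ergodic_sum F n x\<bar> \<le> n * B"
  unfolding ergodic_sum_def
  by (rule order_trans[OF sum_abs]) (use sum_bounded_above[of "{..<n}" "\<lambda>k. \<bar>F ((shift ^^ k) x)\<bar>" B] F_bound in auto)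

lemma ln_wt_append:
  assumes "u @ v \<in> W (n + m)" "length u = n" "length v = m"
  shows "\<bar>ln (wt (u @ v)) - ln (wt u) - ln (wt v)\<bar> \<le> 2 * D"
proof -
  let ?x = "rep (u @ v)"
  have x: "?x \<in> X" "pre (n + m) ?x = u @ v" using rep[OF assms(1)] by auto
  then have p: "pre n ?x = u" "pre m ((shift ^^ n) ?x) = v"
    using assms(2,3) by (auto simp: pre_append funpow_shift append_eq_append_conv)
  have "ln (wt (u @ v)) = ergodic_sum F (n + m) ?x" using assms by (simp add: wt_def)
  then show ?thesis
    using wt_close[OF x(1) p(1)] wt_close[OF _ p(2)] x(1) by (simp add: ergodic_sum_add)
qed

lemma wt_append:
  assumes "u @ v \<in> W (n + m)" "length u = n" "length v = m"
  shows "wt (u @ v) \<le> E * wt u * wt v"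
proof -
  have "ln (wt (u @ v)) \<le> (4 * D + g * B) + ln (wt u) + ln (wt v)"
    using ln_wt_append[OF assms] D0 mult_nonneg_nonneg[OF of_nat_0_le_iff[of g] B0] by linarith
  then have "exp (ln (wt (u @ v))) \<le> exp ((4 * D + g * B) + ln (wt u) + ln (wt v))" by (subst exp_le_cancel_iff)
  then show ?thesis by (simp add: exp_add E_def)
qed

lemma wt_gap:
  assumes "u @ z @ v \<in> W (n + g + m)" "length u = n" "length z = g" "length v = m"
  shows "wt u * wt v \<le> E * wt (u @ z @ v)"
proof -
  have zv: "z @ v \<in> W (g + m)" using W_take_drop(2)[of "u @ z @ v" n "g + m"] assms by (simp add: add.assoc)
  have z: "z \<in> W g" using W_take_drop(1)[OF zv] assms by simp
  have "\<bar>ln (wt z)\<bar> \<le> g * B" using ergodic_sum_bound[OF rep(1)[OF z], of g] assms by (simp add: wt_def)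
  then have "ln (wt u) + ln (wt v) \<le> (4 * D + g * B) + ln (wt (u @ z @ v))"
    using ln_wt_append[of u "z @ v" n "g + m"] ln_wt_append[OF zv] assms by (simp add: add.assoc)
  then have "exp (ln (wt u) + ln (wt v)) \<le> exp ((4 * D + g * B) + ln (wt (u @ z @ v)))" by (subst exp_le_cancel_iff)
  then show ?thesis by (simp add: exp_add E_def)
qed

lemma Z_append: "Z (n + m) \<le> E * Z n * Z m"
proof -
  have "Z (n + m) \<le> (\<Sum>w\<in>W (n + m). E * wt (take n w) * wt (drop n w))"
    unfolding Z_def
  proof (rule sum_mono)
    fix w assume "w \<in> W (n + m)"
    then show "wt w \<le> E * wt (take n w) * wt (drop n w)"
      using wt_append[of "take n w" "drop n w" n m] W_length by force
  qed
  also have "\<dots> = (\<Sum>(u, v)\<in>(\<lambda>w. (take n w, drop n w)) ` W (n + m). E * wt u * wt v)"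
  proof (subst sum.reindex)
    show "inj_on (\<lambda>w. (take n w, drop n w)) (W (n + m))"
      by (rule inj_on_inverseI[where g = "\<lambda>(u, v). u @ v"]) simp
  qed simp
  also have "\<dots> \<le> (\<Sum>(u, v)\<in>W n \<times> W m. E * wt u * wt v)"
  proof (rule sum_mono2)
    show "(\<lambda>w. (take n w, drop n w)) ` W (n + m) \<subseteq> W n \<times> W m" using W_take_drop by blast
  qed (auto intro!: mult_nonneg_nonneg simp: less_imp_le[OF wt_pos] less_imp_le[OF E0])
  also have "\<dots> = E * (Z n * Z m)"
    unfolding Z_def sum_product sum.cartesian_product by (simp add: sum_distrib_left split_def mult.assoc)
  also have "\<dots> = E * Z n * Z m" by simp
  finally show ?thesis .
qed

definition conn :: "'a list \<Rightarrow> 'a list \<Rightarrow> 'a list" where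
  "conn u v = (SOME c. length c = g \<and> u @ c @ v \<in> W (length u + g + length v))"

lemma conn:
  assumes "u \<in> W n" "v \<in> W m"
  shows "length (conn u v) = g" "u @ conn u v @ v \<in> W (n + g + m)"
  using someI_ex[OF gap[OF assms]] W_length[OF assms(1)] W_length[OF assms(2)] unfolding conn_def by auto

text \<open>Words of fixed lengths can be recovered from the glued word, so gluing is injective and
  a product of partition sums is bounded by a single one.\<close>

lemma Z_gap: "Z n * Z m \<le> E * Z (n + g + m)"
proof -
  let ?j = "\<lambda>(u, v). u @ conn u v @ v"
  have "Z n * Z m = (\<Sum>(u, v)\<in>W n \<times> W m. wt u * wt v)"
    unfolding Z_def sum_product sum.cartesian_product ..
  also have "\<dots> \<le> (\<Sum>p\<in>W n \<times> W m. E * wt (?j p))"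
  proof (rule sum_mono, clarify)
    fix u v assume uv: "u \<in> W n" "v \<in> W m"
    show "wt u * wt v \<le> E * wt (u @ conn u v @ v)"
      using wt_gap[OF conn(2)[OF uv] W_length[OF uv(1)] conn(1)[OF uv] W_length[OF uv(2)]] .
  qed
  also have "\<dots> = (\<Sum>w\<in>?j ` (W n \<times> W m). E * wt w)"
  proof (rule sum.reindex_cong[symmetric, OF _ refl])
    show "inj_on ?j (W n \<times> W m)"
    proof (rule inj_onI, clarify)
      fix u v u' v' assume *: "u \<in> W n" "v \<in> W m" "u' \<in> W n" "v' \<in> W m" "u @ conn u v @ v = u' @ conn u' v' @ v'"
      have "length u = length u'" using W_length[OF *(1)] W_length[OF *(3)] by simp
      then have "u = u' \<and> conn u v @ v = conn u' v' @ v'"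
        using *(5) append_eq_append_conv[of u u' "conn u v @ v" "conn u' v' @ v'"] by blast
      moreover have "length (conn u v) = length (conn u' v')" using conn(1)[OF *(1,2)] conn(1)[OF *(3,4)] by simp
      ultimately show "u = u' \<and> v = v'" using append_eq_append_conv[of "conn u v" "conn u' v'" v v'] by blast
    qed
  qed simp
  also have "\<dots> \<le> (\<Sum>w\<in>W (n + g + m). E * wt w)"
  proof (rule sum_mono2)
    show "?j ` (W n \<times> W m) \<subseteq> W (n + g + m)" using conn(2) by auto
  qed (auto intro!: mult_nonneg_nonneg simp: less_imp_le[OF wt_pos] less_imp_le[OF E0])
  finally show ?thesis unfolding Z_def sum_distrib_left .
qed

text \<open>The a priori constant \<open>K\<close> is unspecified. If \<open>Z n\<close> exceeded
  \<open>E\<close>, gluing copies would make the partition sums grow geometrically; if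
  \<open>E * Z n\<close> were below one, concatenation would make them decay. Both contradict
  \<open>K\<close>, so \<open>E\<close> takes over as the bound.\<close>

lemma Z_bounds:
  assumes K: "K > 0" and ZK: "\<And>n. n \<ge> 1 \<Longrightarrow> inverse K \<le> Z n" "\<And>n. n \<ge> 1 \<Longrightarrow> Z n \<le> K" and n: "n \<ge> 1"
  shows "Z n \<le> E" "1 \<le> E * Z n"
proof -
  have "Z n * (Z n / E) ^ j \<le> Z (n + j * (g + n))" for j
  proof (induction j)
    case (Suc j)
    have "Z n * (Z n / E) ^ Suc j = (Z n * (Z n / E) ^ j) * Z n / E" by simp
    also have "\<dots> \<le> Z (n + j * (g + n)) * Z n / E"
      using Suc E0 by (intro divide_right_mono mult_right_mono) (auto intro: less_imp_le)
    also have "\<dots> \<le> Z (n + j * (g + n) + g + n)"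
      using Z_gap[of "n + j * (g + n)" n] E0 by (simp add: divide_le_eq mult.commute)
    finally show ?case by (simp add: algebra_simps)
  qed simp
  then have bd: "Z n * (Z n / E) ^ j \<le> K" for j using ZK(2)[of "n + j * (g + n)"] n by (meson order_trans trans_le_add1)
  show "Z n \<le> E"
  proof (rule ccontr)
    assume "\<not> Z n \<le> E"
    then have "1 < Z n / E" using E0 by (simp add: less_divide_eq)
    then obtain j where "K / Z n < (Z n / E) ^ j" using real_arch_pow by blast
    then have "K < Z n * (Z n / E) ^ j" by (simp add: divide_less_eq mult.commute)
    then show False using bd[of j] by simp
  qed
  have "Z (n + j * n) \<le> Z n * (E * Z n) ^ j" for j
  proof (induction j)
    case (Suc j)
    have "Z (n + j * n + n) \<le> E * Z (n + j * n) * Z n" by (rule Z_append)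
    also have "\<dots> \<le> E * (Z n * (E * Z n) ^ j) * Z n"
      using Suc E0 by (intro mult_right_mono mult_left_mono) (auto intro: less_imp_le)
    finally show ?case by (simp add: algebra_simps)
  qed simp
  then have bd2: "inverse K \<le> Z n * (E * Z n) ^ j" for j using ZK(1)[of "n + j * n"] n by (meson order_trans trans_le_add1)
  show "1 \<le> E * Z n"
  proof (rule ccontr)
    assume "\<not> 1 \<le> E * Z n"
    then have "(\<lambda>j. Z n * (E * Z n) ^ j) \<longlonglongrightarrow> Z n * 0"
      using E0 by (intro tendsto_mult LIMSEQ_power_zero) (auto intro: tendsto_const simp: less_imp_le)
    then have "inverse K \<le> Z n * 0" by (rule LIMSEQ_le_const) (use bd2 in auto)
    then show False using K by simp
  qed
qed


text \<open>The probability of reading \<open>w\<close> at position \<open>j\<close> in a word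
  \<open>V\<close> of length \<open>N\<close> drawn with probability proportional to its weight. The
  window may overrun \<open>V\<close>; it is then read off the representative. \<open>psiN\<close>
  averages over \<open>j\<close> to become shift-invariant in the limit.\<close>

definition occ :: "nat \<Rightarrow> nat \<Rightarrow> 'a list \<Rightarrow> real" where
  "occ N j w = (\<Sum>V\<in>W N. wt V / Z N * of_bool (pre (length w) (shZ (int j) (rep V)) = w))"

definition psiN :: "nat \<Rightarrow> 'a list \<Rightarrow> real" where
  "psiN N w = (\<Sum>j<N. occ N j w) / N"

lemma sum_of_bool_append:
  fixes x :: "int \<Rightarrow> 'a"
  shows   "(\<Sum>v\<in>words k. of_bool (pre (length (w @ v)) x = w @ v) :: real) = of_bool (pre (length w) x = w)"
proof -
  have "(\<Sum>v\<in>words k. of_bool (pre (length (w @ v)) x = w @ v) :: real) =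
      (\<Sum>v\<in>words k. if v = pre k (shZ (int (length w)) x) then of_bool (pre (length w) x = w) else 0)"
    by (intro sum.cong refl) (auto simp: pre_append)
  then show ?thesis by (simp only: sum.delta finite_words) simp
qed

lemma sum_of_bool_prepend:
  fixes x :: "int \<Rightarrow> 'a"
  shows   "(\<Sum>v\<in>words k. of_bool (pre (length (v @ w)) x = v @ w) :: real) = of_bool (pre (length w) (shZ (int k) x) = w)"
proof -
  have "(\<Sum>v\<in>words k. of_bool (pre (length (v @ w)) x = v @ w) :: real) =
      (\<Sum>v\<in>words k. if v = pre k x then of_bool (pre (length w) (shZ (int k) x) = w) else 0)"
    by (intro sum.cong refl) (auto simp: pre_append)
  then show ?thesis by (simp only: sum.delta finite_words) simp
qed

lemma wt_sum: "(\<Sum>V\<in>W N. wt V / Z N) = 1"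
  using less_imp_neq[OF Z_pos[of N]] unfolding sum_divide_distrib[symmetric] by (simp add: Z_def[symmetric])

lemma occ_01: "0 \<le> occ N j w" "occ N j w \<le> 1"
proof -
  show "0 \<le> occ N j w" unfolding occ_def by (intro sum_nonneg) (simp add: less_imp_le)
  have "occ N j w \<le> (\<Sum>V\<in>W N. wt V / Z N * 1)" unfolding occ_def
    by (intro sum_mono mult_left_mono) (auto simp: less_imp_le)
  then show "occ N j w \<le> 1" using wt_sum by simp
qed

lemma occ_append: "(\<Sum>v\<in>words k. occ N j (w @ v)) = occ N j w"
  unfolding occ_def by (subst sum.swap) (simp only: sum_distrib_left[symmetric] sum_of_bool_append)

lemma occ_prepend: "(\<Sum>v\<in>words k. occ N j (v @ w)) = occ N (j + k) w"
  unfolding occ_def by (subst sum.swap) (simp only: sum_distrib_left[symmetric] sum_of_bool_prepend shZ_shZ of_nat_add add.commute[of "int k"])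

lemma psiN_01: "0 \<le> psiN N w" "psiN N w \<le> 1"
proof -
  show "0 \<le> psiN N w" unfolding psiN_def by (intro divide_nonneg_nonneg sum_nonneg occ_01) auto
  have "(\<Sum>j<N. occ N j w) \<le> (\<Sum>j<N. 1)" by (intro sum_mono occ_01)
  then show "psiN N w \<le> 1" unfolding psiN_def by (cases "N = 0") (auto simp: divide_le_eq)
qed

lemma psiN_append: "(\<Sum>v\<in>words k. psiN N (w @ v)) = psiN N w"
  unfolding psiN_def sum_divide_distrib[symmetric] by (subst sum.swap) (simp add: occ_append)

text \<open>Summing out a prefix of length \<open>k\<close> moves the averaging window by
  \<open>k\<close>, which changes an average of numbers in \<open>[0, 1]\<close> only at its two
  ends.\<close>

lemma psiN_prepend: "\<bar>(\<Sum>v\<in>words k. psiN N (v @ w)) - psiN N w\<bar> \<le> k / N"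
proof -
  have "(\<Sum>v\<in>words k. psiN N (v @ w)) - psiN N w = ((\<Sum>j<N. occ N (j + k) w) - (\<Sum>j<N. occ N j w)) / N"
    unfolding psiN_def sum_divide_distrib[symmetric] by (subst sum.swap) (simp add: occ_prepend diff_divide_distrib)
  then show ?thesis using window_shift_avg[where a = "\<lambda>j. occ N j w" and N = N and m = k] occ_01 by (simp add: abs_divide divide_right_mono)
qed

lemma psiN_outside: "w \<notin> W (length w) \<Longrightarrow> psiN N w = 0"
proof -
  assume w: "w \<notin> W (length w)"
  have "occ N j w = 0" for j unfolding occ_def
  proof (rule sum.neutral, rule ballI)
    fix V assume "V \<in> W N"
    then have "pre (length w) (shZ (int j) (rep V)) \<in> W (length w)" using rep by simp
    then show "wt V / Z N * of_bool (pre (length w) (shZ (int j) (rep V)) = w) = 0" using w by auto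
  qed
  then show ?thesis by (simp add: psiN_def)
qed

lemma occ_Z: "occ N j w * Z N = (\<Sum>V\<in>W N. wt V * of_bool (pre (length w) (shZ (int j) (rep V)) = w))"
  unfolding occ_def sum_distrib_right by (intro sum.cong refl) (use Z_pos[of N] in \<open>simp add: less_imp_neq[symmetric]\<close>)

context
  fixes K :: real
  assumes K: "K > 0" and ZK: "\<And>n. n \<ge> 1 \<Longrightarrow> inverse K \<le> Z n" "\<And>n. n \<ge> 1 \<Longrightarrow> Z n \<le> K"
begin

lemma Z_le: "Z n \<le> E" and Z_ge: "1 \<le> E * Z n"
proof -
  have 0: "W 0 = {[]}" using X_ne by (auto simp: W_def pre_def)
  have "Z 0 = 1" unfolding Z_def 0 by (simp add: wt_def ergodic_sum_def)
  then show "Z n \<le> E" "1 \<le> E * Z n"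
    using Z_bounds[OF K ZK, of n] E1 by (cases "n = 0"; auto)+
qed

text \<open>Cut \<open>V\<close> before and after the window: \<open>wt V\<close> is at most
  \<open>E^2\<close> times the product of three weights. Bounding the two outer partition sums costs
  another \<open>E^2\<close>, and dividing by \<open>Z N\<close> one more \<open>E\<close>.\<close>

lemma occ_upper:
  assumes w: "w \<in> W n" and j: "j + n \<le> N"
  shows "occ N j w \<le> E ^ 5 * wt w"
proof -
  obtain m where m: "N = j + (n + m)" using j by (metis add.assoc le_iff_add)
  have lw: "length w = n" using W_length[OF w] .
  let ?S = "{V \<in> W N. take n (drop j V) = w}"
  have iff: "pre (length w) (shZ (int j) (rep V)) = w \<longleftrightarrow> take n (drop j V) = w" if "V \<in> W N" for V
    using take_drop_pre[of n j N "rep V"] rep[OF that] j lw by simp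
  have "occ N j w * Z N = (\<Sum>V\<in>?S. wt V)" unfolding occ_Z
    by (rule sum.mono_neutral_cong_right) (auto simp: iff)
  also have "\<dots> \<le> (\<Sum>V\<in>?S. (\<lambda>(u, v). E\<^sup>2 * wt w * (wt u * wt v)) (take j V, drop (j + n) V))"
  proof (rule sum_mono)
    fix V assume V: "V \<in> ?S"
    let ?u = "take j V" and ?v = "drop (j + n) V"
    have d: "drop j V \<in> W (n + m)" "length V = j + (n + m)" using W_take_drop(2)[of V j "n + m"] V m W_length by auto
    have dv: "drop j V = w @ ?v" using V append_take_drop_id[of n "drop j V"] by (simp add: add.commute)
    have Vu: "V = ?u @ (w @ ?v)" using append_take_drop_id[of j V] dv by simp
    have "wt V \<le> E * wt ?u * wt (w @ ?v)"
      using wt_append[of ?u "w @ ?v" j "n + m"] Vu V m d lw by simp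
    also have "\<dots> \<le> E * wt ?u * (E * wt w * wt ?v)"
      using wt_append[of w ?v n m] d dv lw E0 by (intro mult_left_mono) (auto simp: less_imp_le)
    finally show "wt V \<le> (\<lambda>(u, v). E\<^sup>2 * wt w * (wt u * wt v)) (?u, ?v)"
      by (simp add: power2_eq_square mult_ac)
  qed
  also have "\<dots> = (\<Sum>(u, v)\<in>(\<lambda>V. (take j V, drop (j + n) V)) ` ?S. E\<^sup>2 * wt w * (wt u * wt v))"
  proof (subst sum.reindex)
    show "inj_on (\<lambda>V. (take j V, drop (j + n) V)) ?S"
    proof (rule inj_on_inverseI[where g = "\<lambda>(u, v). u @ w @ v"])
      fix V assume "V \<in> ?S"
      then show "(\<lambda>(u, v). u @ w @ v) (take j V, drop (j + n) V) = V"
        using append_take_drop_id[of n "drop j V"] append_take_drop_id[of j V] by (simp add: add.commute)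
    qed
  qed simp
  also have "\<dots> \<le> (\<Sum>(u, v)\<in>W j \<times> W m. E\<^sup>2 * wt w * (wt u * wt v))"
  proof (rule sum_mono2)
    show "(\<lambda>V. (take j V, drop (j + n) V)) ` ?S \<subseteq> W j \<times> W m"
      using W_take_drop(1)[of _ j "n + m"] W_take_drop(2)[of _ "j + n" m] m by (auto simp: add.assoc)
  qed (auto simp: less_imp_le intro!: mult_nonneg_nonneg)
  also have "\<dots> = E\<^sup>2 * wt w * (Z j * Z m)"
    unfolding Z_def sum_product sum.cartesian_product by (simp add: sum_distrib_left split_def)
  also have "\<dots> \<le> E\<^sup>2 * wt w * (E * E)"
    by (intro mult_left_mono mult_mono Z_le) (use E0 in \<open>auto simp: less_imp_le intro!: mult_nonneg_nonneg\<close>)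
  finally have a: "occ N j w * Z N \<le> E ^ 4 * wt w" by (simp add: power_numeral_reduce mult_ac)
  have "occ N j w \<le> occ N j w * (E * Z N)" using occ_01(1)[of N j w] Z_ge[of N] mult_left_mono by fastforce
  also have "\<dots> \<le> E * (E ^ 4 * wt w)" using mult_left_mono[OF a, of E] E0 by (simp add: mult_ac)
  finally show ?thesis by (simp add: power_numeral_reduce mult_ac)
qed

text \<open>The converse construction: words before and after \<open>w\<close> are attached through
  gaps, so \<open>g\<close> free positions are required on each side. Two gaps give
  \<open>E^2\<close>, the bound on \<open>Z N\<close> gives \<open>E\<close>, and the lower bounds
  on the outer partition sums give \<open>E^2\<close>.\<close>

lemma occ_lower:
  assumes w: "w \<in> W n" and j: "g \<le> j" "j + n + g \<le> N"
  shows "wt w \<le> E ^ 5 * occ N j w"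
proof -
  obtain i where i: "j = i + g" using j(1) by (metis add.commute le_iff_add)
  obtain m where m: "N = j + n + g + m" using j(2) by (metis le_iff_add)
  have lw: "length w = n" using W_length[OF w] .
  let ?q = "\<lambda>v. w @ conn w v @ v"
  let ?V = "\<lambda>(u, v). u @ conn u (?q v) @ ?q v"
  let ?S = "{V \<in> W N. pre (length w) (shZ (int j) (rep V)) = w}"
  have V: "?V (u, v) \<in> ?S" "wt u * wt v * wt w \<le> E\<^sup>2 * wt (?V (u, v))"
      "take i (?V (u, v)) = u" "drop (j + n + g) (?V (u, v)) = v" if uv: "u \<in> W i" "v \<in> W m" for u v
  proof -
    note q = conn[OF w uv(2)]
    note c = conn[OF uv(1) q(2)]
    note l = W_length[OF uv(1)] W_length[OF uv(2)] lw q(1) c(1)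
    have VW: "?V (u, v) \<in> W N" using c(2) m i by (simp add: add.assoc)
    have "take n (drop j (?V (u, v))) = w" using l i by simp
    then have "pre (length w) (shZ (int j) (rep (?V (u, v)))) = w"
      using take_drop_pre[of n j N "rep (?V (u, v))"] rep[OF VW] m lw by simp
    then show "?V (u, v) \<in> ?S" using VW by blast
    have "wt u * (wt w * wt v) \<le> wt u * (E * wt (?q v))"
      using wt_gap[OF q(2)] l by (intro mult_left_mono) (auto simp: less_imp_le)
    also have "\<dots> \<le> E * (E * wt (?V (u, v)))"
      using wt_gap[OF c(2)] l mult_left_mono[of "wt u * wt (?q v)" "E * wt (?V (u, v))" E] E0 by (simp add: mult_ac)
    finally show "wt u * wt v * wt w \<le> E\<^sup>2 * wt (?V (u, v))" by (simp add: power2_eq_square mult_ac)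
    show "take i (?V (u, v)) = u" "drop (j + n + g) (?V (u, v)) = v" using l i by auto
  qed
  have "(Z i * Z m) * wt w = (\<Sum>(u, v)\<in>W i \<times> W m. wt u * wt v * wt w)"
    unfolding Z_def sum_product sum.cartesian_product by (simp add: sum_distrib_right split_def)
  also have "\<dots> \<le> (\<Sum>p\<in>W i \<times> W m. E\<^sup>2 * wt (?V p))"
    by (rule sum_mono) (use V(2) in auto)
  also have "\<dots> = (\<Sum>V\<in>?V ` (W i \<times> W m). E\<^sup>2 * wt V)"
  proof (rule sum.reindex_cong[symmetric, OF _ refl])
    show "inj_on ?V (W i \<times> W m)"
      by (rule inj_on_inverseI[where g = "\<lambda>V. (take i V, drop (j + n + g) V)"]) (use V(3,4) in force)
  qed simp
  also have "\<dots> \<le> (\<Sum>V\<in>?S. E\<^sup>2 * wt V)"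
    by (rule sum_mono2) (use V(1) in \<open>auto simp: less_imp_le\<close>)
  also have "\<dots> = E\<^sup>2 * (\<Sum>V\<in>?S. wt V)" by (simp add: sum_distrib_left)
  also have "(\<Sum>V\<in>?S. wt V) = occ N j w * Z N" unfolding occ_Z
    by (rule sum.mono_neutral_cong_left) auto
  also have "\<dots> \<le> occ N j w * E" by (intro mult_left_mono Z_le occ_01)
  finally have a: "Z i * Z m * wt w \<le> E\<^sup>2 * (occ N j w * E)" using E0 by (simp add: mult_left_mono)
  have "1 * 1 \<le> (E * Z i) * (E * Z m)" by (intro mult_mono Z_ge) (use E0 in \<open>auto simp: less_imp_le\<close>)
  then have "1 * wt w \<le> ((E * Z i) * (E * Z m)) * wt w" by (intro mult_right_mono) (auto simp: less_imp_le)
  also have "\<dots> = E\<^sup>2 * (Z i * Z m * wt w)" by (simp add: power2_eq_square)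
  also have "\<dots> \<le> E\<^sup>2 * (E\<^sup>2 * (occ N j w * E))" by (intro mult_left_mono a) simp
  finally show ?thesis by (simp add: power2_eq_square power_numeral_reduce mult_ac)
qed

lemma psiN_upper:
  assumes w: "w \<in> W n" and N: "N > 0" shows "psiN N w \<le> E ^ 5 * wt w + n / N"
proof -
  have "(\<Sum>j<N. occ N j w) \<le> (\<Sum>j<N. E ^ 5 * wt w + of_bool (N - n < j + 1))"
  proof (rule sum_mono)
    fix j assume "j \<in> {..<N}"
    have "0 \<le> E ^ 5 * wt w" using E0 by (simp add: less_imp_le)
    then show "occ N j w \<le> E ^ 5 * wt w + of_bool (N - n < j + 1)"
      using occ_upper[OF w, of j N] occ_01(2)[of N j w] by (cases "j + n \<le> N") (auto intro: order_trans)
  qed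
  also have "\<dots> = N * (E ^ 5 * wt w) + card ({..<N} \<inter> {j. N - n < j + 1})"
    by (simp add: sum.distrib sum_of_bool_eq Int_def)
  also have "card ({..<N} \<inter> {j. N - n < j + 1}) \<le> card {N - n..<N}" by (rule card_mono) auto
  also have "card {N - n..<N} \<le> n" by simp
  finally have "(\<Sum>j<N. occ N j w) \<le> N * (E ^ 5 * wt w) + n" by simp
  then show ?thesis unfolding psiN_def using N by (simp add: field_simps)
qed

lemma psiN_lower:
  assumes w: "w \<in> W n" and N: "N > 0" shows "wt w * (1 - (n + 2 * g) / N) \<le> E ^ 5 * psiN N w"
proof -
  have "(real N - (n + 2 * g)) * wt w \<le> real (card {g..<N - n - g}) * wt w"
    by (intro mult_right_mono) (auto simp: less_imp_le)
  also have "\<dots> = (\<Sum>j\<in>{g..<N - n - g}. wt w)" by simp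
  also have "\<dots> \<le> (\<Sum>j\<in>{g..<N - n - g}. E ^ 5 * occ N j w)"
    by (intro sum_mono occ_lower[OF w]) auto
  also have "\<dots> \<le> (\<Sum>j<N. E ^ 5 * occ N j w)"
    by (rule sum_mono2) (use occ_01 E0 in \<open>auto simp: less_imp_le intro!: mult_nonneg_nonneg\<close>)
  finally have "(real N - (n + 2 * g)) * wt w \<le> E ^ 5 * (\<Sum>j<N. occ N j w)" by (simp add: sum_distrib_left)
  then have "(real N - (n + 2 * g)) * wt w / N \<le> E ^ 5 * (\<Sum>j<N. occ N j w) / N" by (rule divide_right_mono) simp
  moreover have "(real N - (n + 2 * g)) * wt w / N = wt w * (1 - (n + 2 * g) / N)" using N by (simp add: field_simps)
  ultimately show ?thesis unfolding psiN_def by simp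
qed

end


end

lemma (in finite_measure) measure_fibres:
  assumes "A \<in> sets M" "finite S" "\<And>x. x \<in> A \<Longrightarrow> Y x \<in> S" "\<And>s. s \<in> S \<Longrightarrow> {x \<in> A. Y x = s} \<in> sets M"
  shows "(\<Sum>s\<in>S. measure M {x \<in> A. Y x = s}) = measure M A"
proof -
  have "measure M (\<Union>s\<in>S. {x \<in> A. Y x = s}) = (\<Sum>s\<in>S. measure M {x \<in> A. Y x = s})"
    by (rule finite_measure_finite_Union) (use assms in \<open>auto simp: disjoint_family_on_def\<close>)
  moreover have "(\<Union>s\<in>S. {x \<in> A. Y x = s}) = A" using assms(3) by blast
  ultimately show ?thesis by simp
qed

lemma (in sft) shift_inv_funpow:
  assumes "\<mu> \<in> shift_inv_probs X" "A \<in> sets XM"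
  shows "measure \<mu> ((shift ^^ k) -` A \<inter> X) = measure \<mu> A"
  using assms(2)
proof (induction k arbitrary: A)
  case 0
  then show ?case using sets.sets_into_space[OF 0] by (simp add: Int_absorb2)
next
  case (Suc k)
  have S: "shift -` A \<inter> X \<in> sets XM" using measurable_sets[OF shift_measurable Suc.prems] by simp
  have "(shift ^^ Suc k) -` A \<inter> X = (shift ^^ k) -` (shift -` A \<inter> X) \<inter> X" by auto
  also have "measure \<mu> \<dots> = measure \<mu> (shift -` A \<inter> X)" by (rule Suc.IH[OF S])
  also have "\<dots> = measure \<mu> A" using assms(1) Suc.prems unfolding shift_inv_probs_def by auto
  finally show ?case .
qed

lemma (in sft) cyl_eq: "cyl X x n = {z \<in> X. pre n z = pre n x}"
proof -
  have "(\<forall>i. 0 \<le> i \<and> i < int n \<longrightarrow> z i = x i) \<longleftrightarrow> (\<forall>i<n. z (int i) = x (int i))" for z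
    by (metis nonneg_int_cases of_nat_0_le_iff of_nat_less_iff)
  then show ?thesis unfolding cyl_def pre_eq_iff by simp
qed

text \<open>A limit \<psi> of \<open>psiN\<close> is a stationary law comparable to
  \<open>wt\<close> with constant \<open>E ^ 5\<close>. The given \<mu> is dominated by it, with a
  factor involving \<open>K\<close>, and \<psi> is mixing; uniqueness identifies \<mu> with \<psi>,
  whereupon \<open>K\<close> disappears. The sixth power comes from moving from the representative
  to \<open>x\<close>.\<close>

theorem (in sft_potential) uniform_gibbs:
  assumes mu: "\<mu> \<in> shift_inv_probs X" and K: "K > 0"
    and gibbs: "\<And>x n. x \<in> X \<Longrightarrow> n \<ge> 1 \<Longrightarrow> inverse K \<le> measure \<mu> (cyl X x n) / exp (ergodic_sum F n x) \<and>
        measure \<mu> (cyl X x n) / exp (ergodic_sum F n x) \<le> K"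
    and x: "x \<in> X"
  shows "measure \<mu> (cyl X x n) \<le> E ^ 6 * exp (ergodic_sum F n x)"
    and "exp (ergodic_sum F n x) \<le> E ^ 6 * measure \<mu> (cyl X x n)"
proof -
  interpret prob_space \<mu> using mu by (simp add: shift_inv_probs_def)
  have sets_mu: "sets \<mu> = sets XM" using mu by (simp add: shift_inv_probs_def)
  have cs: "{x \<in> X. pre n (shZ j x) = w} \<in> sets \<mu>" for n j w using cylinder_sets sets_mu by simp
  have cs0: "{x \<in> X. pre n x = w} \<in> sets \<mu>" for n w using cs[of n 0 w] by simp
  have sp: "space \<mu> = X" using sets_eq_imp_space_eq[OF sets_mu] by simp
  define m where "m w = measure \<mu> {x \<in> X. pre (length w) x = w}" for w
  have m_r: "(\<Sum>v\<in>words k. m (w @ v)) = m w" for w k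
  proof -
    have "m (w @ v) = measure \<mu> {x \<in> {x \<in> X. pre (length w) x = w}. pre k (shZ (int (length w)) x) = v}"
      if "v \<in> words k" for v
      unfolding m_def by (rule arg_cong[of _ _ "measure \<mu>"]) (use that in \<open>auto simp: pre_append\<close>)
    then have "(\<Sum>v\<in>words k. m (w @ v)) =
        (\<Sum>v\<in>words k. measure \<mu> {x \<in> {x \<in> X. pre (length w) x = w}. pre k (shZ (int (length w)) x) = v})"
      by (rule sum.cong[OF refl])
    also have "\<dots> = m w" unfolding m_def
    proof (rule measure_fibres)
      fix v
      have "{x \<in> {x \<in> X. pre (length w) x = w}. pre k (shZ (int (length w)) x) = v} =
        {x \<in> X. pre (length w) x = w} \<inter> {x \<in> X. pre k (shZ (int (length w)) x) = v}" by auto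
      then show "{x \<in> {x \<in> X. pre (length w) x = w}. pre k (shZ (int (length w)) x) = v} \<in> sets \<mu>"
        using sets.Int[OF cs0 cs] by simp
    qed (use finite_words cs0 in auto)
    finally show ?thesis .
  qed
  have m_l: "(\<Sum>v\<in>words k. m (v @ w)) = m w" for w k
  proof -
    let ?A = "{x \<in> X. pre (length w) (shZ (int k) x) = w}"
    have "m (v @ w) = measure \<mu> {x \<in> ?A. pre k x = v}" if "v \<in> words k" for v
      unfolding m_def by (rule arg_cong[of _ _ "measure \<mu>"]) (use that in \<open>auto simp: pre_append\<close>)
    then have "(\<Sum>v\<in>words k. m (v @ w)) = (\<Sum>v\<in>words k. measure \<mu> {x \<in> ?A. pre k x = v})"
      by (rule sum.cong[OF refl])
    also have "\<dots> = measure \<mu> ?A"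
    proof (rule measure_fibres)
      fix v
      have "{x \<in> ?A. pre k x = v} = ?A \<inter> {x \<in> X. pre k x = v}" by auto
      then show "{x \<in> ?A. pre k x = v} \<in> sets \<mu>" using sets.Int[OF cs cs0] by simp
    qed (use finite_words cs in auto)
    also have "?A = (shift ^^ k) -` {x \<in> X. pre (length w) x = w} \<inter> X" by (auto simp: funpow_shift)
    also have "measure \<mu> \<dots> = m w" unfolding m_def
      by (rule shift_inv_funpow[OF mu]) (use cs0 sets_mu in simp)
    finally show ?thesis .
  qed
  have m_nil: "m [] = 1" unfolding m_def using prob_space sp by (simp add: pre_def)
  have mcyl: "measure \<mu> (cyl X z n) = m (pre n z)" for z n unfolding cyl_eq m_def by simp
  have mwt: "m w \<le> K * wt w" "wt w \<le> K * m w" if w: "w \<in> W n" and n: "n \<ge> 1" for w n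
  proof -
    have e: "measure \<mu> (cyl X (rep w) n) = m w" "exp (ergodic_sum F n (rep w)) = wt w"
      using rep[OF w] W_length[OF w] mcyl by (simp_all add: wt_def)
    have "inverse K \<le> m w / wt w" "m w / wt w \<le> K" using gibbs[OF rep(1)[OF w] n] unfolding e by auto
    then show "m w \<le> K * wt w" "wt w \<le> K * m w"
      using K wt_pos[of w] by (auto simp: pos_divide_le_eq pos_le_divide_eq inverse_eq_divide field_simps)
  qed
  have m_out: "m w = 0" if "w \<notin> W (length w)" for w
  proof -
    have "pre (length w) x \<noteq> w" if "x \<in> X" for x
      using pre_W[OF that, of "length w"] \<open>w \<notin> W (length w)\<close> by metis
    then have e: "{x \<in> X. pre (length w) x = w} = {}" by simp
    show ?thesis unfolding m_def e by simp
  qed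
  have m_sum: "(\<Sum>w\<in>W n. m w) = 1" for n
  proof -
    have "(\<Sum>w\<in>W n. m w) = (\<Sum>w\<in>words n. m w)"
      by (rule sum.mono_neutral_left) (use finite_words W_length m_out in auto)
    then show ?thesis using m_r[of "[]" n] m_nil by simp
  qed
  have ZK: "inverse K \<le> Z n" "Z n \<le> K" if n: "n \<ge> 1" for n
  proof -
    have "1 \<le> (\<Sum>w\<in>W n. K * wt w)" unfolding m_sum[of n, symmetric] by (intro sum_mono mwt(1)[OF _ n])
    then show "inverse K \<le> Z n" using K unfolding Z_def sum_distrib_left[symmetric]
      by (simp add: inverse_eq_divide divide_le_eq mult.commute)
    have "Z n \<le> (\<Sum>w\<in>W n. K * m w)" unfolding Z_def by (intro sum_mono mwt(2)[OF _ n])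
    then show "Z n \<le> K" unfolding sum_distrib_left[symmetric] m_sum by simp
  qed
  obtain \<F> :: "nat filter" where F: "\<F> \<noteq> bot" "\<F> \<le> sequentially" "\<And>a::nat \<Rightarrow> real. Bseq a \<Longrightarrow> \<exists>l. (a \<longlongrightarrow> l) \<F>"
    using bounded_sequences_converge_filter by blast
  have "\<exists>l. ((\<lambda>N. psiN N w) \<longlongrightarrow> l) \<F>" for w
    by (rule F(3), rule BseqI'[of _ 1]) (use psiN_01[of _ w] in auto)
  then obtain \<psi> where \<psi>: "\<And>w. ((\<lambda>N. psiN N w) \<longlongrightarrow> \<psi> w) \<F>" by metis
  have seqF: "(a \<longlongrightarrow> l) \<F>" if "a \<longlonglongrightarrow> l" for a :: "nat \<Rightarrow> real" and l
    using tendsto_mono[OF F(2) that] .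
  have evF: "eventually P \<F>" if "eventually P sequentially" for P using that F(2) by (rule filter_leD[rotated])
  have inv0: "((\<lambda>N. real c / real N) \<longlongrightarrow> 0) \<F>" for c :: nat
    by (rule seqF) (intro tendsto_divide_0[OF tendsto_const] filterlim_at_top_imp_at_infinity filterlim_real_sequentially)
  have psi0: "0 \<le> \<psi> w" for w
    by (rule tendsto_lowerbound[OF \<psi> always_eventually F(1)]) (use psiN_01 in auto)
  have psi_r: "(\<Sum>v\<in>words k. \<psi> (w @ v)) = \<psi> w" for w k
  proof -
    have "((\<lambda>N. \<Sum>v\<in>words k. psiN N (w @ v)) \<longlongrightarrow> (\<Sum>v\<in>words k. \<psi> (w @ v))) \<F>" by (intro tendsto_sum \<psi>)
    then show ?thesis unfolding psiN_append using tendsto_unique[OF F(1) _ \<psi>[of w]] by blast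
  qed
  have psi_l: "(\<Sum>v\<in>words k. \<psi> (v @ w)) = \<psi> w" for w k
  proof -
    have "((\<lambda>N. \<bar>(\<Sum>v\<in>words k. psiN N (v @ w)) - psiN N w\<bar>) \<longlongrightarrow> \<bar>(\<Sum>v\<in>words k. \<psi> (v @ w)) - \<psi> w\<bar>) \<F>"
      by (intro tendsto_intros \<psi>)
    then have "\<bar>(\<Sum>v\<in>words k. \<psi> (v @ w)) - \<psi> w\<bar> \<le> 0"
      by (rule tendsto_le[OF F(1) inv0[of k]]) (use psiN_prepend in auto)
    then show ?thesis by simp
  qed
  have psi_nil: "\<psi> [] = 1"
  proof (rule tendsto_unique[OF F(1) \<psi>], rule seqF, rule tendsto_eventually)
    have "psiN N [] = 1" if "N > 0" for N
      using that wt_sum[of N] by (simp add: psiN_def occ_def pre_def)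
    then show "eventually (\<lambda>N. psiN N [] = 1) sequentially"
      by (rule eventually_mono[OF eventually_gt_at_top[of 0]])
  qed
  have psi_out: "\<psi> w = 0" if "w \<notin> W (length w)" for w
    using tendsto_unique[OF F(1) \<psi>[of w]] psiN_outside[OF that] by simp
  have psi_le: "\<psi> w \<le> E ^ 5 * wt w" if w: "w \<in> W n" for w n
  proof -
    have "((\<lambda>N. E ^ 5 * wt w + real n / real N) \<longlongrightarrow> E ^ 5 * wt w + 0) \<F>" by (intro tendsto_intros inv0)
    then have "\<psi> w \<le> E ^ 5 * wt w + 0"
      by (rule tendsto_le[OF F(1) _ \<psi>])
        (rule evF, rule eventually_mono[OF eventually_gt_at_top[of 0]], use psiN_upper[OF K ZK w] in blast)
    then show ?thesis by simp
  qed
  have psi_ge: "wt w \<le> E ^ 5 * \<psi> w" if w: "w \<in> W n" for w n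
  proof -
    have l: "((\<lambda>N. wt w * (1 - real (n + 2 * g) / real N)) \<longlongrightarrow> wt w * (1 - 0)) \<F>" by (intro tendsto_intros inv0)
    have "((\<lambda>N. E ^ 5 * psiN N w) \<longlongrightarrow> E ^ 5 * \<psi> w) \<F>" by (intro tendsto_intros \<psi>)
    then have "wt w * (1 - 0) \<le> E ^ 5 * \<psi> w"
      by (rule tendsto_le[OF F(1) _ l])
        (rule evF, rule eventually_mono[OF eventually_gt_at_top[of 0]], use psiN_lower[OF K ZK w] in blast)
    then show ?thesis by simp
  qed
  have E5: "0 < E ^ 5" using E0 by simp
  \<comment> \<open>The exponent 16 collects \<open>E ^ 10\<close> from two upper bounds for \<psi>,
    \<open>E\<close> for the gap and \<open>E ^ 5\<close> from the lower bound. The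
    \<open>max 1\<close> covers the empty word, where the Gibbs bounds are not given.\<close>
  have mpsi: "m w = \<psi> w" for w
  proof (rule dominated_by_mixing_unique[where K = "max 1 (K * E ^ 5)" and c = "inverse (E ^ 16)" and g = g])
    fix w
    show "m w \<le> max 1 (K * E ^ 5) * \<psi> w"
    proof (cases "w \<in> W (length w) \<and> w \<noteq> []")
      case True
      then have "m w \<le> K * wt w" by (intro mwt(1)) (auto simp: Suc_le_eq)
      also have "\<dots> \<le> K * (E ^ 5 * \<psi> w)" using psi_ge True K by (intro mult_left_mono) auto
      also have "\<dots> \<le> max 1 (K * E ^ 5) * \<psi> w" using psi0[of w] by (simp add: mult.assoc[symmetric] mult_right_mono)
      finally show ?thesis .
    next
      case False
      have "1 * \<psi> w \<le> max 1 (K * E ^ 5) * \<psi> w" using psi0 by (intro mult_right_mono) auto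
      then show ?thesis using False m_out[of w] psi_out[of w] m_nil psi_nil by (cases "w = []") auto
    qed
  next
    fix u v
    show "inverse (E ^ 16) * \<psi> u * \<psi> v \<le> (\<Sum>z\<in>words g. \<psi> (u @ z @ v))"
    proof (cases "u \<in> W (length u) \<and> v \<in> W (length v)")
      case True
      then have uv: "u \<in> W (length u)" "v \<in> W (length v)" by auto
      note c = conn[OF uv]
      have "\<psi> u * \<psi> v \<le> (E ^ 5 * wt u) * (E ^ 5 * wt v)"
        using psi_le[OF uv(1)] psi_le[OF uv(2)] psi0 by (intro mult_mono) (auto intro: order_trans)
      also have "\<dots> = E ^ 10 * (wt u * wt v)" by (simp add: mult_ac power_add[symmetric])
      also have "\<dots> \<le> E ^ 10 * (E * wt (u @ conn u v @ v))"
        using wt_gap[OF c(2) refl c(1) refl] E0 by (intro mult_left_mono) auto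
      also have "\<dots> \<le> E ^ 10 * (E * (E ^ 5 * \<psi> (u @ conn u v @ v)))"
        using psi_ge[OF c(2)] E0 by (intro mult_left_mono) auto
      also have "\<dots> = E ^ 16 * \<psi> (u @ conn u v @ v)" by (simp add: mult.assoc[symmetric] power_Suc[symmetric] power_add[symmetric] del: power_Suc)
      also have "\<psi> (u @ conn u v @ v) \<le> (\<Sum>z\<in>words g. \<psi> (u @ z @ v))"
        by (rule member_le_sum[where f = "\<lambda>z. \<psi> (u @ z @ v)"]) (use c psi0 finite_words in auto)
      finally show ?thesis using E0 by (simp add: inverse_eq_divide divide_le_eq mult.commute mult_left_mono)
    next
      case False
      then have "inverse (E ^ 16) * \<psi> u * \<psi> v = 0" using psi_out by auto
      also have "0 \<le> (\<Sum>z\<in>words g. \<psi> (u @ z @ v))" by (intro sum_nonneg psi0)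
      finally show ?thesis .
    qed
  qed (use psi0 psi_nil m_nil psi_r psi_l m_r m_l E0 in \<open>auto simp: m_def\<close>)
  let ?w = "pre n x"
  have w: "?w \<in> W n" using x by simp
  have "\<bar>ergodic_sum F n x - ln (wt ?w)\<bar> \<le> D" using wt_close[OF x refl] .
  moreover have "D \<le> ln E" using D0 mult_nonneg_nonneg[OF of_nat_0_le_iff[of g] B0] by (simp add: E_def)
  ultimately have a: "ln (wt ?w) \<le> ln E + ergodic_sum F n x" "ergodic_sum F n x \<le> ln E + ln (wt ?w)" by linarith+
  have a1: "wt ?w \<le> E * exp (ergodic_sum F n x)"
    using a(1) E0 wt_pos[of ?w] exp_le_cancel_iff[of "ln (wt ?w)" "ln E + ergodic_sum F n x"] by (simp add: exp_add)
  have a2: "exp (ergodic_sum F n x) \<le> E * wt ?w"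
    using a(2) E0 wt_pos[of ?w] exp_le_cancel_iff[of "ergodic_sum F n x" "ln E + ln (wt ?w)"] by (simp add: exp_add)
  have "measure \<mu> (cyl X x n) \<le> E ^ 5 * wt ?w" using mcyl mpsi psi_le[OF w] by simp
  also have "\<dots> \<le> E ^ 5 * (E * exp (ergodic_sum F n x))" using a1 E5 by (intro mult_left_mono) auto
  finally show "measure \<mu> (cyl X x n) \<le> E ^ 6 * exp (ergodic_sum F n x)" by (simp add: power_numeral_reduce mult_ac)
  have "exp (ergodic_sum F n x) \<le> E * (E ^ 5 * measure \<mu> (cyl X x n))"
    using order_trans[OF a2 mult_left_mono[OF psi_ge[OF w], of E]] E0 mcyl mpsi by simp
  then show "exp (ergodic_sum F n x) \<le> E ^ 6 * measure \<mu> (cyl X x n)" by (simp add: power_numeral_reduce mult_ac)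
qed

section \<open>Fiberwise pressure\<close>

text \<open>In the application \<open>a N\<close> is \<open>meanZ N\<close>,
  \<open>\<epsilon> M\<close> the mean modulus of a window of radius \<open>M\<close>,
  \<open>C M / N\<close> the boundary cost and \<open>N / (N + real g)\<close> the loss by gaps.
  First \<open>M\<close> is chosen, then \<open>N\<close>, then the threshold for
  \<open>n\<close>.\<close>

lemma sandwich_limit:
  fixes q a \<epsilon> C :: "nat \<Rightarrow> real"
  assumes eps: "\<epsilon> \<longlonglongrightarrow> 0" and a: "a \<longlonglongrightarrow> p"
    and up: "\<And>M N \<delta>. N \<ge> 1 \<Longrightarrow> \<delta> > 0 \<Longrightarrow> eventually (\<lambda>n. q n \<le> a N + \<epsilon> M + C M / N + \<delta>) sequentially"
    and lo: "\<And>M N \<delta>. N \<ge> 1 \<Longrightarrow> \<delta> > 0 \<Longrightarrow> eventually (\<lambda>n. N / (N + real g) * (a N - \<epsilon> M - C M / N) - \<delta> \<le> q n) sequentially"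
  shows "q \<longlonglongrightarrow> p"
proof (rule order_tendstoI)
  have inv: "(\<lambda>N. c / real N) \<longlonglongrightarrow> 0" for c :: real
    by (intro tendsto_divide_0[OF tendsto_const] filterlim_at_top_imp_at_infinity filterlim_real_sequentially)
  have "(\<lambda>N. 1 / (1 + real g / real N)) \<longlonglongrightarrow> 1 / (1 + 0)" by (intro tendsto_intros inv) auto
  moreover have "eventually (\<lambda>N. 1 / (1 + real g / real N) = real N / (real N + real g)) sequentially"
    using eventually_gt_at_top[of 0] by eventually_elim (simp add: field_simps)
  ultimately have fr: "(\<lambda>N. real N / (real N + real g)) \<longlonglongrightarrow> 1" using Lim_transform_eventually by force
  {
    fix r assume r: "p < r"
    then have "eventually (\<lambda>M. \<epsilon> M < (r - p) / 2) sequentially" by (intro order_tendstoD(2)[OF eps]) simp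
    then obtain M where M: "\<epsilon> M < (r - p) / 2" using eventually_happens'[OF trivial_limit_sequentially] by blast
    have "(\<lambda>N. a N + \<epsilon> M + C M / N) \<longlonglongrightarrow> p + \<epsilon> M + 0" by (intro tendsto_intros a inv)
    then have "eventually (\<lambda>N. a N + \<epsilon> M + C M / N < p + (r - p) / 2 \<and> N \<ge> 1) sequentially"
      using M by (intro eventually_conj order_tendstoD(2) eventually_ge_at_top) auto
    then obtain N where N: "a N + \<epsilon> M + C M / N < p + (r - p) / 2" "N \<ge> 1"
      using eventually_happens'[OF trivial_limit_sequentially] by blast
    define \<delta> where "\<delta> = p + (r - p) / 2 - (a N + \<epsilon> M + C M / N)"
    have "\<delta> > 0" using N by (simp add: \<delta>_def)
    from up[OF N(2) this, of M] show "eventually (\<lambda>n. q n < r) sequentially"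
    proof eventually_elim
      case (elim n)
      then have "q n \<le> p + (r - p) / 2" by (simp add: \<delta>_def)
      also have "\<dots> < r" using r by (simp add: field_simps)
      finally show ?case .
    qed
  next
    fix r assume r: "r < p"
    then have "eventually (\<lambda>M. \<epsilon> M < (p - r) / 2) sequentially" by (intro order_tendstoD(2)[OF eps]) simp
    then obtain M where M: "\<epsilon> M < (p - r) / 2" using eventually_happens'[OF trivial_limit_sequentially] by blast
    have "(\<lambda>N. N / (N + real g) * (a N - \<epsilon> M - C M / N)) \<longlonglongrightarrow> 1 * (p - \<epsilon> M - 0)" by (intro tendsto_intros a inv fr)
    then have "eventually (\<lambda>N. p - (p - r) / 2 < N / (N + real g) * (a N - \<epsilon> M - C M / N) \<and> N \<ge> 1) sequentially"
      using M by (intro eventually_conj order_tendstoD(1) eventually_ge_at_top) auto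
    then obtain N where N: "p - (p - r) / 2 < N / (N + real g) * (a N - \<epsilon> M - C M / N)" "N \<ge> 1"
      using eventually_happens'[OF trivial_limit_sequentially] by blast
    define \<delta> where "\<delta> = N / (N + real g) * (a N - \<epsilon> M - C M / N) - (p - (p - r) / 2)"
    have "\<delta> > 0" using N by (simp add: \<delta>_def)
    from lo[OF N(2) this, of M] show "eventually (\<lambda>n. r < q n) sequentially"
    proof eventually_elim
      case (elim n)
      have "r < p - (p - r) / 2" using r by (simp add: field_simps)
      also have "\<dots> \<le> q n" using elim by (simp add: \<delta>_def)
      finally show ?case .
    qed
  }
qed

text \<open>The hypothesis compares arbitrary \<open>N\<close> and \<open>N'\<close>; letting one of
  them run along a convergent subsequence bounds the other from both sides.\<close>

lemma almost_additive_convergent: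
  fixes a \<epsilon> C :: "nat \<Rightarrow> real"
  assumes eps: "\<epsilon> \<longlonglongrightarrow> 0" and bounded: "bounded (range a)"
    and le: "\<And>M N N'. N \<ge> 1 \<Longrightarrow> N' \<ge> 1 \<Longrightarrow> N' / (N' + real g) * (a N' - \<epsilon> M - C M / N') \<le> a N + \<epsilon> M + C M / N"
  shows "convergent a"
proof -
  obtain l r where r: "strict_mono r" and l: "(a \<circ> r) \<longlonglongrightarrow> l"
    using bounded_imp_convergent_subsequence[OF bounded] by blast
  have l': "(\<lambda>j. a (r j)) \<longlonglongrightarrow> l" using l by (simp add: comp_def)
  have rt: "filterlim r at_top sequentially" by (rule filterlim_subseq[OF r])
  have inv: "(\<lambda>N. c / real N) \<longlonglongrightarrow> 0" for c :: real
    by (intro tendsto_divide_0[OF tendsto_const] filterlim_at_top_imp_at_infinity filterlim_real_sequentially)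
  have "(\<lambda>N. 1 / (1 + real g / real N)) \<longlonglongrightarrow> 1 / (1 + 0)" by (intro tendsto_intros inv) auto
  moreover have "eventually (\<lambda>N. 1 / (1 + real g / real N) = real N / (real N + real g)) sequentially"
    using eventually_gt_at_top[of 0] by eventually_elim (simp add: field_simps)
  ultimately have fr: "(\<lambda>N. real N / (real N + real g)) \<longlonglongrightarrow> 1" using Lim_transform_eventually by force
  note invr = filterlim_compose[OF inv rt] and frr = filterlim_compose[OF fr rt]
  have ev: "eventually (\<lambda>j. r j \<ge> 1) sequentially" using rt by (simp add: filterlim_at_top)
  have up: "N / (N + real g) * (a N - \<epsilon> M - C M / N) \<le> l + \<epsilon> M" if "N \<ge> 1" for M N
  proof -
    have "(\<lambda>j. a (r j) + \<epsilon> M + C M / r j) \<longlonglongrightarrow> l + \<epsilon> M + 0" by (intro tendsto_intros l' invr)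
    then have "N / (N + real g) * (a N - \<epsilon> M - C M / N) \<le> l + \<epsilon> M + 0"
      by (rule tendsto_lowerbound[OF _ eventually_mono[OF ev]]) (use le that in auto)
    then show ?thesis by simp
  qed
  have lo: "l - \<epsilon> M \<le> a N + \<epsilon> M + C M / N" if "N \<ge> 1" for M N
  proof -
    have "(\<lambda>j. r j / (r j + real g) * (a (r j) - \<epsilon> M - C M / r j)) \<longlonglongrightarrow> 1 * (l - \<epsilon> M - 0)"
      by (intro tendsto_intros l' invr frr)
    then have "1 * (l - \<epsilon> M - 0) \<le> a N + \<epsilon> M + C M / N"
      by (rule tendsto_upperbound[OF _ eventually_mono[OF ev]]) (use le that in auto)
    then show ?thesis by simp
  qed
  have "a \<longlonglongrightarrow> l"
  proof (rule order_tendstoI)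
    fix s assume s: "l < s"
    then have "eventually (\<lambda>M. \<epsilon> M < (s - l) / 2) sequentially" by (intro order_tendstoD(2)[OF eps]) simp
    then obtain M where M: "\<epsilon> M < (s - l) / 2" using eventually_happens'[OF trivial_limit_sequentially] by blast
    have "(\<lambda>N. (l + \<epsilon> M) * (1 + real g / N) + \<epsilon> M + C M / N) \<longlonglongrightarrow> (l + \<epsilon> M) * (1 + 0) + \<epsilon> M + 0"
      by (intro tendsto_intros inv)
    then have "eventually (\<lambda>N. (l + \<epsilon> M) * (1 + real g / N) + \<epsilon> M + C M / N < s) sequentially"
      by (rule order_tendstoD(2)) (use M in \<open>simp add: field_simps\<close>)
    then show "eventually (\<lambda>N. a N < s) sequentially"
      using eventually_ge_at_top[of 1]
    proof eventually_elim
      case (elim N)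
      then have N: "real N > 0" by simp
      have "(1 + real g / N) * (N / (N + real g) * (a N - \<epsilon> M - C M / N)) \<le> (1 + real g / N) * (l + \<epsilon> M)"
        using up[of N M] elim by (intro mult_left_mono) auto
      moreover have "(1 + real g / N) * (N / (N + real g) * (a N - \<epsilon> M - C M / N)) = a N - \<epsilon> M - C M / N"
      proof -
        have "1 + real g / N = (N + real g) / N" "N + real g \<noteq> 0" using N by (simp_all add: add_divide_distrib)
        then have "(1 + real g / N) * (N / (N + real g)) = 1" using N by simp
        then show ?thesis by (simp only: mult.assoc[symmetric] mult_1_left)
      qed
      ultimately show ?case using elim(1) by (simp add: mult.commute)
    qed
  next
    fix s assume s: "s < l"
    then have "eventually (\<lambda>M. \<epsilon> M < (l - s) / 2) sequentially" by (intro order_tendstoD(2)[OF eps]) simp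
    then obtain M where M: "\<epsilon> M < (l - s) / 2" using eventually_happens'[OF trivial_limit_sequentially] by blast
    have "(\<lambda>N. l - 2 * \<epsilon> M - C M / N) \<longlonglongrightarrow> l - 2 * \<epsilon> M - 0" by (intro tendsto_intros inv)
    then have "eventually (\<lambda>N. s < l - 2 * \<epsilon> M - C M / N) sequentially"
      by (rule order_tendstoD(1)) (use M in \<open>simp add: field_simps\<close>)
    then show "eventually (\<lambda>N. s < a N) sequentially"
      using eventually_ge_at_top[of 1]
    proof eventually_elim
      case (elim N)
      then show ?case using lo[of N M] by simp
    qed
  qed
  then show ?thesis by (rule convergentI)
qed

text \<open>Positions whose window of radius \<open>M\<close> fits inside the word are charged to
  the small \<open>e\<close>; the remaining ones are charged to the envelope \<open>b\<close>, which
  is expensive but is spent on boundedly many positions.\<close>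

lemma boundary_sum_bound:
  fixes a :: "nat \<Rightarrow> real"
  assumes b: "\<And>y. 0 \<le> b y" and e: "\<And>y. 0 \<le> e y"
    and ab: "\<And>k. k < n \<Longrightarrow> a k \<le> 2 * b ((T ^^ k) y)"
    and ae: "\<And>k. M \<le> k \<Longrightarrow> k + M < n \<Longrightarrow> a k \<le> e ((T ^^ k) y)"
  shows "(\<Sum>k<n. a k) \<le> birkhoff_sum T e n y + 2 * (birkhoff_sum T b M y + (birkhoff_sum T b n y - birkhoff_sum T b (n - M) y))"
proof -
  let ?b = "\<lambda>k. b ((T ^^ k) y)"
  have "(\<Sum>k<n. a k) \<le> (\<Sum>k<n. e ((T ^^ k) y) + 2 * (if k < M then ?b k else 0) + 2 * (if n - M \<le> k then ?b k else 0))"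
  proof (rule sum_mono)
    fix k assume k: "k \<in> {..<n}"
    note nn = e[of "(T ^^ k) y"] b[of "(T ^^ k) y"]
    show "a k \<le> e ((T ^^ k) y) + 2 * (if k < M then ?b k else 0) + 2 * (if n - M \<le> k then ?b k else 0)"
    proof (cases "k < M \<or> n - M \<le> k")
      case True
      then show ?thesis using ab[of k] k nn by auto
    next
      case False
      then have "a k \<le> e ((T ^^ k) y)" by (intro ae) auto
      then show ?thesis using False by simp
    qed
  qed
  also have "\<dots> = birkhoff_sum T e n y + 2 * (\<Sum>k<n. if k < M then ?b k else 0) + 2 * (\<Sum>k<n. if n - M \<le> k then ?b k else 0)"
    by (simp add: sum.distrib sum_distrib_left birkhoff_sum_def)
  also have "(\<Sum>k<n. if k < M then ?b k else 0) \<le> birkhoff_sum T b M y"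
  proof -
    have "(\<Sum>k<n. if k < M then ?b k else 0) = (\<Sum>k\<in>{..<n} \<inter> {k. k < M}. ?b k)" by (simp add: sum.inter_restrict)
    also have "\<dots> \<le> (\<Sum>k<M. ?b k)" by (rule sum_mono2) (auto simp: b)
    finally show ?thesis by (simp add: birkhoff_sum_def)
  qed
  also have "(\<Sum>k<n. if n - M \<le> k then ?b k else 0) = birkhoff_sum T b n y - birkhoff_sum T b (n - M) y"
  proof -
    have "(\<Sum>k<n. if n - M \<le> k then ?b k else 0) = (\<Sum>k\<in>{..<n} \<inter> {k. n - M \<le> k}. ?b k)" by (simp add: sum.inter_restrict)
    also have "{..<n} \<inter> {k. n - M \<le> k} = {n - M..<n}" by auto
    finally show ?thesis by (simp add: birkhoff_sum_diff)
  qed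
  finally show ?thesis by simp
qed

locale pressure_system = sft X + ergodic_system \<nu> T
  for X :: "(int \<Rightarrow> 'a::finite) set" and \<nu> :: "'y::topological_space measure" and T :: "'y \<Rightarrow> 'y" +
  fixes G :: "(int \<Rightarrow> 'a) \<Rightarrow> 'y \<Rightarrow> real" and b :: "'y \<Rightarrow> real" and e :: "nat \<Rightarrow> 'y \<Rightarrow> real"
  assumes G_joint: "(\<lambda>z. G (fst z) (snd z)) \<in> borel_measurable (Xmeas X \<Otimes>\<^sub>M borel)"
    and G_bound: "\<And>x y. x \<in> X \<Longrightarrow> \<bar>G x y\<bar> \<le> b y"
    and b_int: "integrable \<nu> b"
    and e_int: "\<And>M. integrable \<nu> (e M)" and e_nonneg: "\<And>M y. 0 \<le> e M y"
    and G_modulus: "\<And>M x z y. x \<in> X \<Longrightarrow> z \<in> X \<Longrightarrow> cen M x = cen M z \<Longrightarrow> \<bar>G x y - G z y\<bar> \<le> e M y"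
    and e_lim: "(\<lambda>M. \<integral>y. e M y \<partial>\<nu>) \<longlonglongrightarrow> 0"
begin

definition Gn :: "nat \<Rightarrow> (int \<Rightarrow> 'a) \<Rightarrow> 'y \<Rightarrow> real" where
  "Gn n x y = (\<Sum>k<n. G ((shift ^^ k) x) ((T ^^ k) y))"

definition logZ :: "nat \<Rightarrow> 'y \<Rightarrow> real" where
  "logZ n y = ln (\<Sum>w\<in>W n. exp (Gn n (rep w) y))"

text \<open>The price for changing a point inside a cylinder of length \<open>n\<close>. Letters
  outside the word are undetermined, so windows of radius \<open>M\<close> fit only in its interior,
  and the ends are paid with \<open>b\<close>.\<close>

definition osc :: "nat \<Rightarrow> nat \<Rightarrow> 'y \<Rightarrow> real" where
  "osc M n y = birkhoff_sum T (e M) n y +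
     2 * (birkhoff_sum T b M y + (birkhoff_sum T b n y - birkhoff_sum T b (n - M) y))"

lemma b_nonneg: "0 \<le> b y"
proof -
  obtain x where "x \<in> X" using X_ne by blast
  from G_bound[OF this, of y] show ?thesis by linarith
qed

lemma G_measurable: "x \<in> X \<Longrightarrow> G x \<in> borel_measurable \<nu>"
proof -
  assume x: "x \<in> X"
  have "(\<lambda>y. (x, y)) \<in> measurable \<nu> (Xmeas X \<Otimes>\<^sub>M borel)"
    using x by (intro measurable_Pair) (auto simp: measurable_ident_sets[OF sets_nu])
  from measurable_compose[OF this G_joint] show ?thesis by simp
qed

lemma Gn_measurable [measurable]: "x \<in> X \<Longrightarrow> Gn n x \<in> borel_measurable \<nu>"
  unfolding Gn_def
proof (intro borel_measurable_sum)
  fix k assume "x \<in> X" "k \<in> {..<n}"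
  then have "G ((shift ^^ k) x) \<in> borel_measurable \<nu>" using G_measurable shift_X by blast
  from measurable_compose[OF funpow_measurable this]
  show "(\<lambda>y. G ((shift ^^ k) x) ((T ^^ k) y)) \<in> borel_measurable \<nu>" .
qed

lemma Gn_bound: "x \<in> X \<Longrightarrow> \<bar>Gn n x y\<bar> \<le> birkhoff_sum T b n y"
  unfolding Gn_def birkhoff_sum_def
  by (rule order_trans[OF sum_abs sum_mono]) (simp add: G_bound)

lemma Gn_add: "Gn (n + m) x y = Gn n x y + Gn m ((shift ^^ n) x) ((T ^^ n) y)"
proof (induction m)
  case (Suc m)
  have "(shift ^^ (n + m)) x = (shift ^^ m) ((shift ^^ n) x)" "(T ^^ (n + m)) y = (T ^^ m) ((T ^^ n) y)"
    by (simp_all add: funpow_add add.commute[of n])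
  then show ?case using Suc by (simp add: Gn_def del: funpow.simps)
qed (simp add: Gn_def)

lemma Gn_distortion:
  assumes "x \<in> X" "z \<in> X" "pre n x = pre n z"
  shows "\<bar>Gn n x y - Gn n z y\<bar> \<le> osc M n y"
proof -
  let ?d = "\<lambda>k. \<bar>G ((shift ^^ k) x) ((T ^^ k) y) - G ((shift ^^ k) z) ((T ^^ k) y)\<bar>"
  have "\<bar>Gn n x y - Gn n z y\<bar> \<le> (\<Sum>k<n. ?d k)"
    unfolding Gn_def sum_subtractf[symmetric] by (rule sum_abs)
  also have "\<dots> \<le> osc M n y"
    unfolding osc_def
  proof (rule boundary_sum_bound[OF b_nonneg e_nonneg])
    show "?d k \<le> 2 * b ((T ^^ k) y)" for k
      using G_bound[of "(shift ^^ k) x" "(T ^^ k) y"] G_bound[of "(shift ^^ k) z" "(T ^^ k) y"] assms by simp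
    show "?d k \<le> e M ((T ^^ k) y)" if "M \<le> k" "k + M < n" for k
      using assms that by (intro G_modulus) (auto simp: funpow_shift cen_from_pre)
  qed
  finally show ?thesis .
qed

lemma osc_integrable: "integrable \<nu> (osc M n)"
  unfolding osc_def using e_int b_int by auto

lemma osc_integral: "(\<integral>y. osc M n y \<partial>\<nu>) \<le> n * (\<integral>y. e M y \<partial>\<nu>) + 4 * M * (\<integral>y. b y \<partial>\<nu>)"
proof -
  have b0: "0 \<le> (\<integral>y. b y \<partial>\<nu>)" using b_nonneg by simp
  have "(\<integral>y. osc M n y \<partial>\<nu>) = n * (\<integral>y. e M y \<partial>\<nu>) + 2 * (M * (\<integral>y. b y \<partial>\<nu>) + (n * (\<integral>y. b y \<partial>\<nu>) - (n - M) * (\<integral>y. b y \<partial>\<nu>)))"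
    unfolding osc_def using e_int b_int by (simp add: integral_birkhoff_sum integrable_birkhoff_sum)
  also have "n * (\<integral>y. b y \<partial>\<nu>) - (n - M) * (\<integral>y. b y \<partial>\<nu>) = (n - (n - M)) * (\<integral>y. b y \<partial>\<nu>)"
    by (simp add: of_nat_diff left_diff_distrib)
  also have "\<dots> \<le> M * (\<integral>y. b y \<partial>\<nu>)" using b0 by (intro mult_right_mono) auto
  finally show ?thesis by simp
qed

lemma sum_exp_pos [simp]: "0 < (\<Sum>w\<in>W n. exp (h w :: real))"
  by (rule sum_pos) auto

text \<open>With suprema over cylinders the log partition function is exactly subadditive, and with
  infima (\<open>Linf\<close>) it is superadditive up to a gap, whereas \<open>logZ\<close> with
  representatives is measurable and can be integrated. Both differ from \<open>logZ\<close> by at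
  most \<open>osc\<close>.\<close>

definition Usup :: "nat \<Rightarrow> 'y \<Rightarrow> real" where
  "Usup n y = ln (\<Sum>w\<in>W n. exp (SUP x\<in>{x\<in>X. pre n x = w}. Gn n x y))"

definition Linf :: "nat \<Rightarrow> 'y \<Rightarrow> real" where
  "Linf n y = ln (\<Sum>w\<in>W n. exp (INF x\<in>{x\<in>X. pre n x = w}. Gn n x y))"

lemma Gn_bdd: "bdd_above ((\<lambda>x. Gn n x y) ` {x\<in>X. P x})" "bdd_below ((\<lambda>x. Gn n x y) ` {x\<in>X. P x})"
  using Gn_bound[of _ n y] by (auto intro!: bdd_aboveI2[where M = "birkhoff_sum T b n y"]
    bdd_belowI2[where m = "- birkhoff_sum T b n y"] simp: abs_le_iff) (smt (verit))

lemma sup_ge: "x \<in> X \<Longrightarrow> Gn n x y \<le> (SUP z\<in>{z\<in>X. pre n z = pre n x}. Gn n z y)"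
  by (rule cSUP_upper[OF _ Gn_bdd(1)]) simp

lemma inf_le: "x \<in> X \<Longrightarrow> (INF z\<in>{z\<in>X. pre n z = pre n x}. Gn n z y) \<le> Gn n x y"
  by (rule cINF_lower[OF Gn_bdd(2)]) simp

lemma cylinder_ne: "w \<in> W n \<Longrightarrow> {x\<in>X. pre n x = w} \<noteq> {}"
  using rep by blast

lemma logZ_le_Usup: "logZ n y \<le> Usup n y"
  unfolding logZ_def Usup_def
proof (subst ln_le_cancel_iff)
  show "(\<Sum>w\<in>W n. exp (Gn n (rep w) y)) \<le> (\<Sum>w\<in>W n. exp (SUP x\<in>{x\<in>X. pre n x = w}. Gn n x y))"
  proof (intro sum_mono, subst exp_le_cancel_iff)
    fix w assume w: "w \<in> W n"
    show "Gn n (rep w) y \<le> (SUP x\<in>{x\<in>X. pre n x = w}. Gn n x y)"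
      using sup_ge[OF rep(1)[OF w], of n y] unfolding rep(2)[OF w] .
  qed
qed auto

lemma Linf_le_logZ: "Linf n y \<le> logZ n y"
  unfolding logZ_def Linf_def
proof (subst ln_le_cancel_iff)
  show "(\<Sum>w\<in>W n. exp (INF x\<in>{x\<in>X. pre n x = w}. Gn n x y)) \<le> (\<Sum>w\<in>W n. exp (Gn n (rep w) y))"
  proof (intro sum_mono, subst exp_le_cancel_iff)
    fix w assume w: "w \<in> W n"
    show "(INF x\<in>{x\<in>X. pre n x = w}. Gn n x y) \<le> Gn n (rep w) y"
      using inf_le[OF rep(1)[OF w], of n y] unfolding rep(2)[OF w] .
  qed
qed auto

lemma Usup_le: "Usup n y \<le> logZ n y + osc M n y"
proof -
  have "(\<Sum>w\<in>W n. exp (SUP x\<in>{x\<in>X. pre n x = w}. Gn n x y)) \<le> (\<Sum>w\<in>W n. exp (Gn n (rep w) y + osc M n y))"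
  proof (intro sum_mono)
    fix w assume w: "w \<in> W n"
    have "(SUP x\<in>{x\<in>X. pre n x = w}. Gn n x y) \<le> Gn n (rep w) y + osc M n y"
    proof (rule cSUP_least[OF cylinder_ne[OF w]])
      fix x assume "x \<in> {x \<in> X. pre n x = w}"
      then show "Gn n x y \<le> Gn n (rep w) y + osc M n y"
        using Gn_distortion[of x "rep w" n y M] rep[OF w] by (simp add: abs_le_iff)
    qed
    then show "exp (SUP x\<in>{x\<in>X. pre n x = w}. Gn n x y) \<le> exp (Gn n (rep w) y + osc M n y)" by simp
  qed
  also have "\<dots> = exp (logZ n y + osc M n y)" by (simp add: exp_add logZ_def sum_distrib_right)
  finally have "ln (\<Sum>w\<in>W n. exp (SUP x\<in>{x\<in>X. pre n x = w}. Gn n x y)) \<le> ln (exp (logZ n y + osc M n y))"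
    by (subst ln_le_cancel_iff) auto
  then show ?thesis by (simp add: Usup_def)
qed

lemma Linf_ge: "logZ n y - osc M n y \<le> Linf n y"
proof -
  have "exp (logZ n y - osc M n y) = (\<Sum>w\<in>W n. exp (Gn n (rep w) y - osc M n y))"
    by (simp add: exp_diff logZ_def sum_divide_distrib)
  also have "\<dots> \<le> (\<Sum>w\<in>W n. exp (INF x\<in>{x\<in>X. pre n x = w}. Gn n x y))"
  proof (intro sum_mono)
    fix w assume w: "w \<in> W n"
    have "Gn n (rep w) y - osc M n y \<le> (INF x\<in>{x\<in>X. pre n x = w}. Gn n x y)"
    proof (rule cINF_greatest[OF cylinder_ne[OF w]])
      fix x assume "x \<in> {x \<in> X. pre n x = w}"
      then show "Gn n (rep w) y - osc M n y \<le> Gn n x y"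
        using Gn_distortion[of x "rep w" n y M] rep[OF w] by (simp add: abs_le_iff)
    qed
    then show "exp (Gn n (rep w) y - osc M n y) \<le> exp (INF x\<in>{x\<in>X. pre n x = w}. Gn n x y)" by simp
  qed
  finally have "ln (exp (logZ n y - osc M n y)) \<le> ln (\<Sum>w\<in>W n. exp (INF x\<in>{x\<in>X. pre n x = w}. Gn n x y))"
    by (subst ln_le_cancel_iff) auto
  then show ?thesis by (simp add: Linf_def)
qed

lemma W0: "W 0 = {[]}"
  using X_ne by (auto simp: W_def pre_def)

lemma Usup_0: "Usup 0 y = 0"
proof -
  have "(SUP x\<in>{x\<in>X. pre 0 x = []}. Gn 0 x y) = 0"
    using X_ne by (simp add: Gn_def pre_def)
  then show ?thesis by (simp add: Usup_def W0)
qed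

lemma Linf_0: "Linf 0 y = 0"
proof -
  have "(INF x\<in>{x\<in>X. pre 0 x = []}. Gn 0 x y) = 0"
    using X_ne by (simp add: Gn_def pre_def)
  then show ?thesis by (simp add: Linf_def W0)
qed

lemma Usup_add: "Usup (n + m) y \<le> Usup n y + Usup m ((T ^^ n) y)"
proof -
  let ?s = "\<lambda>n w y. SUP x\<in>{x\<in>X. pre n x = w}. Gn n x y"
  have "(\<Sum>w\<in>W (n + m). exp (?s (n + m) w y)) \<le>
      (\<Sum>w\<in>W (n + m). exp (?s n (take n w) y) * exp (?s m (drop n w) ((T ^^ n) y)))"
  proof (intro sum_mono)
    fix w assume w: "w \<in> W (n + m)"
    have "?s (n + m) w y \<le> ?s n (take n w) y + ?s m (drop n w) ((T ^^ n) y)"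
    proof (rule cSUP_least[OF cylinder_ne[OF w]])
      fix x assume x: "x \<in> {x \<in> X. pre (n + m) x = w}"
      then have "pre n x = take n w" "pre m ((shift ^^ n) x) = drop n w" by (auto simp: pre_append funpow_shift)
      then show "Gn (n + m) x y \<le> ?s n (take n w) y + ?s m (drop n w) ((T ^^ n) y)"
        using sup_ge[of x n y] sup_ge[of "(shift ^^ n) x" m "(T ^^ n) y"] x by (simp add: Gn_add)
    qed
    then show "exp (?s (n + m) w y) \<le> exp (?s n (take n w) y) * exp (?s m (drop n w) ((T ^^ n) y))"
      by (simp add: exp_add[symmetric])
  qed
  also have "\<dots> = (\<Sum>(u, v)\<in>(\<lambda>w. (take n w, drop n w)) ` W (n + m). exp (?s n u y) * exp (?s m v ((T ^^ n) y)))"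
  proof (subst sum.reindex)
    show "inj_on (\<lambda>w. (take n w, drop n w)) (W (n + m))"
      by (rule inj_on_inverseI[where g = "\<lambda>(u, v). u @ v"]) simp
  qed simp
  also have "\<dots> \<le> (\<Sum>(u, v)\<in>W n \<times> W m. exp (?s n u y) * exp (?s m v ((T ^^ n) y)))"
  proof (rule sum_mono2)
    show "(\<lambda>w. (take n w, drop n w)) ` W (n + m) \<subseteq> W n \<times> W m" using W_take_drop by blast
  qed auto
  also have "\<dots> = (\<Sum>u\<in>W n. exp (?s n u y)) * (\<Sum>v\<in>W m. exp (?s m v ((T ^^ n) y)))"
    unfolding sum_product sum.cartesian_product ..
  finally have "Usup (n + m) y \<le> ln ((\<Sum>u\<in>W n. exp (?s n u y)) * (\<Sum>v\<in>W m. exp (?s m v ((T ^^ n) y))))"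
    unfolding Usup_def by (subst ln_le_cancel_iff) (auto intro!: mult_pos_pos)
  also have "\<dots> = Usup n y + Usup m ((T ^^ n) y)"
    unfolding Usup_def by (intro ln_mult_pos) auto
  finally show ?thesis .
qed

lemma card_pos: "1 \<le> real CARD('a)"
  using finite_UNIV_card_ge_0[where 'a = 'a] by simp

lemma ln_card_W: "ln (real (card (W n))) \<le> n * ln (real CARD('a))"
proof -
  have "real (card (W n)) \<le> real CARD('a) ^ n" using card_W[of n] by (metis of_nat_le_iff of_nat_power)
  moreover have "0 < real (card (W n))" by (simp add: card_gt_0_iff)
  ultimately have "ln (real (card (W n))) \<le> ln (real CARD('a) ^ n)"
    by (subst ln_le_cancel_iff) auto
  then show ?thesis by (simp add: ln_realpow)
qed

lemma logZ_bound: "\<bar>logZ n y\<bar> \<le> birkhoff_sum T b n y + n * ln (real CARD('a))"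
proof -
  let ?B = "birkhoff_sum T b n y"
  have c: "1 \<le> real (card (W n))" using card_gt_0_iff[of "W n"] by (simp add: Suc_le_eq)
  have "(\<Sum>w\<in>W n. exp (Gn n (rep w) y)) \<le> (\<Sum>w\<in>W n. exp ?B)"
    using Gn_bound[OF rep(1)] by (intro sum_mono) (auto simp: abs_le_iff)
  then have "logZ n y \<le> ln (card (W n) * exp ?B)" unfolding logZ_def using c by (subst ln_le_cancel_iff) auto
  also have "\<dots> = ln (card (W n)) + ?B" using c by (subst ln_mult_pos) auto
  finally have 1: "logZ n y \<le> ?B + n * ln (real CARD('a))" using ln_card_W[of n] by linarith
  have "(\<Sum>w\<in>W n. exp (- ?B)) \<le> (\<Sum>w\<in>W n. exp (Gn n (rep w) y))"
  proof (intro sum_mono, subst exp_le_cancel_iff)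
    fix w assume w: "w \<in> W n"
    show "- ?B \<le> Gn n (rep w) y" using Gn_bound[OF rep(1)[OF w], of n y] by linarith
  qed
  then have "ln (card (W n) * exp (- ?B)) \<le> logZ n y" unfolding logZ_def using c by (subst ln_le_cancel_iff) auto
  moreover have "ln (card (W n) * exp (- ?B)) = ln (card (W n)) + - ?B" using c by (subst ln_mult_pos) auto
  moreover have "0 \<le> ln (card (W n))" "0 \<le> n * ln (real CARD('a))" using c card_pos by auto
  ultimately show ?thesis using 1 by linarith
qed

lemma logZ_measurable [measurable]: "logZ n \<in> borel_measurable \<nu>"
proof -
  have [measurable]: "w \<in> W n \<Longrightarrow> Gn n (rep w) \<in> borel_measurable \<nu>" for w using rep by simp
  show ?thesis unfolding logZ_def by measurable
qed

lemma logZ_integrable: "integrable \<nu> (logZ n)"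
  by (rule Bochner_Integration.integrable_bound[where f = "\<lambda>y. birkhoff_sum T b n y + n * ln (real CARD('a))"])
    (use b_int logZ_bound in \<open>auto intro!: AE_I2 intro: order_trans[OF _ abs_ge_self]\<close>)

lemma Usup_1: "Usup 1 y \<le> b y + ln (real CARD('a))"
proof -
  have "(\<Sum>w\<in>W 1. exp (SUP x\<in>{x\<in>X. pre 1 x = w}. Gn 1 x y)) \<le> (\<Sum>w\<in>W 1. exp (b y))"
  proof (intro sum_mono)
    fix w assume w: "w \<in> W 1"
    have "(SUP x\<in>{x\<in>X. pre 1 x = w}. Gn 1 x y) \<le> b y"
      by (rule cSUP_least[OF cylinder_ne[OF w]]) (use Gn_bound[of _ 1 y] in \<open>auto simp: birkhoff_sum_def abs_le_iff\<close>)
    then show "exp (SUP x\<in>{x\<in>X. pre 1 x = w}. Gn 1 x y) \<le> exp (b y)" by simp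
  qed
  also have "\<dots> = card (W 1) * exp (b y)" by simp
  finally have "Usup 1 y \<le> ln (card (W 1) * exp (b y))" unfolding Usup_def
    by (subst ln_le_cancel_iff) (auto simp: card_gt_0_iff)
  also have "\<dots> = ln (card (W 1)) + b y" by (subst ln_mult_pos) (auto simp: card_gt_0_iff)
  finally show ?thesis using ln_card_W[of 1] by simp
qed

lemma Linf_gap:
  assumes gap: "\<And>u v. u \<in> W n \<Longrightarrow> v \<in> W m \<Longrightarrow> \<exists>c. length c = g \<and> u @ c @ v \<in> W (n + g + m)"
  shows "Linf n y - birkhoff_sum T b g ((T ^^ n) y) + Linf m ((T ^^ (n + g)) y) \<le> Linf (n + g + m) y"
proof -
  let ?i = "\<lambda>n w y. INF x\<in>{x\<in>X. pre n x = w}. Gn n x y"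
  let ?B = "birkhoff_sum T b g ((T ^^ n) y)"
  have "\<exists>c. \<forall>u v. u \<in> W n \<and> v \<in> W m \<longrightarrow> length (c u v) = g \<and> u @ c u v @ v \<in> W (n + g + m)"
    using gap by metis
  then obtain c where c: "\<And>u v. u \<in> W n \<Longrightarrow> v \<in> W m \<Longrightarrow> length (c u v) = g"
    "\<And>u v. u \<in> W n \<Longrightarrow> v \<in> W m \<Longrightarrow> u @ c u v @ v \<in> W (n + g + m)" by blast
  let ?j = "\<lambda>(u, v). u @ c u v @ v"
  have inj: "inj_on ?j (W n \<times> W m)"
    by (rule inj_on_inverseI[where g = "\<lambda>w. (take n w, drop (n + g) w)"]) (use c W_length in auto)
  have "exp (- ?B) * ((\<Sum>u\<in>W n. exp (?i n u y)) * (\<Sum>v\<in>W m. exp (?i m v ((T ^^ (n + g)) y)))) =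
    (\<Sum>(u, v)\<in>W n \<times> W m. exp (?i n u y - ?B + ?i m v ((T ^^ (n + g)) y)))"
    unfolding sum_product sum.cartesian_product
    by (simp add: sum_distrib_left split_def exp_add exp_diff exp_minus field_simps)
  also have "\<dots> \<le> (\<Sum>p\<in>W n \<times> W m. exp (?i (n + g + m) (?j p) y))"
  proof (rule sum_mono)
    fix p assume "p \<in> W n \<times> W m"
    then obtain u v where p: "p = (u, v)" and uv: "u \<in> W n" "v \<in> W m" by blast
    have "?i n u y - ?B + ?i m v ((T ^^ (n + g)) y) \<le> ?i (n + g + m) (u @ c u v @ v) y"
    proof (rule cINF_greatest[OF cylinder_ne[OF c(2)[OF uv]]])
      fix x assume x: "x \<in> {x \<in> X. pre (n + g + m) x = u @ c u v @ v}"
      then have "pre n x = u" "pre m ((shift ^^ (n + g)) x) = v"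
        using W_length[OF uv(1)] c(1)[OF uv] W_length[OF uv(2)]
        by (auto simp: pre_append funpow_shift append_eq_append_conv simp flip: append_assoc)
      then show "?i n u y - ?B + ?i m v ((T ^^ (n + g)) y) \<le> Gn (n + g + m) x y"
        using inf_le[of x n y] inf_le[of "(shift ^^ (n + g)) x" m "(T ^^ (n + g)) y"] x
          Gn_bound[of "(shift ^^ n) x" g "(T ^^ n) y"] by (simp add: Gn_add abs_le_iff)
    qed
    then show "(case p of (u, v) \<Rightarrow> exp (?i n u y - ?B + ?i m v ((T ^^ (n + g)) y))) \<le> exp (?i (n + g + m) (?j p) y)"
      by (simp add: p)
  qed
  also have "\<dots> = (\<Sum>w\<in>?j ` (W n \<times> W m). exp (?i (n + g + m) w y))"
    by (rule sum.reindex_cong[symmetric, OF inj refl]) simp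
  also have "\<dots> \<le> (\<Sum>w\<in>W (n + g + m). exp (?i (n + g + m) w y))"
    by (rule sum_mono2) (use c(2) in auto)
  finally have "ln (exp (- ?B) * ((\<Sum>u\<in>W n. exp (?i n u y)) * (\<Sum>v\<in>W m. exp (?i m v ((T ^^ (n + g)) y))))) \<le> Linf (n + g + m) y"
    unfolding Linf_def by (subst ln_le_cancel_iff) (auto intro!: mult_pos_pos)
  moreover have "ln (exp (- ?B) * ((\<Sum>u\<in>W n. exp (?i n u y)) * (\<Sum>v\<in>W m. exp (?i m v ((T ^^ (n + g)) y))))) =
     - ?B + (Linf n y + Linf m ((T ^^ (n + g)) y))"
    unfolding Linf_def by (subst ln_mult_pos, simp, simp add: mult_pos_pos, subst ln_mult_pos) auto
  ultimately show ?thesis by linarith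
qed

text \<open>\<open>Linf_gap\<close> with a gap of one letter and an empty right word; the gap letter
  is any right extension.\<close>

lemma Linf_Suc: "Linf n y - b ((T ^^ n) y) \<le> Linf (Suc n) y"
proof -
  have "Linf n y - birkhoff_sum T b 1 ((T ^^ n) y) + Linf 0 ((T ^^ (n + 1)) y) \<le> Linf (n + 1 + 0) y"
  proof (rule Linf_gap)
    fix u v assume uv: "u \<in> W n" "v \<in> W 0"
    then obtain c where c: "u @ c \<in> W (n + 1)" using W_extend_right[of u n 1] by blast
    then have "length c = 1" using W_length[OF c] W_length[OF uv(1)] by simp
    then show "\<exists>c. length c = 1 \<and> u @ c @ v \<in> W (n + 1 + 0)" using c uv(2) by (auto simp: W0)
  qed
  then show ?thesis by (simp add: birkhoff_sum_def Linf_0)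
qed

abbreviation meanZ :: "nat \<Rightarrow> real" where "meanZ n \<equiv> (\<integral>y. logZ n y \<partial>\<nu>) / n"

definition pstar :: real where "pstar = lim meanZ"

text \<open>\<open>block_limsup\<close> with blocks of length \<open>N\<close> for
  \<open>Usup\<close>, and with blocks of length \<open>N + g\<close> for \<open>- Linf\<close>,
  bounds the upper and lower limits at almost every point by expressions in \<open>meanZ N\<close>,
  for every \<open>N\<close>. Evaluating both at one good point yields convergence of
  \<open>meanZ\<close>; the same bounds then squeeze \<open>logZ n y / n\<close>.\<close>

theorem logZ_limit:
  shows "meanZ \<longlonglongrightarrow> pstar" and "AE y in \<nu>. (\<lambda>n. logZ n y / n) \<longlonglongrightarrow> pstar"
proof -
  obtain g where g: "\<forall>n m. \<forall>u\<in>W n. \<forall>v\<in>W m. \<exists>c. length c = g \<and> u @ c @ v \<in> W (n + g + m)"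
    by (rule exE[OF uniform_gap])
  have gap: "\<exists>c. length c = g \<and> u @ c @ v \<in> W (n + g + m)" if "u \<in> W n" "v \<in> W m" for u v n m
    using g that by blast
  let ?Ib = "\<integral>y. b y \<partial>\<nu>"
  define \<epsilon> where "\<epsilon> M = (\<integral>y. e M y \<partial>\<nu>)" for M
  \<comment> \<open>The boundary cost \<open>4 * M\<close> from \<open>osc_integral\<close>, plus
    one mean of \<open>b\<close> for each of the \<open>g\<close> gap letters.\<close>
  define C where "C M = (4 * M + real g) * ?Ib" for M :: nat
  have Ib: "0 \<le> ?Ib" using b_nonneg by simp
  have b': "integrable \<nu> (\<lambda>y. b y + ln (real CARD('a)))" using b_int by simp
  have lnA0: "0 \<le> ln (real CARD('a))" using card_pos by simp
  have up: "AE y in \<nu>. \<forall>\<delta>>0. eventually (\<lambda>n. logZ n y / n \<le> meanZ N + \<epsilon> M + C M / N + \<delta>) sequentially"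
    if N: "N \<ge> 1" for M N
  proof -
    have \<phi>: "integrable \<nu> (\<lambda>y. logZ N y + osc M N y)" using logZ_integrable osc_integrable by auto
    have "AE y in \<nu>. \<forall>\<delta>>0. eventually (\<lambda>n. Usup n y / n \<le> (\<integral>y. logZ N y + osc M N y \<partial>\<nu>) / N + \<delta>) sequentially"
    proof (rule block_limsup[OF _ b' _ \<phi>])
      show "Usup (Suc n) y \<le> Usup n y + (b ((T ^^ n) y) + ln (real CARD('a)))" for n y
        using Usup_add[of n 1 y] Usup_1[of "(T ^^ n) y"] by simp
      show "Usup (n + N) y \<le> Usup n y + (logZ N ((T ^^ n) y) + osc M N ((T ^^ n) y))" for n y
        using Usup_add[of n N y] Usup_le[of N "(T ^^ n) y" M] by linarith
    qed (use N b_nonneg lnA0 Usup_0 in auto)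
    moreover have "(\<integral>y. logZ N y + osc M N y \<partial>\<nu>) / N \<le> meanZ N + \<epsilon> M + C M / N"
    proof -
      have "(\<integral>y. logZ N y + osc M N y \<partial>\<nu>) = (\<integral>y. logZ N y \<partial>\<nu>) + (\<integral>y. osc M N y \<partial>\<nu>)"
        using logZ_integrable osc_integrable by (rule Bochner_Integration.integral_add)
      also have "(\<integral>y. osc M N y \<partial>\<nu>) \<le> N * \<epsilon> M + C M"
        using osc_integral[of M N] mult_nonneg_nonneg[OF of_nat_0_le_iff[of g] Ib]
        unfolding \<epsilon>_def C_def distrib_right by linarith
      finally have "(\<integral>y. logZ N y + osc M N y \<partial>\<nu>) / N \<le> ((\<integral>y. logZ N y \<partial>\<nu>) + (N * \<epsilon> M + C M)) / N"
        by (intro divide_right_mono) auto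
      then show ?thesis using N by (simp add: add_divide_distrib)
    qed
    ultimately show ?thesis
    proof (elim AE_mp, intro AE_I2 impI allI)
      fix y \<delta> assume *: "\<forall>\<delta>>0. eventually (\<lambda>n. Usup n y / n \<le> (\<integral>y. logZ N y + osc M N y \<partial>\<nu>) / N + \<delta>) sequentially"
        and **: "(\<integral>y. logZ N y + osc M N y \<partial>\<nu>) / N \<le> meanZ N + \<epsilon> M + C M / N" and \<delta>: "\<delta> > (0::real)"
      from *[rule_format, OF \<delta>] show "eventually (\<lambda>n. logZ n y / n \<le> meanZ N + \<epsilon> M + C M / N + \<delta>) sequentially"
      proof eventually_elim
        case (elim n)
        have "logZ n y / n \<le> Usup n y / n" by (intro divide_right_mono logZ_le_Usup) simp
        then show ?case using elim ** by linarith
      qed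
    qed
  qed
  have lo: "AE y in \<nu>. \<forall>\<delta>>0. eventually (\<lambda>n. N / (N + real g) * (meanZ N - \<epsilon> M - C M / N) - \<delta> \<le> logZ n y / n) sequentially"
    if N: "N \<ge> 1" for M N
  proof -
    let ?\<phi> = "\<lambda>y. birkhoff_sum T b g y - logZ N ((T ^^ g) y) + osc M N ((T ^^ g) y)"
    have \<phi>: "integrable \<nu> ?\<phi>"
      using integrable_funpow[OF logZ_integrable, of N g] integrable_funpow[OF osc_integrable, of M N g] b_int
      by (intro Bochner_Integration.integrable_add Bochner_Integration.integrable_diff integrable_birkhoff_sum)
    have "AE y in \<nu>. \<forall>\<delta>>0. eventually (\<lambda>n. - Linf n y / n \<le> (\<integral>y. ?\<phi> y \<partial>\<nu>) / (N + g) + \<delta>) sequentially"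
    proof (rule block_limsup[OF _ b_int b_nonneg \<phi>])
      show "- Linf (Suc n) y \<le> - Linf n y + b ((T ^^ n) y)" for n y
        using Linf_Suc[of n y] by simp
      show "- Linf (n + (N + g)) y \<le> - Linf n y + ?\<phi> ((T ^^ n) y)" for n y
      proof -
        have "(T ^^ (n + g)) y = (T ^^ g) ((T ^^ n) y)" by (simp add: funpow_add add.commute[of n])
        then have "Linf n y - birkhoff_sum T b g ((T ^^ n) y) + Linf N ((T ^^ g) ((T ^^ n) y)) \<le> Linf (n + g + N) y"
          using Linf_gap[OF gap, of n N y] by simp
        then show ?thesis using Linf_ge[of N "(T ^^ g) ((T ^^ n) y)" M] by (simp add: ac_simps)
      qed
    qed (use N Linf_0 in auto)
    moreover have "(\<integral>y. ?\<phi> y \<partial>\<nu>) / (N + g) \<le> - (N / (N + real g) * (meanZ N - \<epsilon> M - C M / N))"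
    proof -
      have "(\<integral>y. ?\<phi> y \<partial>\<nu>) = g * ?Ib - (\<integral>y. logZ N y \<partial>\<nu>) + (\<integral>y. osc M N y \<partial>\<nu>)"
        using integrable_funpow[OF logZ_integrable, of N g] integrable_funpow[OF osc_integrable, of M N g] b_int
          integral_funpow[of "logZ N" g] integral_funpow[of "osc M N" g] osc_integrable[of M N]
        by (simp add: integral_birkhoff_sum integrable_birkhoff_sum)
      also have "\<dots> \<le> - N * (meanZ N - \<epsilon> M - C M / N)"
      proof -
        have "N * (meanZ N - \<epsilon> M - C M / N) = (\<integral>y. logZ N y \<partial>\<nu>) - N * \<epsilon> M - C M"
          using N by (simp add: right_diff_distrib)
        then show ?thesis using osc_integral[of M N] unfolding \<epsilon>_def C_def distrib_right by linarith
      qed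
      finally have "(\<integral>y. ?\<phi> y \<partial>\<nu>) / (N + real g) \<le> (- N * (meanZ N - \<epsilon> M - C M / N)) / (N + real g)"
        by (intro divide_right_mono) auto
      then show ?thesis by simp
    qed
    ultimately show ?thesis
    proof (elim AE_mp, intro AE_I2 impI allI)
      fix y \<delta> assume *: "\<forall>\<delta>>0. eventually (\<lambda>n. - Linf n y / n \<le> (\<integral>y. ?\<phi> y \<partial>\<nu>) / (N + g) + \<delta>) sequentially"
        and **: "(\<integral>y. ?\<phi> y \<partial>\<nu>) / (N + g) \<le> - (N / (N + real g) * (meanZ N - \<epsilon> M - C M / N))" and \<delta>: "\<delta> > (0::real)"
      from *[rule_format, OF \<delta>] show "eventually (\<lambda>n. N / (N + real g) * (meanZ N - \<epsilon> M - C M / N) - \<delta> \<le> logZ n y / n) sequentially"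
      proof eventually_elim
        case (elim n)
        have "Linf n y / n \<le> logZ n y / n" by (intro divide_right_mono Linf_le_logZ) simp
        moreover have "- Linf n y / n = - (Linf n y / n)" by simp
        ultimately show ?case using elim ** by linarith
      qed
    qed
  qed
  have AEall: "AE y in \<nu>. \<forall>N\<ge>1. \<forall>M. (\<forall>\<delta>>0. eventually (\<lambda>n. logZ n y / n \<le> meanZ N + \<epsilon> M + C M / N + \<delta>) sequentially) \<and>
     (\<forall>\<delta>>0. eventually (\<lambda>n. N / (N + real g) * (meanZ N - \<epsilon> M - C M / N) - \<delta> \<le> logZ n y / n) sequentially)"
    unfolding AE_all_countable using up lo by (auto simp: AE_conj_iff AE_all_countable)
  have eps: "\<epsilon> \<longlonglongrightarrow> 0" unfolding \<epsilon>_def by (rule e_lim)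
  have "convergent meanZ"
  proof (rule almost_additive_convergent[OF eps])
    show "bounded (range meanZ)"
    proof (rule boundedI)
      fix z assume "z \<in> range meanZ"
      then obtain n where z: "z = meanZ n" by blast
      have "\<bar>\<integral>y. logZ n y \<partial>\<nu>\<bar> \<le> (\<integral>y. \<bar>logZ n y\<bar> \<partial>\<nu>)" by (rule integral_abs_bound)
      also have "\<dots> \<le> (\<integral>y. birkhoff_sum T b n y + n * ln (real CARD('a)) \<partial>\<nu>)"
        by (rule integral_mono) (use logZ_integrable[of n] b_int logZ_bound[of n] in auto)
      also have "\<dots> = n * (?Ib + ln (real CARD('a)))"
      proof -
        have "prob UNIV = 1" using prob_space by simp
        then show ?thesis using b_int by (simp add: integral_birkhoff_sum integrable_birkhoff_sum algebra_simps)
      qed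
      finally have "\<bar>\<integral>y. logZ n y \<partial>\<nu>\<bar> \<le> n * (?Ib + ln (real CARD('a)))" .
      then show "norm z \<le> ?Ib + ln (real CARD('a))" unfolding z using Ib lnA0
        by (cases "n = 0") (auto simp: abs_divide divide_le_eq mult.commute)
    qed
    fix M N N' :: nat assume NN: "N \<ge> 1" "N' \<ge> 1"
    \<comment> \<open>The desired inequality does not involve \<open>y\<close>; a single point of
      the full-measure set is enough to derive it from the two bounds on
      \<open>logZ n y / n\<close>.\<close>
    obtain y where y: "\<forall>N\<ge>1. \<forall>M. (\<forall>\<delta>>0. eventually (\<lambda>n. logZ n y / n \<le> meanZ N + \<epsilon> M + C M / N + \<delta>) sequentially) \<and>
     (\<forall>\<delta>>0. eventually (\<lambda>n. N / (N + real g) * (meanZ N - \<epsilon> M - C M / N) - \<delta> \<le> logZ n y / n) sequentially)"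
      using eventually_happens[OF AEall] AE_False prob_space by (auto simp: trivial_limit_def)
    show "N' / (N' + real g) * (meanZ N' - \<epsilon> M - C M / N') \<le> meanZ N + \<epsilon> M + C M / N"
    proof (rule field_le_epsilon)
      fix d :: real assume "d > 0"
      then have d: "d / 2 > 0" by simp
      have "eventually (\<lambda>n. N' / (N' + real g) * (meanZ N' - \<epsilon> M - C M / N') - d / 2 \<le> meanZ N + \<epsilon> M + C M / N + d / 2) sequentially"
        using y[rule_format, OF NN(1), of M, THEN conjunct1, rule_format, OF d]
          y[rule_format, OF NN(2), of M, THEN conjunct2, rule_format, OF d]
        by eventually_elim linarith
      then show "N' / (N' + real g) * (meanZ N' - \<epsilon> M - C M / N') \<le> meanZ N + \<epsilon> M + C M / N + d" by simp
    qed
  qed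
  then show lim: "meanZ \<longlonglongrightarrow> pstar" unfolding pstar_def by (rule convergent_LIMSEQ_iff[THEN iffD1])
  from AEall show "AE y in \<nu>. (\<lambda>n. logZ n y / n) \<longlonglongrightarrow> pstar"
  proof eventually_elim
    case (elim y)
    show ?case by (rule sandwich_limit[OF eps lim, where C = C and g = g]) (use elim in blast)+
  qed
qed

end

section \<open>Fiber entropy of a joining\<close>

text \<open>Entropy of a finite-valued map rather than of a partition, so that labels can be
  refined, paired and concatenated like words; null labels contribute zero through the factor in
  front of the logarithm.\<close>

definition label_entropy :: "'x measure \<Rightarrow> ('x \<Rightarrow> 'i) \<Rightarrow> 'i set \<Rightarrow> real" where
  "label_entropy \<eta> Z I = (\<Sum>i\<in>I. - measure \<eta> {x \<in> space \<eta>. Z x = i} * ln (measure \<eta> {x \<in> space \<eta>. Z x = i}))"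

context prob_space
begin

lemma label_sum:
  assumes "finite I" "\<And>x. x \<in> space M \<Longrightarrow> Z x \<in> I" "\<And>i. i \<in> I \<Longrightarrow> {x \<in> space M. Z x = i} \<in> sets M"
  shows "(\<Sum>i\<in>I. prob {x \<in> space M. Z x = i}) = 1"
  using measure_fibres[of "space M" I Z] assms prob_space by simp

lemma label_entropy_le:
  assumes "finite I" "\<And>x. x \<in> space M \<Longrightarrow> Z x \<in> I" "\<And>i. i \<in> I \<Longrightarrow> {x \<in> space M. Z x = i} \<in> sets M"
    and "\<And>i. i \<in> I \<Longrightarrow> 0 < R i" "sum R I \<le> 1"
  shows "label_entropy M Z I \<le> (\<Sum>i\<in>I. prob {x \<in> space M. Z x = i} * - ln (R i))"
proof -
  have "label_entropy M Z I \<le> (\<Sum>i\<in>I. - prob {x \<in> space M. Z x = i} * ln (R i))"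
    unfolding label_entropy_def by (rule gibbs_inequality) (use assms label_sum[OF assms(1-3)] in auto)
  then show ?thesis by simp
qed

lemma label_entropy_nonneg:
  assumes "finite I" shows "0 \<le> label_entropy M Z I"
  unfolding label_entropy_def
proof (rule sum_nonneg)
  fix i
  let ?p = "prob {x \<in> space M. Z x = i}"
  have "?p * ln ?p \<le> 0" by (cases "?p = 0") (auto intro!: mult_nonneg_nonpos simp: zero_less_measure_iff less_le)
  then show "0 \<le> - ?p * ln ?p" by simp
qed

lemma label_entropy_card:
  assumes "finite I" "\<And>x. x \<in> space M \<Longrightarrow> Z x \<in> I" "\<And>i. i \<in> I \<Longrightarrow> {x \<in> space M. Z x = i} \<in> sets M"
  shows "label_entropy M Z I \<le> ln (card I)"
proof -
  have I: "I \<noteq> {}" using label_sum[OF assms] by auto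
  then have c: "0 < real (card I)" using assms(1) by (simp add: card_gt_0_iff)
  have "label_entropy M Z I \<le> (\<Sum>i\<in>I. prob {x \<in> space M. Z x = i} * - ln (1 / card I))"
    by (rule label_entropy_le) (use assms c in auto)
  also have "\<dots> = ln (card I)"
    using c by (simp only: sum_distrib_right[symmetric] label_sum[OF assms]) (simp add: ln_div)
  finally show ?thesis .
qed

lemma label_entropy_refine:
  assumes fin: "finite I" "finite J" and J: "\<And>x. x \<in> space M \<Longrightarrow> Y x \<in> J"
    and meas: "\<And>i j. i \<in> I \<Longrightarrow> j \<in> J \<Longrightarrow> {x \<in> space M. Z x = i \<and> Y x = j} \<in> sets M"
    and measZ: "\<And>i. i \<in> I \<Longrightarrow> {x \<in> space M. Z x = i} \<in> sets M"
  shows "label_entropy M Z I \<le> label_entropy M (\<lambda>x. (Z x, Y x)) (I \<times> J)"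
proof -
  let ?p = "\<lambda>i. prob {x \<in> space M. Z x = i}" and ?q = "\<lambda>i j. prob {x \<in> space M. Z x = i \<and> Y x = j}"
  have "- ?p i * ln (?p i) \<le> (\<Sum>j\<in>J. - ?q i j * ln (?q i j))" if i: "i \<in> I" for i
  proof -
    have "(\<Sum>j\<in>J. prob {x \<in> {x \<in> space M. Z x = i}. Y x = j}) = ?p i"
      by (rule measure_fibres) (use fin J meas measZ i in auto)
    moreover have "{x \<in> {x \<in> space M. Z x = i}. Y x = j} = {x \<in> space M. Z x = i \<and> Y x = j}" for j by auto
    ultimately have p: "?p i = (\<Sum>j\<in>J. ?q i j)" by simp
    have "?q i j * ln (?q i j) \<le> ?q i j * ln (?p i)" if j: "j \<in> J" for j
    proof (cases "?q i j = 0")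
      case False
      then have pos: "0 < ?q i j" by (simp add: zero_less_measure_iff)
      have "?q i j \<le> ?p i" by (rule finite_measure_mono[OF _ measZ[OF i]]) auto
      then have "ln (?q i j) \<le> ln (?p i)" using pos by (subst ln_le_cancel_iff) auto
      then show ?thesis using pos by (intro mult_left_mono) auto
    qed simp
    then have "(\<Sum>j\<in>J. ?q i j * ln (?q i j)) \<le> (\<Sum>j\<in>J. ?q i j * ln (?p i))" by (rule sum_mono)
    also have "\<dots> = ?p i * ln (?p i)" using p by (simp add: sum_distrib_right)
    finally show ?thesis by (simp add: sum_negf)
  qed
  then have "label_entropy M Z I \<le> (\<Sum>i\<in>I. \<Sum>j\<in>J. - ?q i j * ln (?q i j))"
    unfolding label_entropy_def by (rule sum_mono)
  also have "\<dots> = label_entropy M (\<lambda>x. (Z x, Y x)) (I \<times> J)"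
    unfolding label_entropy_def sum.cartesian_product by (rule sum.cong) auto
  finally show ?thesis .
qed

end

definition words_in :: "'s set \<Rightarrow> nat \<Rightarrow> 's list set" where
  "words_in S n = {c. set c \<subseteq> S \<and> length c = n}"

lemma finite_words_in [simp]: "finite S \<Longrightarrow> finite (words_in S n)"
  unfolding words_in_def by (rule finite_lists_length_eq)

lemma words_in_take_drop: "c \<in> words_in S (m + n) \<Longrightarrow> take m c \<in> words_in S m \<and> drop m c \<in> words_in S n"
  by (auto simp: words_in_def dest: in_set_takeD in_set_dropD)

lemma sum_words_in_append:
  assumes "finite S"
  shows "(\<Sum>c\<in>words_in S (m + n). f (take m c) (drop m c)) = (\<Sum>u\<in>words_in S m. \<Sum>v\<in>words_in S n. f u v)"
proof -
  have "(\<Sum>u\<in>words_in S m. \<Sum>v\<in>words_in S n. f u v) = (\<Sum>(u, v)\<in>words_in S m \<times> words_in S n. f u v)"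
    by (simp add: sum.cartesian_product)
  also have "\<dots> = (\<Sum>c\<in>words_in S (m + n). f (take m c) (drop m c))"
  proof (rule sum.reindex_bij_witness[where i = "\<lambda>w. (take m w, drop m w)" and j = "\<lambda>(u, v). u @ v"])
    fix c assume "c \<in> words_in S (m + n)"
    then show "(take m c, drop m c) \<in> words_in S m \<times> words_in S n" using words_in_take_drop by blast
  qed (auto simp: words_in_def)
  finally show ?thesis ..
qed

lemma sum_words_in_prod:
  fixes f :: "nat \<Rightarrow> 's \<Rightarrow> real"
  assumes "finite S"
  shows "(\<Sum>c\<in>words_in S n. \<Prod>k<n. f k (c ! k)) = (\<Prod>k<n. \<Sum>a\<in>S. f k a)"
proof (induction n arbitrary: f)
  case 0
  have "words_in S 0 = {[]}" by (auto simp: words_in_def)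
  then show ?case by simp
next
  case (Suc n)
  have "(\<Sum>c\<in>words_in S (Suc n). \<Prod>k<Suc n. f k (c ! k)) =
      (\<Sum>(a, c)\<in>S \<times> words_in S n. f 0 a * (\<Prod>k<n. f (Suc k) (c ! k)))"
    by (rule sum.reindex_bij_witness[where i = "\<lambda>(a, c). a # c" and j = "\<lambda>c. (hd c, tl c)"])
      (auto simp: words_in_def prod.lessThan_Suc_shift length_Suc_conv simp del: prod.lessThan_Suc)
  also have "\<dots> = (\<Sum>a\<in>S. f 0 a) * (\<Sum>c\<in>words_in S n. \<Prod>k<n. f (Suc k) (c ! k))"
    unfolding sum_product sum.cartesian_product by (simp add: split_def)
  also have "\<dots> = (\<Prod>k<Suc n. \<Sum>a\<in>S. f k a)"
    by (simp add: Suc.IH[of "\<lambda>k. f (Suc k)"] prod.lessThan_Suc_shift del: prod.lessThan_Suc)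
  finally show ?case .
qed

locale label_partition = sft X for X :: "(int \<Rightarrow> 'a::finite) set" +
  fixes \<alpha> :: "(int \<Rightarrow> 'a) set set"
  assumes part: "fin_partition X \<alpha>"
begin

definition lab :: "(int \<Rightarrow> 'a) \<Rightarrow> (int \<Rightarrow> 'a) set" where
  "lab x = (THE a. a \<in> \<alpha> \<and> x \<in> a)"

definition code :: "nat \<Rightarrow> (int \<Rightarrow> 'a) \<Rightarrow> (int \<Rightarrow> 'a) set list" where
  "code n x = map (\<lambda>k. lab ((shift ^^ k) x)) [0..<n]"

lemma fin: "finite \<alpha>" and \<alpha>_sets: "a \<in> \<alpha> \<Longrightarrow> a \<in> sets XM" and cover: "\<Union>\<alpha> = X"
  and disj: "a \<in> \<alpha> \<Longrightarrow> a' \<in> \<alpha> \<Longrightarrow> x \<in> a \<Longrightarrow> x \<in> a' \<Longrightarrow> a = a'"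
  using part by (auto simp: fin_partition_def)

lemma lab: assumes "x \<in> X" shows "lab x \<in> \<alpha>" "x \<in> lab x"
proof -
  obtain a where a: "a \<in> \<alpha>" "x \<in> a" using assms cover by blast
  then have "lab x = a" unfolding lab_def using disj by (intro the_equality) auto
  then show "lab x \<in> \<alpha>" "x \<in> lab x" using a by auto
qed

lemma lab_eq: "x \<in> X \<Longrightarrow> a \<in> \<alpha> \<Longrightarrow> lab x = a \<longleftrightarrow> x \<in> a"
  using lab disj by blast

lemma \<alpha>_ne: "\<alpha> \<noteq> {}" using cover X_ne by auto

lemma length_code [simp]: "length (code n x) = n" by (simp add: code_def)

lemma nth_code [simp]: "k < n \<Longrightarrow> code n x ! k = lab ((shift ^^ k) x)" by (simp add: code_def)

lemma code_in: "x \<in> X \<Longrightarrow> code n x \<in> words_in \<alpha> n"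
  unfolding words_in_def by (auto simp: code_def lab)

lemma code_append: "code (m + n) x = code m x @ code n ((shift ^^ m) x)"
  by (rule nth_equalityI) (auto simp: nth_append funpow_shift)

lemma code_eq_iff:
  assumes x: "x \<in> X" and c: "c \<in> words_in \<alpha> n"
  shows "code n x = c \<longleftrightarrow> (\<forall>k<n. (shift ^^ k) x \<in> c ! k)"
proof -
  have l: "length c = n" and ck: "k < n \<Longrightarrow> c ! k \<in> \<alpha>" for k using c by (auto simp: words_in_def subset_iff)
  have "lab ((shift ^^ k) x) = c ! k \<longleftrightarrow> (shift ^^ k) x \<in> c ! k" if "k < n" for k
    using lab_eq[of "(shift ^^ k) x" "c ! k"] x ck[OF that] by simp
  then show ?thesis using l by (simp add: list_eq_iff_nth_eq cong: imp_cong)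
qed

lemma code_sets [measurable]: "c \<in> words_in \<alpha> n \<Longrightarrow> {x \<in> X. code n x = c} \<in> sets XM"
proof -
  assume c: "c \<in> words_in \<alpha> n"
  then have l: "length c = n" and ck: "k < n \<Longrightarrow> c ! k \<in> \<alpha>" for k by (auto simp: words_in_def subset_iff)
  have "{x \<in> X. code n x = c} = {x \<in> space XM. \<forall>k\<in>{..<n}. (shift ^^ k) x \<in> c ! k}"
    using code_eq_iff[OF _ c] by auto
  also have "\<dots> \<in> sets XM"
  proof (rule sets.sets_Collect_finite_All)
    fix k assume "k \<in> {..<n}"
    then have "(shift ^^ k) -` (c ! k) \<inter> space XM \<in> sets XM"
      using measurable_sets[OF funpow_shift_measurable \<alpha>_sets[OF ck]] by simp
    then show "{x \<in> space XM. (shift ^^ k) x \<in> c ! k} \<in> sets XM" by (simp add: vimage_def Int_def conj_commute)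
  qed simp
  finally show ?thesis .
qed

lemma join_n_eq: "join_n X \<alpha> n = (\<lambda>c. {x \<in> X. code n x = c}) ` words_in \<alpha> n"
proof (intro set_eqI iffI)
  fix A assume "A \<in> join_n X \<alpha> n"
  then obtain c where c: "A = X \<inter> (\<Inter>k<n. (shift ^^ k) -` c k)" "\<forall>k<n. c k \<in> \<alpha>" unfolding join_n_def by blast
  have "A = {x \<in> X. code n x = map c [0..<n]}"
  proof -
    have "map c [0..<n] \<in> words_in \<alpha> n" using c(2) by (auto simp: words_in_def)
    then show ?thesis unfolding c(1) using code_eq_iff[of _ "map c [0..<n]" n] by auto
  qed
  moreover have "map c [0..<n] \<in> words_in \<alpha> n" using c(2) by (auto simp: words_in_def)
  ultimately show "A \<in> (\<lambda>c. {x \<in> X. code n x = c}) ` words_in \<alpha> n" by blast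
next
  fix A assume "A \<in> (\<lambda>c. {x \<in> X. code n x = c}) ` words_in \<alpha> n"
  then obtain c where c: "A = {x \<in> X. code n x = c}" "c \<in> words_in \<alpha> n" by blast
  then have l: "length c = n" and ck: "k < n \<Longrightarrow> c ! k \<in> \<alpha>" for k by (auto simp: words_in_def subset_iff)
  have "A = X \<inter> (\<Inter>k<n. (shift ^^ k) -` (c ! k))"
    unfolding c(1) using code_eq_iff[OF _ c(2)] by auto
  then show "A \<in> join_n X \<alpha> n" unfolding join_n_def using ck by blast
qed

text \<open>Distinct label words can name the same cell only if both cells are empty, and then the
  summand vanishes.\<close>

lemma Hpart_eq:
  assumes "space \<eta> = X"
  shows "Hpart \<eta> (join_n X \<alpha> n) = label_entropy \<eta> (code n) (words_in \<alpha> n)"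
proof -
  let ?h = "\<lambda>C. if measure \<eta> C = 0 then 0 else measure \<eta> C * ln (measure \<eta> C)"
  have "(\<Sum>C\<in>join_n X \<alpha> n. ?h C) = sum (?h \<circ> (\<lambda>c. {x \<in> X. code n x = c})) (words_in \<alpha> n)"
    unfolding join_n_eq
  proof (rule sum.reindex_nontrivial)
    fix c d assume "c \<in> words_in \<alpha> n" "d \<in> words_in \<alpha> n" "c \<noteq> d" "{x \<in> X. code n x = c} = {x \<in> X. code n x = d}"
    then have "{x \<in> X. code n x = c} = {}" by blast
    then show "?h {x \<in> X. code n x = c} = 0" by (simp only: measure_empty) simp
  qed (use fin in simp)
  then show ?thesis unfolding Hpart_def label_entropy_def assms by (simp add: comp_def sum_negf[symmetric] cong: if_cong)
    (auto intro!: sum.cong)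
qed

end

section \<open>Integration against a joining and its disintegration\<close>

locale joining = sft X + ergodic_system \<nu> T
  for X :: "(int \<Rightarrow> 'a::finite) set" and \<nu> :: "'y::topological_space measure" and T :: "'y \<Rightarrow> 'y" +
  fixes jn :: "((int \<Rightarrow> 'a) \<times> 'y) measure" and \<kappa> :: "'y \<Rightarrow> (int \<Rightarrow> 'a) measure"
  assumes jn: "jn \<in> joinings X \<nu> T" and dis: "disintegration X \<nu> jn \<kappa>"
begin

sublocale J: prob_space jn using jn by (simp add: joinings_def)

lemma sets_jn [measurable_cong]: "sets jn = sets (XM \<Otimes>\<^sub>M borel)" using jn by (simp add: joinings_def)

lemma space_jn: "space jn = X \<times> UNIV"
  using sets_eq_imp_space_eq[OF sets_jn] by (simp add: space_pair_measure)

lemma kernel_prob: "prob_space (\<kappa> y)" and sets_kernel: "sets (\<kappa> y) = sets XM"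
  using dis by (auto simp: disintegration_def)

lemma space_kernel [simp]: "space (\<kappa> y) = X"
  using sets_eq_imp_space_eq[OF sets_kernel] by simp

lemma kernel_measurable: "A \<in> sets XM \<Longrightarrow> (\<lambda>y. measure (\<kappa> y) A) \<in> borel_measurable \<nu>"
  using dis unfolding disintegration_def by (simp cong: measurable_cong_sets add: sets_nu)

lemma kernel_le_1: "measure (\<kappa> y) A \<le> 1"
  using prob_space.prob_le_1[OF kernel_prob] .

lemma jn_rectangle: "A \<in> sets XM \<Longrightarrow> B \<in> sets borel \<Longrightarrow> measure jn (A \<times> B) = (\<integral>y. indicator B y * measure (\<kappa> y) A \<partial>\<nu>)"
  using dis by (simp add: disintegration_def)

lemma fst_measurable: "fst \<in> measurable jn XM" and snd_measurable: "snd \<in> measurable jn borel" 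
  by measurable

text \<open>Restricting the joining to \<open>A\<close> in the first coordinate and projecting gives
  \<nu> with density \<open>measure (\<kappa> y) A\<close>: on Borel sets this is the rectangle
  formula of the disintegration, and then it transfers to integrals.\<close>

lemma jn_fibre:
  fixes u :: "'y \<Rightarrow> real"
  assumes A: "A \<in> sets XM" and u: "integrable \<nu> u"
  shows "integrable jn (\<lambda>z. indicator A (fst z) * u (snd z))"
    and "(\<integral>z. indicator A (fst z) * u (snd z) \<partial>jn) = (\<integral>y. measure (\<kappa> y) A * u y \<partial>\<nu>)"
proof -
  let ?g = "\<lambda>z. indicator A (fst z) :: real"
  have gm: "?g \<in> borel_measurable jn" using measurable_compose[OF fst_measurable borel_measurable_indicator[OF A]] .
  have km: "(\<lambda>y. measure (\<kappa> y) A) \<in> borel_measurable \<nu>" by (rule kernel_measurable[OF A])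
  have um: "u \<in> borel_measurable borel" using u by (simp cong: measurable_cong_sets add: sets_nu[symmetric])
  have sm: "snd \<in> measurable (density jn (\<lambda>z. ennreal (?g z))) borel" using snd_measurable by simp
  have eq: "distr (density jn (\<lambda>z. ennreal (?g z))) borel snd = density \<nu> (\<lambda>y. ennreal (measure (\<kappa> y) A))"
  proof (rule measure_eqI)
    fix B assume "B \<in> sets (distr (density jn (\<lambda>z. ennreal (?g z))) borel snd)"
    then have B: "B \<in> sets borel" by simp
    have AB: "A \<times> B \<in> sets jn" using A B by (simp add: sets_jn)
    have s: "snd -` B \<inter> space jn \<in> sets jn" using measurable_sets[OF snd_measurable B] .
    have "emeasure (distr (density jn (\<lambda>z. ennreal (?g z))) borel snd) B = emeasure (density jn (\<lambda>z. ennreal (?g z))) (snd -` B \<inter> space jn)"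
      using B sm by (simp add: emeasure_distr)
    also have "\<dots> = (\<integral>\<^sup>+z. ennreal (?g z) * indicator (snd -` B \<inter> space jn) z \<partial>jn)"
      using s gm by (intro emeasure_density) auto
    also have "\<dots> = (\<integral>\<^sup>+z. indicator (A \<times> B) z \<partial>jn)"
      by (rule nn_integral_cong) (auto simp: space_jn indicator_def)
    also have "\<dots> = emeasure jn (A \<times> B)" using AB by simp
    also have "\<dots> = ennreal (\<integral>y. indicator B y * measure (\<kappa> y) A \<partial>\<nu>)"
      using jn_rectangle[OF A B] by (simp add: J.emeasure_eq_measure)
    also have "\<dots> = (\<integral>\<^sup>+y. ennreal (indicator B y * measure (\<kappa> y) A) \<partial>\<nu>)"
    proof (rule nn_integral_eq_integral[symmetric])
      show "integrable \<nu> (\<lambda>y. indicator B y * measure (\<kappa> y) A)"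
      proof (rule integrable_const_bound[where B = 1])
        show "(\<lambda>y. indicator B y * measure (\<kappa> y) A) \<in> borel_measurable \<nu>"
          using B by (intro borel_measurable_times borel_measurable_indicator km) (simp add: sets_nu)
      qed (use kernel_le_1 in \<open>auto simp: indicator_def\<close>)
    qed auto
    also have "\<dots> = (\<integral>\<^sup>+y. ennreal (measure (\<kappa> y) A) * indicator B y \<partial>\<nu>)"
      by (rule nn_integral_cong) (auto simp: indicator_def)
    also have "\<dots> = emeasure (density \<nu> (\<lambda>y. ennreal (measure (\<kappa> y) A))) B"
      using B km by (intro emeasure_density[symmetric]) (auto simp: sets_nu)
    finally show "emeasure (distr (density jn (\<lambda>z. ennreal (?g z))) borel snd) B = emeasure (density \<nu> (\<lambda>y. ennreal (measure (\<kappa> y) A))) B" .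
  qed (simp add: sets_nu)
  have I2: "integrable (density \<nu> (\<lambda>y. ennreal (measure (\<kappa> y) A))) u"
  proof (subst integrable_density)
    show "integrable \<nu> (\<lambda>y. measure (\<kappa> y) A *\<^sub>R u y)"
      by (rule Bochner_Integration.integrable_bound[OF u])
        (use km u kernel_le_1 in \<open>auto intro!: AE_I2 mult_left_le_one_le simp: abs_mult\<close>)
  qed (use km u in auto)
  then have "integrable (distr (density jn (\<lambda>z. ennreal (?g z))) borel snd) u" by (simp only: eq)
  from integrable_distr[OF sm this] have "integrable (density jn (\<lambda>z. ennreal (?g z))) (\<lambda>z. u (snd z))" .
  then show "integrable jn (\<lambda>z. ?g z * u (snd z))"
    by (subst (asm) integrable_density) (use gm measurable_compose[OF snd_measurable um] in auto)
  have "(\<integral>z. ?g z * u (snd z) \<partial>jn) = (\<integral>z. u (snd z) \<partial>(density jn (\<lambda>z. ennreal (?g z))))"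
    by (subst integral_density) (use gm measurable_compose[OF snd_measurable um] in auto)
  also have "\<dots> = (\<integral>y. u y \<partial>(distr (density jn (\<lambda>z. ennreal (?g z))) borel snd))"
    by (rule integral_distr[OF sm um, symmetric])
  also have "\<dots> = (\<integral>y. measure (\<kappa> y) A * u y \<partial>\<nu>)" unfolding eq
    by (subst integral_density) (use km u in auto)
  finally show "(\<integral>z. ?g z * u (snd z) \<partial>jn) = (\<integral>y. measure (\<kappa> y) A * u y \<partial>\<nu>)" .
qed

text \<open>An integrand that depends on \<open>x\<close> through a finite label splits into
  finitely many terms of the kind treated in \<open>jn_fibre\<close>; integrals against the joining
  thus become finite sums over fibers.\<close>

lemma jn_label:
  fixes H :: "'i \<Rightarrow> 'y \<Rightarrow> real"
  assumes I: "finite I" and Z: "\<And>x. x \<in> X \<Longrightarrow> Z x \<in> I" "\<And>i. i \<in> I \<Longrightarrow> {x \<in> X. Z x = i} \<in> sets XM"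
    and H: "\<And>i. i \<in> I \<Longrightarrow> integrable \<nu> (H i)"
  shows "integrable jn (\<lambda>z. H (Z (fst z)) (snd z))"
    and "(\<integral>z. H (Z (fst z)) (snd z) \<partial>jn) = (\<integral>y. (\<Sum>i\<in>I. measure (\<kappa> y) {x \<in> X. Z x = i} * H i y) \<partial>\<nu>)"
proof -
  have eq: "H (Z (fst z)) (snd z) = (\<Sum>i\<in>I. indicator {x \<in> X. Z x = i} (fst z) * H i (snd z))" if "z \<in> space jn" for z
  proof -
    have fz: "fst z \<in> X" using that by (auto simp: space_jn)
    have "(\<Sum>i\<in>I. indicator {x \<in> X. Z x = i} (fst z) * H i (snd z)) = (\<Sum>i\<in>I. if i = Z (fst z) then H i (snd z) else 0)"
      using fz by (intro sum.cong refl) (auto simp: indicator_def)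
    then show ?thesis using Z(1)[OF fz] I by simp
  qed
  have fi: "integrable jn (\<lambda>z. indicator {x \<in> X. Z x = i} (fst z) * H i (snd z))" if "i \<in> I" for i
    using jn_fibre(1)[OF Z(2)[OF that] H[OF that]] .
  have "integrable jn (\<lambda>z. \<Sum>i\<in>I. indicator {x \<in> X. Z x = i} (fst z) * H i (snd z))"
    using fi by (rule Bochner_Integration.integrable_sum)
  then show "integrable jn (\<lambda>z. H (Z (fst z)) (snd z))" by (subst Bochner_Integration.integrable_cong[OF refl eq])
  have "(\<integral>z. H (Z (fst z)) (snd z) \<partial>jn) = (\<integral>z. (\<Sum>i\<in>I. indicator {x \<in> X. Z x = i} (fst z) * H i (snd z)) \<partial>jn)"
    by (rule Bochner_Integration.integral_cong[OF refl eq])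
  also have "\<dots> = (\<Sum>i\<in>I. \<integral>z. indicator {x \<in> X. Z x = i} (fst z) * H i (snd z) \<partial>jn)"
    using fi by (rule Bochner_Integration.integral_sum)
  also have "\<dots> = (\<Sum>i\<in>I. \<integral>y. measure (\<kappa> y) {x \<in> X. Z x = i} * H i y \<partial>\<nu>)"
    using jn_fibre(2) Z(2) H by (intro sum.cong refl) auto
  also have "\<dots> = (\<integral>y. (\<Sum>i\<in>I. measure (\<kappa> y) {x \<in> X. Z x = i} * H i y) \<partial>\<nu>)"
  proof (rule Bochner_Integration.integral_sum[symmetric])
    fix i assume i: "i \<in> I"
    show "integrable \<nu> (\<lambda>y. measure (\<kappa> y) {x \<in> X. Z x = i} * H i y)"
      by (rule Bochner_Integration.integrable_bound[OF H[OF i]])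
        (use kernel_measurable[OF Z(2)[OF i]] H[OF i] kernel_le_1 in \<open>auto intro!: AE_I2 mult_left_le_one_le simp: abs_mult\<close>)
  qed
  finally show "(\<integral>z. H (Z (fst z)) (snd z) \<partial>jn) = (\<integral>y. (\<Sum>i\<in>I. measure (\<kappa> y) {x \<in> X. Z x = i} * H i y) \<partial>\<nu>)" .
qed

definition ST :: "(int \<Rightarrow> 'a) \<times> 'y \<Rightarrow> (int \<Rightarrow> 'a) \<times> 'y" where "ST = (\<lambda>(x, y). (shift x, T y))"

lemma ST_measurable: "ST \<in> measurable jn jn"
proof -
  have "(\<lambda>z. (shift (fst z), T (snd z))) \<in> measurable jn (XM \<Otimes>\<^sub>M borel)"
    using measurable_compose[OF fst_measurable shift_measurable] measurable_compose[OF snd_measurable T_borel] by (rule measurable_Pair)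
  then have "ST \<in> measurable jn (XM \<Otimes>\<^sub>M borel)" by (simp add: ST_def split_def)
  then show ?thesis by (simp cong: measurable_cong_sets add: sets_jn)
qed

lemma ST_funpow: "(ST ^^ k) z = ((shift ^^ k) (fst z), (T ^^ k) (snd z))"
  by (induction k) (simp_all add: ST_def)

lemma distr_ST: "distr jn jn ST = jn"
proof (rule measure_eqI)
  fix A assume "A \<in> sets (distr jn jn ST)"
  then have A: "A \<in> sets jn" by simp
  then show "emeasure (distr jn jn ST) A = emeasure jn A"
    using jn ST_measurable unfolding joinings_def ST_def by (simp add: emeasure_distr J.emeasure_eq_measure)
qed simp

lemma funpow_ST_measurable: "(ST ^^ k) \<in> measurable jn jn"
proof (induction k)
  case (Suc k)
  then show ?case unfolding funpow.simps(2) by (rule measurable_comp[OF _ ST_measurable])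
qed simp

lemma distr_funpow_ST: "distr jn jn (ST ^^ k) = jn"
proof (induction k)
  case 0
  then show ?case by (simp add: distr_id2 id_def)
next
  case (Suc k)
  have "distr jn jn (ST ^^ Suc k) = distr (distr jn jn (ST ^^ k)) jn ST"
    using ST_measurable funpow_ST_measurable by (subst distr_distr) auto
  then show ?case by (simp only: Suc distr_ST)
qed

lemma jn_invariant:
  fixes h :: "(int \<Rightarrow> 'a) \<times> 'y \<Rightarrow> real"
  assumes h: "integrable jn h"
  shows "integrable jn (\<lambda>z. h ((shift ^^ k) (fst z), (T ^^ k) (snd z)))"
    and "(\<integral>z. h ((shift ^^ k) (fst z), (T ^^ k) (snd z)) \<partial>jn) = (\<integral>z. h z \<partial>jn)"
proof -
  have h': "integrable (distr jn jn (ST ^^ k)) h" unfolding distr_funpow_ST by (rule h)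
  from integrable_distr[OF funpow_ST_measurable this]
  show "integrable jn (\<lambda>z. h ((shift ^^ k) (fst z), (T ^^ k) (snd z)))" by (simp add: ST_funpow)
  have "(\<integral>z. h z \<partial>(distr jn jn (ST ^^ k))) = (\<integral>z. h ((ST ^^ k) z) \<partial>jn)"
    by (rule integral_distr[OF funpow_ST_measurable borel_measurable_integrable[OF h]])
  then show "(\<integral>z. h ((shift ^^ k) (fst z), (T ^^ k) (snd z)) \<partial>jn) = (\<integral>z. h z \<partial>jn)"
    by (simp add: ST_funpow distr_funpow_ST)
qed

lemma jn_snd:
  fixes u :: "'y \<Rightarrow> real" assumes u: "integrable \<nu> u"
  shows "integrable jn (\<lambda>z. u (snd z))" "(\<integral>z. u (snd z) \<partial>jn) = (\<integral>y. u y \<partial>\<nu>)"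
proof -
  have "{x \<in> X. (\<lambda>_. ()) x = ()} = X" by simp
  moreover have "measure (\<kappa> y) X = 1" for y using prob_space.prob_space[OF kernel_prob[of y]] by simp
  ultimately show "integrable jn (\<lambda>z. u (snd z))" "(\<integral>z. u (snd z) \<partial>jn) = (\<integral>y. u y \<partial>\<nu>)"
    using jn_label[of "{()}" "\<lambda>_. ()" "\<lambda>_. u"] u sets.top[of XM] by auto
qed

end

locale joining_partition = joining X \<nu> T jn \<kappa> + label_partition X \<alpha>
  for X :: "(int \<Rightarrow> 'a::finite) set" and \<nu> :: "'y::topological_space measure" and T jn \<kappa> \<alpha>
begin

definition ent :: "nat \<Rightarrow> real" where
  "ent n = (\<integral>y. label_entropy (\<kappa> y) (code n) (words_in \<alpha> n) \<partial>\<nu>)"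

lemma Hpart_ent: "(\<integral>y. Hpart (\<kappa> y) (join_n X \<alpha> n) \<partial>\<nu>) = ent n"
  unfolding ent_def by (simp add: Hpart_eq)

lemma code_sets': "c \<in> words_in \<alpha> n \<Longrightarrow> {x \<in> space (\<kappa> y). code n x = c} \<in> sets (\<kappa> y)"
  using code_sets by (simp add: sets_kernel)

lemma code_in': "x \<in> space (\<kappa> y) \<Longrightarrow> code n x \<in> words_in \<alpha> n"
  using code_in by simp

lemma label_entropy_integrable:
  "integrable \<nu> (\<lambda>y. label_entropy (\<kappa> y) (code n) (words_in \<alpha> n))"
proof (rule integrable_const_bound[where B = "ln (card (words_in \<alpha> n))"])
  show "AE y in \<nu>. norm (label_entropy (\<kappa> y) (code n) (words_in \<alpha> n)) \<le> ln (card (words_in \<alpha> n))"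
    using prob_space.label_entropy_card[OF kernel_prob finite_words_in[OF fin] code_in' code_sets']
      prob_space.label_entropy_nonneg[OF kernel_prob finite_words_in[OF fin]] by (intro AE_I2) auto
  have "(\<lambda>y. measure (\<kappa> y) {x \<in> X. code n x = c}) \<in> borel_measurable \<nu>" if "c \<in> words_in \<alpha> n" for c
    by (rule kernel_measurable[OF code_sets[OF that]])
  then show "(\<lambda>y. label_entropy (\<kappa> y) (code n) (words_in \<alpha> n)) \<in> borel_measurable \<nu>"
    unfolding label_entropy_def by (intro borel_measurable_sum) simp
qed

lemma ent_nonneg: "0 \<le> ent n"
  unfolding ent_def using prob_space.label_entropy_nonneg[OF kernel_prob finite_words_in[OF fin]] by simp

text \<open>Smoothing by \<open>\<epsilon>\<close> keeps the logarithms of fiber probabilities bounded.\<close>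

definition smooth :: "real \<Rightarrow> nat \<Rightarrow> (int \<Rightarrow> 'a) set list \<Rightarrow> 'y \<Rightarrow> real" where
  "smooth \<epsilon> n c y = (measure (\<kappa> y) {x \<in> X. code n x = c} + \<epsilon>) / (1 + \<epsilon> * card (words_in \<alpha> n))"

context
  fixes \<epsilon> :: real assumes eps: "\<epsilon> > 0"
begin

lemma smooth_denominator: "1 \<le> 1 + \<epsilon> * card (words_in \<alpha> n)"
  unfolding le_add_same_cancel1 by (intro mult_nonneg_nonneg) (use eps in auto)

lemma smooth_denominator_pos: "0 < 1 + \<epsilon> * card (words_in \<alpha> n)"
  by (rule less_le_trans[OF zero_less_one smooth_denominator])

lemma code_sum: "(\<Sum>c\<in>words_in \<alpha> n. measure (\<kappa> y) {x \<in> X. code n x = c}) = 1"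
proof -
  have "(\<Sum>c\<in>words_in \<alpha> n. measure (\<kappa> y) {x \<in> space (\<kappa> y). code n x = c}) = 1"
    by (rule prob_space.label_sum[OF kernel_prob]) (use fin code_in' code_sets' in auto)
  then show ?thesis by simp
qed

lemma smooth_pos: "0 < smooth \<epsilon> n c y"
  unfolding smooth_def by (rule divide_pos_pos[OF add_nonneg_pos[OF measure_nonneg eps] smooth_denominator_pos])

lemma smooth_sum: "(\<Sum>c\<in>words_in \<alpha> n. smooth \<epsilon> n c y) = 1"
proof -
  have "(\<Sum>c\<in>words_in \<alpha> n. measure (\<kappa> y) {x \<in> X. code n x = c} + \<epsilon>) = 1 + \<epsilon> * card (words_in \<alpha> n)"
    by (simp add: sum.distrib code_sum)
  then show ?thesis unfolding smooth_def sum_divide_distrib[symmetric] using smooth_denominator_pos[of n] by simp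
qed

lemma smooth_integrable: "c \<in> words_in \<alpha> n \<Longrightarrow> integrable \<nu> (\<lambda>y. - ln (smooth \<epsilon> n c y))"
proof -
  assume c: "c \<in> words_in \<alpha> n"
  let ?k = "1 + \<epsilon> * card (words_in \<alpha> n)"
  have k: "1 \<le> ?k" by (rule smooth_denominator)
  note km = kernel_measurable[OF code_sets[OF c]]
  have lo: "\<epsilon> / ?k \<le> smooth \<epsilon> n c y" for y unfolding smooth_def using k by (intro divide_right_mono) auto
  have hi: "smooth \<epsilon> n c y \<le> 1 + \<epsilon>" for y
  proof -
    have "smooth \<epsilon> n c y \<le> (1 + \<epsilon>) / ?k" unfolding smooth_def using k kernel_le_1 by (intro divide_right_mono) auto
    also have "\<dots> \<le> (1 + \<epsilon>) / 1"
      using k smooth_denominator_pos[of n] eps by (intro divide_left_mono) simp_all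
    finally show ?thesis by simp
  qed
  have e0: "0 < \<epsilon> / ?k" by (rule divide_pos_pos[OF eps smooth_denominator_pos])
  show ?thesis
  proof (rule integrable_const_bound[where B = "\<bar>ln (\<epsilon> / ?k)\<bar> + \<bar>ln (1 + \<epsilon>)\<bar>"])
    show "AE y in \<nu>. norm (- ln (smooth \<epsilon> n c y)) \<le> \<bar>ln (\<epsilon> / ?k)\<bar> + \<bar>ln (1 + \<epsilon>)\<bar>"
    proof (rule AE_I2)
      fix y
      have "ln (\<epsilon> / ?k) \<le> ln (smooth \<epsilon> n c y)" using lo[of y] e0 smooth_pos[of n c y] by (subst ln_le_cancel_iff) auto
      moreover have "ln (smooth \<epsilon> n c y) \<le> ln (1 + \<epsilon>)" using hi[of y] eps smooth_pos[of n c y] by (subst ln_le_cancel_iff) auto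
      ultimately show "norm (- ln (smooth \<epsilon> n c y)) \<le> \<bar>ln (\<epsilon> / ?k)\<bar> + \<bar>ln (1 + \<epsilon>)\<bar>" by simp
    qed
    show "(\<lambda>y. - ln (smooth \<epsilon> n c y)) \<in> borel_measurable \<nu>" unfolding smooth_def using km by measurable
  qed
qed

lemma smooth_entropy:
  "(\<Sum>c\<in>words_in \<alpha> n. measure (\<kappa> y) {x \<in> X. code n x = c} * - ln (smooth \<epsilon> n c y)) \<le>
     label_entropy (\<kappa> y) (code n) (words_in \<alpha> n) + \<epsilon> * card (words_in \<alpha> n)"
proof -
  let ?k = "1 + \<epsilon> * card (words_in \<alpha> n)" and ?p = "\<lambda>c. measure (\<kappa> y) {x \<in> X. code n x = c}"
  have k: "1 \<le> ?k" by (rule smooth_denominator)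
  have "?p c * - ln (smooth \<epsilon> n c y) \<le> - ?p c * ln (?p c) + ?p c * ln ?k" for c
  proof (cases "?p c = 0")
    case False
    then have p: "0 < ?p c" by (simp add: zero_less_measure_iff)
    have "ln (?p c) \<le> ln (?p c + \<epsilon>)" using p eps by (subst ln_le_cancel_iff) auto
    moreover have "ln (smooth \<epsilon> n c y) = ln (?p c + \<epsilon>) - ln ?k" unfolding smooth_def using p eps smooth_denominator_pos[of n] by (intro ln_divide_pos) auto
    ultimately have "- ln (smooth \<epsilon> n c y) \<le> - ln (?p c) + ln ?k" by linarith
    then have "?p c * - ln (smooth \<epsilon> n c y) \<le> ?p c * (- ln (?p c) + ln ?k)" using p by (intro mult_left_mono) auto
    then show ?thesis by (simp add: algebra_simps)
  qed simp
  then have "(\<Sum>c\<in>words_in \<alpha> n. ?p c * - ln (smooth \<epsilon> n c y)) \<le> (\<Sum>c\<in>words_in \<alpha> n. - ?p c * ln (?p c) + ?p c * ln ?k)"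
    by (rule sum_mono)
  also have "\<dots> = label_entropy (\<kappa> y) (code n) (words_in \<alpha> n) + (\<Sum>c\<in>words_in \<alpha> n. ?p c) * ln ?k"
    by (simp add: sum.distrib sum_subtractf sum_negf label_entropy_def sum_distrib_right)
  also have "(\<Sum>c\<in>words_in \<alpha> n. ?p c) = 1"
    by (rule code_sum)
  also have "ln ?k \<le> \<epsilon> * card (words_in \<alpha> n)" using k ln_le_minus_one[of ?k] by simp
  finally show ?thesis by simp
qed

lemma smooth_jn:
  "integrable jn (\<lambda>z. - ln (smooth \<epsilon> n (code n (fst z)) (snd z)))"
  "(\<integral>z. - ln (smooth \<epsilon> n (code n (fst z)) (snd z)) \<partial>jn) \<le> ent n + \<epsilon> * card (words_in \<alpha> n)"
proof -
  note l = jn_label[where I = "words_in \<alpha> n" and Z = "code n" and H = "\<lambda>c y. - ln (smooth \<epsilon> n c y)",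
    OF finite_words_in[OF fin] code_in code_sets smooth_integrable]
  show "integrable jn (\<lambda>z. - ln (smooth \<epsilon> n (code n (fst z)) (snd z)))" using l(1) .
  have "(\<integral>z. - ln (smooth \<epsilon> n (code n (fst z)) (snd z)) \<partial>jn) =
    (\<integral>y. (\<Sum>c\<in>words_in \<alpha> n. measure (\<kappa> y) {x \<in> X. code n x = c} * - ln (smooth \<epsilon> n c y)) \<partial>\<nu>)" using l(2) .
  also have "\<dots> \<le> (\<integral>y. label_entropy (\<kappa> y) (code n) (words_in \<alpha> n) + \<epsilon> * card (words_in \<alpha> n) \<partial>\<nu>)"
  proof (rule integral_mono)
    show "integrable \<nu> (\<lambda>y. \<Sum>c\<in>words_in \<alpha> n. measure (\<kappa> y) {x \<in> X. code n x = c} * - ln (smooth \<epsilon> n c y))"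
    proof (rule Bochner_Integration.integrable_sum)
      fix c assume c: "c \<in> words_in \<alpha> n"
      show "integrable \<nu> (\<lambda>y. measure (\<kappa> y) {x \<in> X. code n x = c} * - ln (smooth \<epsilon> n c y))"
        by (rule Bochner_Integration.integrable_bound[OF smooth_integrable[OF c]])
          (use kernel_measurable[OF code_sets[OF c]] borel_measurable_integrable[OF smooth_integrable[OF c]] kernel_le_1
            in \<open>auto intro!: AE_I2 mult_left_le_one_le simp: abs_mult\<close>)
    qed
  qed (use label_entropy_integrable smooth_entropy in auto)
  also have "\<dots> = ent n + \<epsilon> * card (words_in \<alpha> n)"
    unfolding ent_def using label_entropy_integrable prob_space by simp
  finally show "(\<integral>z. - ln (smooth \<epsilon> n (code n (fst z)) (snd z)) \<partial>jn) \<le> ent n + \<epsilon> * card (words_in \<alpha> n)" .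
qed

text \<open>The labels of length \<open>m + n\<close> are tested against the product of the smoothed
  laws over \<open>y\<close> and over \<open>(T ^^ m) y\<close>. The second factor is brought back
  to time zero under the integral by invariance of the joining, so no pointwise relation between
  \<open>\<kappa> (T y)\<close> and the shifted \<open>\<kappa> y\<close> enters.\<close>

lemma ent_add_smooth:
  "ent (m + n) \<le> ent m + ent n + \<epsilon> * (card (words_in \<alpha> m) + card (words_in \<alpha> n))"
proof -
  let ?H = "\<lambda>c y. - ln (smooth \<epsilon> m (take m c) y) + - ln (smooth \<epsilon> n (drop m c) ((T ^^ m) y))"
  have Hint: "integrable \<nu> (?H c)" if "c \<in> words_in \<alpha> (m + n)" for c
    using words_in_take_drop[OF that] by (intro Bochner_Integration.integrable_add smooth_integrable integrable_funpow[OF smooth_integrable]) auto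
  note l = jn_label[where I = "words_in \<alpha> (m + n)" and Z = "code (m + n)" and H = ?H,
    OF finite_words_in[OF fin] code_in code_sets Hint]
  have pt: "label_entropy (\<kappa> y) (code (m + n)) (words_in \<alpha> (m + n)) \<le>
    (\<Sum>c\<in>words_in \<alpha> (m + n). measure (\<kappa> y) {x \<in> X. code (m + n) x = c} * ?H c y)" for y
  proof -
    let ?R = "\<lambda>c. smooth \<epsilon> m (take m c) y * smooth \<epsilon> n (drop m c) ((T ^^ m) y)"
    have "sum ?R (words_in \<alpha> (m + n)) = (\<Sum>u\<in>words_in \<alpha> m. \<Sum>v\<in>words_in \<alpha> n. smooth \<epsilon> m u y * smooth \<epsilon> n v ((T ^^ m) y))"
      by (rule sum_words_in_append[OF fin])
    also have "\<dots> = 1" by (simp add: sum_distrib_left[symmetric] smooth_sum)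
    finally have "sum ?R (words_in \<alpha> (m + n)) = 1" .
    then have "label_entropy (\<kappa> y) (code (m + n)) (words_in \<alpha> (m + n)) \<le>
      (\<Sum>c\<in>words_in \<alpha> (m + n). measure (\<kappa> y) {x \<in> space (\<kappa> y). code (m + n) x = c} * - ln (?R c))"
      by (intro prob_space.label_entropy_le[OF kernel_prob finite_words_in[OF fin] code_in' code_sets'])
        (auto intro!: mult_pos_pos smooth_pos)
    then show ?thesis using smooth_pos by (simp add: ln_mult_pos)
  qed
  have int_sum: "integrable \<nu> (\<lambda>y. \<Sum>c\<in>words_in \<alpha> (m + n). measure (\<kappa> y) {x \<in> X. code (m + n) x = c} * ?H c y)"
  proof (rule Bochner_Integration.integrable_sum)
    fix c assume c: "c \<in> words_in \<alpha> (m + n)"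
    show "integrable \<nu> (\<lambda>y. measure (\<kappa> y) {x \<in> X. code (m + n) x = c} * ?H c y)"
      by (rule Bochner_Integration.integrable_bound[OF Hint[OF c]])
        (use kernel_measurable[OF code_sets[OF c]] borel_measurable_integrable[OF Hint[OF c]] kernel_le_1
          in \<open>auto intro!: AE_I2 mult_left_le_one_le simp: abs_mult\<close>)
  qed
  have "ent (m + n) \<le> (\<integral>y. (\<Sum>c\<in>words_in \<alpha> (m + n). measure (\<kappa> y) {x \<in> X. code (m + n) x = c} * ?H c y) \<partial>\<nu>)"
    unfolding ent_def by (rule integral_mono[OF label_entropy_integrable int_sum pt])
  also have "\<dots> = (\<integral>z. ?H (code (m + n) (fst z)) (snd z) \<partial>jn)" using l(2) by simp
  also have "\<dots> = (\<integral>z. - ln (smooth \<epsilon> m (code m (fst z)) (snd z)) +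
      - ln (smooth \<epsilon> n (code n ((shift ^^ m) (fst z))) ((T ^^ m) (snd z))) \<partial>jn)"
    by (simp add: code_append)
  also have "\<dots> = (\<integral>z. - ln (smooth \<epsilon> m (code m (fst z)) (snd z)) \<partial>jn) +
      (\<integral>z. - ln (smooth \<epsilon> n (code n ((shift ^^ m) (fst z))) ((T ^^ m) (snd z))) \<partial>jn)"
    using smooth_jn(1)[of m] jn_invariant(1)[OF smooth_jn(1)[of n], of m] by (intro Bochner_Integration.integral_add) auto
  also have "(\<integral>z. - ln (smooth \<epsilon> n (code n ((shift ^^ m) (fst z))) ((T ^^ m) (snd z))) \<partial>jn) =
      (\<integral>z. - ln (smooth \<epsilon> n (code n (fst z)) (snd z)) \<partial>jn)"
    using jn_invariant(2)[OF smooth_jn(1)[of n], of m] by simp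
  finally show ?thesis using smooth_jn(2)[of m] smooth_jn(2)[of n] by (simp add: distrib_left)
qed

end

lemma ent_subadditive: "ent (m + n) \<le> ent m + ent n"
proof (rule field_le_epsilon)
  fix d :: real assume d: "d > 0"
  let ?k = "real (card (words_in \<alpha> m) + card (words_in \<alpha> n))"
  have "ent (m + n) \<le> ent m + ent n + (d / (?k + 1)) * ?k" using ent_add_smooth[of "d / (?k + 1)" m n] d by simp
  also have "(d / (?k + 1)) * ?k \<le> d" using d by (simp add: divide_le_eq) 
  finally show "ent (m + n) \<le> ent m + ent n + d" by simp
qed

lemma ent_convergent: "convergent (\<lambda>n. ent n / n)"
  by (rule fekete[OF ent_subadditive ent_nonneg])

end


context joining_partition
begin

text \<open>Each cell is close to a clopen set, and membership in finitely many clopen sets is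
  visible in one window. \<open>D\<close> collects all symmetric differences, so outside
  \<open>D\<close> the window determines the label.\<close>

lemma partition_decoding:
  assumes \<delta>: "\<delta> > 0"
  shows "\<exists>D M0. D \<in> sets XM \<and> measure jn (D \<times> UNIV) < \<delta> \<and>
    (\<forall>M\<ge>M0. \<exists>dec. \<forall>x\<in>X - D. lab x = dec (cen M x))"
proof -
  define P where "P = distr jn XM fst"
  interpret P: prob_space P unfolding P_def by (rule J.prob_space_distr[OF fst_measurable])
  have setsP: "sets P = sets XM" by (simp add: P_def)
  have c: "0 < real (card \<alpha>)" using fin \<alpha>_ne by (simp add: card_gt_0_iff)
  then have d: "\<delta> / card \<alpha> > 0" using \<delta> by simp
  have "\<forall>a\<in>\<alpha>. \<exists>C. C \<in> Alg \<and> measure P ((a - C) \<union> (C - a)) < \<delta> / card \<alpha>"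
    using sets_approx[OF P.finite_measure_axioms setsP \<alpha>_sets d] by blast
  from bchoice[OF this] obtain C
    where CC: "\<forall>a\<in>\<alpha>. C a \<in> Alg \<and> measure P ((a - C a) \<union> (C a - a)) < \<delta> / card \<alpha>" by (rule exE)
  have C: "C a \<in> Alg" "measure P ((a - C a) \<union> (C a - a)) < \<delta> / card \<alpha>" if "a \<in> \<alpha>" for a
    using bspec[OF CC that] by simp_all
  have "\<forall>a\<in>\<alpha>. \<exists>n. \<forall>m\<ge>n. C a = X \<inter> cen m -` (cen m ` C a)"
    by (rule ballI) (rule Alg_eq_level[OF C(1)])
  from bchoice[OF this] obtain lev where "\<forall>a\<in>\<alpha>. \<forall>m\<ge>lev a. C a = X \<inter> cen m -` (cen m ` C a)" by (rule exE)
  then have lev: "C a = X \<inter> cen m -` (cen m ` C a)" if "a \<in> \<alpha>" "m \<ge> lev a" for a m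
    using that by (elim ballE allE impE) auto
  define D where "D = (\<Union>a\<in>\<alpha>. (a - C a) \<union> (C a - a))"
  have sd: "(a - C a) \<union> (C a - a) \<in> sets XM" if "a \<in> \<alpha>" for a
    using \<alpha>_sets[OF that] Alg_sets[OF C(1)[OF that]] by auto
  have D: "D \<in> sets XM" unfolding D_def using sd fin by (intro sets.finite_UN) auto
  have "measure P D \<le> (\<Sum>a\<in>\<alpha>. measure P ((a - C a) \<union> (C a - a)))"
    unfolding D_def using sd fin by (intro P.finite_measure_subadditive_finite) (auto simp: setsP)
  also have "\<dots> < (\<Sum>a\<in>\<alpha>. \<delta> / card \<alpha>)" using C(2) fin \<alpha>_ne by (intro sum_strict_mono) auto
  also have "\<dots> = \<delta>" using c by simp
  finally have "measure P D < \<delta>" .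
  moreover have "measure P D = measure jn (D \<times> UNIV)"
  proof -
    have "fst -` D \<inter> space jn = D \<times> UNIV" using sets.sets_into_space[OF D] by (auto simp: space_jn)
    then show ?thesis unfolding P_def by (subst measure_distr[OF fst_measurable D]) simp
  qed
  moreover have "\<exists>dec. \<forall>x\<in>X - D. lab x = dec (cen M x)" if M: "M \<ge> Max (lev ` \<alpha>)" for M
  proof (intro exI ballI)
    fix x assume x: "x \<in> X - D"
    have levM: "M \<ge> lev a" if "a \<in> \<alpha>" for a using M fin that by (meson Max_ge finite_imageI image_eqI le_trans)
    have iff: "cen M x \<in> cen M ` C a \<longleftrightarrow> x \<in> a" if a: "a \<in> \<alpha>" for a
      using lev[OF a levM[OF a]] x a unfolding D_def by blast
    \<comment> \<open>Outside \<open>D\<close> membership in a cell and in its clopen approximation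
      agree, so both definite descriptions have the same defining predicate.\<close>
    show "lab x = (\<lambda>v. THE a. a \<in> \<alpha> \<and> v \<in> cen M ` C a) (cen M x)"
      unfolding lab_def by (intro arg_cong[where f = The] ext conj_cong refl) (simp add: iff)
  qed
  ultimately show ?thesis using D by (intro exI[of _ D] exI[of _ "Max (lev ` \<alpha>)"]) auto
qed

end

locale joined_pressure = pressure_system X \<nu> T G b e + joining_partition X \<nu> T jn \<kappa> \<alpha>
  for X :: "(int \<Rightarrow> 'a::finite) set" and \<nu> :: "'y::topological_space measure" and T G b e jn \<kappa> \<alpha>
begin

lemma G_jn: "integrable jn (\<lambda>z. G (fst z) (snd z))"
proof (rule Bochner_Integration.integrable_bound[OF jn_snd(1)[OF b_int]])
  show "(\<lambda>z. G (fst z) (snd z)) \<in> borel_measurable jn" using G_joint by (simp cong: measurable_cong_sets add: sets_jn)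
  show "AE z in jn. norm (G (fst z) (snd z)) \<le> norm (b (snd z))"
    using G_bound b_nonneg by (intro AE_I2) (auto simp: space_jn)
qed

lemma Gn_jn:
  "integrable jn (\<lambda>z. Gn n (fst z) (snd z))" "(\<integral>z. Gn n (fst z) (snd z) \<partial>jn) = n * (\<integral>z. G (fst z) (snd z) \<partial>jn)"
proof -
  note i = jn_invariant[OF G_jn]
  show "integrable jn (\<lambda>z. Gn n (fst z) (snd z))"
    unfolding Gn_def using i(1) by (intro Bochner_Integration.integrable_sum) simp
  show "(\<integral>z. Gn n (fst z) (snd z) \<partial>jn) = n * (\<integral>z. G (fst z) (snd z) \<partial>jn)"
    unfolding Gn_def using i by (subst Bochner_Integration.integral_sum) auto
qed

context
  fixes M n :: nat and \<eta> :: real and dec D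
  assumes eta: "0 < \<eta>" "\<eta> < 1" and D: "D \<in> sets XM"
    and dec: "\<And>x. x \<in> X - D \<Longrightarrow> lab x = dec (cen M x)"
begin

abbreviation N\<alpha> :: real where "N\<alpha> \<equiv> real (card \<alpha>)"

lemma N\<alpha>: "1 \<le> N\<alpha>"
proof -
  have "0 < card \<alpha>" using fin \<alpha>_ne by (simp add: card_gt_0_iff)
  then show ?thesis by simp
qed

text \<open>Conditional weight of label \<open>a\<close> at time \<open>k\<close> given the word: in
  the interior it bets \<open>1 - \<eta>\<close> on the decoded label and gives
  \<open>\<eta> / N\<alpha>\<close> to the others, so a decoding failure has finite cost; near the
  ends, where the window leaves the word, it is uniform.\<close>

definition Q :: "nat \<Rightarrow> 'a list \<Rightarrow> (int \<Rightarrow> 'a) set \<Rightarrow> real" where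
  "Q k w a = (if M \<le> k \<and> k + M < n
     then (if a = dec (take (2 * M + 1) (drop (k - M) w)) then 1 - \<eta> else \<eta> / N\<alpha>) else 1 / N\<alpha>)"

lemma Q_pos: "0 < Q k w a"
  using eta N\<alpha> unfolding Q_def by (auto intro!: divide_pos_pos)

lemma Q_sum: "(\<Sum>a\<in>\<alpha>. Q k w a) \<le> 1"
proof (cases "M \<le> k \<and> k + M < n")
  case True
  let ?d = "dec (take (2 * M + 1) (drop (k - M) w))"
  have "(\<Sum>a\<in>\<alpha>. Q k w a) \<le> (\<Sum>a\<in>\<alpha>. (if a = ?d then 1 - \<eta> else 0) + \<eta> / N\<alpha>)"
    using True eta N\<alpha> unfolding Q_def by (intro sum_mono) auto
  also have "\<dots> = (if ?d \<in> \<alpha> then 1 - \<eta> else 0) + N\<alpha> * (\<eta> / N\<alpha>)" using fin by (simp add: sum.distrib)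
  also have "\<dots> \<le> 1" using eta N\<alpha> by auto
  finally show ?thesis .
next
  case False
  then have "(\<Sum>a\<in>\<alpha>. Q k w a) = (\<Sum>a\<in>\<alpha>. 1 / N\<alpha>)" unfolding Q_def by (intro sum.cong) auto
  then show ?thesis using N\<alpha> by simp
qed

lemma Q_cost:
  assumes x: "x \<in> X" and k: "k < n"
  shows "- ln (Q k (pre n x) (lab ((shift ^^ k) x))) \<le>
    - ln (1 - \<eta>) + ln (N\<alpha> / \<eta>) * indicator D ((shift ^^ k) x) + (if k < M \<or> n - M \<le> k then ln N\<alpha> else 0)"
proof -
  let ?x = "(shift ^^ k) x"
  have nn: "0 \<le> - ln (1 - \<eta>)" "0 \<le> ln N\<alpha>" "0 \<le> ln (N\<alpha> / \<eta>)" using eta N\<alpha> by (auto simp: le_divide_eq)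
  have ind: "0 \<le> ln (N\<alpha> / \<eta>) * indicator D ?x" using nn(3) by (simp add: indicator_def)
  show ?thesis
  proof (cases "M \<le> k \<and> k + M < n")
    case True
    then have cx: "take (2 * M + 1) (drop (k - M) (pre n x)) = cen M ?x"
      using cen_from_pre[OF conjunct1[OF True] conjunct2[OF True], of x] by (simp only: funpow_shift)
    have nk: "\<not> (k < M \<or> n - M \<le> k)" using True by auto
    show ?thesis
    proof (cases "lab ?x = dec (cen M ?x)")
      case True2: True
      then have "Q k (pre n x) (lab ?x) = 1 - \<eta>" unfolding Q_def using True cx by simp
      then show ?thesis using ind nk by simp
    next
      case False
      then have Dx: "?x \<in> D" using dec[of ?x] x by auto
      have "Q k (pre n x) (lab ?x) = \<eta> / N\<alpha>" unfolding Q_def using True cx False by simp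
      moreover have "- ln (\<eta> / N\<alpha>) = ln (N\<alpha> / \<eta>)" using eta N\<alpha> by (simp add: ln_div)
      ultimately show ?thesis using Dx nn nk by simp
    qed
  next
    case False
    then have kb: "k < M \<or> n - M \<le> k" by auto
    have "Q k (pre n x) (lab ?x) = 1 / N\<alpha>" unfolding Q_def if_not_P[OF False] ..
    moreover have "- ln (1 / N\<alpha>) = ln N\<alpha>" using N\<alpha> by (simp add: ln_div)
    ultimately have "- ln (Q k (pre n x) (lab ?x)) = ln N\<alpha>" by (simp only:)
    then show ?thesis unfolding if_P[OF kb] using ind nn(1) by linarith
  qed
qed

lemma boundary_count: "(\<Sum>k<n. if k < M \<or> n - M \<le> k then ln N\<alpha> else 0) \<le> 2 * M * ln N\<alpha>"
proof -
  have "(\<Sum>k<n. if k < M \<or> n - M \<le> k then ln N\<alpha> else 0) = (\<Sum>k\<in>{..<n} \<inter> {k. k < M \<or> n - M \<le> k}. ln N\<alpha>)"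
    using sum.inter_restrict[of "{..<n}" "\<lambda>_. ln N\<alpha>" "{k. k < M \<or> n - M \<le> k}"] by simp
  also have "\<dots> = card ({..<n} \<inter> {k. k < M \<or> n - M \<le> k}) * ln N\<alpha>" by simp
  also have "\<dots> \<le> (2 * M) * ln N\<alpha>"
  proof (rule mult_right_mono)
    have "card ({..<n} \<inter> {k. k < M \<or> n - M \<le> k}) \<le> card ({..<M} \<union> {n - M..<n})" by (rule card_mono) auto
    also have "\<dots> \<le> card {..<M} + card {n - M..<n}" by (rule card_Un_le)
    also have "\<dots> \<le> 2 * M" by simp
    finally show "real (card ({..<n} \<inter> {k. k < M \<or> n - M \<le> k})) \<le> real (2 * M)" by (rule of_nat_mono)
  qed (use N\<alpha> in simp)
  finally show ?thesis by simp
qed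

text \<open>The entropy of the partition is bounded by testing the fiber measures against the Gibbs weights
  on words of length \<open>n\<close> times the conditional weights \<open>Q\<close> that decode the partition from windows.\<close>

lemma ent_upper:
  "ent n \<le> (\<integral>y. logZ n y \<partial>\<nu>) - n * (\<integral>z. G (fst z) (snd z) \<partial>jn) + (\<integral>y. osc M n y \<partial>\<nu>) +
    n * (- ln (1 - \<eta>) + ln (N\<alpha> / \<eta>) * measure jn (D \<times> UNIV)) + 2 * M * ln N\<alpha>"
proof -
  let ?I = "words_in \<alpha> n \<times> W n"
  let ?Z = "\<lambda>x. (code n x, pre n x)"
  define H where "H i y = logZ n y - Gn n (rep (snd i)) y + (\<Sum>k<n. - ln (Q k (snd i) (fst i ! k)))" for i y
  define R where "R y i = exp (Gn n (rep (snd i)) y - logZ n y) * (\<Prod>k<n. Q k (snd i) (fst i ! k))" for i y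
  have Rpos: "0 < R y i" for y i unfolding R_def by (intro mult_pos_pos prod_pos Q_pos) auto
  have lnR: "- ln (R y i) = H i y" for y i
  proof -
    have "0 < (\<Prod>k<n. Q k (snd i) (fst i ! k))" by (intro prod_pos Q_pos)
    then have "ln (R y i) = (Gn n (rep (snd i)) y - logZ n y) + ln (\<Prod>k<n. Q k (snd i) (fst i ! k))"
      unfolding R_def by (subst ln_mult_pos) auto
    also have "ln (\<Prod>k<n. Q k (snd i) (fst i ! k)) = (\<Sum>k<n. ln (Q k (snd i) (fst i ! k)))"
      by (rule ln_prod) (simp_all add: less_imp_neq[OF Q_pos, symmetric])
    finally show ?thesis by (simp add: H_def sum_negf)
  qed
  have Rsum: "sum (R y) ?I \<le> 1" for y
  proof -
    have "sum (R y) ?I = (\<Sum>c\<in>words_in \<alpha> n. \<Sum>w\<in>W n. R y (c, w))" by (simp add: sum.cartesian_product)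
    also have "\<dots> = (\<Sum>w\<in>W n. \<Sum>c\<in>words_in \<alpha> n. R y (c, w))" by (rule sum.swap)
    also have "\<dots> = (\<Sum>w\<in>W n. exp (Gn n (rep w) y - logZ n y) * (\<Prod>k<n. \<Sum>a\<in>\<alpha>. Q k w a))"
    proof -
      have "(\<Sum>c\<in>words_in \<alpha> n. \<Prod>k<n. Q k w (c ! k)) = (\<Prod>k<n. \<Sum>a\<in>\<alpha>. Q k w a)" for w
        by (rule sum_words_in_prod[OF fin])
      then show ?thesis unfolding R_def by (simp add: sum_distrib_left[symmetric])
    qed
    also have "\<dots> \<le> (\<Sum>w\<in>W n. exp (Gn n (rep w) y - logZ n y) * 1)"
      by (intro sum_mono mult_left_mono prod_le_1) (auto intro!: sum_nonneg Q_sum simp: less_imp_le[OF Q_pos])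
    also have "\<dots> = 1"
      using less_imp_neq[OF sum_exp_pos[where n = n and h = "\<lambda>w. Gn n (rep w) y"], symmetric]
      by (simp add: exp_diff sum_divide_distrib[symmetric] logZ_def)
    finally show ?thesis .
  qed
  have Zin: "?Z x \<in> ?I" if "x \<in> X" for x using code_in that by simp
  have Zset: "{x \<in> X. ?Z x = i} \<in> sets XM" if i: "i \<in> ?I" for i
  proof -
    have "{x \<in> X. ?Z x = i} = {x \<in> X. code n x = fst i} \<inter> {x \<in> X. pre n (shZ 0 x) = snd i}" by (auto simp: prod_eq_iff)
    moreover have "fst i \<in> words_in \<alpha> n" using i by auto
    ultimately show ?thesis using sets.Int[OF code_sets cylinder_sets] by (simp only:)
  qed
  have Hint: "integrable \<nu> (H i)" if "i \<in> ?I" for i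
  proof -
    have ri: "rep (snd i) \<in> X" using that rep by auto
    have "integrable \<nu> (Gn n (rep (snd i)))"
      by (rule Bochner_Integration.integrable_bound[OF integrable_birkhoff_sum[OF b_int]])
        (use Gn_bound[OF ri] Gn_measurable[OF ri] in \<open>auto intro!: AE_I2 intro: order_trans[OF _ abs_ge_self]\<close>)
    then show ?thesis unfolding H_def using logZ_integrable by (intro Bochner_Integration.integrable_add Bochner_Integration.integrable_diff) auto
  qed
  note l = jn_label[where I = ?I and Z = ?Z and H = H, OF _ Zin Zset Hint]
  have pt: "label_entropy (\<kappa> y) (code n) (words_in \<alpha> n) \<le> (\<Sum>i\<in>?I. measure (\<kappa> y) {x \<in> X. ?Z x = i} * H i y)" for y
  proof -
    interpret Ky: prob_space "\<kappa> y" by (rule kernel_prob)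
    have "label_entropy (\<kappa> y) (code n) (words_in \<alpha> n) \<le> label_entropy (\<kappa> y) ?Z ?I"
    proof (rule Ky.label_entropy_refine)
      fix i j assume "i \<in> words_in \<alpha> n" "j \<in> W n"
      then have "{x \<in> X. ?Z x = (i, j)} \<in> sets XM" by (intro Zset) auto
      then show "{x \<in> space (\<kappa> y). code n x = i \<and> pre n x = j} \<in> sets (\<kappa> y)" by (simp add: sets_kernel)
    qed (use fin code_sets' in auto)
    also have "\<dots> \<le> (\<Sum>i\<in>?I. measure (\<kappa> y) {x \<in> space (\<kappa> y). ?Z x = i} * - ln (R y i))"
      by (rule Ky.label_entropy_le) (use fin Zin Zset Rpos Rsum in \<open>auto simp: sets_kernel\<close>)
    finally show ?thesis by (simp add: lnR)
  qed
  have int_sum: "integrable \<nu> (\<lambda>y. \<Sum>i\<in>?I. measure (\<kappa> y) {x \<in> X. ?Z x = i} * H i y)"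
  proof (rule Bochner_Integration.integrable_sum)
    fix i assume i: "i \<in> ?I"
    show "integrable \<nu> (\<lambda>y. measure (\<kappa> y) {x \<in> X. ?Z x = i} * H i y)"
      by (rule Bochner_Integration.integrable_bound[OF Hint[OF i]])
        (use kernel_measurable[OF Zset[OF i]] borel_measurable_integrable[OF Hint[OF i]] kernel_le_1
          in \<open>auto intro!: AE_I2 mult_left_le_one_le simp: abs_mult\<close>)
  qed
  let ?c = "ln (N\<alpha> / \<eta>)"
  let ?ind = "\<lambda>k z. indicator D ((shift ^^ k) (fst z)) :: real"
  have ind_int: "integrable jn (?ind k)" and ind_val: "(\<integral>z. ?ind k z \<partial>jn) = measure jn (D \<times> UNIV)" for k
  proof -
    have m: "(\<lambda>z. indicator D (fst z) :: real) \<in> borel_measurable jn"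
      using measurable_compose[OF fst_measurable borel_measurable_indicator[OF D]] .
    have i0: "integrable jn (\<lambda>z. indicator D (fst z) :: real)"
      by (rule J.integrable_const_bound[where B = 1]) (use m in auto)
    have "(\<integral>z. indicator D (fst z) \<partial>jn) = (\<integral>z. indicator (D \<times> UNIV) z \<partial>jn)"
      by (rule Bochner_Integration.integral_cong) (auto simp: indicator_def)
    also have "\<dots> = measure jn (D \<times> UNIV)" using D by (simp add: sets_jn)
    finally show "(\<integral>z. ?ind k z \<partial>jn) = measure jn (D \<times> UNIV)" using jn_invariant(2)[OF i0, of k] by simp
    show "integrable jn (?ind k)" using jn_invariant(1)[OF i0, of k] by simp
  qed
  have "ent n \<le> (\<integral>y. (\<Sum>i\<in>?I. measure (\<kappa> y) {x \<in> X. ?Z x = i} * H i y) \<partial>\<nu>)"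
    unfolding ent_def by (rule integral_mono[OF label_entropy_integrable int_sum pt])
  also have "\<dots> = (\<integral>z. H (?Z (fst z)) (snd z) \<partial>jn)" using l(2) fin by simp
  also have "\<dots> \<le> (\<integral>z. logZ n (snd z) - Gn n (fst z) (snd z) + osc M n (snd z) +
      (\<Sum>k<n. - ln (1 - \<eta>) + ?c * ?ind k z) + 2 * M * ln N\<alpha> \<partial>jn)"
  proof (rule integral_mono)
    show "integrable jn (\<lambda>z. H (?Z (fst z)) (snd z))" using l(1) fin by simp
    show "integrable jn (\<lambda>z. logZ n (snd z) - Gn n (fst z) (snd z) + osc M n (snd z) +
      (\<Sum>k<n. - ln (1 - \<eta>) + ?c * ?ind k z) + 2 * M * ln N\<alpha>)"
      using jn_snd(1)[OF logZ_integrable[of n]] jn_snd(1)[OF osc_integrable[of M n]] Gn_jn(1)[of n] ind_int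
      by (intro Bochner_Integration.integrable_add Bochner_Integration.integrable_diff Bochner_Integration.integrable_sum) auto
    fix z assume z: "z \<in> space jn"
    then have x: "fst z \<in> X" by (auto simp: space_jn)
    let ?w = "pre n (fst z)"
    have w: "?w \<in> W n" using x by simp
    have "\<bar>Gn n (fst z) (snd z) - Gn n (rep ?w) (snd z)\<bar> \<le> osc M n (snd z)"
      using Gn_distortion[OF x rep(1)[OF w], of n "snd z" M] rep(2)[OF w] by simp
    moreover have "(\<Sum>k<n. - ln (Q k ?w (code n (fst z) ! k))) \<le>
      (\<Sum>k<n. - ln (1 - \<eta>) + ?c * ?ind k z) + 2 * M * ln N\<alpha>"
    proof -
      have "(\<Sum>k<n. - ln (Q k ?w (code n (fst z) ! k))) \<le>
        (\<Sum>k<n. - ln (1 - \<eta>) + ?c * ?ind k z + (if k < M \<or> n - M \<le> k then ln N\<alpha> else 0))"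
        using Q_cost[OF x] by (intro sum_mono) auto
      then show ?thesis using boundary_count by (simp only: sum.distrib)
    qed
    ultimately show "H (?Z (fst z)) (snd z) \<le> logZ n (snd z) - Gn n (fst z) (snd z) + osc M n (snd z) +
      (\<Sum>k<n. - ln (1 - \<eta>) + ?c * ?ind k z) + 2 * M * ln N\<alpha>"
      unfolding H_def fst_conv snd_conv by linarith
  qed
  also have "\<dots> = (\<integral>y. logZ n y \<partial>\<nu>) - n * (\<integral>z. G (fst z) (snd z) \<partial>jn) + (\<integral>y. osc M n y \<partial>\<nu>) +
    (\<Sum>k<n. - ln (1 - \<eta>) + ?c * measure jn (D \<times> UNIV)) + 2 * M * ln N\<alpha>"
    using jn_snd[OF logZ_integrable[of n]] jn_snd[OF osc_integrable[of M n]] Gn_jn[of n] ind_int ind_val J.prob_space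
    by (simp add: Bochner_Integration.integral_sum Bochner_Integration.integrable_sum)
  finally show ?thesis by simp
qed

end

text \<open>Dividing \<open>ent_upper\<close> by \<open>n\<close> leaves three errors per letter,
  each made at most \<open>d / 3\<close>: the bet on the decoded label, the decoding failures and
  the mean modulus.\<close>

theorem entropy_le: "lim (\<lambda>n. ent n / n) \<le> pstar - (\<integral>z. G (fst z) (snd z) \<partial>jn)"
proof -
  let ?IG = "\<integral>z. G (fst z) (snd z) \<partial>jn"
  have lim: "(\<lambda>n. ent n / n) \<longlonglongrightarrow> lim (\<lambda>n. ent n / n)" using ent_convergent by (simp add: convergent_LIMSEQ_iff)
  have N: "1 \<le> real (card \<alpha>)"
  proof -
    have "0 < card \<alpha>" using fin \<alpha>_ne by (simp add: card_gt_0_iff)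
    then show ?thesis by simp
  qed
  have inv: "(\<lambda>N. c / real N) \<longlonglongrightarrow> 0" for c :: real
    by (intro tendsto_divide_0[OF tendsto_const] filterlim_at_top_imp_at_infinity filterlim_real_sequentially)
  show ?thesis
  proof (rule field_le_epsilon)
    fix d :: real assume d: "d > 0"
    \<comment> \<open>The order of choices matters: the failure cost \<open>?c\<close> depends on
      \<open>\<eta>\<close>, the admissible size \<open>\<delta>\<close> of the bad set on
      \<open>?c\<close>, and the window radius \<open>M\<close> on that set.\<close>
    define \<eta> where "\<eta> = 1 - exp (- d / 3)"
    have eta: "0 < \<eta>" "\<eta> < 1" and le: "- ln (1 - \<eta>) = d / 3" using d by (auto simp: \<eta>_def)
    let ?c = "ln (real (card \<alpha>) / \<eta>)"
    have c: "0 \<le> ?c" using eta N by (auto simp: le_divide_eq)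
    define \<delta> where "\<delta> = d / 3 / (?c + 1)"
    have \<delta>: "\<delta> > 0" using d c by (auto simp: \<delta>_def intro!: divide_pos_pos add_nonneg_pos)
    obtain D M0 where DM: "D \<in> sets XM \<and> measure jn (D \<times> UNIV) < \<delta> \<and>
        (\<forall>M\<ge>M0. \<exists>dec. \<forall>x\<in>X - D. lab x = dec (cen M x))"
      using partition_decoding[OF \<delta>] by (elim exE)
    note D = conjunct1[OF DM] conjunct1[OF conjunct2[OF DM]]
      and M0 = conjunct2[OF conjunct2[OF DM], rule_format]
    have "eventually (\<lambda>M. (\<integral>y. e M y \<partial>\<nu>) < d / 3 \<and> M \<ge> M0) sequentially"
      using d by (intro eventually_conj order_tendstoD(2)[OF e_lim] eventually_ge_at_top) auto
    then obtain M where M: "(\<integral>y. e M y \<partial>\<nu>) < d / 3" "M \<ge> M0"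
      using eventually_happens'[OF trivial_limit_sequentially] by blast
    obtain dec where "\<forall>x\<in>X - D. lab x = dec (cen M x)" using M0[OF M(2)] by (rule exE)
    then have dec: "lab x = dec (cen M x)" if "x \<in> X - D" for x using that by (rule bspec)
    have cost: "?c * measure jn (D \<times> UNIV) \<le> d / 3"
    proof -
      have "?c * measure jn (D \<times> UNIV) \<le> ?c * \<delta>" using D(2) c by (intro mult_left_mono) auto
      also have "\<dots> = d / 3 * (?c / (?c + 1))" by (simp add: \<delta>_def)
      also have "\<dots> \<le> d / 3 * 1" using c d by (intro mult_left_mono) (auto simp: divide_le_eq)
      finally show ?thesis by simp
    qed
    let ?K = "4 * M * (\<integral>y. b y \<partial>\<nu>) + 2 * M * ln (card \<alpha>)"
    have "ent n / n \<le> meanZ n - ?IG + d + ?K / n" if n: "n > 0" for n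
    proof -
      have "n * (- ln (1 - \<eta>) + ?c * measure jn (D \<times> UNIV)) \<le> n * (2 * d / 3)"
        using le cost by (intro mult_left_mono) auto
      moreover have "n * (\<integral>y. e M y \<partial>\<nu>) \<le> n * (d / 3)" using M(1) by (intro mult_left_mono) auto
      ultimately have "ent n \<le> (\<integral>y. logZ n y \<partial>\<nu>) - n * ?IG + n * d + ?K"
        using ent_upper[OF eta D(1) dec, of n] osc_integral[of M n] by (simp add: algebra_simps)
      then have "ent n / n \<le> ((\<integral>y. logZ n y \<partial>\<nu>) - n * ?IG + n * d + ?K) / n" by (rule divide_right_mono) simp
      then show ?thesis using n by (simp add: add_divide_distrib diff_divide_distrib)
    qed
    then have "eventually (\<lambda>n. ent n / n \<le> meanZ n - ?IG + d + ?K / n) sequentially"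
      by (rule eventually_mono[OF eventually_gt_at_top[of 0]])
    moreover have "(\<lambda>n. meanZ n - ?IG + d + ?K / n) \<longlonglongrightarrow> pstar - ?IG + d + 0"
      by (intro tendsto_intros logZ_limit(1) inv)
    ultimately have "lim (\<lambda>n. ent n / n) \<le> pstar - ?IG + d + 0"
      by (intro tendsto_le[OF trivial_limit_sequentially _ lim]) auto
    then show "lim (\<lambda>n. ent n / n) \<le> pstar - ?IG + d" by simp
  qed
qed

end

section \<open>Empirical joinings\<close>

context sft
begin

definition CW :: "nat \<Rightarrow> 'a list set" where "CW m = cen m ` X"

definition Cyl :: "nat \<Rightarrow> 'a list \<Rightarrow> (int \<Rightarrow> 'a) set" where "Cyl m v = {x \<in> X. cen m x = v}"

lemma finite_CW [simp]: "finite (CW m)"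
  by (rule finite_subset[OF _ finite_words[of "2 * m + 1"]]) (auto simp: CW_def)

lemma cen_CW [simp]: "x \<in> X \<Longrightarrow> cen m x \<in> CW m" by (simp add: CW_def)

lemma Cyl_Alg: "Cyl m v \<in> Alg"
  unfolding Alg_def Cyl_def by (intro CollectI exI[of _ m] exI[of _ "{v}"]) auto

lemma Cyl_sets: "Cyl m v \<in> sets XM"
  by (rule Alg_sets[OF Cyl_Alg])

lemma Alg_image_CW: "A \<in> Alg \<Longrightarrow> cen m ` A \<subseteq> CW m"
  by (auto simp: Alg_def CW_def)

text \<open>Along the filter the numerical code of each letter converges, and convergent integers
  are eventually constant; this picks the letters of the cluster point.\<close>

lemma sequence_compact:
  fixes x :: "nat \<Rightarrow> int \<Rightarrow> 'a"
  shows "\<exists>z. \<forall>m i0. \<exists>i\<ge>i0. cen m (x i) = cen m z"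
proof -
  obtain \<F> :: "nat filter" where F: "\<F> \<noteq> bot" "\<F> \<le> sequentially" "\<And>a::nat \<Rightarrow> real. Bseq a \<Longrightarrow> \<exists>l. (a \<longlongrightarrow> l) \<F>"
    using bounded_sequences_converge_filter by blast
  have "\<exists>a. eventually (\<lambda>i. x i j = a) \<F>" for j
  proof -
    let ?g = "\<lambda>i. real (to_nat (x i j))"
    have "Bseq ?g"
    proof (rule BseqI'[of _ "real (Max (to_nat ` (UNIV :: 'a set)))"])
      show "norm (?g i) \<le> real (Max (to_nat ` (UNIV :: 'a set)))" for i by simp
    qed
    then obtain l where l: "(?g \<longlongrightarrow> l) \<F>" using F(3) by blast
    have ev: "eventually (\<lambda>i. \<bar>?g i - l\<bar> < 1 / 2) \<F>" using tendstoD[OF l, of "1/2"] by (simp add: dist_real_def)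
    then obtain i0 where i0: "\<bar>?g i0 - l\<bar> < 1 / 2" using eventually_happens'[OF F(1)] by blast
    have "eventually (\<lambda>i. x i j = x i0 j) \<F>" using ev
    proof eventually_elim
      case (elim i)
      then have "\<bar>?g i - ?g i0\<bar> < 1" using i0 by linarith
      then have "to_nat (x i j) = to_nat (x i0 j)" by linarith
      then show ?case by simp
    qed
    then show ?thesis by blast
  qed
  then obtain z where z: "\<And>j. eventually (\<lambda>i. x i j = z j) \<F>" by metis
  have "\<exists>i\<ge>i0. cen m (x i) = cen m z" for m i0
  proof -
    have "eventually (\<lambda>i. \<forall>j\<in>{- int m..int m}. x i j = z j) \<F>"
      by (rule eventually_ball_finite) (use z in auto)
    moreover have "eventually (\<lambda>i. i \<ge> i0) \<F>" using F(2) eventually_ge_at_top[of i0] by (rule filter_leD)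
    ultimately have "eventually (\<lambda>i. i \<ge> i0 \<and> cen m (x i) = cen m z) \<F>"
      by eventually_elim (auto simp: cen_eq_iff abs_le_iff)
    then show ?thesis using eventually_happens'[OF F(1)] by blast
  qed
  then show ?thesis by blast
qed

text \<open>Compactness of \<open>X\<close>: a cluster point of points chosen from the sets belongs
  to \<open>X\<close> by closedness and to every \<open>A i\<close>, since membership in a clopen
  set is read off a window.\<close>

lemma Alg_decseq_ne:
  assumes A: "range A \<subseteq> Alg" "decseq A" "\<And>i. A i \<noteq> {}"
  shows "(\<Inter>i. A i) \<noteq> {}"
proof -
  have "\<forall>i. \<exists>x. x \<in> A i" using A(3) by blast
  from choice[OF this] obtain x where x: "\<And>i. x i \<in> A i" by blast
  have AX: "A i \<subseteq> X" for i using A(1) unfolding Alg_def by blast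
  obtain z where z: "\<And>m i0. \<exists>i\<ge>i0. cen m (x i) = cen m z" using sequence_compact[of x] by blast
  have zX: "z \<in> X"
  proof (rule X_closed)
    fix n obtain i where "cen n (x i) = cen n z" using z[of 0 n] by blast
    then show "\<exists>y\<in>X. cen n y = cen n z" using x[of i] AX by blast
  qed
  have "z \<in> A i" for i
  proof -
    have "A i \<in> Alg" using A(1) by auto
    then obtain n Q where Q: "A i = X \<inter> cen n -` Q" unfolding Alg_def by blast
    obtain k where k: "k \<ge> i" "cen n (x k) = cen n z" using z[of i n] by blast
    have "x k \<in> A i" using x[of k] decseqD[OF A(2) k(1)] by blast
    then show ?thesis using Q k(2) zX by auto
  qed
  then show ?thesis by blast
qed

definition restr :: "nat \<Rightarrow> nat \<Rightarrow> 'a list \<Rightarrow> 'a list" where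
  "restr n m v = take (2 * n + 1) (drop (m - n) v)"

lemma restr_cen: "n \<le> m \<Longrightarrow> restr n m (cen m x) = cen n x"
  unfolding restr_def by (rule cen_coarsen[symmetric])

text \<open>Kolmogorov extension. The consistent weights define an additive function on the clopen
  sets, and by compactness a decreasing sequence of these with empty intersection is eventually
  empty, so continuity at the empty set is automatic.\<close>

lemma cylinder_measure_exists:
  fixes p :: "nat \<Rightarrow> 'a list \<Rightarrow> real"
  assumes p0: "\<And>m v. 0 \<le> p m v" and p1: "\<And>m. (\<Sum>v\<in>CW m. p m v) = 1"
    and cons: "\<And>m v. v \<in> CW m \<Longrightarrow> p m v = (\<Sum>u\<in>{u \<in> CW (Suc m). restr m (Suc m) u = v}. p (Suc m) u)"
  shows "\<exists>\<kappa>. prob_space \<kappa> \<and> sets \<kappa> = sets XM \<and> (\<forall>m. \<forall>v\<in>CW m. measure \<kappa> (Cyl m v) = p m v)"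
proof -
  define s where "s m A = (\<Sum>v\<in>cen m ` A. p m v)" for m and A :: "(int \<Rightarrow> 'a) set"
  have fA: "finite (cen m ` A)" if "A \<in> Alg" for m A using Alg_image_CW[OF that] by (rule finite_subset) simp
  have step: "s (Suc m) A = s m A" if A: "A \<in> Alg" and lev: "A = X \<inter> cen m -` (cen m ` A)" for m A
  proof -
    have eq: "cen (Suc m) ` A = (\<Union>v\<in>cen m ` A. {u \<in> CW (Suc m). restr m (Suc m) u = v})" (is "_ = ?U")
    proof
      show "cen (Suc m) ` A \<subseteq> ?U"
      proof (rule image_subsetI)
        fix a assume a: "a \<in> A"
        have "cen (Suc m) a \<in> CW (Suc m)" "restr m (Suc m) (cen (Suc m) a) = cen m a"
          using Alg_image_CW[OF A, of "Suc m"] a by (auto intro: restr_cen)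
        then show "cen (Suc m) a \<in> ?U" using a by blast
      qed
      show "?U \<subseteq> cen (Suc m) ` A"
      proof
        fix u assume "u \<in> ?U"
        then obtain x a where x: "x \<in> X" "u = cen (Suc m) x" "a \<in> A" "restr m (Suc m) u = cen m a" by (auto simp: CW_def)
        then have "cen m x = cen m a" by (simp add: restr_cen)
        then have "x \<in> A" using lev x by blast
        then show "u \<in> cen (Suc m) ` A" using x by blast
      qed
    qed
    have "s (Suc m) A = (\<Sum>v\<in>cen m ` A. \<Sum>u\<in>{u \<in> CW (Suc m). restr m (Suc m) u = v}. p (Suc m) u)"
      unfolding s_def eq by (rule sum.UNION_disjoint) (use fA[OF A] in auto)
    also have "\<dots> = s m A" unfolding s_def
      by (rule sum.cong[OF refl]) (use cons Alg_image_CW[OF A, of m] in auto)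
    finally show ?thesis .
  qed
  have stable: "\<exists>n. \<forall>m\<ge>n. s m A = s n A \<and> A = X \<inter> cen m -` (cen m ` A)" if A: "A \<in> Alg" for A
  proof -
    obtain n where n: "\<forall>m\<ge>n. A = X \<inter> cen m -` (cen m ` A)" using Alg_eq_level[OF A] by (rule exE)
    have "s m A = s n A" if "m \<ge> n" for m
      using that
    proof (induction m rule: dec_induct)
      case (step k)
      have "A = X \<inter> cen k -` (cen k ` A)" using n step(1) by simp
      then show ?case using step(3) \<open>\<And>m A. A \<in> Alg \<Longrightarrow> A = X \<inter> cen m -` (cen m ` A) \<Longrightarrow> s (Suc m) A = s m A\<close>[OF A] by simp
    qed simp
    then show ?thesis using n by blast
  qed
  \<comment> \<open>\<open>s m A\<close> is constant in \<open>m\<close> once \<open>A\<close> is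
    determined by windows of radius \<open>m\<close>; taking the limit avoids choosing a
    level.\<close>
  define f where "f A = lim (\<lambda>m. s m A)" for A
  have f_eq: "eventually (\<lambda>m. f A = s m A \<and> A = X \<inter> cen m -` (cen m ` A)) sequentially" if A: "A \<in> Alg" for A
  proof -
    obtain n where nn: "\<forall>m\<ge>n. s m A = s n A \<and> A = X \<inter> cen m -` (cen m ` A)" using stable[OF A] by (rule exE)
    have n: "s m A = s n A" "A = X \<inter> cen m -` (cen m ` A)" if "m \<ge> n" for m
      using conjunct1[OF nn[rule_format, OF that]] conjunct2[OF nn[rule_format, OF that]] by -
    have "(\<lambda>m. s m A) \<longlonglongrightarrow> s n A"
      by (rule tendsto_eventually) (rule eventually_mono[OF eventually_ge_at_top[of n]], rule n(1))
    then have "f A = s n A" unfolding f_def by (rule limI)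
    then have "f A = s m A \<and> A = X \<inter> cen m -` (cen m ` A)" if "m \<ge> n" for m
      by (intro conjI n(2)[OF that]) (simp only: n(1)[OF that])
    then show ?thesis by (rule eventually_mono[OF eventually_ge_at_top[of n]])
  qed
  have s0: "0 \<le> s m A" for m A unfolding s_def by (intro sum_nonneg p0)
  have f0: "0 \<le> f A" if "A \<in> Alg" for A
    using eventually_happens'[OF trivial_limit_sequentially f_eq[OF that]] s0 by auto
  have f_add: "f (A \<union> B) = f A + f B" if AB: "A \<in> Alg" "B \<in> Alg" "A \<inter> B = {}" "A \<union> B \<in> Alg" for A B
  proof -
    have "eventually (\<lambda>m. f (A \<union> B) = f A + f B) sequentially"
      using f_eq[OF AB(1)] f_eq[OF AB(2)] f_eq[OF AB(4)]
    proof eventually_elim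
      case (elim m)
      have "cen m ` A \<inter> cen m ` B = {}"
      proof (rule ccontr)
        assume "cen m ` A \<inter> cen m ` B \<noteq> {}"
        then obtain a c where ac: "a \<in> A" "c \<in> B" "cen m a = cen m c" by blast
        have "c \<in> X" using AB(2) ac(2) by (auto simp: Alg_def)
        moreover have "cen m c \<in> cen m ` A" unfolding ac(3)[symmetric] using ac(1) by (rule imageI)
        ultimately have "c \<in> X \<inter> cen m -` (cen m ` A)" by blast
        then have "c \<in> A" using elim(1) by blast
        then show False using ac AB(3) by blast
      qed
      then have "s m (A \<union> B) = s m A + s m B"
        unfolding s_def image_Un using fA[OF AB(1)] fA[OF AB(2)] by (intro sum.union_disjoint) auto
      then show ?case using elim by simp
    qed
    then show ?thesis using eventually_happens'[OF trivial_limit_sequentially] by blast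
  qed
  have f_empty: "f {} = 0" unfolding f_def s_def by simp
  interpret Al: algebra X Alg by (rule algebra_Alg)
  have "\<exists>\<mu> :: (int \<Rightarrow> 'a) set \<Rightarrow> ennreal. (\<forall>A \<in> Alg. \<mu> A = ennreal (f A)) \<and> measure_space X (sigma_sets X Alg) \<mu>"
  proof (rule Al.caratheodory_empty_continuous)
    show "positive Alg (\<lambda>A. ennreal (f A))" by (simp add: positive_def f_empty)
    show "additive Alg (\<lambda>A. ennreal (f A))" unfolding additive_def
      using f_add[OF _ _ _ Al.Un] f0 by (auto simp: ennreal_plus[symmetric] simp del: ennreal_plus)
    fix A :: "nat \<Rightarrow> (int \<Rightarrow> 'a) set"
    assume A: "range A \<subseteq> Alg" "decseq A" "(\<Inter>i. A i) = {}"
    then obtain i where i: "A i = {}" using Alg_decseq_ne[OF A(1,2)] by blast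
    have "A k = {}" if "k \<ge> i" for k using decseqD[OF A(2) that] i by blast
    then have "eventually (\<lambda>k. ennreal (f (A k)) = 0) sequentially"
      using f_empty by (intro eventually_mono[OF eventually_ge_at_top[of i]]) simp
    then show "(\<lambda>k. ennreal (f (A k))) \<longlonglongrightarrow> 0" by (rule tendsto_eventually)
  qed simp
  then obtain \<mu> where \<mu>: "\<forall>A\<in>Alg. \<mu> A = ennreal (f A)" "measure_space X (sigma_sets X Alg) \<mu>" by blast
  define \<kappa> where "\<kappa> = measure_of X (sigma_sets X Alg) \<mu>"
  have subset: "sigma_sets X Alg \<subseteq> Pow X" using sigma_sets_into_sp[of Alg X] Al.space_closed by blast
  have sets: "sets \<kappa> = sets XM"
    unfolding \<kappa>_def sets_XM_Alg using subset \<mu>(2) by (simp add: sets_measure_of sigma_algebra.sigma_sets_eq measure_space_def)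
  have space: "space \<kappa> = X" unfolding \<kappa>_def using subset by (rule space_measure_of)
  have em: "emeasure \<kappa> A = ennreal (f A)" if "A \<in> Alg" for A
  proof -
    have "emeasure \<kappa> A = \<mu> A"
      unfolding \<kappa>_def using \<mu>(2) that by (intro emeasure_measure_of_sigma) (auto simp: measure_space_def)
    then show ?thesis using \<mu>(1) that by simp
  qed
  have fX: "f X = 1"
  proof -
    have "s m X = 1" for m unfolding s_def using p1[of m] by (simp add: CW_def)
    then show ?thesis unfolding f_def by simp
  qed
  have "prob_space \<kappa>"
    by (rule prob_spaceI) (use em[OF Al.top] fX space in simp)
  moreover have "measure \<kappa> (Cyl m v) = p m v" if v: "v \<in> CW m" for m v
  proof -
    have "s k (Cyl m v) = p m v" if "k \<ge> m" for k
      using that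
    proof (induction k rule: dec_induct)
      case base
      have "cen m ` Cyl m v = {v}" using v by (auto simp: Cyl_def CW_def)
      then show ?case by (simp add: s_def)
    next
      case (step k)
      have "Cyl m v = X \<inter> cen k -` (cen k ` Cyl m v)"
      proof
        show "X \<inter> cen k -` (cen k ` Cyl m v) \<subseteq> Cyl m v"
        proof
          fix x assume "x \<in> X \<inter> cen k -` (cen k ` Cyl m v)"
          then obtain a where a: "a \<in> Cyl m v" "cen k x = cen k a" "x \<in> X" by blast
          have "cen m x = cen m a" using restr_cen[OF step(1), of x] restr_cen[OF step(1), of a] a(2) by simp
          then show "x \<in> Cyl m v" using a by (simp add: Cyl_def)
        qed
      qed (auto simp: Cyl_def)
      then show ?case using step(3) \<open>\<And>m A. A \<in> Alg \<Longrightarrow> A = X \<inter> cen m -` (cen m ` A) \<Longrightarrow> s (Suc m) A = s m A\<close>[OF Cyl_Alg] by simp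
    qed
    then have "eventually (\<lambda>k. s k (Cyl m v) = p m v) sequentially"
      by (rule eventually_mono[OF eventually_ge_at_top[of m]])
    then have "f (Cyl m v) = p m v" unfolding f_def by (intro limI tendsto_eventually)
    then show ?thesis using em[OF Cyl_Alg, of m v] p0 by (simp add: measure_def)
  qed
  ultimately show ?thesis using sets by blast
qed

lemma Alg_measure_sum:
  assumes "A \<in> Alg" "A = X \<inter> cen m -` (cen m ` A)" and k: "finite_measure \<kappa>" "sets \<kappa> = sets XM"
  shows "measure \<kappa> A = (\<Sum>v\<in>cen m ` A. measure \<kappa> (Cyl m v))"
proof -
  interpret finite_measure \<kappa> by (rule k(1))
  have fin: "finite (cen m ` A)" using Alg_image_CW[OF assms(1)] by (rule finite_subset) simp
  have "A = (\<Union>v\<in>cen m ` A. Cyl m v)"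
  proof
    show "(\<Union>v\<in>cen m ` A. Cyl m v) \<subseteq> A"
    proof
      fix x assume "x \<in> (\<Union>v\<in>cen m ` A. Cyl m v)"
      then have "x \<in> X \<inter> cen m -` (cen m ` A)" by (auto simp: Cyl_def)
      then show "x \<in> A" using assms(2) by blast
    qed
    show "A \<subseteq> (\<Union>v\<in>cen m ` A. Cyl m v)" using assms(1) by (auto simp: Cyl_def Alg_def)
  qed
  then have "measure \<kappa> A = measure \<kappa> (\<Union>v\<in>cen m ` A. Cyl m v)" by simp
  also have "\<dots> = (\<Sum>v\<in>cen m ` A. measure \<kappa> (Cyl m v))"
    by (rule finite_measure_finite_Union[OF fin]) (use Cyl_sets k(2) in \<open>auto simp: disjoint_family_on_def Cyl_def\<close>)
  finally show ?thesis .
qed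

lemma sets_pair_XM:
  fixes N :: "'y measure"
  shows "sets (XM \<Otimes>\<^sub>M N) = sigma_sets (X \<times> space N) {A \<times> B | A B. A \<in> Alg \<and> B \<in> sets N}"
    (is "_ = sigma_sets ?\<Omega> ?E")
proof
  have E: "?E \<subseteq> Pow ?\<Omega>"
    using algebra.axioms(1)[OF algebra_Alg] sets.sets_into_space by (auto simp: Alg_def)
  interpret S: sigma_algebra ?\<Omega> "sigma_sets ?\<Omega> ?E" by (rule sigma_algebra_sigma_sets[OF E])
  have rect: "A \<times> B \<in> sigma_sets ?\<Omega> ?E" if A: "A \<in> sets XM" and B: "B \<in> sets N" for A B
    using A[unfolded sets_XM_Alg]
  proof (induction rule: sigma_sets.induct)
    case (Basic a)
    then show ?case using B by (intro sigma_sets.Basic) blast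
  next
    case (Compl a)
    have "X \<in> Alg" using algebra.top[OF algebra_Alg] .
    then have "X \<times> B \<in> sigma_sets ?\<Omega> ?E" using B by (intro sigma_sets.Basic) blast
    then have "X \<times> B - a \<times> B \<in> sigma_sets ?\<Omega> ?E" using Compl by (intro S.Diff) auto
    moreover have "(X - a) \<times> B = X \<times> B - a \<times> B" by auto
    ultimately show ?case by simp
  next
    case (Union a)
    then have "(\<Union>i. a i \<times> B) \<in> sigma_sets ?\<Omega> ?E" by (intro S.countable_UN) auto
    moreover have "(\<Union>i. a i) \<times> B = (\<Union>i. a i \<times> B)" by auto
    ultimately show ?case by simp
  qed (simp add: sigma_sets.Empty)
  show "sets (XM \<Otimes>\<^sub>M N) \<subseteq> sigma_sets ?\<Omega> ?E"
    unfolding sets_pair_measure space_XM by (rule S.sigma_sets_subset) (use rect in auto)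
  show "sigma_sets ?\<Omega> ?E \<subseteq> sets (XM \<Otimes>\<^sub>M N)"
    using sets.sigma_sets_subset[of ?E "XM \<Otimes>\<^sub>M N"] Alg_sets by (auto simp: space_pair_measure)
qed

end

section \<open>Entropy of labelled finite weights\<close>

lemma sum_over_labels:
  fixes \<sigma> :: "'w \<Rightarrow> real"
  assumes "finite S"
  shows "(\<Sum>z\<in>Z ` S. (\<Sum>w\<in>{w \<in> S. Z w = z}. \<sigma> w) * g z) = (\<Sum>w\<in>S. \<sigma> w * g (Z w))"
proof -
  have "(\<Sum>z\<in>Z ` S. (\<Sum>w\<in>{w \<in> S. Z w = z}. \<sigma> w) * g z) = (\<Sum>z\<in>Z ` S. \<Sum>w\<in>{w \<in> S. Z w = z}. \<sigma> w * g (Z w))"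
    by (simp add: sum_distrib_right)
  also have "\<dots> = (\<Sum>w\<in>S. \<sigma> w * g (Z w))" by (rule sum.image_gen[OF assms, symmetric])
  finally show ?thesis .
qed

text \<open>Shannon entropy of the image of \<open>\<sigma>\<close> under \<open>Z\<close>, written
  as a mean over \<open>S\<close>: every \<open>w\<close> pays minus the logarithm of the mass of
  its class.\<close>

definition weight_entropy :: "('w \<Rightarrow> real) \<Rightarrow> 'w set \<Rightarrow> ('w \<Rightarrow> 'z) \<Rightarrow> real" where
  "weight_entropy \<sigma> S Z = (\<Sum>w\<in>S. \<sigma> w * - ln (\<Sum>w'\<in>{w' \<in> S. Z w' = Z w}. \<sigma> w'))"

lemma weight_entropy_le:
  assumes S: "finite S" and \<sigma>: "\<And>w. w \<in> S \<Longrightarrow> 0 < \<sigma> w" "sum \<sigma> S = 1"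
    and R: "\<And>z. z \<in> Z ` S \<Longrightarrow> 0 < R z" "sum R (Z ` S) \<le> 1"
  shows "weight_entropy \<sigma> S Z \<le> (\<Sum>w\<in>S. \<sigma> w * - ln (R (Z w)))"
proof -
  let ?p = "\<lambda>z. \<Sum>w\<in>{w \<in> S. Z w = z}. \<sigma> w"
  have "(\<Sum>z\<in>Z ` S. - ?p z * ln (?p z)) \<le> (\<Sum>z\<in>Z ` S. - ?p z * ln (R z))"
  proof (rule gibbs_inequality)
    show "0 \<le> ?p z" for z using \<sigma> by (intro sum_nonneg) (auto simp: less_imp_le)
    show "sum ?p (Z ` S) = 1" using sum.image_gen[OF S, of \<sigma> Z] \<sigma>(2) by simp
  qed (use S R in auto)
  moreover have "(\<Sum>z\<in>Z ` S. - ?p z * ln (?p z)) = weight_entropy \<sigma> S Z"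
    unfolding weight_entropy_def using sum_over_labels[OF S, where Z = Z and \<sigma> = \<sigma> and g = "\<lambda>z. - ln (?p z)"] by simp
  moreover have "(\<Sum>z\<in>Z ` S. - ?p z * ln (R z)) = (\<Sum>w\<in>S. \<sigma> w * - ln (R (Z w)))"
    using sum_over_labels[OF S, where Z = Z and \<sigma> = \<sigma> and g = "\<lambda>z. - ln (R z)"] by simp
  ultimately show ?thesis by simp
qed

context sft
begin

text \<open>Chain rule as an inequality: the word law is tested against the product of the true law
  of the first \<open>m\<close> letters and the weight \<open>Q\<close> of the remaining
  \<open>r\<close>.\<close>

lemma weight_entropy_pre_append:
  assumes S: "finite S" and \<sigma>: "\<And>w. w \<in> S \<Longrightarrow> 0 < \<sigma> w" "sum \<sigma> S = 1" and P: "\<And>w. w \<in> S \<Longrightarrow> P w \<in> X"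
    and Q: "\<And>v. v \<in> W r \<Longrightarrow> 0 < Q v" "sum Q (W r) \<le> 1"
  shows "weight_entropy \<sigma> S (\<lambda>w. pre (m + r) (P w)) \<le>
    weight_entropy \<sigma> S (\<lambda>w. pre m (P w)) + (\<Sum>w\<in>S. \<sigma> w * - ln (Q (pre r ((shift ^^ m) (P w)))))"
proof -
  let ?p = "\<lambda>u. \<Sum>w'\<in>{w' \<in> S. pre m (P w') = u}. \<sigma> w'"
  let ?R = "\<lambda>v. ?p (take m v) * Q (drop m v)"
  let ?Z = "\<lambda>w. pre (m + r) (P w)"
  have td: "take m (?Z w) = pre m (P w)" "drop m (?Z w) = pre r ((shift ^^ m) (P w))" for w
    by (simp_all add: pre_append funpow_shift)
  have ppos: "0 < ?p (pre m (P w))" if "w \<in> S" for w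
    using S \<sigma>(1) that by (intro sum_pos) auto
  have Qpos: "0 < Q (pre r ((shift ^^ m) (P w)))" if "w \<in> S" for w using P[OF that] by (intro Q) simp
  have "weight_entropy \<sigma> S ?Z \<le> (\<Sum>w\<in>S. \<sigma> w * - ln (?R (?Z w)))"
  proof (rule weight_entropy_le[OF S \<sigma>])
    fix z assume "z \<in> ?Z ` S"
    then show "0 < ?R z" using ppos Qpos by (auto simp: td intro!: mult_pos_pos)
  next
    have inj: "inj_on (\<lambda>v. (take m v, drop m v)) (?Z ` S)"
      by (rule inj_on_inverseI[where g = "\<lambda>(u, v). u @ v"]) simp
    have "sum ?R (?Z ` S) = (\<Sum>(u, v)\<in>(\<lambda>v. (take m v, drop m v)) ` ?Z ` S. ?p u * Q v)"
      by (subst sum.reindex[OF inj]) simp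
    also have "\<dots> \<le> (\<Sum>(u, v)\<in>(\<lambda>w. pre m (P w)) ` S \<times> W r. ?p u * Q v)"
    proof (rule sum_mono2)
      show "(\<lambda>v. (take m v, drop m v)) ` ?Z ` S \<subseteq> (\<lambda>w. pre m (P w)) ` S \<times> W r" using P by (auto simp: td)
      fix b assume "b \<in> (\<lambda>w. pre m (P w)) ` S \<times> W r - (\<lambda>v. (take m v, drop m v)) ` ?Z ` S"
      then show "0 \<le> (case b of (u, v) \<Rightarrow> ?p u * Q v)"
        using \<sigma>(1) Q(1) by (auto intro!: mult_nonneg_nonneg sum_nonneg simp: less_imp_le)
    qed (use S in simp)
    also have "\<dots> = (\<Sum>u\<in>(\<lambda>w. pre m (P w)) ` S. ?p u) * sum Q (W r)"
      unfolding sum_product sum.cartesian_product ..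
    also have "(\<Sum>u\<in>(\<lambda>w. pre m (P w)) ` S. ?p u) = 1"
      using sum.image_gen[OF S, of \<sigma> "\<lambda>w. pre m (P w)"] \<sigma>(2) by simp
    finally show "sum ?R (?Z ` S) \<le> 1" using Q(2) by simp
  qed
  also have "\<dots> = (\<Sum>w\<in>S. \<sigma> w * - ln (?p (pre m (P w))) + \<sigma> w * - ln (Q (pre r ((shift ^^ m) (P w)))))"
    using ppos Qpos by (intro sum.cong refl) (simp add: td ln_mult_pos algebra_simps)
  also have "\<dots> = weight_entropy \<sigma> S (\<lambda>w. pre m (P w)) + (\<Sum>w\<in>S. \<sigma> w * - ln (Q (pre r ((shift ^^ m) (P w)))))"
    by (simp add: sum_subtractf sum_negf weight_entropy_def)
  finally show ?thesis .
qed

text \<open>The block argument of Misiurewicz: running through all \<open>q\<close> phases lets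
  every position start one test block, so only the summed means of \<open>- ln Q\<close> remain. In
  each phase at most \<open>2 * q\<close> boundary letters cost \<open>ln (real CARD('a))\<close>
  each, which gives the factor \<open>2 * (real q)\<^sup>2\<close>.\<close>

lemma weight_entropy_blocks:
  assumes S: "finite S" and \<sigma>: "\<And>w. w \<in> S \<Longrightarrow> 0 < \<sigma> w" "sum \<sigma> S = 1" and P: "\<And>w. w \<in> S \<Longrightarrow> P w \<in> X"
    and q: "q > 0" and Q: "\<And>k v. v \<in> W q \<Longrightarrow> 0 < Q k v" "\<And>k. sum (Q k) (W q) \<le> 1"
  shows "q * weight_entropy \<sigma> S (\<lambda>w. pre n (P w)) \<le>
    (\<Sum>k<n. \<Sum>w\<in>S. \<sigma> w * - ln (Q k (pre q ((shift ^^ k) (P w))))) + 2 * (real q)\<^sup>2 * ln (real CARD('a))"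
proof -
  let ?\<phi> = "\<lambda>k. \<Sum>w\<in>S. \<sigma> w * - ln (Q k (pre q ((shift ^^ k) (P w))))"
  let ?u = "\<lambda>m. weight_entropy \<sigma> S (\<lambda>w. pre m (P w))"
  let ?l = "ln (real CARD('a))"
  have card: "1 \<le> real CARD('a)" using finite_UNIV_card_ge_0[where 'a = 'a] by simp
  have l0: "0 \<le> ?l" using card by simp
  have \<phi>0: "0 \<le> ?\<phi> k" for k
  proof (intro sum_nonneg mult_nonneg_nonneg)
    fix w assume w: "w \<in> S"
    show "0 \<le> \<sigma> w" using \<sigma>(1)[OF w] by simp
    let ?v = "pre q ((shift ^^ k) (P w))"
    have v: "?v \<in> W q" using P[OF w] by simp
    have "Q k ?v \<le> sum (Q k) (W q)" using v Q(1) by (intro member_le_sum) (auto simp: less_imp_le)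
    then have "Q k ?v \<le> 1" using Q(2)[of k] by linarith
    then show "0 \<le> - ln (Q k ?v)" using Q(1)[OF v] by simp
  qed
  have "q * ?u n \<le> (\<Sum>k<n - (q - 1). ?\<phi> k) + q * ((\<Sum>k<q. ?l) + (\<Sum>k=n-q..<n. ?l))"
  proof (rule block_sum_bound[OF q l0])
    have "{w' \<in> S. pre 0 (P w') = pre 0 (P w)} = S" for w by (auto simp: pre_def)
    then show "?u 0 \<le> 0" using \<sigma>(2) by (simp add: weight_entropy_def)
    fix m
    show "?u (m + q) \<le> ?u m + ?\<phi> m" by (rule weight_entropy_pre_append[OF S \<sigma> P Q(1) Q(2)])
    have "?u (m + 1) \<le> ?u m + (\<Sum>w\<in>S. \<sigma> w * - ln (1 / real CARD('a)))"
    proof (rule weight_entropy_pre_append[OF S \<sigma> P, where r = 1 and Q = "\<lambda>_. 1 / real CARD('a)"])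
      show "(\<Sum>v\<in>W 1. 1 / real CARD('a)) \<le> 1" using card_W[of 1] card by (simp add: divide_le_eq)
    qed (use card in auto)
    also have "(\<Sum>w\<in>S. \<sigma> w * - ln (1 / real CARD('a))) = ?l"
      unfolding sum_distrib_right[symmetric] \<sigma>(2) using card by (simp add: ln_div)
    finally show "?u (Suc m) \<le> ?u m + ?l" by simp
  qed
  also have "(\<Sum>k<n - (q - 1). ?\<phi> k) \<le> (\<Sum>k<n. ?\<phi> k)" by (rule sum_mono2) (use \<phi>0 in auto)
  also have "q * ((\<Sum>k<q. ?l) + (\<Sum>k=n-q..<n. ?l)) \<le> q * (q * ?l + q * ?l)"
  proof (intro mult_left_mono add_mono)
    have "(\<Sum>k=n-q..<n. ?l) = real (n - (n - q)) * ?l" by simp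
    also have "\<dots> \<le> q * ?l" using l0 by (intro mult_right_mono) auto
    finally show "(\<Sum>k=n-q..<n. ?l) \<le> q * ?l" .
  qed auto
  finally show ?thesis by (simp add: power2_eq_square algebra_simps)
qed

lemma weight_entropy_inj:
  assumes "finite S" "inj_on Z S"
  shows "weight_entropy \<sigma> S Z = (\<Sum>w\<in>S. \<sigma> w * - ln (\<sigma> w))"
  unfolding weight_entropy_def
proof (rule sum.cong[OF refl])
  fix w assume w: "w \<in> S"
  then have "{w' \<in> S. Z w' = Z w} = {w}" using assms(2) by (auto dest: inj_onD)
  then show "\<sigma> w * - ln (\<Sum>w'\<in>{w' \<in> S. Z w' = Z w}. \<sigma> w') = \<sigma> w * - ln (\<sigma> w)" by simp
qed

end


text \<open>Domination by the probability measure forces continuity at the empty set, hence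
  countable additivity, and also absolute continuity; Radon-Nikodym applies. This recovers a density
  from a limit functional that is a priori only finitely additive.\<close>

lemma (in prob_space) dominated_additive_density:
  fixes g :: "'a set \<Rightarrow> real"
  assumes g0: "\<And>B. B \<in> events \<Longrightarrow> 0 \<le> g B" and g_le: "\<And>B. B \<in> events \<Longrightarrow> g B \<le> prob B"
    and add: "\<And>B C. B \<in> events \<Longrightarrow> C \<in> events \<Longrightarrow> B \<inter> C = {} \<Longrightarrow> g (B \<union> C) = g B + g C"
  shows "\<exists>k\<in>borel_measurable M. (\<forall>x. 0 \<le> k x) \<and> (\<forall>B\<in>events. has_bochner_integral M (\<lambda>x. indicator B x * k x) (g B))"
proof -
  define N where "N = measure_of (space M) events (\<lambda>B. ennreal (g B))"
  have ge: "g {} = 0" using add[of "{}" "{}"] by simp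
  have ms: "measure_space (space M) events (\<lambda>B. ennreal (g B))"
    unfolding measure_space_def
  proof (intro conjI)
    show "sigma_algebra (space M) events" by (rule sets.sigma_algebra_axioms)
    show pos: "positive events (\<lambda>B. ennreal (g B))" by (simp add: positive_def ge)
    show "countably_additive events (\<lambda>B. ennreal (g B))"
    proof (rule sets.empty_continuous_imp_countably_additive[OF pos])
      show "additive events (\<lambda>B. ennreal (g B))" unfolding additive_def
        using add g0 by (auto simp: ennreal_plus[symmetric] simp del: ennreal_plus)
      fix A :: "nat \<Rightarrow> 'a set" assume A: "range A \<subseteq> events" "decseq A" "(\<Inter>i. A i) = {}"
      have "(\<lambda>i. prob (A i)) \<longlonglongrightarrow> prob (\<Inter>i. A i)" by (rule finite_Lim_measure_decseq) (use A in auto)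
      then have p0: "(\<lambda>i. prob (A i)) \<longlonglongrightarrow> 0" using A(3) by simp
      have "(\<lambda>i. g (A i)) \<longlonglongrightarrow> 0"
        by (rule tendsto_sandwich[OF _ _ tendsto_const p0]) (use g0 g_le A(1) in auto)
      then have "(\<lambda>i. ennreal (g (A i))) \<longlonglongrightarrow> ennreal 0" by (rule tendsto_ennrealI)
      then show "(\<lambda>i. ennreal (g (A i))) \<longlonglongrightarrow> 0" by simp
    qed simp
  qed
  have setsN: "sets N = events" unfolding N_def by (simp add: sets.space_closed)
  have emN: "emeasure N B = ennreal (g B)" if "B \<in> events" for B
    unfolding N_def using ms that by (intro emeasure_measure_of_sigma) (auto simp: measure_space_def)
  have "absolutely_continuous M N"
    unfolding absolutely_continuous_def
  proof
    fix B assume "B \<in> null_sets M"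
    then have B: "B \<in> events" "prob B = 0" by (auto simp: measure_def)
    then have "g B = 0" using g0[OF B(1)] g_le[OF B(1)] by simp
    then show "B \<in> null_sets N" using B emN by (intro null_setsI) (auto simp: setsN)
  qed
  then obtain f where f [measurable]: "f \<in> borel_measurable M" and dN: "density M f = N" using Radon_Nikodym setsN by blast
  have em: "(\<integral>\<^sup>+x. f x * indicator B x \<partial>M) = ennreal (g B)" if "B \<in> events" for B
    using emeasure_density[OF f that] emN[OF that] dN by simp
  have "(\<integral>\<^sup>+x. f x \<partial>M) = ennreal (g (space M))"
    using em[OF sets.top] nn_integral_cong[of M "\<lambda>x. f x * indicator (space M) x" f] by simp
  then have fin: "AE x in M. f x \<noteq> \<infinity>" by (intro nn_integral_PInf_AE) auto
  let ?k = "\<lambda>x. enn2real (f x)"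
  have "has_bochner_integral M (\<lambda>x. indicator B x * ?k x) (g B)" if B: "B \<in> events" for B
  proof (rule has_bochner_integral_nn_integral)
    have "(\<integral>\<^sup>+x. ennreal (indicator B x * ?k x) \<partial>M) = (\<integral>\<^sup>+x. f x * indicator B x \<partial>M)"
    proof (rule nn_integral_cong_AE)
      show "AE x in M. ennreal (indicator B x * ?k x) = f x * indicator B x"
        using fin by eventually_elim (auto simp: indicator_def less_top)
    qed
    then show "(\<integral>\<^sup>+x. ennreal (indicator B x * ?k x) \<partial>M) = ennreal (g B)" using em[OF B] by simp
    have [measurable]: "B \<in> events" by (rule B)
    show "(\<lambda>x. indicator B x * ?k x) \<in> borel_measurable M" by measurable
  qed (use g0[OF B] in \<open>auto intro!: AE_I2\<close>)
  then show ?thesis by (intro bexI[of _ ?k]) auto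
qed

lemma (in prob_space) AE_eq_of_set_integrals:
  fixes k k' :: "'a \<Rightarrow> real"
  assumes m: "k \<in> borel_measurable M" "k' \<in> borel_measurable M" and nn: "\<And>x. 0 \<le> k x" "\<And>x. 0 \<le> k' x"
    and i: "\<And>B. B \<in> events \<Longrightarrow> has_bochner_integral M (\<lambda>x. indicator B x * k x) (g B)"
    and i': "\<And>B. B \<in> events \<Longrightarrow> has_bochner_integral M (\<lambda>x. indicator B x * k' x) (g B)"
  shows "AE x in M. k x = k' x"
proof -
  have *: "emeasure (density M (\<lambda>x. ennreal (h x))) B = ennreal (g B)"
    if h: "h \<in> borel_measurable M" "\<And>x. 0 \<le> h x" and hi: "has_bochner_integral M (\<lambda>x. indicator B x * h x) (g B)" and B: "B \<in> events"
    for h :: "'a \<Rightarrow> real" and B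
  proof -
    have "emeasure (density M (\<lambda>x. ennreal (h x))) B = (\<integral>\<^sup>+x. ennreal (h x) * indicator B x \<partial>M)"
      using h B by (intro emeasure_density) auto
    also have "\<dots> = (\<integral>\<^sup>+x. ennreal (indicator B x * h x) \<partial>M)" by (rule nn_integral_cong) (auto simp: indicator_def)
    also have "\<dots> = ennreal (\<integral>x. indicator B x * h x \<partial>M)"
      using hi h by (intro nn_integral_eq_integral) (auto simp: has_bochner_integral_iff)
    also have "\<dots> = ennreal (g B)" using hi by (simp add: has_bochner_integral_iff)
    finally show ?thesis .
  qed
  have "density M (\<lambda>x. ennreal (k x)) = density M (\<lambda>x. ennreal (k' x))"
    by (rule measure_eqI) (use *[OF m(1) nn(1) i] *[OF m(2) nn(2) i'] in auto)
  then have "AE x in M. ennreal (k x) = ennreal (k' x)" using m by (subst (asm) density_unique_iff) auto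
  then show ?thesis by eventually_elim (use nn in simp)
qed

section \<open>Empirical averages of the Gibbs weights\<close>

context pressure_system
begin

definition sw :: "nat \<Rightarrow> 'y \<Rightarrow> 'a list \<Rightarrow> real" where
  "sw n y w = exp (Gn n (rep w) y - logZ n y)"

text \<open>The empirical measure over \<open>y\<close>: words are drawn with the normalised Gibbs
  weights \<open>sw\<close>, and their representatives are averaged over the first \<open>n\<close>
  times. \<open>Lam\<close> integrates over the base, and \<open>adm\<close> describes the
  integrands for which everything is finite.\<close>

definition emp :: "nat \<Rightarrow> ((int \<Rightarrow> 'a) \<Rightarrow> 'y \<Rightarrow> real) \<Rightarrow> 'y \<Rightarrow> real" where
  "emp n h y = (\<Sum>k<n. \<Sum>w\<in>W n. sw n y w * h ((shift ^^ k) (rep w)) ((T ^^ k) y)) / n"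

definition Lam :: "nat \<Rightarrow> ((int \<Rightarrow> 'a) \<Rightarrow> 'y \<Rightarrow> real) \<Rightarrow> real" where
  "Lam n h = (\<integral>y. emp n h y \<partial>\<nu>)"

definition adm :: "((int \<Rightarrow> 'a) \<Rightarrow> 'y \<Rightarrow> real) \<Rightarrow> ('y \<Rightarrow> real) \<Rightarrow> bool" where
  "adm h u \<longleftrightarrow> (\<forall>x\<in>X. h x \<in> borel_measurable \<nu>) \<and> (\<forall>x\<in>X. \<forall>y. \<bar>h x y\<bar> \<le> u y) \<and> integrable \<nu> u"

lemma sw_pos [simp]: "0 < sw n y w" by (simp add: sw_def)

lemma sw_sum: "(\<Sum>w\<in>W n. sw n y w) = 1"
  using less_imp_neq[OF sum_exp_pos[where n = n and h = "\<lambda>w. Gn n (rep w) y"], symmetric]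
  by (simp add: sw_def exp_diff sum_divide_distrib[symmetric] logZ_def)

lemma sw_measurable: "w \<in> W n \<Longrightarrow> (\<lambda>y. sw n y w) \<in> borel_measurable \<nu>"
  unfolding sw_def using Gn_measurable[OF rep(1)] by measurable

lemma sw_average_le: "(\<And>w. w \<in> W n \<Longrightarrow> g w \<le> c) \<Longrightarrow> (\<Sum>w\<in>W n. sw n y w * g w) \<le> c"
proof -
  assume g: "\<And>w. w \<in> W n \<Longrightarrow> g w \<le> c"
  have "(\<Sum>w\<in>W n. sw n y w * g w) \<le> (\<Sum>w\<in>W n. sw n y w * c)" by (intro sum_mono mult_left_mono g) (auto simp: less_imp_le)
  then show ?thesis by (simp add: sum_distrib_right[symmetric] sw_sum)
qed

lemma sw_average_abs: "(\<And>w. w \<in> W n \<Longrightarrow> \<bar>g w\<bar> \<le> c) \<Longrightarrow> \<bar>\<Sum>w\<in>W n. sw n y w * g w\<bar> \<le> c"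
proof -
  assume g: "\<And>w. w \<in> W n \<Longrightarrow> \<bar>g w\<bar> \<le> c"
  have "(\<Sum>w\<in>W n. sw n y w * g w) \<le> c" by (rule sw_average_le) (use g in \<open>simp add: abs_le_iff\<close>)
  moreover have "(\<Sum>w\<in>W n. sw n y w * - g w) \<le> c" by (rule sw_average_le) (use g in \<open>simp add: abs_le_iff\<close>)
  ultimately show ?thesis by (simp add: sum_negf abs_le_iff)
qed

lemma row_measurable:
  assumes "adm h u"
  shows "(\<lambda>y. \<Sum>w\<in>W n. sw n y w * h ((shift ^^ k) (rep w)) ((T ^^ k) y)) \<in> borel_measurable \<nu>"
proof (intro borel_measurable_sum borel_measurable_times sw_measurable)
  fix w assume w: "w \<in> W n"
  have "h ((shift ^^ k) (rep w)) \<in> borel_measurable \<nu>" using assms rep(1)[OF w] by (simp add: adm_def)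
  from measurable_compose[OF funpow_measurable this]
  show "(\<lambda>y. h ((shift ^^ k) (rep w)) ((T ^^ k) y)) \<in> borel_measurable \<nu>" .
qed

lemma row_bound:
  assumes "adm h u"
  shows "\<bar>\<Sum>w\<in>W n. sw n y w * h ((shift ^^ k) (rep w)) ((T ^^ k) y)\<bar> \<le> u ((T ^^ k) y)"
  by (rule sw_average_abs) (use assms rep in \<open>simp add: adm_def\<close>)

lemma row_integrable:
  assumes "adm h u"
  shows "integrable \<nu> (\<lambda>y. \<Sum>w\<in>W n. sw n y w * h ((shift ^^ k) (rep w)) ((T ^^ k) y))"
proof (rule Bochner_Integration.integrable_bound)
  show "integrable \<nu> (\<lambda>y. u ((T ^^ k) y))" using assms by (intro integrable_funpow) (simp add: adm_def)
qed (use row_measurable[OF assms] row_bound[OF assms] in \<open>auto intro!: AE_I2 intro: order_trans[OF _ abs_ge_self]\<close>)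

lemma emp_integrable: "adm h u \<Longrightarrow> integrable \<nu> (emp n h)"
  unfolding emp_def by (intro Bochner_Integration.integrable_divide Bochner_Integration.integrable_sum row_integrable)

lemma adm_nonneg: "adm h u \<Longrightarrow> 0 \<le> u y"
  using X_ne by (auto simp: adm_def intro: order_trans[OF abs_ge_zero])

lemma Lam_row: "adm h u \<Longrightarrow> Lam n h = (\<Sum>k<n. \<integral>y. (\<Sum>w\<in>W n. sw n y w * h ((shift ^^ k) (rep w)) ((T ^^ k) y)) \<partial>\<nu>) / n"
  unfolding Lam_def emp_def using row_integrable by (simp add: Bochner_Integration.integral_sum)

lemma row_integral_bound:
  assumes "adm h u"
  shows "\<bar>\<integral>y. (\<Sum>w\<in>W n. sw n y w * h ((shift ^^ k) (rep w)) ((T ^^ k) y)) \<partial>\<nu>\<bar> \<le> (\<integral>y. u y \<partial>\<nu>)"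
proof -
  have u: "integrable \<nu> u" using assms by (simp add: adm_def)
  have "\<bar>\<integral>y. (\<Sum>w\<in>W n. sw n y w * h ((shift ^^ k) (rep w)) ((T ^^ k) y)) \<partial>\<nu>\<bar> \<le>
     (\<integral>y. \<bar>\<Sum>w\<in>W n. sw n y w * h ((shift ^^ k) (rep w)) ((T ^^ k) y)\<bar> \<partial>\<nu>)" by (rule integral_abs_bound)
  also have "\<dots> \<le> (\<integral>y. u ((T ^^ k) y) \<partial>\<nu>)"
    by (rule integral_mono) (use row_integrable[OF assms] row_bound[OF assms] u in auto)
  also have "\<dots> = (\<integral>y. u y \<partial>\<nu>)" using u by (intro integral_funpow) auto
  finally show ?thesis .
qed

lemma Lam_bound: "adm h u \<Longrightarrow> \<bar>Lam n h\<bar> \<le> (\<integral>y. u y \<partial>\<nu>)"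
proof -
  assume h: "adm h u"
  let ?r = "\<lambda>k. \<integral>y. (\<Sum>w\<in>W n. sw n y w * h ((shift ^^ k) (rep w)) ((T ^^ k) y)) \<partial>\<nu>"
  have u0: "0 \<le> (\<integral>y. u y \<partial>\<nu>)" using adm_nonneg[OF h] by simp
  have "\<bar>\<Sum>k<n. ?r k\<bar> \<le> (\<Sum>k<n. \<bar>?r k\<bar>)" by (rule sum_abs)
  also have "\<dots> \<le> (\<Sum>k<n. \<integral>y. u y \<partial>\<nu>)" by (intro sum_mono row_integral_bound[OF h])
  also have "\<dots> = n * (\<integral>y. u y \<partial>\<nu>)" by simp
  finally have "\<bar>\<Sum>k<n. ?r k\<bar> \<le> n * (\<integral>y. u y \<partial>\<nu>)" .
  then show ?thesis unfolding Lam_row[OF h] using u0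
    by (cases "n = 0") (auto simp: abs_divide divide_le_eq mult.commute)
qed

lemma adm_sum:
  assumes "finite I" "\<And>i. i \<in> I \<Longrightarrow> adm (h i) (u i)"
  shows "adm (\<lambda>x y. \<Sum>i\<in>I. h i x y) (\<lambda>y. \<Sum>i\<in>I. u i y)"
  using assms unfolding adm_def
  by (auto intro!: borel_measurable_sum Bochner_Integration.integrable_sum order_trans[OF sum_abs] sum_mono)

lemma adm_diff: "adm h u \<Longrightarrow> adm h' u' \<Longrightarrow> adm (\<lambda>x y. h x y - h' x y) (\<lambda>y. u y + u' y)"
  unfolding adm_def by (auto intro!: order_trans[OF abs_triangle_ineq4] add_mono borel_measurable_diff)

lemma adm_cmult: "adm h u \<Longrightarrow> adm (\<lambda>x y. c * h x y) (\<lambda>y. \<bar>c\<bar> * u y)"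
  unfolding adm_def by (auto simp: abs_mult intro!: mult_left_mono)

lemma Lam_sum:
  assumes "finite I" "\<And>i. i \<in> I \<Longrightarrow> adm (h i) (u i)"
  shows "Lam n (\<lambda>x y. \<Sum>i\<in>I. h i x y) = (\<Sum>i\<in>I. Lam n (h i))"
proof -
  have "emp n (\<lambda>x y. \<Sum>i\<in>I. h i x y) = (\<lambda>y. \<Sum>i\<in>I. emp n (h i) y)"
  proof
    fix y
    have "(\<Sum>k<n. \<Sum>w\<in>W n. sw n y w * (\<Sum>i\<in>I. h i ((shift ^^ k) (rep w)) ((T ^^ k) y))) =
      (\<Sum>k<n. \<Sum>i\<in>I. \<Sum>w\<in>W n. sw n y w * h i ((shift ^^ k) (rep w)) ((T ^^ k) y))"
      by (subst sum.swap) (simp add: sum_distrib_left)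
    also have "\<dots> = (\<Sum>i\<in>I. \<Sum>k<n. \<Sum>w\<in>W n. sw n y w * h i ((shift ^^ k) (rep w)) ((T ^^ k) y))" by (rule sum.swap)
    finally show "emp n (\<lambda>x y. \<Sum>i\<in>I. h i x y) y = (\<Sum>i\<in>I. emp n (h i) y)" by (simp add: emp_def sum_divide_distrib)
  qed
  then show ?thesis unfolding Lam_def
    using emp_integrable[OF assms(2)] by (simp add: Bochner_Integration.integral_sum)
qed

lemma Lam_diff: "adm h u \<Longrightarrow> adm h' u' \<Longrightarrow> Lam n (\<lambda>x y. h x y - h' x y) = Lam n h - Lam n h'"
proof -
  assume a: "adm h u" "adm h' u'"
  have "emp n (\<lambda>x y. h x y - h' x y) = (\<lambda>y. emp n h y - emp n h' y)"
    by (rule ext) (simp add: emp_def diff_divide_distrib[symmetric] sum_subtractf[symmetric] right_diff_distrib)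
  then show ?thesis unfolding Lam_def using emp_integrable[OF a(1), of n] emp_integrable[OF a(2), of n] by simp
qed

lemma Lam_cmult: "Lam n (\<lambda>x y. c * h x y) = c * Lam n h"
proof -
  have "emp n (\<lambda>x y. c * h x y) y = c * emp n h y" for y
    by (simp add: emp_def sum_distrib_left mult_ac)
  then show ?thesis by (simp add: Lam_def)
qed

lemma Lam_mono:
  assumes "adm h u" "adm h' u'" "\<And>x y. x \<in> X \<Longrightarrow> h x y \<le> h' x y"
  shows "Lam n h \<le> Lam n h'"
  unfolding Lam_def
proof (rule integral_mono[OF emp_integrable[OF assms(1)] emp_integrable[OF assms(2)]])
  fix y show "emp n h y \<le> emp n h' y"
    unfolding emp_def using assms(3) rep
    by (intro divide_right_mono sum_mono mult_left_mono) (auto simp: less_imp_le)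
qed

lemma Lam_cong:
  assumes "\<And>x y. x \<in> X \<Longrightarrow> h x y = h' x y"
  shows "Lam n h = Lam n h'"
proof -
  have "emp n h = emp n h'"
    unfolding emp_def using assms rep by (intro ext arg_cong[where f = "\<lambda>s. s / real n"] sum.cong refl) auto
  then show ?thesis by (simp add: Lam_def)
qed

lemma Lam_snd:
  assumes u: "integrable \<nu> u" and n: "n > 0"
  shows "Lam n (\<lambda>x y. u y) = (\<integral>y. u y \<partial>\<nu>)"
proof -
  have a: "adm (\<lambda>x y. u y) (\<lambda>y. \<bar>u y\<bar>)" using u by (simp add: adm_def)
  have "(\<Sum>w\<in>W n. sw n y w * u ((T ^^ k) y)) = u ((T ^^ k) y)" for k y
    by (simp add: sum_distrib_right[symmetric] sw_sum)
  then show ?thesis unfolding Lam_row[OF a] using u n by (simp add: integral_funpow borel_measurable_integrable)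
qed

lemma adm_shift: "adm h u \<Longrightarrow> adm (\<lambda>x y. h (shift x) (T y)) (\<lambda>y. u (T y))"
  unfolding adm_def using integrable_funpow[of u 1] by (auto intro: measurable_compose[OF T_measurable])

text \<open>Shifting turns row \<open>k\<close> into row \<open>Suc k\<close>, so the difference
  telescopes to just two rows.\<close>

lemma Lam_shift:
  assumes h: "adm h u"
  shows "\<bar>Lam n (\<lambda>x y. h (shift x) (T y)) - Lam n h\<bar> \<le> 2 * (\<integral>y. u y \<partial>\<nu>) / n"
proof -
  define r where "r k = (\<integral>y. (\<Sum>w\<in>W n. sw n y w * h ((shift ^^ k) (rep w)) ((T ^^ k) y)) \<partial>\<nu>)" for k
  have rb: "\<bar>r k\<bar> \<le> (\<integral>y. u y \<partial>\<nu>)" for k unfolding r_def by (rule row_integral_bound[OF h])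
  have "Lam n (\<lambda>x y. h (shift x) (T y)) = (\<Sum>k<n. r (Suc k)) / n"
    unfolding Lam_row[OF adm_shift[OF h]] r_def by simp
  then have "Lam n (\<lambda>x y. h (shift x) (T y)) - Lam n h = (\<Sum>k<n. r (Suc k) - r k) / n"
    unfolding Lam_row[OF h] r_def[symmetric] by (simp add: diff_divide_distrib sum_subtractf)
  also have "\<dots> = (r n - r 0) / n" by (simp only: sum_lessThan_telescope)
  finally have eq: "Lam n (\<lambda>x y. h (shift x) (T y)) - Lam n h = (r n - r 0) / n" .
  have "\<bar>r n - r 0\<bar> \<le> 2 * (\<integral>y. u y \<partial>\<nu>)" using rb[of n] rb[of 0] by linarith
  then have "\<bar>r n - r 0\<bar> / n \<le> 2 * (\<integral>y. u y \<partial>\<nu>) / n" by (rule divide_right_mono) simp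
  then show ?thesis unfolding eq abs_divide by simp
qed

text \<open>The pressure is the entropy of the empirical Gibbs weights plus their mean energy; the entropy is
  tested against products of the conditional weights \<open>Q\<close> over blocks of length \<open>q\<close>.\<close>

lemma meanZ_upper:
  assumes n: "n > 0" and q: "q > 0"
    and Q: "\<And>v y. v \<in> W q \<Longrightarrow> 0 < Q v y" "\<And>y. (\<Sum>v\<in>W q. Q v y) \<le> 1"
    and aQ: "adm (\<lambda>x y. - ln (Q (pre q x) y)) u"
    and aG: "adm G' u'" "\<And>x y. x \<in> X \<Longrightarrow> G x y \<le> G' x y + e M y"
  shows "q * meanZ n \<le> Lam n (\<lambda>x y. - ln (Q (pre q x) y)) + q * (Lam n G' + (\<integral>y. e M y \<partial>\<nu>)) + 2 * (real q)\<^sup>2 * ln (real CARD('a)) / n"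
proof -
  let ?l = "ln (real CARD('a))"
  let ?HQ = "\<lambda>x y. - ln (Q (pre q x) y)"
  have pt: "q * logZ n y \<le> n * emp n ?HQ y + q * (n * emp n G' y + birkhoff_sum T (e M) n y) + 2 * (real q)\<^sup>2 * ?l" for y
  proof -
    have lnsw: "- ln (sw n y w) = logZ n y - Gn n (rep w) y" for w by (simp add: sw_def)
    have "inj_on (\<lambda>w. pre n (rep w)) (W n)" by (rule inj_onI) (simp add: rep)
    then have "weight_entropy (sw n y) (W n) (\<lambda>w. pre n (rep w)) = (\<Sum>w\<in>W n. sw n y w * - ln (sw n y w))"
      by (rule weight_entropy_inj[OF finite_W])
    also have "\<dots> = logZ n y - (\<Sum>w\<in>W n. sw n y w * Gn n (rep w) y)"
      unfolding lnsw by (simp add: right_diff_distrib sum_subtractf sum_distrib_right[symmetric] sw_sum)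
    finally have WE: "logZ n y = weight_entropy (sw n y) (W n) (\<lambda>w. pre n (rep w)) + (\<Sum>w\<in>W n. sw n y w * Gn n (rep w) y)"
      by simp
    have "q * weight_entropy (sw n y) (W n) (\<lambda>w. pre n (rep w)) \<le>
      (\<Sum>k<n. \<Sum>w\<in>W n. sw n y w * - ln (Q (pre q ((shift ^^ k) (rep w))) ((T ^^ k) y))) + 2 * (real q)\<^sup>2 * ?l"
      by (rule weight_entropy_blocks[where Q = "\<lambda>k v. Q v ((T ^^ k) y)"]) (use q Q rep sw_sum in auto)
    also have "(\<Sum>k<n. \<Sum>w\<in>W n. sw n y w * - ln (Q (pre q ((shift ^^ k) (rep w))) ((T ^^ k) y))) = n * emp n ?HQ y"
      using n by (simp add: emp_def)
    finally have 1: "q * weight_entropy (sw n y) (W n) (\<lambda>w. pre n (rep w)) \<le> n * emp n ?HQ y + 2 * (real q)\<^sup>2 * ?l" .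
    have "(\<Sum>w\<in>W n. sw n y w * Gn n (rep w) y) \<le>
        (\<Sum>w\<in>W n. sw n y w * (\<Sum>k<n. G' ((shift ^^ k) (rep w)) ((T ^^ k) y) + e M ((T ^^ k) y)))"
      unfolding Gn_def using rep aG(2) by (intro sum_mono mult_left_mono) (auto simp: less_imp_le)
    also have "\<dots> = (\<Sum>w\<in>W n. \<Sum>k<n. sw n y w * G' ((shift ^^ k) (rep w)) ((T ^^ k) y)) +
        (\<Sum>w\<in>W n. sw n y w * birkhoff_sum T (e M) n y)"
      by (simp add: sum.distrib distrib_left sum_distrib_left birkhoff_sum_def)
    also have "(\<Sum>w\<in>W n. \<Sum>k<n. sw n y w * G' ((shift ^^ k) (rep w)) ((T ^^ k) y)) = n * emp n G' y"
      using n by (subst sum.swap) (simp add: emp_def)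
    also have "(\<Sum>w\<in>W n. sw n y w * birkhoff_sum T (e M) n y) = birkhoff_sum T (e M) n y"
      by (simp add: sum_distrib_right[symmetric] sw_sum)
    finally have "(\<Sum>w\<in>W n. sw n y w * Gn n (rep w) y) \<le> n * emp n G' y + birkhoff_sum T (e M) n y" .
    then have "q * (\<Sum>w\<in>W n. sw n y w * Gn n (rep w) y) \<le> q * (n * emp n G' y + birkhoff_sum T (e M) n y)"
      by (intro mult_left_mono) auto
    then show ?thesis using 1 unfolding WE by (subst distrib_left) linarith
  qed
  have iQ: "integrable \<nu> (emp n ?HQ)" by (rule emp_integrable[OF aQ])
  have iG: "integrable \<nu> (emp n G')" by (rule emp_integrable[OF aG(1)])
  have "(\<integral>y. q * logZ n y \<partial>\<nu>) \<le> (\<integral>y. n * emp n ?HQ y + q * (n * emp n G' y + birkhoff_sum T (e M) n y) + 2 * (real q)\<^sup>2 * ?l \<partial>\<nu>)"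
    by (rule integral_mono) (use logZ_integrable iQ iG e_int pt in auto)
  also have "\<dots> = n * Lam n ?HQ + q * (n * Lam n G' + n * (\<integral>y. e M y \<partial>\<nu>)) + 2 * (real q)\<^sup>2 * ?l"
  proof -
    have "prob UNIV = 1" using prob_space by simp
    then show ?thesis using iQ iG e_int[of M] by (simp add: Lam_def integral_birkhoff_sum integrable_birkhoff_sum)
  qed
  finally have "q * (\<integral>y. logZ n y \<partial>\<nu>) \<le> n * Lam n ?HQ + q * (n * Lam n G' + n * (\<integral>y. e M y \<partial>\<nu>)) + 2 * (real q)\<^sup>2 * ?l"
    using logZ_integrable by simp
  then have "q * (\<integral>y. logZ n y \<partial>\<nu>) / n \<le> (n * Lam n ?HQ + q * (n * Lam n G' + n * (\<integral>y. e M y \<partial>\<nu>)) + 2 * (real q)\<^sup>2 * ?l) / n"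
    by (rule divide_right_mono) simp
  also have "\<dots> = Lam n ?HQ + q * (Lam n G' + (\<integral>y. e M y \<partial>\<nu>)) + 2 * (real q)\<^sup>2 * ?l / n"
    using n by (simp add: add_divide_distrib distrib_left)
  finally show ?thesis by simp
qed

end

section \<open>The fiber variational principle\<close>

lemma (in sft) Alg_shift:
  assumes "A \<in> Alg" shows "shift -` A \<inter> X \<in> Alg"
proof -
  obtain n Q where A: "A = X \<inter> cen n -` Q" using assms unfolding Alg_def by blast
  have "cen n (shift x) = take (2 * n + 1) (drop 2 (cen (n + 1) x))" for x
    unfolding cen_def shift_eq_shZ by (subst take_drop_pre) auto
  then have "shift -` A \<inter> X = X \<inter> cen (n + 1) -` {w. take (2 * n + 1) (drop 2 w) \<in> Q}"
    unfolding A by auto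
  then show ?thesis unfolding Alg_def by blast
qed

context pressure_system
begin

context
  fixes \<F> :: "nat filter"
  assumes F: "\<F> \<noteq> bot" "\<F> \<le> sequentially" "\<forall>a::nat \<Rightarrow> real. Bseq a \<longrightarrow> (\<exists>l. (a \<longlongrightarrow> l) \<F>)"
begin

text \<open>The limit functional: positive, invariant and with marginal \<nu>, but not known to be a
  measure until the kernel is built.\<close>

definition Phi :: "((int \<Rightarrow> 'a) \<Rightarrow> 'y \<Rightarrow> real) \<Rightarrow> real" where
  "Phi h = Lim \<F> (\<lambda>n. Lam n h)"

lemma Phi_tendsto:
  assumes "adm h u" shows "((\<lambda>n. Lam n h) \<longlongrightarrow> Phi h) \<F>"
proof -
  have "Bseq (\<lambda>n. Lam n h)" by (rule BseqI'[where K = "\<integral>y. u y \<partial>\<nu>"]) (use Lam_bound[OF assms] in simp)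
  then obtain l where "((\<lambda>n. Lam n h) \<longlongrightarrow> l) \<F>" using F(3) by blast
  then show ?thesis unfolding Phi_def using tendsto_Lim[OF F(1)] by metis
qed

lemma seq_tendsto: "a \<longlonglongrightarrow> l \<Longrightarrow> (a \<longlongrightarrow> (l::real)) \<F>"
  by (rule tendsto_mono[OF F(2)])

lemma Phi_eqI: "adm h u \<Longrightarrow> ((\<lambda>n. Lam n h) \<longlongrightarrow> l) \<F> \<Longrightarrow> Phi h = l"
  using tendsto_unique[OF F(1) Phi_tendsto] by blast

lemma Phi_sum:
  assumes "finite I" "\<And>i. i \<in> I \<Longrightarrow> adm (h i) (u i)"
  shows "Phi (\<lambda>x y. \<Sum>i\<in>I. h i x y) = (\<Sum>i\<in>I. Phi (h i))"
proof (rule Phi_eqI[OF adm_sum[OF assms]])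
  have "((\<lambda>n. \<Sum>i\<in>I. Lam n (h i)) \<longlongrightarrow> (\<Sum>i\<in>I. Phi (h i))) \<F>"
    by (intro tendsto_sum Phi_tendsto[OF assms(2)])
  moreover have "Lam n (\<lambda>x y. \<Sum>i\<in>I. h i x y) = (\<Sum>i\<in>I. Lam n (h i))" for n by (rule Lam_sum[OF assms])
  ultimately show "((\<lambda>n. Lam n (\<lambda>x y. \<Sum>i\<in>I. h i x y)) \<longlongrightarrow> (\<Sum>i\<in>I. Phi (h i))) \<F>" by simp
qed

lemma Phi_diff:
  assumes "adm h u" "adm h' u'"
  shows "Phi (\<lambda>x y. h x y - h' x y) = Phi h - Phi h'"
  by (rule Phi_eqI[OF adm_diff[OF assms]]) (simp add: Lam_diff[OF assms] tendsto_diff Phi_tendsto[OF assms(1)] Phi_tendsto[OF assms(2)])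

lemma Phi_cmult: "adm h u \<Longrightarrow> Phi (\<lambda>x y. c * h x y) = c * Phi h"
  by (rule Phi_eqI[OF adm_cmult]) (auto simp: Lam_cmult intro!: tendsto_mult Phi_tendsto)

lemma Phi_mono:
  assumes "adm h u" "adm h' u'" "\<And>x y. x \<in> X \<Longrightarrow> h x y \<le> h' x y"
  shows "Phi h \<le> Phi h'"
  using tendsto_le[OF F(1) Phi_tendsto[OF assms(2)] Phi_tendsto[OF assms(1)]] Lam_mono[OF assms] by simp

lemma Phi_cong: "(\<And>x y. x \<in> X \<Longrightarrow> h x y = h' x y) \<Longrightarrow> Phi h = Phi h'"
  unfolding Phi_def using Lam_cong[of h h'] by simp

lemma Phi_bound: "adm h u \<Longrightarrow> \<bar>Phi h\<bar> \<le> (\<integral>y. u y \<partial>\<nu>)"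
  by (rule tendsto_upperbound[OF tendsto_rabs[OF Phi_tendsto] always_eventually F(1)]) (auto simp: Lam_bound)

lemma Phi_snd:
  assumes u: "integrable \<nu> u" shows "Phi (\<lambda>x y. u y) = (\<integral>y. u y \<partial>\<nu>)"
proof (rule Phi_eqI)
  show "adm (\<lambda>x y. u y) (\<lambda>y. \<bar>u y\<bar>)" using u by (simp add: adm_def)
  show "((\<lambda>n. Lam n (\<lambda>x y. u y)) \<longlongrightarrow> (\<integral>y. u y \<partial>\<nu>)) \<F>"
    by (intro seq_tendsto tendsto_eventually eventually_mono[OF eventually_gt_at_top[of 0]] Lam_snd[OF u])
qed

lemma Phi_shift:
  assumes h: "adm h u" shows "Phi (\<lambda>x y. h (shift x) (T y)) = Phi h"
proof -
  have "(\<lambda>n. 2 * (\<integral>y. u y \<partial>\<nu>) / real n) \<longlonglongrightarrow> 0"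
    by (intro tendsto_divide_0[OF tendsto_const] filterlim_at_top_imp_at_infinity filterlim_real_sequentially)
  then have l0: "((\<lambda>n. 2 * (\<integral>y. u y \<partial>\<nu>) / real n) \<longlongrightarrow> 0) \<F>" by (rule seq_tendsto)
  have "((\<lambda>n. \<bar>Lam n (\<lambda>x y. h (shift x) (T y)) - Lam n h\<bar>) \<longlongrightarrow> \<bar>Phi (\<lambda>x y. h (shift x) (T y)) - Phi h\<bar>) \<F>"
    by (intro tendsto_rabs tendsto_diff Phi_tendsto[OF h] Phi_tendsto[OF adm_shift[OF h]])
  then have "\<bar>Phi (\<lambda>x y. h (shift x) (T y)) - Phi h\<bar> \<le> 0"
    by (rule tendsto_le[OF F(1) l0]) (use Lam_shift[OF h] in auto)
  then show ?thesis by simp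
qed

lemma adm_snd: "integrable \<nu> u \<Longrightarrow> adm (\<lambda>x y. u y) (\<lambda>y. \<bar>u y\<bar>)"
  by (simp add: adm_def)

definition ind :: "(int \<Rightarrow> 'a) set \<Rightarrow> ('y \<Rightarrow> real) \<Rightarrow> (int \<Rightarrow> 'a) \<Rightarrow> 'y \<Rightarrow> real" where
  "ind A u = (\<lambda>x y. indicator A x * u y)"

lemma adm_ind: "integrable \<nu> u \<Longrightarrow> adm (ind A u) (\<lambda>y. \<bar>u y\<bar>)"
  unfolding adm_def ind_def by (auto simp: indicator_def)

lemma indicator_integrable: "B \<in> events \<Longrightarrow> integrable \<nu> (indicator B :: 'y \<Rightarrow> real)"
  by (simp add: less_top[symmetric])

text \<open>\<open>Phi_snd\<close> fixes the marginal to be exactly \<nu>, so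
  \<open>B \<mapsto> Phi (ind A (indicator B))\<close> is dominated by \<nu> and has a density; no
  mass can escape although the observation space need not be compact.\<close>

lemma cylinder_density_exists:
  "\<exists>k\<in>borel_measurable \<nu>. (\<forall>y. 0 \<le> k y) \<and> (\<forall>B\<in>events. has_bochner_integral \<nu> (\<lambda>y. indicator B y * k y) (Phi (ind A (indicator B))))"
proof (rule dominated_additive_density)
  fix B assume B: "B \<in> events"
  note iB = indicator_integrable[OF B]
  have z: "adm (\<lambda>x y. 0) (\<lambda>y. 0)" by (simp add: adm_def)
  have "Phi (\<lambda>x y. 0) = 0" using Phi_snd[of "\<lambda>_. 0"] by simp
  then show "0 \<le> Phi (ind A (indicator B))"
    using Phi_mono[OF z adm_ind[OF iB, of A]] by (simp add: ind_def)
  have "Phi (ind A (indicator B)) \<le> Phi (\<lambda>x y. indicator B y)"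
    by (rule Phi_mono[OF adm_ind[OF iB] adm_snd[OF iB]]) (auto simp: ind_def indicator_def)
  then show "Phi (ind A (indicator B)) \<le> prob B" using Phi_snd[OF iB] B by simp
next
  fix B C assume BC: "B \<in> events" "C \<in> events" "B \<inter> C = {}"
  define h where "h i = ind A (indicator (if i then B else C))" for i
  have h: "adm (h i) (\<lambda>y. \<bar>indicator (if i then B else C) y\<bar>)" for i
    unfolding h_def using BC by (intro adm_ind indicator_integrable) auto
  have "Phi (\<lambda>x y. \<Sum>i\<in>UNIV. h i x y) = (\<Sum>i\<in>UNIV. Phi (h i))" by (rule Phi_sum[OF _ h]) simp
  moreover have "Phi (ind A (indicator (B \<union> C))) = Phi (\<lambda>x y. \<Sum>i\<in>UNIV. h i x y)"
    by (rule Phi_cong) (use BC(3) in \<open>auto simp: h_def ind_def UNIV_bool indicator_def\<close>)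
  ultimately show "Phi (ind A (indicator (B \<union> C))) = Phi (ind A (indicator B)) + Phi (ind A (indicator C))"
    by (simp add: UNIV_bool h_def)
qed

lemma Phi_partition:
  assumes "finite I" "\<And>x. x \<in> X \<Longrightarrow> (\<Sum>i\<in>I. indicator (C i) x :: real) = indicator A x" and u: "integrable \<nu> u"
  shows "(\<Sum>i\<in>I. Phi (ind (C i) u)) = Phi (ind A u)"
proof -
  have "Phi (\<lambda>x y. \<Sum>i\<in>I. ind (C i) u x y) = (\<Sum>i\<in>I. Phi (ind (C i) u))"
    by (rule Phi_sum[OF assms(1) adm_ind[OF u]])
  moreover have "Phi (\<lambda>x y. \<Sum>i\<in>I. ind (C i) u x y) = Phi (ind A u)"
    by (rule Phi_cong) (simp add: ind_def sum_distrib_right[symmetric] assms(2))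
  ultimately show ?thesis by simp
qed

lemma indicator_cylinders:
  assumes "x \<in> X" "finite V" shows "(\<Sum>v\<in>V. indicator (Cyl m v) x :: real) = of_bool (cen m x \<in> V)"
proof -
  have "(\<Sum>v\<in>V. indicator (Cyl m v) x :: real) = (\<Sum>v\<in>V. if v = cen m x then 1 else 0)"
    using assms(1) by (intro sum.cong refl) (auto simp: Cyl_def)
  then show ?thesis using assms(2) by simp
qed

text \<open>The densities of cylinders satisfy normalisation and consistency almost everywhere.
  These are countably many conditions, so outside one null set the densities extend to a probability
  measure on the fiber; the formula for \<open>Phi\<close> then passes from indicators to integrable
  functions.\<close>

lemma fibre_kernel_exists:
  "\<exists>\<kappa>. (\<forall>y. prob_space (\<kappa> y) \<and> sets (\<kappa> y) = sets XM) \<and> \<kappa> \<in> measurable \<nu> (subprob_algebra XM) \<and>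
     (\<forall>A\<in>Alg. \<forall>u. integrable \<nu> u \<longrightarrow> Phi (ind A u) = (\<integral>y. measure (\<kappa> y) A * u y \<partial>\<nu>))"
proof -
  have "\<forall>c. \<exists>k. k \<in> borel_measurable \<nu> \<and> (\<forall>y. 0 \<le> k y) \<and>
     (\<forall>B\<in>events. has_bochner_integral \<nu> (\<lambda>y. indicator B y * k y) (Phi (ind (Cyl (fst c) (snd c)) (indicator B))))"
  proof (rule allI)
    fix c :: "nat \<times> 'a list"
    show "\<exists>k. k \<in> borel_measurable \<nu> \<and> (\<forall>y. 0 \<le> k y) \<and>
     (\<forall>B\<in>events. has_bochner_integral \<nu> (\<lambda>y. indicator B y * k y) (Phi (ind (Cyl (fst c) (snd c)) (indicator B))))"
      using cylinder_density_exists[of "Cyl (fst c) (snd c)"] unfolding Bex_def .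
  qed
  from choice[OF this] obtain k' where k': "\<forall>c. k' c \<in> borel_measurable \<nu> \<and> (\<forall>y. 0 \<le> k' c y) \<and>
     (\<forall>B\<in>events. has_bochner_integral \<nu> (\<lambda>y. indicator B y * k' c y) (Phi (ind (Cyl (fst c) (snd c)) (indicator B))))" by (rule exE)
  define k where "k m v = k' (m, v)" for m v
  have km [measurable]: "k m v \<in> borel_measurable \<nu>" and k0: "0 \<le> k m v y"
    and ki: "B \<in> events \<Longrightarrow> has_bochner_integral \<nu> (\<lambda>y. indicator B y * k m v y) (Phi (ind (Cyl m v) (indicator B)))" for m v y B
    using spec[OF k', of "(m, v)"] by (auto simp: k_def)
  have ksum: "has_bochner_integral \<nu> (\<lambda>y. indicator B y * (\<Sum>v\<in>V. k m v y)) (\<Sum>v\<in>V. Phi (ind (Cyl m v) (indicator B)))"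
    if "B \<in> events" for B m V
    unfolding sum_distrib_left by (intro has_bochner_integral_sum ki that)
  have ae1: "AE y in \<nu>. (\<Sum>v\<in>CW m. k m v y) = 1" for m
  proof (rule AE_eq_of_set_integrals[where g = "\<lambda>B. \<Sum>v\<in>CW m. Phi (ind (Cyl m v) (indicator B))"])
    fix B assume B: "B \<in> events"
    show "has_bochner_integral \<nu> (\<lambda>y. indicator B y * (\<Sum>v\<in>CW m. k m v y)) (\<Sum>v\<in>CW m. Phi (ind (Cyl m v) (indicator B)))"
      by (rule ksum[OF B])
    have "(\<Sum>v\<in>CW m. Phi (ind (Cyl m v) (indicator B))) = Phi (ind UNIV (indicator B))"
      by (rule Phi_partition[OF finite_CW _ indicator_integrable[OF B]]) (simp add: indicator_cylinders)
    also have "\<dots> = prob B" using Phi_snd[OF indicator_integrable[OF B]] B by (simp add: ind_def)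
    finally show "has_bochner_integral \<nu> (\<lambda>y. indicator B y * 1) (\<Sum>v\<in>CW m. Phi (ind (Cyl m v) (indicator B)))"
      using B by (simp add: has_bochner_integral_iff less_top[symmetric])
  qed (use k0 in \<open>auto intro!: sum_nonneg\<close>)
  have ae2: "AE y in \<nu>. k m v y = (\<Sum>u\<in>{u \<in> CW (Suc m). restr m (Suc m) u = v}. k (Suc m) u y)" for m v
  proof (rule AE_eq_of_set_integrals[where g = "\<lambda>B. Phi (ind (Cyl m v) (indicator B))"])
    fix B assume B: "B \<in> events"
    show "has_bochner_integral \<nu> (\<lambda>y. indicator B y * k m v y) (Phi (ind (Cyl m v) (indicator B)))" by (rule ki[OF B])
    have "(\<Sum>u\<in>{u \<in> CW (Suc m). restr m (Suc m) u = v}. Phi (ind (Cyl (Suc m) u) (indicator B))) = Phi (ind (Cyl m v) (indicator B))"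
    proof (rule Phi_partition[OF _ _ indicator_integrable[OF B]])
      fix x assume x: "x \<in> X"
      have "restr m (Suc m) (cen (Suc m) x) = cen m x" by (rule restr_cen) simp
      then show "(\<Sum>u\<in>{u \<in> CW (Suc m). restr m (Suc m) u = v}. indicator (Cyl (Suc m) u) x :: real) = indicator (Cyl m v) x"
        using x by (simp add: indicator_cylinders) (simp add: Cyl_def indicator_def)
    qed simp
    then show "has_bochner_integral \<nu> (\<lambda>y. indicator B y * (\<Sum>u\<in>{u \<in> CW (Suc m). restr m (Suc m) u = v}. k (Suc m) u y)) (Phi (ind (Cyl m v) (indicator B)))"
      by (rule subst) (rule ksum[OF B])
  qed (use k0 in \<open>auto intro!: sum_nonneg\<close>)
  define good where "good y \<longleftrightarrow> (\<forall>m. (\<Sum>v\<in>CW m. k m v y) = 1 \<and> (\<forall>v. k m v y = (\<Sum>u\<in>{u \<in> CW (Suc m). restr m (Suc m) u = v}. k (Suc m) u y)))" for y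
  have "AE y in \<nu>. good y" unfolding good_def using ae1 ae2 by (simp add: AE_all_countable AE_conj_iff)
  then obtain N where N: "{y \<in> space \<nu>. \<not> good y} \<subseteq> N" "emeasure \<nu> N = 0" "N \<in> events" by (rule AE_E)
  obtain x0 where x0: "x0 \<in> X" using X_ne by blast
  \<comment> \<open>On the null set the weights of a point mass at \<open>x0\<close> are used, since
    \<open>disintegration\<close> demands a probability measure for every \<open>y\<close>.\<close>
  define p where "p y m v = (if y \<in> N then of_bool (cen m x0 = v) else k m v y)" for y m v
  have "\<exists>\<kappa>. prob_space \<kappa> \<and> sets \<kappa> = sets XM \<and> (\<forall>m. \<forall>v\<in>CW m. measure \<kappa> (Cyl m v) = p y m v)" for y
  proof (rule cylinder_measure_exists)
    show "0 \<le> p y m v" for m v using k0 by (simp add: p_def)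
    show "(\<Sum>v\<in>CW m. p y m v) = 1" for m
    proof (cases "y \<in> N")
      case True
      have "(\<Sum>v\<in>CW m. p y m v) = (\<Sum>v\<in>CW m. if v = cen m x0 then 1 else 0)"
        using True by (intro sum.cong refl) (auto simp: p_def)
      then show ?thesis using x0 by simp
    next
      case False
      then have g: "good y" using N(1) by auto
      show ?thesis unfolding p_def if_not_P[OF False]
        by (rule spec[OF g[unfolded good_def], of m, THEN conjunct1])
    qed
    show "p y m v = (\<Sum>u\<in>{u \<in> CW (Suc m). restr m (Suc m) u = v}. p y (Suc m) u)" for m v
    proof (cases "y \<in> N")
      case True
      have r: "restr m (Suc m) (cen (Suc m) x0) = cen m x0" by (rule restr_cen) simp
      have "(\<Sum>u\<in>{u \<in> CW (Suc m). restr m (Suc m) u = v}. p y (Suc m) u) =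
        (\<Sum>u\<in>{u \<in> CW (Suc m). restr m (Suc m) u = v}. if u = cen (Suc m) x0 then 1 else 0)"
        using True by (intro sum.cong refl) (auto simp: p_def)
      then show ?thesis using x0 r True by (simp add: p_def)
    next
      case False
      then have g: "good y" using N(1) by auto
      show ?thesis unfolding p_def if_not_P[OF False]
        by (rule spec[OF g[unfolded good_def], of m, THEN conjunct2, THEN spec])
    qed
  qed
  then have "\<forall>y. \<exists>\<kappa>. prob_space \<kappa> \<and> sets \<kappa> = sets XM \<and> (\<forall>m. \<forall>v\<in>CW m. measure \<kappa> (Cyl m v) = p y m v)" by (rule allI)
  from choice[OF this] obtain \<kappa> where \<kappa>: "\<forall>y. prob_space (\<kappa> y) \<and> sets (\<kappa> y) = sets XM \<and> (\<forall>m. \<forall>v\<in>CW m. measure (\<kappa> y) (Cyl m v) = p y m v)"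
    by (rule exE)
  have kp: "prob_space (\<kappa> y)" and ks: "sets (\<kappa> y) = sets XM" and kc: "v \<in> CW m \<Longrightarrow> measure (\<kappa> y) (Cyl m v) = p y m v" for y m v
    using spec[OF \<kappa>, of y] by auto
  have k_fin: "finite_measure (\<kappa> y)" for y using kp[of y] by (simp add: prob_space_def)
  have pm: "(\<lambda>y. p y m v) \<in> borel_measurable \<nu>" for m v
    unfolding p_def using N(3) by (intro measurable_If_set) auto
  have Alg_meas: "(\<lambda>y. measure (\<kappa> y) A) \<in> borel_measurable \<nu>" if A: "A \<in> Alg" for A
  proof -
    obtain m where m: "\<forall>m'\<ge>m. A = X \<inter> cen m' -` (cen m' ` A)" using Alg_eq_level[OF A] by (rule exE)
    have "measure (\<kappa> y) A = (\<Sum>v\<in>cen m ` A. p y m v)" for y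
    proof -
      have "measure (\<kappa> y) A = (\<Sum>v\<in>cen m ` A. measure (\<kappa> y) (Cyl m v))"
        by (rule Alg_measure_sum[OF A _ k_fin ks]) (use m in blast)
      also have "\<dots> = (\<Sum>v\<in>cen m ` A. p y m v)"
        by (rule sum.cong[OF refl]) (use kc Alg_image_CW[OF A, of m] in blast)
      finally show ?thesis .
    qed
    then show ?thesis using pm by (simp add: borel_measurable_sum)
  qed
  have kernel: "\<kappa> \<in> measurable \<nu> (subprob_algebra XM)"
  proof (rule measurable_subprob_algebra_generated[OF sets_XM_Alg Int_stable_Alg])
    show "Alg \<subseteq> Pow X" by (auto simp: Alg_def)
    have em: "(\<lambda>y. emeasure (\<kappa> y) A) \<in> borel_measurable \<nu>" if "A \<in> Alg" for A
      using Alg_meas[OF that] by (simp add: finite_measure.emeasure_eq_measure[OF k_fin])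
    show "A \<in> Alg \<Longrightarrow> (\<lambda>y. emeasure (\<kappa> y) A) \<in> borel_measurable \<nu>" for A by (rule em)
    show "(\<lambda>y. emeasure (\<kappa> y) X) \<in> borel_measurable \<nu>" by (rule em[OF algebra.top[OF algebra_Alg]])
  qed (use kp ks in \<open>auto intro: prob_space_imp_subprob_space\<close>)
  have cyl: "Phi (ind (Cyl m v) u) = (\<integral>y. measure (\<kappa> y) (Cyl m v) * u y \<partial>\<nu>)" if v: "v \<in> CW m" and u: "integrable \<nu> u" for m v u
    using u
  proof (induction u rule: integrable_induct)
    case (base B c)
    have iB: "integrable \<nu> (indicator B :: 'y \<Rightarrow> real)" by (rule indicator_integrable[OF base(1)])
    have "(\<integral>y. measure (\<kappa> y) (Cyl m v) * (indicator B y *\<^sub>R c) \<partial>\<nu>) = (\<integral>y. c * (indicator B y * k m v y) \<partial>\<nu>)"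
    proof (rule integral_cong_AE)
      have "AE y in \<nu>. y \<notin> N" using N(2,3) by (intro AE_not_in null_setsI)
      then show "AE y in \<nu>. measure (\<kappa> y) (Cyl m v) * (indicator B y *\<^sub>R c) = c * (indicator B y * k m v y)"
        by eventually_elim (simp add: kc[OF v] p_def)
    qed (use base(1) km Alg_meas[OF Cyl_Alg] in auto)
    also have "\<dots> = c * Phi (ind (Cyl m v) (indicator B))"
      using ki[OF base(1), of m v] by (simp add: has_bochner_integral_iff)
    also have "\<dots> = Phi (\<lambda>x y. c * ind (Cyl m v) (indicator B) x y)" by (rule Phi_cmult[OF adm_ind[OF iB], symmetric])
    also have "\<dots> = Phi (ind (Cyl m v) (\<lambda>y. indicator B y *\<^sub>R c))" by (rule Phi_cong) (simp add: ind_def)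
    finally show ?case by simp
  next
    case (add f g)
    have i: "integrable \<nu> (\<lambda>y. measure (\<kappa> y) (Cyl m v) * h y)" if "integrable \<nu> h" for h
      by (rule Bochner_Integration.integrable_bound[OF that])
        (use that Alg_meas[OF Cyl_Alg] prob_space.prob_le_1[OF kp] in \<open>auto intro!: AE_I2 mult_left_le_one_le simp: abs_mult\<close>)
    define h where "h j = ind (Cyl m v) (if j then f else g)" for j
    have h: "adm (h j) (\<lambda>y. \<bar>(if j then f else g) y\<bar>)" for j unfolding h_def using add by (intro adm_ind) auto
    have "Phi (ind (Cyl m v) (\<lambda>y. f y + g y)) = Phi (\<lambda>x y. \<Sum>j\<in>UNIV. h j x y)"
      by (rule Phi_cong) (simp add: ind_def h_def UNIV_bool distrib_left)
    also have "\<dots> = (\<Sum>j\<in>UNIV. Phi (h j))" by (rule Phi_sum[OF _ h]) simp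
    finally show ?case using add i by (simp add: h_def UNIV_bool distrib_left)
  next
    case (lim f s)
    have IH: "Phi (ind (Cyl m v) (s i)) = (\<integral>y. measure (\<kappa> y) (Cyl m v) * s i y \<partial>\<nu>)" for i using lim by simp
    have sint: "integrable \<nu> (s i)" for i using lim by simp
    have slim: "(\<lambda>i. s i y) \<longlonglongrightarrow> f y" for y using lim by simp
    have sbound: "norm (s i y) \<le> 2 * norm (f y)" for i y using lim by simp
    have fint: "integrable \<nu> f" using lim by simp
    have ff: "integrable \<nu> (\<lambda>y. 2 * \<bar>f y\<bar>)" using fint by simp
    have c1: "(\<lambda>i. \<integral>y. measure (\<kappa> y) (Cyl m v) * s i y \<partial>\<nu>) \<longlonglongrightarrow> (\<integral>y. measure (\<kappa> y) (Cyl m v) * f y \<partial>\<nu>)"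
    proof (rule integral_dominated_convergence[OF _ _ ff])
      show "AE y in \<nu>. (\<lambda>i. measure (\<kappa> y) (Cyl m v) * s i y) \<longlonglongrightarrow> measure (\<kappa> y) (Cyl m v) * f y"
        using slim by (intro AE_I2 tendsto_mult tendsto_const) auto
      show "AE y in \<nu>. norm (measure (\<kappa> y) (Cyl m v) * s i y) \<le> 2 * \<bar>f y\<bar>" for i
      proof (rule AE_I2)
        fix y
        have "norm (measure (\<kappa> y) (Cyl m v) * s i y) \<le> 1 * \<bar>s i y\<bar>"
          using mult_right_mono[OF prob_space.prob_le_1[OF kp], of "\<bar>s i y\<bar>"] by (simp add: abs_mult)
        then show "norm (measure (\<kappa> y) (Cyl m v) * s i y) \<le> 2 * \<bar>f y\<bar>" using sbound[of i y] by simp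
      qed
    qed (use sint fint Alg_meas[OF Cyl_Alg] in auto)
    have c2: "(\<lambda>i. \<integral>y. \<bar>f y - s i y\<bar> \<partial>\<nu>) \<longlonglongrightarrow> (\<integral>y. 0 \<partial>\<nu>)"
    proof (rule integral_dominated_convergence[where w = "\<lambda>y. 3 * \<bar>f y\<bar>"])
      show "AE y in \<nu>. (\<lambda>i. \<bar>f y - s i y\<bar>) \<longlonglongrightarrow> 0"
      proof (rule AE_I2)
        fix y
        have "(\<lambda>i. \<bar>f y - s i y\<bar>) \<longlonglongrightarrow> \<bar>f y - f y\<bar>" using slim[of y] by (intro tendsto_intros) auto
        then show "(\<lambda>i. \<bar>f y - s i y\<bar>) \<longlonglongrightarrow> 0" by simp
      qed
      show "AE y in \<nu>. norm (\<bar>f y - s i y\<bar>) \<le> 3 * \<bar>f y\<bar>" for i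
      proof (rule AE_I2)
        fix y show "norm (\<bar>f y - s i y\<bar>) \<le> 3 * \<bar>f y\<bar>" using sbound[of i y] by simp
      qed
    qed (use sint fint in auto)
    \<comment> \<open>\<open>Phi_bound\<close> makes \<open>Phi\<close> continuous in mean, so
      convergence in mean of the approximating functions suffices.\<close>
    have "(\<lambda>i. Phi (ind (Cyl m v) (s i))) \<longlonglongrightarrow> Phi (ind (Cyl m v) f)"
    proof (rule LIMSEQ_I)
      fix r :: real assume "r > 0"
      then obtain i0 where i0: "\<And>i. i \<ge> i0 \<Longrightarrow> \<bar>\<integral>y. \<bar>f y - s i y\<bar> \<partial>\<nu>\<bar> < r"
        using LIMSEQ_D[OF c2, of r] by auto
      have "norm (Phi (ind (Cyl m v) (s i)) - Phi (ind (Cyl m v) f)) < r" if "i \<ge> i0" for i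
      proof -
        have d: "integrable \<nu> (\<lambda>y. f y - s i y)" using sint fint by simp
        have "Phi (ind (Cyl m v) (\<lambda>y. f y - s i y)) = Phi (\<lambda>x y. ind (Cyl m v) f x y - ind (Cyl m v) (s i) x y)"
          by (rule Phi_cong) (simp add: ind_def right_diff_distrib)
        also have "\<dots> = Phi (ind (Cyl m v) f) - Phi (ind (Cyl m v) (s i))"
          by (rule Phi_diff[OF adm_ind adm_ind]) (use sint fint in auto)
        finally have "\<bar>Phi (ind (Cyl m v) f) - Phi (ind (Cyl m v) (s i))\<bar> \<le> (\<integral>y. \<bar>f y - s i y\<bar> \<partial>\<nu>)"
          using Phi_bound[OF adm_ind[OF d, of "Cyl m v"]] by simp
        then show ?thesis using i0[OF that] by (simp add: abs_minus_commute)
      qed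
      then show "\<exists>no. \<forall>n\<ge>no. norm (Phi (ind (Cyl m v) (s n)) - Phi (ind (Cyl m v) f)) < r" by blast
    qed
    then show ?case using LIMSEQ_unique[OF c1] unfolding IH by simp
  qed
  have "Phi (ind A u) = (\<integral>y. measure (\<kappa> y) A * u y \<partial>\<nu>)" if A: "A \<in> Alg" and u: "integrable \<nu> u" for A u
  proof -
    obtain m where m: "\<forall>m'\<ge>m. A = X \<inter> cen m' -` (cen m' ` A)" using Alg_eq_level[OF A] by (rule exE)
    then have lev: "A = X \<inter> cen m -` (cen m ` A)" by blast
    have fin: "finite (cen m ` A)" using Alg_image_CW[OF A] by (rule finite_subset) simp
    have "Phi (ind A u) = (\<Sum>v\<in>cen m ` A. Phi (ind (Cyl m v) u))"
    proof (rule Phi_partition[OF fin _ u, symmetric])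
      fix x assume x: "x \<in> X"
      then have "cen m x \<in> cen m ` A \<longleftrightarrow> x \<in> A" using lev by blast
      then show "(\<Sum>v\<in>cen m ` A. indicator (Cyl m v) x :: real) = indicator A x"
        unfolding indicator_cylinders[OF x fin] by (simp add: indicator_def)
    qed
    also have "\<dots> = (\<Sum>v\<in>cen m ` A. \<integral>y. measure (\<kappa> y) (Cyl m v) * u y \<partial>\<nu>)"
      by (rule sum.cong[OF refl]) (use cyl[OF _ u] Alg_image_CW[OF A, of m] in blast)
    also have "\<dots> = (\<integral>y. (\<Sum>v\<in>cen m ` A. measure (\<kappa> y) (Cyl m v) * u y) \<partial>\<nu>)"
    proof (rule Bochner_Integration.integral_sum[symmetric])
      show "integrable \<nu> (\<lambda>y. measure (\<kappa> y) (Cyl m v) * u y)" for v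
        by (rule Bochner_Integration.integrable_bound[OF u])
          (use u Alg_meas[OF Cyl_Alg] prob_space.prob_le_1[OF kp] in \<open>auto intro!: AE_I2 mult_left_le_one_le simp: abs_mult\<close>)
    qed
    also have "\<dots> = (\<integral>y. measure (\<kappa> y) A * u y \<partial>\<nu>)"
      using Alg_measure_sum[OF A lev k_fin ks] by (simp add: sum_distrib_right)
    finally show ?thesis .
  qed
  then show ?thesis using kp ks kernel by blast
qed


text \<open>A bounded functional of the empirical averages converges to an integral against the joining
  built from the kernel.\<close>

lemma joining_from_limit:
  "\<exists>jn \<kappa>. jn \<in> joinings X \<nu> T \<and> disintegration X \<nu> jn \<kappa> \<and>
     (\<forall>m H. (\<forall>v\<in>CW m. integrable \<nu> (H v)) \<longrightarrow> Phi (\<lambda>x y. H (cen m x) y) = (\<integral>z. H (cen m (fst z)) (snd z) \<partial>jn))"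
proof -
  obtain \<kappa> where \<kappa>: "(\<forall>y. prob_space (\<kappa> y) \<and> sets (\<kappa> y) = sets XM) \<and> \<kappa> \<in> measurable \<nu> (subprob_algebra XM) \<and>
     (\<forall>A\<in>Alg. \<forall>u. integrable \<nu> u \<longrightarrow> Phi (ind A u) = (\<integral>y. measure (\<kappa> y) A * u y \<partial>\<nu>))"
    by (rule exE[OF fibre_kernel_exists])
  have kp: "prob_space (\<kappa> y)" and ks: "sets (\<kappa> y) = sets XM" for y using \<kappa> by auto
  have km: "\<kappa> \<in> measurable \<nu> (subprob_algebra XM)" using \<kappa> by blast
  have kPhi: "Phi (ind A u) = (\<integral>y. measure (\<kappa> y) A * u y \<partial>\<nu>)" if "A \<in> Alg" "integrable \<nu> u" for A u using \<kappa> that by blast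
  have k_fin: "finite_measure (\<kappa> y)" for y using kp[of y] by (simp add: prob_space_def)
  have kA: "(\<lambda>y. emeasure (\<kappa> y) A) \<in> borel_measurable \<nu>" if "A \<in> sets XM" for A
    using measurable_emeasure_kernel[OF km that] .
  have kA': "(\<lambda>y. measure (\<kappa> y) A) \<in> borel_measurable \<nu>" if "A \<in> sets XM" for A
    unfolding measure_def using kA[OF that] by measurable
  let ?B = "XM \<Otimes>\<^sub>M (borel :: 'y measure)"
  define jn where "jn = \<nu> \<bind> (\<lambda>y. distr (\<kappa> y) ?B (\<lambda>x. (x, y)))"
  have D: "(\<lambda>y. distr (\<kappa> y) ?B (\<lambda>x. (x, y))) \<in> measurable \<nu> (subprob_algebra ?B)"
  proof (rule measurable_distr2[OF _ km])
    have "(\<lambda>z. (snd z, fst z)) \<in> measurable (\<nu> \<Otimes>\<^sub>M XM) ?B"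
      by (rule measurable_Pair) (auto simp: measurable_fst'' intro: measurable_compose[OF measurable_fst measurable_ident_sets[OF sets_nu]])
    then show "(\<lambda>(y, x). (x, y)) \<in> measurable (\<nu> \<Otimes>\<^sub>M XM) ?B" by (simp add: split_def)
  qed
  have pm: "(\<lambda>x. (x, y)) \<in> measurable (\<kappa> y) ?B" for y
    by (intro measurable_Pair measurable_ident_sets[OF ks] measurable_const) simp
  have sets_jn: "sets jn = sets ?B" unfolding jn_def by (rule sets_bind[where N = ?B]) auto
  have space_jn: "space jn = X \<times> UNIV" using sets_eq_imp_space_eq[OF sets_jn] by (simp add: space_pair_measure)
  have em: "emeasure jn (A \<times> B) = ennreal (\<integral>y. measure (\<kappa> y) A * indicator B y \<partial>\<nu>)"
    and im: "integrable \<nu> (\<lambda>y. measure (\<kappa> y) A * indicator B y)" if A: "A \<in> sets XM" and B: "B \<in> sets borel" for A B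
  proof -
    have AB: "A \<times> B \<in> sets ?B" using A B by simp
    have Bn: "B \<in> events" using B sets_nu by simp
    show i: "integrable \<nu> (\<lambda>y. measure (\<kappa> y) A * indicator B y)"
    proof (rule integrable_const_bound[where B = 1])
      show "(\<lambda>y. measure (\<kappa> y) A * indicator B y) \<in> borel_measurable \<nu>"
        by (intro borel_measurable_times borel_measurable_indicator kA'[OF A] Bn)
    qed (use prob_space.prob_le_1[OF kp] in \<open>auto simp: indicator_def\<close>)
    have "emeasure jn (A \<times> B) = (\<integral>\<^sup>+y. emeasure (distr (\<kappa> y) ?B (\<lambda>x. (x, y))) (A \<times> B) \<partial>\<nu>)"
      unfolding jn_def by (rule emeasure_bind[OF _ D AB]) simp
    also have "\<dots> = (\<integral>\<^sup>+y. ennreal (measure (\<kappa> y) A * indicator B y) \<partial>\<nu>)"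
    proof (rule nn_integral_cong)
      fix y
      have sp: "space (\<kappa> y) = X" using sets_eq_imp_space_eq[OF ks] by simp
      have "(\<lambda>x. (x, y)) -` (A \<times> B) \<inter> space (\<kappa> y) = (if y \<in> B then A else {})"
        using sets.sets_into_space[OF A] sp by auto
      then show "emeasure (distr (\<kappa> y) ?B (\<lambda>x. (x, y))) (A \<times> B) = ennreal (measure (\<kappa> y) A * indicator B y)"
        using finite_measure.emeasure_eq_measure[OF k_fin] by (subst emeasure_distr[OF pm AB]) (auto simp: indicator_def)
    qed
    also have "\<dots> = ennreal (\<integral>y. measure (\<kappa> y) A * indicator B y \<partial>\<nu>)"
      by (rule nn_integral_eq_integral[OF i]) auto
    finally show "emeasure jn (A \<times> B) = ennreal (\<integral>y. measure (\<kappa> y) A * indicator B y \<partial>\<nu>)" .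
  qed
  have emPhi: "emeasure jn (A \<times> B) = ennreal (Phi (ind A (indicator B)))" if "A \<in> Alg" "B \<in> sets borel" for A B
    using em[OF Alg_sets[OF that(1)] that(2)] kPhi[OF that(1) indicator_integrable] that(2) sets_nu by simp
  have nu_em: "emeasure jn (X \<times> B) = emeasure \<nu> B" if B: "B \<in> sets borel" for B
  proof -
    have "measure (\<kappa> y) X = 1" for y
      using prob_space.prob_space[OF kp[of y]] sets_eq_imp_space_eq[OF ks[of y]] by simp
    then show ?thesis using em[OF sets.top[of XM, unfolded space_XM] B] B sets_nu by (simp add: emeasure_eq_measure)
  qed
  have pj: "prob_space jn"
  proof (rule prob_spaceI)
    show "emeasure jn (space jn) = 1" unfolding space_jn using nu_em[of UNIV] emeasure_space_1 by simp
  qed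
  interpret J: prob_space jn by (rule pj)
  define ST :: "(int \<Rightarrow> 'a) \<times> 'y \<Rightarrow> (int \<Rightarrow> 'a) \<times> 'y" where "ST = (\<lambda>(x, y). (shift x, T y))"
  have STm: "ST \<in> measurable jn jn"
  proof -
    have "(\<lambda>z. (shift (fst z), T (snd z))) \<in> measurable ?B ?B"
      using measurable_compose[OF measurable_fst shift_measurable] measurable_compose[OF measurable_snd T_borel] by (rule measurable_Pair)
    then have "ST \<in> measurable ?B ?B" by (simp add: ST_def split_def)
    then show ?thesis by (simp cong: measurable_cong_sets add: sets_jn)
  qed
  \<comment> \<open>The rectangles with clopen first side form a generator stable under
    intersection; on them invariance is \<open>Phi_shift\<close>.\<close>
  have inv: "distr jn jn ST = jn"
  proof (rule measure_eqI_generator_eq[where E = "{A \<times> B | A B. A \<in> Alg \<and> B \<in> sets (borel :: 'y measure)}" and \<Omega> = "X \<times> UNIV" and A = "\<lambda>_. X \<times> UNIV"])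
    let ?E = "{A \<times> B | A B. A \<in> Alg \<and> B \<in> sets (borel :: 'y measure)}"
    show "Int_stable ?E"
    proof (rule Int_stableI)
      fix a b assume "a \<in> ?E" "b \<in> ?E"
      then obtain A B A' B' where *: "a = A \<times> B" "b = A' \<times> B'" "A \<in> Alg" "A' \<in> Alg" "B \<in> sets borel" "B' \<in> sets (borel :: 'y measure)" by blast
      have "a \<inter> b = (A \<inter> A') \<times> (B \<inter> B')" using * by auto
      moreover have "A \<inter> A' \<in> Alg" using Int_stable_Alg *(3,4) by (rule Int_stableD)
      ultimately show "a \<inter> b \<in> ?E" using * by blast
    qed
    show "?E \<subseteq> Pow (X \<times> UNIV)" by (auto simp: Alg_def)
    show "sets (distr jn jn ST) = sigma_sets (X \<times> UNIV) ?E" "sets jn = sigma_sets (X \<times> UNIV) ?E"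
      using sets_pair_XM[of "borel :: 'y measure"] by (simp_all add: sets_jn)
    show "range (\<lambda>_. X \<times> UNIV) \<subseteq> ?E" using algebra.top[OF algebra_Alg]
      by (intro image_subsetI CollectI exI[of _ X] exI[of _ UNIV]) simp
    fix C assume "C \<in> ?E"
    then obtain A B where C: "C = A \<times> B" "A \<in> Alg" "B \<in> sets (borel :: 'y measure)" by blast
    have TB: "T -` B \<in> sets borel" using measurable_sets[OF T_borel C(3)] by simp
    have iB: "integrable \<nu> (indicator B :: 'y \<Rightarrow> real)" using C(3) sets_nu by (intro indicator_integrable) simp
    have "C \<in> sets jn" using C Alg_sets by (simp add: sets_jn)
    then have "emeasure (distr jn jn ST) C = emeasure jn (ST -` C \<inter> space jn)" by (rule emeasure_distr[OF STm])
    also have "ST -` C \<inter> space jn = (shift -` A \<inter> X) \<times> (T -` B)" unfolding space_jn C(1) ST_def by auto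
    also have "emeasure jn \<dots> = ennreal (Phi (ind (shift -` A \<inter> X) (indicator (T -` B))))"
      by (rule emPhi[OF Alg_shift[OF C(2)] TB])
    also have "Phi (ind (shift -` A \<inter> X) (indicator (T -` B))) = Phi (\<lambda>x y. ind A (indicator B) (shift x) (T y))"
      by (rule Phi_cong) (auto simp: ind_def indicator_def)
    also have "\<dots> = Phi (ind A (indicator B))" by (rule Phi_shift[OF adm_ind[OF iB]])
    also have "ennreal \<dots> = emeasure jn C" unfolding C(1) by (rule emPhi[OF C(2,3), symmetric])
    finally show "emeasure (distr jn jn ST) C = emeasure jn C" .
  qed (auto simp: emeasure_distr STm space_jn[symmetric] simp del: space_jn)
  have jn_in: "jn \<in> joinings X \<nu> T"
    unfolding joinings_def
  proof (intro CollectI conjI ballI)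
    fix A assume A: "A \<in> sets jn"
    have "measure (distr jn jn ST) A = measure jn (ST -` A \<inter> space jn)" by (rule measure_distr[OF STm A])
    then have "measure jn A = measure jn (ST -` A \<inter> space jn)" by (simp only: inv)
    then show "measure jn ((\<lambda>(x, y). (shift x, T y)) -` A \<inter> space jn) = measure jn A" by (simp add: ST_def)
  next
    show "distr jn borel snd = \<nu>"
    proof (rule measure_eqI)
      fix B assume "B \<in> sets (distr jn borel snd)"
      then have B: "B \<in> sets borel" by simp
      have sm: "snd \<in> measurable jn borel" using measurable_snd[of XM borel] by (simp cong: measurable_cong_sets add: sets_jn)
      have "snd -` B \<inter> space jn = X \<times> B" by (auto simp: space_jn)
      then show "emeasure (distr jn borel snd) B = emeasure \<nu> B" using nu_em[OF B] by (simp add: emeasure_distr[OF sm B])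
    qed (simp add: sets_nu)
  qed (use pj sets_jn in auto)
  have dis: "disintegration X \<nu> jn \<kappa>"
    unfolding disintegration_def
  proof (intro conjI allI ballI)
    fix A assume A: "A \<in> sets XM"
    show "(\<lambda>y. measure (\<kappa> y) A) \<in> borel_measurable borel" using kA'[OF A] by (simp cong: measurable_cong_sets add: sets_nu)
    fix B :: "'y set" assume B: "B \<in> sets borel"
    have "0 \<le> (\<integral>y. measure (\<kappa> y) A * indicator B y \<partial>\<nu>)" by simp
    then show "measure jn (A \<times> B) = (\<integral>y. indicator B y * measure (\<kappa> y) A \<partial>\<nu>)"
      using em[OF A B] by (simp add: measure_def mult.commute)
  qed (use kp ks in auto)
  interpret JJ: joining X \<nu> T jn \<kappa> by unfold_locales (use jn_in dis in auto)
  have "Phi (\<lambda>x y. H (cen m x) y) = (\<integral>z. H (cen m (fst z)) (snd z) \<partial>jn)" if H: "\<forall>v\<in>CW m. integrable \<nu> (H v)" for m H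
  proof -
    have Hv: "integrable \<nu> (H v)" if "v \<in> CW m" for v using H that by blast
    have "Phi (\<lambda>x y. H (cen m x) y) = Phi (\<lambda>x y. \<Sum>v\<in>CW m. ind (Cyl m v) (H v) x y)"
    proof (rule Phi_cong)
      fix x y assume x: "x \<in> X"
      have "(\<Sum>v\<in>CW m. ind (Cyl m v) (H v) x y) = (\<Sum>v\<in>CW m. if v = cen m x then H v y else 0)"
        using x by (intro sum.cong refl) (auto simp: ind_def Cyl_def)
      then show "H (cen m x) y = (\<Sum>v\<in>CW m. ind (Cyl m v) (H v) x y)" using x by simp
    qed
    also have "\<dots> = (\<Sum>v\<in>CW m. Phi (ind (Cyl m v) (H v)))" by (rule Phi_sum[OF finite_CW adm_ind[OF Hv]])
    also have "\<dots> = (\<Sum>v\<in>CW m. \<integral>y. measure (\<kappa> y) (Cyl m v) * H v y \<partial>\<nu>)"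
      by (rule sum.cong[OF refl]) (rule kPhi[OF Cyl_Alg Hv])
    also have "\<dots> = (\<integral>y. (\<Sum>v\<in>CW m. measure (\<kappa> y) (Cyl m v) * H v y) \<partial>\<nu>)"
    proof (rule Bochner_Integration.integral_sum[symmetric])
      fix v assume v: "v \<in> CW m"
      show "integrable \<nu> (\<lambda>y. measure (\<kappa> y) (Cyl m v) * H v y)"
        by (rule Bochner_Integration.integrable_bound[OF Hv[OF v]])
          (use Hv[OF v] kA'[OF Cyl_sets] prob_space.prob_le_1[OF kp] in \<open>auto intro!: AE_I2 mult_left_le_one_le simp: abs_mult\<close>)
    qed
    also have "\<dots> = (\<integral>z. H (cen m (fst z)) (snd z) \<partial>jn)"
      by (rule JJ.jn_label(2)[where I = "CW m" and Z = "cen m", OF _ _ _ Hv, folded Cyl_def, symmetric]) (auto simp: Cyl_sets)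
    finally show ?thesis .
  qed
  then show ?thesis using jn_in dis by blast
qed

end

text \<open>Optimality is stated through test weights \<open>Q\<close> because, for fixed
  \<open>Q\<close>, both sides of \<open>meanZ_upper\<close> converge along the filter; no
  semicontinuity of the entropy is involved. Inserting the fiber laws of the limit joining for
  \<open>Q\<close> turns the inequality into one about its entropy.\<close>

theorem optimal_joining_exists:
  "\<exists>jn \<kappa>. jn \<in> joinings X \<nu> T \<and> disintegration X \<nu> jn \<kappa> \<and>
     (\<forall>q Q. q > 0 \<and> (\<forall>v\<in>W q. \<forall>y. 0 < Q v y) \<and> (\<forall>y. (\<Sum>v\<in>W q. Q v y) \<le> 1) \<and>
        (\<forall>v\<in>W q. integrable \<nu> (\<lambda>y. - ln (Q v y))) \<longrightarrow>
        q * (pstar - (\<integral>z. G (fst z) (snd z) \<partial>jn)) \<le> (\<integral>z. - ln (Q (pre q (fst z)) (snd z)) \<partial>jn))"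
proof -
  obtain \<F> :: "nat filter" where F: "\<F> \<noteq> bot" "\<F> \<le> sequentially" "\<forall>a::nat \<Rightarrow> real. Bseq a \<longrightarrow> (\<exists>l. (a \<longlongrightarrow> l) \<F>)"
    using bounded_sequences_converge_filter by blast
  obtain jn \<kappa> where jk: "jn \<in> joinings X \<nu> T \<and> disintegration X \<nu> jn \<kappa> \<and>
     (\<forall>m H. (\<forall>v\<in>CW m. integrable \<nu> (H v)) \<longrightarrow> Phi \<F> (\<lambda>x y. H (cen m x) y) = (\<integral>z. H (cen m (fst z)) (snd z) \<partial>jn))"
    using joining_from_limit[OF F] by (elim exE)
  have PhiI: "Phi \<F> (\<lambda>x y. H (cen m x) y) = (\<integral>z. H (cen m (fst z)) (snd z) \<partial>jn)" if "\<And>v. v \<in> CW m \<Longrightarrow> integrable \<nu> (H v)" for m H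
    using jk that by blast
  interpret JJ: joining X \<nu> T jn \<kappa> by unfold_locales (use jk in auto)
  have main: "q * (pstar - (\<integral>z. G (fst z) (snd z) \<partial>jn)) \<le> (\<integral>z. - ln (Q (pre q (fst z)) (snd z)) \<partial>jn)"
    if q: "q > 0" and Q: "\<And>v y. v \<in> W q \<Longrightarrow> 0 < Q v y" "\<And>y. (\<Sum>v\<in>W q. Q v y) \<le> 1"
      and Qi: "\<And>v. v \<in> W q \<Longrightarrow> integrable \<nu> (\<lambda>y. - ln (Q v y))" for q Q
  proof -
    let ?HQ = "\<lambda>x y. - ln (Q (pre q x) y)"
    let ?IQ = "\<integral>z. - ln (Q (pre q (fst z)) (snd z)) \<partial>jn"
    let ?IG = "\<integral>z. G (fst z) (snd z) \<partial>jn"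
    have aQ: "adm ?HQ (\<lambda>y. \<Sum>v\<in>W q. \<bar>- ln (Q v y)\<bar>)"
      unfolding adm_def
    proof (intro conjI ballI allI)
      fix x y assume x: "x \<in> X"
      show "?HQ x \<in> borel_measurable \<nu>" using Qi[of "pre q x"] x by auto
      show "\<bar>?HQ x y\<bar> \<le> (\<Sum>v\<in>W q. \<bar>- ln (Q v y)\<bar>)"
        by (rule member_le_sum[where f = "\<lambda>v. \<bar>- ln (Q v y)\<bar>"]) (use x in auto)
    qed (use Qi in \<open>auto intro!: Bochner_Integration.integrable_sum\<close>)
    have PQ: "Phi \<F> ?HQ = ?IQ"
    proof -
      have "Phi \<F> (\<lambda>x y. - ln (Q (take q (drop q (cen q x))) y)) = (\<integral>z. - ln (Q (take q (drop q (cen q (fst z)))) (snd z)) \<partial>jn)"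
      proof (rule PhiI[of q "\<lambda>v y. - ln (Q (take q (drop q v)) y)"])
        fix v assume "v \<in> CW q"
        then obtain x where "x \<in> X" "v = cen q x" by (auto simp: CW_def)
        then have "take q (drop q v) \<in> W q" using pre_from_cen[of q x] pre_W[of x q] by simp
        then show "integrable \<nu> (\<lambda>y. - ln (Q (take q (drop q v)) y))" by (rule Qi)
      qed
      then show ?thesis by (simp add: pre_from_cen[symmetric])
    qed
    have step: "q * pstar \<le> ?IQ + q * (?IG + 2 * (\<integral>y. e M y \<partial>\<nu>))" for M
    proof -
      \<comment> \<open>\<open>G\<close> is replaced by its value at a representative of the window
        of radius \<open>M\<close>, because the limit functional is identified as an integral only
        for functions of finite windows. The replacement costs the mean of \<open>e M\<close> twice,
        once before and once after the limit.\<close>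
      define r where "r v = (SOME x. x \<in> X \<and> cen M x = v)" for v
      have r: "r v \<in> X \<and> cen M (r v) = v" if v: "v \<in> CW M" for v
      proof -
        obtain x where "x \<in> X \<and> cen M x = v" using v by (auto simp: CW_def)
        then show ?thesis unfolding r_def by (rule someI[where P = "\<lambda>x. x \<in> X \<and> cen M x = v"])
      qed
      let ?G' = "\<lambda>x y. G (r (cen M x)) y"
      have rx: "r (cen M x) \<in> X" "cen M (r (cen M x)) = cen M x" if "x \<in> X" for x using r[of "cen M x"] that by auto
      have mod: "\<bar>G x y - ?G' x y\<bar> \<le> e M y" if "x \<in> X" for x y
        using G_modulus[OF that rx(1)[OF that]] rx(2)[OF that] by simp
      have aG: "adm ?G' b" unfolding adm_def using rx G_bound b_int G_measurable by auto
      have Gle: "G x y \<le> ?G' x y + e M y" if "x \<in> X" for x y using mod[OF that, of y] by (simp add: abs_le_iff)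
      have Gi: "integrable \<nu> (\<lambda>y. G (r v) y)" if "v \<in> CW M" for v
        by (rule Bochner_Integration.integrable_bound[OF b_int])
          (use r[OF that] G_measurable G_bound in \<open>auto intro!: AE_I2 intro: order_trans[OF _ abs_ge_self]\<close>)
      have PG: "Phi \<F> ?G' = (\<integral>z. ?G' (fst z) (snd z) \<partial>jn)" by (rule PhiI[of M "\<lambda>v y. G (r v) y"]) (rule Gi)
      have "((\<lambda>n. Lam n ?HQ + q * (Lam n ?G' + (\<integral>y. e M y \<partial>\<nu>)) + 2 * (real q)\<^sup>2 * ln (real CARD('a)) / n) \<longlongrightarrow>
         ?IQ + q * ((\<integral>z. ?G' (fst z) (snd z) \<partial>jn) + (\<integral>y. e M y \<partial>\<nu>)) + 0) \<F>"
        unfolding PQ[symmetric] PG[symmetric]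
        by (intro tendsto_intros Phi_tendsto[OF F aQ] Phi_tendsto[OF F aG] tendsto_mono[OF F(2)]
            tendsto_divide_0[OF tendsto_const] filterlim_at_top_imp_at_infinity filterlim_real_sequentially)
      moreover have "((\<lambda>n. q * meanZ n) \<longlongrightarrow> q * pstar) \<F>"
        by (intro tendsto_intros tendsto_mono[OF F(2) logZ_limit(1)])
      moreover have "eventually (\<lambda>n. q * meanZ n \<le> Lam n ?HQ + q * (Lam n ?G' + (\<integral>y. e M y \<partial>\<nu>)) + 2 * (real q)\<^sup>2 * ln (real CARD('a)) / n) \<F>"
      proof (rule filter_leD[OF F(2)], rule eventually_mono[OF eventually_gt_at_top[of 0]])
        fix n :: nat assume "0 < n"
        then show "q * meanZ n \<le> Lam n ?HQ + q * (Lam n ?G' + (\<integral>y. e M y \<partial>\<nu>)) + 2 * (real q)\<^sup>2 * ln (real CARD('a)) / n"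
          by (rule meanZ_upper[OF _ q Q aQ aG Gle])
      qed
      ultimately have "q * pstar \<le> ?IQ + q * ((\<integral>z. ?G' (fst z) (snd z) \<partial>jn) + (\<integral>y. e M y \<partial>\<nu>)) + 0"
        by (intro tendsto_le[OF F(1)])
      moreover have "(\<integral>z. ?G' (fst z) (snd z) \<partial>jn) \<le> ?IG + (\<integral>y. e M y \<partial>\<nu>)"
      proof -
        have iG': "integrable jn (\<lambda>z. ?G' (fst z) (snd z))"
          by (rule JJ.jn_label(1)[where I = "CW M" and Z = "cen M" and H = "\<lambda>v y. G (r v) y"])
            (use Gi Cyl_sets in \<open>auto simp: Cyl_def\<close>)
        have iG: "integrable jn (\<lambda>z. G (fst z) (snd z))"
        proof (rule Bochner_Integration.integrable_bound[OF JJ.jn_snd(1)[OF b_int]])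
          show "(\<lambda>z. G (fst z) (snd z)) \<in> borel_measurable jn" using G_joint by (simp cong: measurable_cong_sets add: JJ.sets_jn)
          show "AE z in jn. norm (G (fst z) (snd z)) \<le> norm (b (snd z))"
            using G_bound b_nonneg by (intro AE_I2) (auto simp: JJ.space_jn)
        qed
        have "(\<integral>z. ?G' (fst z) (snd z) \<partial>jn) \<le> (\<integral>z. G (fst z) (snd z) + e M (snd z) \<partial>jn)"
        proof (rule integral_mono[OF iG'])
          show "integrable jn (\<lambda>z. G (fst z) (snd z) + e M (snd z))" using iG JJ.jn_snd(1)[OF e_int] by simp
          fix z assume "z \<in> space jn"
          then have "fst z \<in> X" by (auto simp: JJ.space_jn)
          from mod[OF this, of "snd z"] show "?G' (fst z) (snd z) \<le> G (fst z) (snd z) + e M (snd z)" by (simp add: abs_le_iff)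
        qed
        also have "\<dots> = ?IG + (\<integral>y. e M y \<partial>\<nu>)" using iG JJ.jn_snd[OF e_int] by simp
        finally show ?thesis .
      qed
      then have "q * ((\<integral>z. ?G' (fst z) (snd z) \<partial>jn) + (\<integral>y. e M y \<partial>\<nu>)) \<le> q * (?IG + 2 * (\<integral>y. e M y \<partial>\<nu>))"
        by (intro mult_left_mono) auto
      ultimately show ?thesis by linarith
    qed
    have "(\<lambda>M. ?IQ + q * (?IG + 2 * (\<integral>y. e M y \<partial>\<nu>))) \<longlonglongrightarrow> ?IQ + q * (?IG + 2 * 0)"
      by (intro tendsto_intros e_lim)
    then have "q * pstar \<le> ?IQ + q * (?IG + 2 * 0)" by (rule LIMSEQ_le_const) (use step in auto)
    then show ?thesis by (simp add: right_diff_distrib)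
  qed
  show ?thesis
  proof (intro exI conjI allI impI)
    show "jn \<in> joinings X \<nu> T" "disintegration X \<nu> jn \<kappa>" using jk by auto
    fix q :: nat and Q :: "'a list \<Rightarrow> 'y \<Rightarrow> real"
    assume a: "q > 0 \<and> (\<forall>v\<in>W q. \<forall>y. 0 < Q v y) \<and> (\<forall>y. (\<Sum>v\<in>W q. Q v y) \<le> 1) \<and>
        (\<forall>v\<in>W q. integrable \<nu> (\<lambda>y. - ln (Q v y)))"
    show "q * (pstar - (\<integral>z. G (fst z) (snd z) \<partial>jn)) \<le> (\<integral>z. - ln (Q (pre q (fst z)) (snd z)) \<partial>jn)"
    proof (rule main)
      show "q > 0" using a by simp
      show "v \<in> W q \<Longrightarrow> 0 < Q v y" for v y using a by simp
      show "(\<Sum>v\<in>W q. Q v y) \<le> 1" for y using a by simp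
      show "v \<in> W q \<Longrightarrow> integrable \<nu> (\<lambda>y. - ln (Q v y))" for v using a by simp
    qed
  qed
qed

lemma fin_partitions_ne: "{X} \<in> fin_partitions X"
  using sets.top[of XM] by (auto simp: fin_partitions_def fin_partition_def)

lemma partition_entropy_le:
  assumes jk: "jn \<in> joinings X \<nu> T" "disintegration X \<nu> jn \<kappa>" and \<alpha>: "\<alpha> \<in> fin_partitions X"
  shows "lim (\<lambda>n. (\<integral>y. Hpart (\<kappa> y) (join_n X \<alpha> n) \<partial>\<nu>) / real n) \<le> pstar - (\<integral>z. G (fst z) (snd z) \<partial>jn)"
proof -
  interpret joining X \<nu> T jn \<kappa> by unfold_locales (use jk in auto)
  interpret label_partition X \<alpha> by unfold_locales (use \<alpha> in \<open>simp add: fin_partitions_def\<close>)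
  interpret joined_pressure X \<nu> T G b e jn \<kappa> \<alpha> by unfold_locales
  show ?thesis unfolding Hpart_ent by (rule entropy_le)
qed

lemma fiber_entropy_le:
  assumes jk: "jn \<in> joinings X \<nu> T" "disintegration X \<nu> jn \<kappa>"
  shows "fiber_entropy X \<nu> \<kappa> \<le> pstar - (\<integral>z. G (fst z) (snd z) \<partial>jn)"
  unfolding fiber_entropy_def
  by (rule cSUP_least) (use fin_partitions_ne partition_entropy_le[OF jk] in auto)

text \<open>The time-zero partition already realises the fiber entropy of the optimal joining.\<close>

theorem fiber_variational_principle:
  "\<exists>jn \<kappa>. jn \<in> joinings X \<nu> T \<and> disintegration X \<nu> jn \<kappa> \<and>
     fiber_entropy X \<nu> \<kappa> = pstar - (\<integral>z. G (fst z) (snd z) \<partial>jn)"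
proof -
  obtain jn \<kappa> where opt: "jn \<in> joinings X \<nu> T \<and> disintegration X \<nu> jn \<kappa> \<and>
     (\<forall>q Q. q > 0 \<and> (\<forall>v\<in>W q. \<forall>y. 0 < Q v y) \<and> (\<forall>y. (\<Sum>v\<in>W q. Q v y) \<le> 1) \<and>
        (\<forall>v\<in>W q. integrable \<nu> (\<lambda>y. - ln (Q v y))) \<longrightarrow>
        q * (pstar - (\<integral>z. G (fst z) (snd z) \<partial>jn)) \<le> (\<integral>z. - ln (Q (pre q (fst z)) (snd z)) \<partial>jn))"
    using optimal_joining_exists by (elim exE)
  have jk: "jn \<in> joinings X \<nu> T" "disintegration X \<nu> jn \<kappa>" using conjunct1[OF opt] conjunct1[OF conjunct2[OF opt]] by auto
  note bound = conjunct2[OF conjunct2[OF opt], rule_format]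
  define cell where "cell a = {x \<in> X. x 0 = a}" for a
  define \<xi> where "\<xi> = range cell"
  have cell_sets: "cell a \<in> sets XM" for a
  proof -
    have "cell a = {x \<in> X. pre 1 (shZ 0 x) = [a]}" by (auto simp: cell_def pre_def)
    then show ?thesis using cylinder_sets[of 1 0 "[a]"] by simp
  qed
  have \<xi>: "fin_partition X \<xi>" unfolding fin_partition_def \<xi>_def using cell_sets by (auto simp: cell_def)
  interpret joining X \<nu> T jn \<kappa> by unfold_locales (use jk in auto)
  interpret label_partition X \<xi> by unfold_locales (rule \<xi>)
  interpret joining_partition X \<nu> T jn \<kappa> \<xi> by unfold_locales
  let ?I = "pstar - (\<integral>z. G (fst z) (snd z) \<partial>jn)"
  have code: "code q x = map cell (pre q x)" if x: "x \<in> X" for q x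
  proof (rule nth_equalityI)
    fix k assume "k < length (code q x)"
    then have k: "k < q" by simp
    have "lab ((shift ^^ k) x) = cell (x (int k))"
      using lab_eq[of "(shift ^^ k) x" "cell (x (int k))"] x by (simp add: \<xi>_def cell_def funpow_shift)
    then show "code q x ! k = map cell (pre q x) ! k" using k by simp
  qed simp
  \<comment> \<open>Letters that never occur in \<open>X\<close> share the empty cell, so
    \<open>map cell\<close> separates words only when they occur.\<close>
  have inj: "inj_on (map cell) (W q)" for q
  proof (rule inj_onI)
    fix v v' assume v: "v \<in> W q" "v' \<in> W q" "map cell v = map cell v'"
    show "v = v'"
    proof (rule nth_equalityI)
      show "length v = length v'" using W_length[OF v(1)] W_length[OF v(2)] by simp
      fix k assume k: "k < length v"
      then have k': "k < q" using W_length[OF v(1)] by simp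
      have "cell (v ! k) = cell (v' ! k)" using arg_cong[OF v(3), of "\<lambda>l. l ! k"] k W_length[OF v(1)] W_length[OF v(2)] by simp
      moreover have m: "(shift ^^ k) (rep v) 0 = v ! k"
        using rep[OF v(1)] nth_pre[OF k', of "rep v"] by (simp add: funpow_shift)
      moreover have "(shift ^^ k) (rep v) \<in> cell (v ! k)"
        using rep[OF v(1)] m by (simp add: cell_def)
      ultimately have "(shift ^^ k) (rep v) \<in> cell (v' ! k)" by (simp only:)
      then show "v ! k = v' ! k" using m unfolding cell_def by simp
    qed
  qed
  have cellW: "map cell v \<in> words_in \<xi> q" if "v \<in> W q" for v q
    using W_length[OF that] by (auto simp: words_in_def \<xi>_def)
  have le: "?I \<le> ent q / q" if q: "q > 0" for q
  proof -
    have "q * ?I \<le> ent q"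
    proof (rule field_le_epsilon)
      fix d :: real assume d: "d > 0"
      let ?k = "real (card (words_in \<xi> q))"
      define \<epsilon> where "\<epsilon> = d / (?k + 1)"
      have \<epsilon>: "\<epsilon> > 0" using d by (simp add: \<epsilon>_def)
      \<comment> \<open>The test weights are the smoothed laws of the first \<open>q\<close> letters
        over \<open>y\<close>, taken from the disintegration of the optimal joining itself.\<close>
      have "q * ?I \<le> (\<integral>z. - ln (smooth \<epsilon> q (map cell (pre q (fst z))) (snd z)) \<partial>jn)"
      proof (rule bound, intro conjI ballI allI)
        fix v y assume v: "v \<in> W q"
        show "0 < smooth \<epsilon> q (map cell v) y" by (rule smooth_pos[OF \<epsilon>])
      next
        fix y
        have "(\<Sum>v\<in>W q. smooth \<epsilon> q (map cell v) y) = (\<Sum>c\<in>map cell ` W q. smooth \<epsilon> q c y)"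
          by (simp add: sum.reindex[OF inj])
        also have "\<dots> \<le> (\<Sum>c\<in>words_in \<xi> q. smooth \<epsilon> q c y)"
          by (rule sum_mono2) (use cellW fin less_imp_le[OF smooth_pos[OF \<epsilon>]] in auto)
        finally show "(\<Sum>v\<in>W q. smooth \<epsilon> q (map cell v) y) \<le> 1" by (simp add: smooth_sum[OF \<epsilon>])
      next
        fix v assume v: "v \<in> W q"
        show "integrable \<nu> (\<lambda>y. - ln (smooth \<epsilon> q (map cell v) y))" by (rule smooth_integrable[OF \<epsilon> cellW[OF v]])
      qed (rule q)
      also have "\<dots> = (\<integral>z. - ln (smooth \<epsilon> q (code q (fst z)) (snd z)) \<partial>jn)"
        by (rule Bochner_Integration.integral_cong) (auto simp: space_jn code)
      also have "\<dots> \<le> ent q + \<epsilon> * ?k" by (rule smooth_jn(2)[OF \<epsilon>])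
      also have "\<epsilon> * ?k \<le> d" using d by (simp add: \<epsilon>_def divide_le_eq)
      finally show "q * ?I \<le> ent q + d" by simp
    qed
    then show ?thesis using q by (simp add: le_divide_eq mult.commute)
  qed
  have lim: "(\<lambda>n. ent n / n) \<longlonglongrightarrow> lim (\<lambda>n. ent n / n)" using ent_convergent by (simp add: convergent_LIMSEQ_iff)
  have "?I \<le> lim (\<lambda>n. ent n / n)"
    by (rule LIMSEQ_le_const[OF lim]) (intro exI[of _ 1] allI impI le, simp)
  also have "\<dots> = lim (\<lambda>n. (\<integral>y. Hpart (\<kappa> y) (join_n X \<xi> n) \<partial>\<nu>) / real n)" by (simp only: Hpart_ent)
  also have "\<dots> \<le> fiber_entropy X \<nu> \<kappa>"
    unfolding fiber_entropy_def
  proof (rule cSUP_upper)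
    show "\<xi> \<in> fin_partitions X" using \<xi> by (simp add: fin_partitions_def)
    show "bdd_above ((\<lambda>\<alpha>. lim (\<lambda>n. (\<integral>y. Hpart (\<kappa> y) (join_n X \<alpha> n) \<partial>\<nu>) / real n)) ` fin_partitions X)"
      by (rule bdd_aboveI2) (rule partition_entropy_le[OF jk])
  qed
  finally have "?I \<le> fiber_entropy X \<nu> \<kappa>" .
  then have "fiber_entropy X \<nu> \<kappa> = ?I" using fiber_entropy_le[OF jk] by (rule antisym[rotated])
  then show ?thesis using jk by (intro exI conjI) auto
qed

text \<open>The functional in the rate function is minus the sum of the fiber entropy and the mean
  of \<open>G\<close>. The variational principle shows that its infimum is attained, which also
  makes the real-valued infimum meaningful.\<close>

lemma rate_value:
  fixes f :: "(int \<Rightarrow> 'a) \<Rightarrow> real" and l :: "(int \<Rightarrow> 'a) \<Rightarrow> 'y \<Rightarrow> real"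
  assumes G_eq: "\<And>x y. x \<in> X \<Longrightarrow> G x y = f x - P - l x y"
    and f: "f \<in> borel_measurable XM" "\<And>x. x \<in> X \<Longrightarrow> \<bar>f x\<bar> \<le> B"
  shows "(INF p\<in>{(jn, \<kappa>). jn \<in> joinings X \<nu> T \<and> disintegration X \<nu> jn \<kappa>}.
      (\<integral>z. l (fst z) (snd z) \<partial>(fst p)) + (P - fiber_entropy X \<nu> (snd p) - (\<integral>z. f (fst z) \<partial>(fst p)))) = - pstar"
proof -
  have val: "(\<integral>z. l (fst z) (snd z) \<partial>jn) + (P - fiber_entropy X \<nu> \<kappa> - (\<integral>z. f (fst z) \<partial>jn)) =
      - (fiber_entropy X \<nu> \<kappa> + (\<integral>z. G (fst z) (snd z) \<partial>jn))"
    if jk: "jn \<in> joinings X \<nu> T" "disintegration X \<nu> jn \<kappa>" for jn \<kappa>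
  proof -
    interpret joining X \<nu> T jn \<kappa> by unfold_locales (use jk in auto)
    have iG: "integrable jn (\<lambda>z. G (fst z) (snd z))"
    proof (rule Bochner_Integration.integrable_bound[OF jn_snd(1)[OF b_int]])
      show "(\<lambda>z. G (fst z) (snd z)) \<in> borel_measurable jn" using G_joint by (simp cong: measurable_cong_sets add: sets_jn)
      show "AE z in jn. norm (G (fst z) (snd z)) \<le> norm (b (snd z))"
        using G_bound b_nonneg by (intro AE_I2) (auto simp: space_jn)
    qed
    have if': "integrable jn (\<lambda>z. f (fst z))"
      by (rule J.integrable_const_bound[where B = B])
        (use f measurable_compose[OF fst_measurable f(1)] in \<open>auto intro!: AE_I2 simp: space_jn\<close>)
    have "(\<integral>z. l (fst z) (snd z) \<partial>jn) = (\<integral>z. f (fst z) - P - G (fst z) (snd z) \<partial>jn)"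
      by (rule Bochner_Integration.integral_cong) (auto simp: space_jn G_eq)
    also have "\<dots> = (\<integral>z. f (fst z) \<partial>jn) - P - (\<integral>z. G (fst z) (snd z) \<partial>jn)"
      using iG if' J.prob_space by simp
    finally show ?thesis by simp
  qed
  obtain jn \<kappa> where opt: "jn \<in> joinings X \<nu> T" "disintegration X \<nu> jn \<kappa>"
     "fiber_entropy X \<nu> \<kappa> = pstar - (\<integral>z. G (fst z) (snd z) \<partial>jn)"
    using fiber_variational_principle by blast
  show ?thesis
  proof (rule cInf_eq_minimum)
    show "- pstar \<in> (\<lambda>p. (\<integral>z. l (fst z) (snd z) \<partial>(fst p)) + (P - fiber_entropy X \<nu> (snd p) - (\<integral>z. f (fst z) \<partial>(fst p)))) `
        {(jn, \<kappa>). jn \<in> joinings X \<nu> T \<and> disintegration X \<nu> jn \<kappa>}"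
      by (rule image_eqI[of _ _ "(jn, \<kappa>)"]) (use opt val[OF opt(1,2)] in auto)
    fix t assume "t \<in> (\<lambda>p. (\<integral>z. l (fst z) (snd z) \<partial>(fst p)) + (P - fiber_entropy X \<nu> (snd p) - (\<integral>z. f (fst z) \<partial>(fst p)))) `
        {(jn, \<kappa>). jn \<in> joinings X \<nu> T \<and> disintegration X \<nu> jn \<kappa>}"
    then obtain jn' \<kappa>' where t: "jn' \<in> joinings X \<nu> T" "disintegration X \<nu> jn' \<kappa>'"
      "t = (\<integral>z. l (fst z) (snd z) \<partial>jn') + (P - fiber_entropy X \<nu> \<kappa>' - (\<integral>z. f (fst z) \<partial>jn'))" by auto
    then show "- pstar \<le> t" using val[OF t(1,2)] fiber_entropy_le[OF t(1,2)] by simp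
  qed
qed

end

section \<open>The family of Gibbs measures\<close>

lemma dX_nonneg [simp]: "0 \<le> dX x z"
  by (simp add: dX_def)

lemma dX_pos: "x \<noteq> z \<Longrightarrow> 0 < dX x z"
  by (simp add: dX_def)

lemma dX_agree:
  assumes "\<And>i. \<bar>i\<bar> < int N \<Longrightarrow> x i = z i" shows "dX x z \<le> (1/2) ^ N"
proof (cases "x = z")
  case False
  then obtain j where j: "x j \<noteq> z j" by blast
  let ?P = "\<lambda>n. \<exists>i. nat \<bar>i\<bar> = n \<and> x i \<noteq> z i"
  have "?P (LEAST n. ?P n)" by (rule LeastI[of ?P "nat \<bar>j\<bar>"]) (use j in blast)
  then obtain i where i: "nat \<bar>i\<bar> = (LEAST n. ?P n)" "x i \<noteq> z i" by (elim exE conjE)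
  have "\<not> \<bar>i\<bar> < int N" using assms[of i] i(2) by blast
  then have "N \<le> (LEAST n. ?P n)" unfolding i(1)[symmetric] by linarith
  then have "(1/2::real) ^ (LEAST n. ?P n) \<le> (1/2) ^ N" by (intro power_decreasing) auto
  then show ?thesis using False by (simp add: dX_def)
qed (simp add: dX_def)

lemma dX_cen: "cen M x = cen M z \<Longrightarrow> dX x z \<le> (1/2) ^ M"
  by (rule dX_agree) (auto simp: cen_eq_iff)

lemma half_power_powr: "((1/2::real) ^ n) powr r = ((1/2) powr r) ^ n"
proof -
  have "((1/2::real) ^ n) powr r = ((1/2) powr real n) powr r" by (subst powr_realpow) auto
  also have "\<dots> = ((1/2) powr r) powr real n" by (simp only: powr_powr mult.commute)
  finally show ?thesis by (subst powr_realpow[symmetric]) auto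
qed

text \<open>Source of the Lipschitz dependence of \<open>P\<close> and of
  \<open>fiber_pressure\<close> on the potential.\<close>

lemma ln_sum_exp_diff:
  fixes a c :: "'b \<Rightarrow> real"
  assumes S: "finite S" "S \<noteq> {}" and d: "\<And>s. s \<in> S \<Longrightarrow> \<bar>a s - c s\<bar> \<le> d"
  shows "\<bar>ln (\<Sum>s\<in>S. exp (a s)) - ln (\<Sum>s\<in>S. exp (c s))\<bar> \<le> d"
proof -
  have pos: "0 < (\<Sum>s\<in>S. exp (h s :: real))" for h by (rule sum_pos) (use S in auto)
  have le: "ln (\<Sum>s\<in>S. exp (h s)) \<le> ln (\<Sum>s\<in>S. exp (k s)) + d" if hk: "\<And>s. s \<in> S \<Longrightarrow> h s \<le> k s + d" for h k :: "'b \<Rightarrow> real"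
  proof -
    have "(\<Sum>s\<in>S. exp (h s)) \<le> (\<Sum>s\<in>S. exp (k s) * exp d)"
      by (rule sum_mono) (use hk in \<open>simp add: exp_add[symmetric]\<close>)
    then have "(\<Sum>s\<in>S. exp (h s)) \<le> (\<Sum>s\<in>S. exp (k s)) * exp d" by (simp add: sum_distrib_right)
    then have "ln (\<Sum>s\<in>S. exp (h s)) \<le> ln ((\<Sum>s\<in>S. exp (k s)) * exp d)" using pos[of h] by (intro ln_mono) auto
    also have "\<dots> = ln (\<Sum>s\<in>S. exp (k s)) + d" using pos[of k] by (simp add: ln_mult_pos)
    finally show ?thesis .
  qed
  have "a s \<le> c s + d" "c s \<le> a s + d" if "s \<in> S" for s using d[OF that] by linarith+
  then have "ln (\<Sum>s\<in>S. exp (a s)) \<le> ln (\<Sum>s\<in>S. exp (c s)) + d" "ln (\<Sum>s\<in>S. exp (c s)) \<le> ln (\<Sum>s\<in>S. exp (a s)) + d"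
    using le by blast+
  then show ?thesis by linarith
qed

lemma linear_bound_limit:
  fixes a e K :: real
  assumes "\<And>m::nat. m \<ge> 1 \<Longrightarrow> real m * a \<le> real m * e + K"
  shows "a \<le> e"
proof (rule LIMSEQ_le_const)
  have "(\<lambda>m. e + K / real m) \<longlonglongrightarrow> e + 0"
    by (intro tendsto_intros tendsto_divide_0[OF tendsto_const] filterlim_at_top_imp_at_infinity filterlim_real_sequentially)
  then show "(\<lambda>m. e + K / real m) \<longlonglongrightarrow> e" by simp
  show "\<exists>N. \<forall>m\<ge>N. a \<le> e + K / real m"
  proof (intro exI[of _ 1] allI impI)
    fix m :: nat assume "m \<ge> 1"
    then show "a \<le> e + K / real m" using assms[of m] by (simp add: field_simps)
  qed
qed

context sft
begin

text \<open>A function continuous in \<open>x\<close> and measurable in \<open>y\<close> is a limit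
  of functions that see \<open>x\<close> only through a finite window; these have countably many
  sections and are jointly measurable.\<close>

lemma pair_measurable_of_continuous:
  fixes h :: "(int \<Rightarrow> 'a) \<Rightarrow> 'y::topological_space \<Rightarrow> real"
  assumes meas: "\<And>x. x \<in> X \<Longrightarrow> h x \<in> borel_measurable borel"
    and cont: "\<And>x y \<epsilon>. x \<in> X \<Longrightarrow> \<epsilon> > 0 \<Longrightarrow> \<exists>\<delta>>0. \<forall>x'\<in>X. dX x' x < \<delta> \<longrightarrow> \<bar>h x' y - h x y\<bar> < \<epsilon>"
  shows "(\<lambda>z. h (fst z) (snd z)) \<in> borel_measurable (XM \<Otimes>\<^sub>M borel)"
proof -
  obtain x0 where x0: "x0 \<in> X" using X_ne by blast
  \<comment> \<open>Words that do not occur get the default \<open>x0\<close>, so that the chosen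
    point lies in \<open>X\<close> for every argument.\<close>
  define sel where "sel M v = (if \<exists>x\<in>X. cen M x = v then (SOME x. x \<in> X \<and> cen M x = v) else x0)" for M v
  have sel_X: "sel M v \<in> X" for M v
  proof (cases "\<exists>x\<in>X. cen M x = v")
    case True
    then have "\<exists>x. x \<in> X \<and> cen M x = v" by blast
    from someI_ex[OF this] show ?thesis using True by (simp add: sel_def)
  qed (simp add: sel_def x0)
  have sel_cen: "cen M (sel M (cen M x)) = cen M x" if "x \<in> X" for M x
  proof -
    have ex: "\<exists>z. z \<in> X \<and> cen M z = cen M x" using that by blast
    from someI_ex[OF ex] show ?thesis using ex unfolding sel_def by auto
  qed
  define q where "q M z = h (sel M (cen M (fst z))) (snd z)" for M and z :: "(int \<Rightarrow> 'a) \<times> 'y"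
  have q_meas: "q M \<in> borel_measurable (XM \<Otimes>\<^sub>M borel)" for M
    unfolding q_def
  proof (rule measurable_compose_countable)
    show "(\<lambda>z. cen M (fst z)) \<in> measurable (XM \<Otimes>\<^sub>M (borel :: 'y measure)) (count_space UNIV)"
      by (rule measurable_compose[OF measurable_fst cen_measurable])
    show "(\<lambda>z. h (sel M v) (snd z)) \<in> borel_measurable (XM \<Otimes>\<^sub>M borel)" for v
      by (rule measurable_compose[OF measurable_snd meas[OF sel_X]])
  qed
  show ?thesis
  proof (rule borel_measurable_LIMSEQ_real[OF _ q_meas])
    fix z :: "(int \<Rightarrow> 'a) \<times> 'y" assume "z \<in> space (XM \<Otimes>\<^sub>M borel)"
    then have z: "fst z \<in> X" by (auto simp: space_pair_measure)
    show "(\<lambda>M. q M z) \<longlonglongrightarrow> h (fst z) (snd z)"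
    proof (rule tendstoI)
      fix \<epsilon> :: real assume "\<epsilon> > 0"
      then obtain \<delta> where \<delta>: "\<delta> > 0" "\<And>x'. x' \<in> X \<Longrightarrow> dX x' (fst z) < \<delta> \<Longrightarrow> \<bar>h x' (snd z) - h (fst z) (snd z)\<bar> < \<epsilon>"
        using cont[OF z] by blast
      have "(\<lambda>M. (1/2::real) ^ M) \<longlonglongrightarrow> 0" by (rule LIMSEQ_realpow_zero) auto
      then have "eventually (\<lambda>M. (1/2::real) ^ M < \<delta>) sequentially" using \<delta>(1) by (rule order_tendstoD(2))
      then show "eventually (\<lambda>M. dist (q M z) (h (fst z) (snd z)) < \<epsilon>) sequentially"
      proof eventually_elim
        case (elim M)
        have "dX (sel M (cen M (fst z))) (fst z) < \<delta>"
          using dX_cen[OF sel_cen[OF z]] elim by (rule order_le_less_trans)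
        then show ?case using \<delta>(2)[OF sel_X] by (simp add: q_def dist_real_def)
      qed
    qed
  qed
qed

lemma measurable_of_continuous:
  assumes "\<And>x \<epsilon>. x \<in> X \<Longrightarrow> \<epsilon> > 0 \<Longrightarrow> \<exists>\<delta>>0. \<forall>x'\<in>X. dX x' x < \<delta> \<longrightarrow> \<bar>h x' - h x :: real\<bar> < \<epsilon>"
  shows "h \<in> borel_measurable XM"
proof -
  have "(\<lambda>z. (\<lambda>x (y::real). h x) (fst z) (snd z)) \<in> borel_measurable (XM \<Otimes>\<^sub>M borel)"
    by (rule pair_measurable_of_continuous) (use assms in auto)
  from measurable_compose[OF _ this, of "\<lambda>x. (x, 0)" XM] show ?thesis by simp
qed

text \<open>At time \<open>k\<close> two points of one cylinder agree around the origin as far as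
  the nearer end of the word, so the differences are bounded by two geometric series, one from each
  end.\<close>

lemma holder_distortion:
  assumes r: "r > 0" and C: "0 \<le> C" and hol: "\<And>x z. x \<in> X \<Longrightarrow> z \<in> X \<Longrightarrow> \<bar>F x - F z\<bar> \<le> C * dX x z powr r"
    and x: "x \<in> X" "z \<in> X" "pre n x = pre n z"
  shows "\<bar>ergodic_sum F n x - ergodic_sum F n z\<bar> \<le> 2 * C / (1 - (1/2) powr r)"
proof -
  let ?q = "(1/2::real) powr r"
  have q1: "?q < 1"
  proof -
    have "?q < 1 powr r" by (rule powr_less_mono2) (use r in auto)
    then show ?thesis by simp
  qed
  have q0: "0 \<le> ?q" by simp
  have bnd: "\<bar>F ((shift ^^ k) x) - F ((shift ^^ k) z)\<bar> \<le> C * (?q ^ k + ?q ^ (n - Suc k))" if k: "k < n" for k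
  proof -
    \<comment> \<open>A coordinate \<open>i\<close> at time \<open>k\<close> is coordinate
      \<open>i + k\<close> at time zero; it lies in \<open>[0, n)\<close> as soon as
      \<open>\<bar>i\<bar> < min (k + 1) (n - k)\<close>.\<close>
    let ?N = "min (k + 1) (n - k)"
    have "dX ((shift ^^ k) x) ((shift ^^ k) z) \<le> (1/2) ^ ?N"
    proof (rule dX_agree)
      fix i assume i: "\<bar>i\<bar> < int ?N"
      then have "nat (i + int k) < n" "0 \<le> i + int k" using k by linarith+
      moreover have "x (int (nat (i + int k))) = z (int (nat (i + int k)))"
        using x(3) calculation(1) unfolding pre_eq_iff by blast
      ultimately show "(shift ^^ k) x i = (shift ^^ k) z i" by (simp add: funpow_shift)
    qed
    then have "dX ((shift ^^ k) x) ((shift ^^ k) z) powr r \<le> ((1/2) ^ ?N) powr r" using r by (intro powr_mono2) auto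
    also have "\<dots> = ?q ^ ?N" by (rule half_power_powr)
    also have "\<dots> \<le> ?q ^ k + ?q ^ (n - Suc k)"
    proof (cases "k + 1 \<le> n - k")
      case True
      have "?q ^ (k + 1) \<le> ?q ^ k" using q0 q1 by (intro power_decreasing) auto
      then show ?thesis using True zero_le_power[OF q0, of "n - Suc k"] by (simp only: min_absorb1)
    next
      case False
      have "?q ^ (n - k) \<le> ?q ^ (n - Suc k)" using q0 q1 by (intro power_decreasing) auto
      moreover have "?N = n - k" using False by simp
      ultimately show ?thesis using zero_le_power[OF q0, of k] by (simp only:)
    qed
    finally have "C * dX ((shift ^^ k) x) ((shift ^^ k) z) powr r \<le> C * (?q ^ k + ?q ^ (n - Suc k))"
      using C by (rule mult_left_mono)
    then show ?thesis using hol[of "(shift ^^ k) x" "(shift ^^ k) z"] x by simp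
  qed
  have geo: "(\<Sum>k<n. ?q ^ k) \<le> 1 / (1 - ?q)"
  proof -
    have "(\<Sum>k<n. ?q ^ k) = (1 - ?q ^ n) / (1 - ?q)" using q1 by (subst sum_gp_strict) auto
    also have "\<dots> \<le> 1 / (1 - ?q)" using q1 q0 by (intro divide_right_mono) auto
    finally show ?thesis .
  qed
  have "\<bar>ergodic_sum F n x - ergodic_sum F n z\<bar> \<le> (\<Sum>k<n. \<bar>F ((shift ^^ k) x) - F ((shift ^^ k) z)\<bar>)"
    unfolding ergodic_sum_def sum_subtractf[symmetric] by (rule sum_abs)
  also have "\<dots> \<le> (\<Sum>k<n. C * (?q ^ k + ?q ^ (n - Suc k)))" by (rule sum_mono) (use bnd in auto)
  also have "\<dots> = C * ((\<Sum>k<n. ?q ^ k) + (\<Sum>k<n. ?q ^ (n - Suc k)))"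
    by (simp only: sum.distrib sum_distrib_left[symmetric])
  also have "(\<Sum>k<n. ?q ^ (n - Suc k)) = (\<Sum>k<n. ?q ^ k)" by (rule sum.nat_diff_reindex)
  also have "C * ((\<Sum>k<n. ?q ^ k) + (\<Sum>k<n. ?q ^ k)) \<le> C * (1 / (1 - ?q) + 1 / (1 - ?q))"
    using geo C by (intro mult_left_mono add_mono) auto
  finally show ?thesis by (simp add: field_simps)
qed

end

section \<open>The parametrised family and its normalised potentials\<close>

locale gibbs_posterior = ergodic_system \<nu> T
  for \<nu> :: "'y::polish_space measure" and T :: "'y \<Rightarrow> 'y" +
  fixes X :: "(int \<Rightarrow> 'a::finite) set"
    and f :: "'p::metric_space \<Rightarrow> (int \<Rightarrow> 'a) \<Rightarrow> real" and r :: real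
    and \<mu> :: "'p \<Rightarrow> (int \<Rightarrow> 'a) measure"
    and L :: "'p \<Rightarrow> (int \<Rightarrow> 'a) \<Rightarrow> 'y \<Rightarrow> real"
    and Lstar :: "'y \<Rightarrow> real" and \<rho> :: "real \<Rightarrow> 'y \<Rightarrow> real"
  assumes X_SFT: "mixing_SFT X"
    and \<Theta>_compact: "compact (UNIV :: 'p set)"
    and f_reg: "regular_family r X f"
    and \<mu>_gibbs: "gibbs_measure X (f \<theta>) (\<mu> \<theta>)"
    and L_cont: "x \<in> X \<Longrightarrow> \<epsilon> > 0 \<Longrightarrow> \<exists>\<delta>>0. \<forall>\<theta>' x' y'. x' \<in> X \<and>
                 dist \<theta>' \<theta> < \<delta> \<and> dX x' x < \<delta> \<and> dist y' y < \<delta> \<longrightarrow>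
                 \<bar>L \<theta>' x' y' - L \<theta> x y\<bar> < \<epsilon>"
    and Lstar_bound: "x \<in> X \<Longrightarrow> \<bar>L \<theta> x y\<bar> \<le> Lstar y"
    and Lstar_int: "integrable \<nu> Lstar"
    and \<rho>_meas: "\<delta> > 0 \<Longrightarrow> \<rho> \<delta> \<in> borel_measurable borel"
    and \<rho>_pos: "\<delta> > 0 \<Longrightarrow> \<rho> \<delta> y > 0"
    and \<rho>_bound: "\<delta> > 0 \<Longrightarrow> x \<in> X \<Longrightarrow> x' \<in> X \<Longrightarrow>
                 max (dist \<theta> \<theta>') (dX x x') \<le> \<delta> \<Longrightarrow> \<bar>L \<theta> x y - L \<theta>' x' y\<bar> \<le> \<rho> \<delta> y"
    and \<rho>_lim: "((\<lambda>\<delta>. \<integral>\<^sup>+ y. ennreal (\<rho> \<delta> y) \<partial>\<nu>) \<longlongrightarrow> 0) (at_right 0)"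
begin

lemma mu_inv: "\<mu> \<theta> \<in> shift_inv_probs X"
  using \<mu>_gibbs by (simp add: gibbs_measure_def)

lemma mu_prob: "prob_space (\<mu> \<theta>)" and sets_mu: "sets (\<mu> \<theta>) = sets (Xmeas X)"
  using mu_inv[of \<theta>] by (simp_all add: shift_inv_probs_def)

text \<open>\<open>X\<close> is nonempty because it carries a probability measure, the Gibbs measure
  of an arbitrary parameter.\<close>

sublocale sft X
proof
  show "mixing_SFT X" by (rule X_SFT)
  have "space (Xmeas X) = X" unfolding Xmeas_def by (rule space_measure_of) auto
  then show "X \<noteq> {}" using prob_space.not_empty[OF mu_prob[of undefined]] sets_eq_imp_space_eq[OF sets_mu[of undefined]] by simp
qed

lemma space_mu [simp]: "space (\<mu> \<theta>) = X"
  using sets_eq_imp_space_eq[OF sets_mu] by simp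

lemma r_pos: "r > 0"
  using f_reg by (simp add: regular_family_def)

definition P :: "'p \<Rightarrow> real" where "P \<theta> = pressure X (f \<theta>)"

text \<open>With the pressure subtracted, the Gibbs property compares cylinders directly with
  \<open>exp (ergodic_sum (F \<theta>) n x)\<close>, as \<open>sft_potential.uniform_gibbs\<close>
  expects.\<close>

definition F :: "'p \<Rightarrow> (int \<Rightarrow> 'a) \<Rightarrow> real" where "F \<theta> x = f \<theta> x - P \<theta>"

lemma ergodic_sum_F: "ergodic_sum (F \<theta>) n x = - real n * P \<theta> + (\<Sum>k<n. f \<theta> ((shift ^^ k) x))"
  by (simp add: ergodic_sum_def F_def sum_subtractf)

lemma gibbs_bounds:
  "\<exists>K>0. \<forall>x\<in>X. \<forall>n\<ge>1. inverse K \<le> measure (\<mu> \<theta>) (cyl X x n) / exp (ergodic_sum (F \<theta>) n x) \<and>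
      measure (\<mu> \<theta>) (cyl X x n) / exp (ergodic_sum (F \<theta>) n x) \<le> K"
  using \<mu>_gibbs[of \<theta>] unfolding gibbs_measure_def P_def[symmetric] ergodic_sum_F by (rule conjunct2)

lemma cyl_sets: "cyl X x n \<in> sets (\<mu> \<theta>)"
  using cylinder_sets[of n 0 "pre n x"] by (simp add: cyl_eq sets_mu)

lemma sum_cyl: "(\<Sum>w\<in>W n. measure (\<mu> \<theta>) (cyl X (rep w) n)) = 1"
proof -
  interpret m: prob_space "\<mu> \<theta>" by (rule mu_prob)
  have "(\<Sum>w\<in>W n. measure (\<mu> \<theta>) {x \<in> X. pre n x = w}) = measure (\<mu> \<theta>) X"
    by (rule m.measure_fibres) (use cylinder_sets[of n 0] sets.top[of XM] in \<open>auto simp: sets_mu\<close>)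
  then show ?thesis using m.prob_space by (simp add: cyl_eq rep(2))
qed

text \<open>The cylinders of length \<open>n\<close> have total mass one, so by the Gibbs property
  the log partition sum is \<open>real n * P \<theta>\<close> up to a bounded error. The pressure is
  thus handled as a growth rate instead of through its definition as a supremum.\<close>

lemma P_Lipschitz:
  assumes "\<And>x. x \<in> X \<Longrightarrow> \<bar>f \<theta> x - f \<theta>' x\<bar> \<le> \<epsilon>"
  shows "\<bar>P \<theta> - P \<theta>'\<bar> \<le> \<epsilon>"
proof -
  define S where "S \<theta> n = (\<Sum>w\<in>W n. exp (\<Sum>k<n. f \<theta> ((shift ^^ k) (rep w))))" for \<theta> n
  have S_pos: "0 < S \<theta> n" for \<theta> n unfolding S_def by (rule sum_pos) auto
  have S: "\<exists>K. \<forall>n\<ge>1. \<bar>ln (S \<theta> n) - real n * P \<theta>\<bar> \<le> K" for \<theta>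
  proof -
    obtain K where K: "K > 0" "\<And>x n. x \<in> X \<Longrightarrow> n \<ge> 1 \<Longrightarrow> inverse K \<le> measure (\<mu> \<theta>) (cyl X x n) / exp (ergodic_sum (F \<theta>) n x) \<and>
      measure (\<mu> \<theta>) (cyl X x n) / exp (ergodic_sum (F \<theta>) n x) \<le> K" using gibbs_bounds[of \<theta>] by blast
    have "\<bar>ln (S \<theta> n) - real n * P \<theta>\<bar> \<le> ln K" if n: "n \<ge> 1" for n
    proof -
      let ?e = "\<Sum>w\<in>W n. exp (ergodic_sum (F \<theta>) n (rep w))"
      have e: "?e = S \<theta> n * exp (- real n * P \<theta>)"
        unfolding S_def ergodic_sum_F exp_add sum_distrib_right by (simp add: mult.commute)
      have "(\<Sum>w\<in>W n. inverse K * exp (ergodic_sum (F \<theta>) n (rep w))) \<le> (\<Sum>w\<in>W n. measure (\<mu> \<theta>) (cyl X (rep w) n))"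
        by (rule sum_mono) (use K(2)[OF rep(1) n] in \<open>auto simp: le_divide_eq\<close>)
      then have "inverse K * ?e \<le> 1" by (simp only: sum_distrib_left[symmetric] sum_cyl)
      then have u: "?e \<le> K" using K(1) by (simp add: field_simps)
      have "(\<Sum>w\<in>W n. measure (\<mu> \<theta>) (cyl X (rep w) n)) \<le> (\<Sum>w\<in>W n. K * exp (ergodic_sum (F \<theta>) n (rep w)))"
        by (rule sum_mono) (use K(2)[OF rep(1) n] in \<open>auto simp: divide_le_eq\<close>)
      then have l: "1 \<le> K * ?e" by (simp only: sum_distrib_left[symmetric] sum_cyl)
      have ep: "0 < ?e" unfolding e using S_pos[of \<theta> n] by simp
      have le: "ln ?e = ln (S \<theta> n) - real n * P \<theta>" unfolding e using S_pos[of \<theta> n] by (simp add: ln_mult_pos)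
      have "ln ?e \<le> ln K" using u ep by (intro ln_mono) auto
      moreover have "0 \<le> ln K + ln ?e" using l K(1) ep ln_ge_zero[OF l] by (simp add: ln_mult_pos)
      ultimately show ?thesis unfolding le by linarith
    qed
    then show ?thesis by blast
  qed
  obtain K where K: "\<And>n. n \<ge> 1 \<Longrightarrow> \<bar>ln (S \<theta> n) - real n * P \<theta>\<bar> \<le> K" using S[of \<theta>] by blast
  obtain K' where K': "\<And>n. n \<ge> 1 \<Longrightarrow> \<bar>ln (S \<theta>' n) - real n * P \<theta>'\<bar> \<le> K'" using S[of \<theta>'] by blast
  have d: "\<bar>ln (S \<theta> n) - ln (S \<theta>' n)\<bar> \<le> real n * \<epsilon>" for n
    unfolding S_def
  proof (rule ln_sum_exp_diff)
    fix w assume w: "w \<in> W n"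
    have "\<bar>(\<Sum>k<n. f \<theta> ((shift ^^ k) (rep w))) - (\<Sum>k<n. f \<theta>' ((shift ^^ k) (rep w)))\<bar>
        \<le> (\<Sum>k<n. \<bar>f \<theta> ((shift ^^ k) (rep w)) - f \<theta>' ((shift ^^ k) (rep w))\<bar>)"
      unfolding sum_subtractf[symmetric] by (rule sum_abs)
    also have "\<dots> \<le> (\<Sum>k<n. \<epsilon>)" by (rule sum_mono) (use assms rep(1)[OF w] in auto)
    finally show "\<bar>(\<Sum>k<n. f \<theta> ((shift ^^ k) (rep w))) - (\<Sum>k<n. f \<theta>' ((shift ^^ k) (rep w)))\<bar> \<le> real n * \<epsilon>" by simp
  qed auto
  have "P \<theta> - P \<theta>' \<le> \<epsilon>"
  proof (rule linear_bound_limit[where K = "K + K'"])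
    fix n :: nat assume "n \<ge> 1"
    then show "real n * (P \<theta> - P \<theta>') \<le> real n * \<epsilon> + (K + K')"
      using K[of n] K'[of n] d[of n] unfolding right_diff_distrib by linarith
  qed
  moreover have "P \<theta>' - P \<theta> \<le> \<epsilon>"
  proof (rule linear_bound_limit[where K = "K + K'"])
    fix n :: nat assume "n \<ge> 1"
    then show "real n * (P \<theta>' - P \<theta>) \<le> real n * \<epsilon> + (K + K')"
      using K[of n] K'[of n] d[of n] unfolding right_diff_distrib by linarith
  qed
  ultimately show ?thesis by linarith
qed

lemma holder_norm_bound:
  assumes h: "holder r X h" and ne: "\<exists>x\<in>X. \<exists>z\<in>X. x \<noteq> z" and x: "x \<in> X" "z \<in> X"
  shows "\<bar>h x\<bar> \<le> holder_norm r X h" and "\<bar>h x - h z\<bar> \<le> holder_norm r X h * dX x z powr r"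
proof -
  let ?q = "\<lambda>p. \<bar>h (fst p) - h (snd p)\<bar> / dX (fst p) (snd p) powr r"
  let ?S = "{(x, y). x \<in> X \<and> y \<in> X \<and> x \<noteq> y}"
  obtain B where B: "\<And>x. x \<in> X \<Longrightarrow> \<bar>h x\<bar> \<le> B" using h unfolding holder_def by blast
  obtain C where C: "\<And>x y. x \<in> X \<Longrightarrow> y \<in> X \<Longrightarrow> \<bar>h x - h y\<bar> \<le> C * dX x y powr r" using h unfolding holder_def by blast
  have b1: "bdd_above ((\<lambda>x. \<bar>h x\<bar>) ` X)" using B by (rule bdd_aboveI2)
  have b2: "bdd_above (?q ` ?S)"
  proof (rule bdd_aboveI2)
    fix p assume "p \<in> ?S"
    then show "?q p \<le> C" using C[of "fst p" "snd p"] dX_pos[of "fst p" "snd p"] by (auto simp: divide_le_eq)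
  qed
  have s1: "\<bar>h x\<bar> \<le> (SUP x\<in>X. \<bar>h x\<bar>)" by (rule cSUP_upper[OF x(1) b1])
  have s2: "?q p \<le> (SUP p\<in>?S. ?q p)" if "p \<in> ?S" for p by (rule cSUP_upper[OF that b2])
  \<comment> \<open>Two distinct points make the second supremum range over a nonempty set of
    nonnegative quotients.\<close>
  obtain a c where ac: "(a, c) \<in> ?S" using ne by blast
  have "0 \<le> ?q (a, c)" by simp
  then have n2: "0 \<le> (SUP p\<in>?S. ?q p)" using s2[OF ac] by (rule order_trans)
  show "\<bar>h x\<bar> \<le> holder_norm r X h" unfolding holder_norm_def using s1 n2 by linarith
  show "\<bar>h x - h z\<bar> \<le> holder_norm r X h * dX x z powr r"
  proof (cases "x = z")
    case True
    then show ?thesis by (simp add: dX_def)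
  next
    case False
    have "\<bar>h x - h z\<bar> / dX x z powr r \<le> (SUP p\<in>?S. ?q p)" using s2[of "(x, z)"] x False by simp
    also have "\<dots> \<le> holder_norm r X h" unfolding holder_norm_def using s1 by linarith
    finally show ?thesis using dX_pos[OF False] by (simp add: divide_le_eq)
  qed
qed

lemma f_holder: "holder r X (f \<theta>)"
  using f_reg by (simp add: regular_family_def)

lemma holder_diff: "holder r X (\<lambda>x. f \<theta> x - f \<theta>' x)"
proof -
  obtain B C where B: "\<And>x. x \<in> X \<Longrightarrow> \<bar>f \<theta> x\<bar> \<le> B" and C: "\<And>x y. x \<in> X \<Longrightarrow> y \<in> X \<Longrightarrow> \<bar>f \<theta> x - f \<theta> y\<bar> \<le> C * dX x y powr r"
    using f_holder[of \<theta>] unfolding holder_def by blast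
  obtain B' C' where B': "\<And>x. x \<in> X \<Longrightarrow> \<bar>f \<theta>' x\<bar> \<le> B'" and C': "\<And>x y. x \<in> X \<Longrightarrow> y \<in> X \<Longrightarrow> \<bar>f \<theta>' x - f \<theta>' y\<bar> \<le> C' * dX x y powr r"
    using f_holder[of \<theta>'] unfolding holder_def by blast
  have "\<bar>f \<theta> x - f \<theta>' x\<bar> \<le> B + B'" if "x \<in> X" for x using B[OF that] B'[OF that] by linarith
  moreover have "\<bar>(f \<theta> x - f \<theta>' x) - (f \<theta> y - f \<theta>' y)\<bar> \<le> (C + C') * dX x y powr r" if "x \<in> X" "y \<in> X" for x y
    using C[OF that] C'[OF that] unfolding distrib_right by linarith
  ultimately show ?thesis unfolding holder_def by blast
qed

text \<open>On a one-point space \<open>holder_norm\<close> contains the supremum of an empty set and carries no information;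
  there the Gibbs property alone forces the normalised potential to vanish.\<close>

lemma F_near:
  assumes "\<epsilon> > 0"
  shows "\<exists>\<delta>>0. \<forall>\<theta>'. dist \<theta>' \<theta> < \<delta> \<longrightarrow> (\<forall>x\<in>X. \<bar>F \<theta>' x - F \<theta> x\<bar> \<le> \<epsilon>) \<and>
      (\<forall>x\<in>X. \<forall>z\<in>X. \<bar>(F \<theta>' x - F \<theta> x) - (F \<theta>' z - F \<theta> z)\<bar> \<le> \<epsilon> * dX x z powr r)"
proof (cases "\<exists>x\<in>X. \<exists>z\<in>X. x \<noteq> z")
  case True
  have "((\<lambda>\<theta>'. holder_norm r X (\<lambda>x. f \<theta>' x - f \<theta> x)) \<longlongrightarrow> 0) (at \<theta>)" using f_reg by (simp add: regular_family_def)
  from tendstoD[OF this, of "\<epsilon> / 2"] assms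
  have "eventually (\<lambda>\<theta>'. dist (holder_norm r X (\<lambda>x. f \<theta>' x - f \<theta> x)) 0 < \<epsilon> / 2) (at \<theta>)" by simp
  then obtain \<delta> where \<delta>: "\<delta> > 0" "\<And>\<theta>'. \<theta>' \<noteq> \<theta> \<Longrightarrow> dist \<theta>' \<theta> < \<delta> \<Longrightarrow> \<bar>holder_norm r X (\<lambda>x. f \<theta>' x - f \<theta> x)\<bar> < \<epsilon> / 2"
    unfolding eventually_at by (auto simp: dist_real_def)
  show ?thesis
  proof (intro exI[of _ \<delta>] conjI allI impI ballI \<delta>(1))
    fix \<theta>' x assume d: "dist \<theta>' \<theta> < \<delta>" and x: "x \<in> X"
    let ?N = "holder_norm r X (\<lambda>x. f \<theta>' x - f \<theta> x)"
    have fd: "\<bar>f \<theta>' x - f \<theta> x\<bar> \<le> \<epsilon> / 2" if "x \<in> X" for x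
    proof (cases "\<theta>' = \<theta>")
      case False
      then show ?thesis using holder_norm_bound(1)[OF holder_diff True that that, of \<theta>' \<theta>] \<delta>(2)[OF False d] by linarith
    qed (use assms in simp)
    then have "\<bar>P \<theta>' - P \<theta>\<bar> \<le> \<epsilon> / 2" by (rule P_Lipschitz)
    then show "\<bar>F \<theta>' x - F \<theta> x\<bar> \<le> \<epsilon>" using fd[OF x] unfolding F_def by linarith
    fix z assume z: "z \<in> X"
    show "\<bar>(F \<theta>' x - F \<theta> x) - (F \<theta>' z - F \<theta> z)\<bar> \<le> \<epsilon> * dX x z powr r"
    proof (cases "\<theta>' = \<theta>")
      case False
      have "(F \<theta>' x - F \<theta> x) - (F \<theta>' z - F \<theta> z) = (f \<theta>' x - f \<theta> x) - (f \<theta>' z - f \<theta> z)" by (simp add: F_def)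
      also have "\<bar>\<dots>\<bar> \<le> ?N * dX x z powr r" by (rule holder_norm_bound(2)[OF holder_diff True x z])
      also have "\<dots> \<le> \<epsilon> * dX x z powr r" using \<delta>(2)[OF False d] assms by (intro mult_right_mono) auto
      finally show ?thesis .
    qed (use assms in simp)
  qed
next
  case False
  obtain x0 where x0: "x0 \<in> X" using X_ne by blast
  have X: "X = {x0}" using False x0 by blast
  have F0: "F \<theta> x0 = 0" for \<theta>
  proof -
    interpret m: prob_space "\<mu> \<theta>" by (rule mu_prob)
    obtain K where K: "K > 0" "\<And>x n. x \<in> X \<Longrightarrow> n \<ge> 1 \<Longrightarrow> inverse K \<le> measure (\<mu> \<theta>) (cyl X x n) / exp (ergodic_sum (F \<theta>) n x) \<and>
      measure (\<mu> \<theta>) (cyl X x n) / exp (ergodic_sum (F \<theta>) n x) \<le> K" using gibbs_bounds[of \<theta>] by blast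
    have "(shift ^^ k) x0 = x0" for k using shift_X(1)[of k x0] x0 unfolding X by blast
    then have es: "ergodic_sum (F \<theta>) n x0 = n * F \<theta> x0" for n by (simp add: ergodic_sum_def)
    have "cyl X x0 n = X" for n unfolding cyl_eq using X by auto
    then have m: "measure (\<mu> \<theta>) (cyl X x0 n) = 1" for n using m.prob_space by simp
    have b: "n * F \<theta> x0 \<le> ln K" "- (n * F \<theta> x0) \<le> ln K" if "n \<ge> 1" for n :: nat
    proof -
      have e: "inverse K \<le> exp (- (n * F \<theta> x0))" "exp (- (n * F \<theta> x0)) \<le> K"
        using K(2)[OF x0 that] unfolding m es by (simp_all add: exp_minus field_simps)
      have "ln (exp (- (n * F \<theta> x0))) \<le> ln K" using e(2) by (intro ln_mono) auto
      then show "- (n * F \<theta> x0) \<le> ln K" by simp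
      have "ln (inverse K) \<le> ln (exp (- (n * F \<theta> x0)))" using e(1) K(1) by (intro ln_mono) auto
      then show "n * F \<theta> x0 \<le> ln K" using K(1) by (simp add: ln_inverse)
    qed
    have "F \<theta> x0 \<le> 0" by (rule linear_bound_limit[where K = "ln K"]) (use b(1) in simp)
    moreover have "- F \<theta> x0 \<le> 0" by (rule linear_bound_limit[where K = "ln K"]) (use b(2) in simp)
    ultimately show ?thesis by linarith
  qed
  have "F \<theta> x = 0" if "x \<in> X" for \<theta> x using F0[of \<theta>] that X by simp
  then show ?thesis using assms by (intro exI[of _ 1]) simp
qed

text \<open>Around each parameter \<open>F_near\<close> with error one controls a whole
  neighbourhood; finitely many neighbourhoods cover the parameter space, and sums over the finite
  net dominate all local constants.\<close>

lemma F_uniform_bounds: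
  "\<exists>B C. 0 \<le> C \<and> (\<forall>\<theta>. \<forall>x\<in>X. \<bar>F \<theta> x\<bar> \<le> B) \<and> (\<forall>\<theta>. \<forall>x\<in>X. \<forall>z\<in>X. \<bar>F \<theta> x - F \<theta> z\<bar> \<le> C * dX x z powr r)"
proof -
  have "\<forall>\<theta>. \<exists>d>0. (\<forall>\<theta>'. dist \<theta>' \<theta> < d \<longrightarrow> (\<forall>x\<in>X. \<bar>F \<theta>' x - F \<theta> x\<bar> \<le> 1) \<and>
      (\<forall>x\<in>X. \<forall>z\<in>X. \<bar>(F \<theta>' x - F \<theta> x) - (F \<theta>' z - F \<theta> z)\<bar> \<le> 1 * dX x z powr r))"
    using F_near[of 1] by (intro allI) simp
  from choice[OF this] obtain \<delta> where \<delta>: "\<And>\<theta>. \<delta> \<theta> > 0"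
    "\<And>\<theta> \<theta>' x. dist \<theta>' \<theta> < \<delta> \<theta> \<Longrightarrow> x \<in> X \<Longrightarrow> \<bar>F \<theta>' x - F \<theta> x\<bar> \<le> 1"
    "\<And>\<theta> \<theta>' x z. dist \<theta>' \<theta> < \<delta> \<theta> \<Longrightarrow> x \<in> X \<Longrightarrow> z \<in> X \<Longrightarrow> \<bar>(F \<theta>' x - F \<theta> x) - (F \<theta>' z - F \<theta> z)\<bar> \<le> 1 * dX x z powr r"
    by blast
  have cov: "(UNIV :: 'p set) \<subseteq> (\<Union>\<theta>\<in>UNIV. ball \<theta> (\<delta> \<theta>))"
  proof
    fix \<theta> :: 'p show "\<theta> \<in> (\<Union>\<theta>\<in>UNIV. ball \<theta> (\<delta> \<theta>))" using \<delta>(1)[of \<theta>] by (intro UN_I[of \<theta>]) auto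
  qed
  obtain D where D0: "D \<subseteq> UNIV" and D: "finite D" "UNIV \<subseteq> (\<Union>\<theta>\<in>D. ball \<theta> (\<delta> \<theta>))"
    by (rule compactE_image[OF \<Theta>_compact _ cov]) simp
  have "\<exists>B C. 0 \<le> B \<and> 0 \<le> C \<and> (\<forall>x\<in>X. \<bar>F \<theta> x\<bar> \<le> B) \<and> (\<forall>x\<in>X. \<forall>z\<in>X. \<bar>F \<theta> x - F \<theta> z\<bar> \<le> C * dX x z powr r)" for \<theta>
  proof -
    obtain B C where B: "\<And>x. x \<in> X \<Longrightarrow> \<bar>f \<theta> x\<bar> \<le> B" and C: "\<And>x y. x \<in> X \<Longrightarrow> y \<in> X \<Longrightarrow> \<bar>f \<theta> x - f \<theta> y\<bar> \<le> C * dX x y powr r"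
      using f_holder[of \<theta>] unfolding holder_def by blast
    have "\<bar>F \<theta> x\<bar> \<le> \<bar>B\<bar> + \<bar>P \<theta>\<bar>" if "x \<in> X" for x using B[OF that] unfolding F_def by linarith
    moreover have "\<bar>F \<theta> x - F \<theta> z\<bar> \<le> \<bar>C\<bar> * dX x z powr r" if "x \<in> X" "z \<in> X" for x z
    proof -
      have "\<bar>F \<theta> x - F \<theta> z\<bar> \<le> C * dX x z powr r" using C[OF that] by (simp add: F_def)
      also have "\<dots> \<le> \<bar>C\<bar> * dX x z powr r" by (rule mult_right_mono) auto
      finally show ?thesis .
    qed
    ultimately show ?thesis by (intro exI[of _ "\<bar>B\<bar> + \<bar>P \<theta>\<bar>"] exI[of _ "\<bar>C\<bar>"]) auto
  qed
  then have "\<forall>\<theta>. \<exists>p. 0 \<le> fst p \<and> 0 \<le> snd p \<and> (\<forall>x\<in>X. \<bar>F \<theta> x\<bar> \<le> fst p) \<and> (\<forall>x\<in>X. \<forall>z\<in>X. \<bar>F \<theta> x - F \<theta> z\<bar> \<le> snd p * dX x z powr r)"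
    by (simp add: split_paired_Ex)
  from choice[OF this] obtain p where p: "\<And>\<theta>. 0 \<le> fst (p \<theta>)" "\<And>\<theta>. 0 \<le> snd (p \<theta>)" "\<And>\<theta> x. x \<in> X \<Longrightarrow> \<bar>F \<theta> x\<bar> \<le> fst (p \<theta>)"
     "\<And>\<theta> x z. x \<in> X \<Longrightarrow> z \<in> X \<Longrightarrow> \<bar>F \<theta> x - F \<theta> z\<bar> \<le> snd (p \<theta>) * dX x z powr r" by blast
  define B where "B = 1 + (\<Sum>\<theta>\<in>D. fst (p \<theta>))"
  define C where "C = 1 + (\<Sum>\<theta>\<in>D. snd (p \<theta>))"
  have near: "\<exists>\<theta>0\<in>D. dist \<theta> \<theta>0 < \<delta> \<theta>0" for \<theta>
  proof -
    have "\<theta> \<in> (\<Union>\<theta>\<in>D. ball \<theta> (\<delta> \<theta>))" using D(2) by blast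
    then show ?thesis by (auto simp: dist_commute)
  qed
  have DB: "fst (p \<theta>0) \<le> (\<Sum>\<theta>\<in>D. fst (p \<theta>))" "snd (p \<theta>0) \<le> (\<Sum>\<theta>\<in>D. snd (p \<theta>))" if "\<theta>0 \<in> D" for \<theta>0
    using that D(1) p(1,2) by (auto intro!: member_le_sum)
  show ?thesis
  proof (rule exI[of _ B], rule exI[of _ C], intro conjI allI ballI)
    show "0 \<le> C" unfolding C_def using sum_nonneg[of D "\<lambda>\<theta>. snd (p \<theta>)"] p(2) by simp
    fix \<theta> x assume x: "x \<in> X"
    obtain \<theta>0 where t: "\<theta>0 \<in> D" "dist \<theta> \<theta>0 < \<delta> \<theta>0" using near by blast
    show "\<bar>F \<theta> x\<bar> \<le> B" using \<delta>(2)[OF t(2) x] p(3)[OF x, of \<theta>0] DB(1)[OF t(1)] unfolding B_def by linarith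
    fix z assume z: "z \<in> X"
    have "\<bar>F \<theta> x - F \<theta> z\<bar> \<le> (1 + snd (p \<theta>0)) * dX x z powr r"
      using \<delta>(3)[OF t(2) x z] p(4)[OF x z, of \<theta>0] unfolding distrib_right by linarith
    also have "\<dots> \<le> C * dX x z powr r" using DB(2)[OF t(1)] unfolding C_def by (intro mult_right_mono) auto
    finally show "\<bar>F \<theta> x - F \<theta> z\<bar> \<le> C * dX x z powr r" .
  qed
qed

text \<open>The bound, the distortion and the gap fed into \<open>sft_potential\<close> do not
  depend on \<theta>, whereas the constant \<open>K\<close> of the individual Gibbs property may;
  the former alone determine \<open>A\<close>.\<close>

lemma uniform_gibbs_constant:
  "\<exists>A\<ge>1. \<forall>\<theta>. \<forall>x\<in>X. \<forall>n. measure (\<mu> \<theta>) (cyl X x n) \<le> A * exp (ergodic_sum (F \<theta>) n x) \<and>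
     exp (ergodic_sum (F \<theta>) n x) \<le> A * measure (\<mu> \<theta>) (cyl X x n)"
proof -
  obtain B C where C: "0 \<le> C" and FB: "\<And>\<theta> x. x \<in> X \<Longrightarrow> \<bar>F \<theta> x\<bar> \<le> B"
    and FC: "\<And>\<theta> x z. x \<in> X \<Longrightarrow> z \<in> X \<Longrightarrow> \<bar>F \<theta> x - F \<theta> z\<bar> \<le> C * dX x z powr r"
    using F_uniform_bounds by blast
  obtain g where g: "\<And>n m u v. u \<in> W n \<Longrightarrow> v \<in> W m \<Longrightarrow> \<exists>c. length c = g \<and> u @ c @ v \<in> W (n + g + m)"
  proof -
    obtain g where g: "\<forall>n m. \<forall>u\<in>W n. \<forall>v\<in>W m. \<exists>c. length c = g \<and> u @ c @ v \<in> W (n + g + m)"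
      by (rule exE[OF uniform_gap])
    show ?thesis by (rule that[of g]) (use g in auto)
  qed
  let ?D = "2 * C / (1 - (1/2) powr r)"
  have sp: "sft_potential X (F \<theta>) B ?D g" for \<theta>
    by unfold_locales (use FB g holder_distortion[OF r_pos C FC] in auto)
  define A where "A = sft_potential.E B ?D g ^ 6"
  have A1: "A \<ge> 1" unfolding A_def by (rule one_le_power) (rule sft_potential.E1[OF sp[of undefined]])
  show ?thesis
  proof (intro exI[of _ A] conjI allI ballI A1)
    fix \<theta> x n assume x: "x \<in> X"
    obtain K where K: "K > 0" "\<And>x n. x \<in> X \<Longrightarrow> n \<ge> 1 \<Longrightarrow> inverse K \<le> measure (\<mu> \<theta>) (cyl X x n) / exp (ergodic_sum (F \<theta>) n x) \<and>
      measure (\<mu> \<theta>) (cyl X x n) / exp (ergodic_sum (F \<theta>) n x) \<le> K" using gibbs_bounds[of \<theta>] by blast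
    show "measure (\<mu> \<theta>) (cyl X x n) \<le> A * exp (ergodic_sum (F \<theta>) n x)"
      unfolding A_def by (rule sft_potential.uniform_gibbs(1)[OF sp mu_inv K x])
    show "exp (ergodic_sum (F \<theta>) n x) \<le> A * measure (\<mu> \<theta>) (cyl X x n)"
      unfolding A_def by (rule sft_potential.uniform_gibbs(2)[OF sp mu_inv K x])
  qed
qed

end

section \<open>Asymptotics of the Gibbs posterior\<close>

context gibbs_posterior
begin

definition G :: "'p \<Rightarrow> (int \<Rightarrow> 'a) \<Rightarrow> 'y \<Rightarrow> real" where "G \<theta> x y = F \<theta> x - L \<theta> x y"

lemma Lstar_nonneg: "0 \<le> Lstar y"
proof -
  obtain x where "x \<in> X" using X_ne by blast
  from Lstar_bound[OF this, of undefined y] show ?thesis by linarith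
qed

lemma f_measurable: "f \<theta> \<in> borel_measurable XM"
proof (rule measurable_of_continuous)
  fix x and \<epsilon> :: real assume x: "x \<in> X" and e: "\<epsilon> > 0"
  obtain C where C: "\<And>x y. x \<in> X \<Longrightarrow> y \<in> X \<Longrightarrow> \<bar>f \<theta> x - f \<theta> y\<bar> \<le> C * dX x y powr r"
    using f_holder[of \<theta>] unfolding holder_def by blast
  define \<eta> where "\<eta> = \<epsilon> / (\<bar>C\<bar> + 1)"
  have \<eta>: "\<eta> > 0" using e by (simp add: \<eta>_def)
  show "\<exists>\<delta>>0. \<forall>x'\<in>X. dX x' x < \<delta> \<longrightarrow> \<bar>f \<theta> x' - f \<theta> x\<bar> < \<epsilon>"
  proof (intro exI[of _ "\<eta> powr (1 / r)"] conjI ballI impI)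
    show "0 < \<eta> powr (1 / r)" using \<eta> by simp
    fix x' assume x': "x' \<in> X" "dX x' x < \<eta> powr (1 / r)"
    have "dX x' x powr r < (\<eta> powr (1 / r)) powr r" using x'(2) r_pos by (intro powr_less_mono2) auto
    also have "\<dots> = \<eta>" using r_pos \<eta> by (simp add: powr_powr)
    finally have d: "dX x' x powr r < \<eta>" .
    have "\<bar>f \<theta> x' - f \<theta> x\<bar> \<le> C * dX x' x powr r" by (rule C[OF x'(1) x])
    also have "\<dots> \<le> (\<bar>C\<bar> + 1) * dX x' x powr r" by (intro mult_right_mono) auto
    also have "\<dots> < (\<bar>C\<bar> + 1) * \<eta>" using d by (intro mult_strict_left_mono) auto
    also have "\<dots> = \<epsilon>" by (simp add: \<eta>_def)
    finally show "\<bar>f \<theta> x' - f \<theta> x\<bar> < \<epsilon>" .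
  qed
qed

lemma L_joint: "(\<lambda>z. L \<theta> (fst z) (snd z)) \<in> borel_measurable (XM \<Otimes>\<^sub>M borel)"
proof (rule pair_measurable_of_continuous)
  fix x assume x: "x \<in> X"
  have "continuous_on UNIV (L \<theta> x)"
  proof (unfold continuous_on_iff, intro ballI allI impI)
    fix y :: 'y and \<epsilon> :: real assume "\<epsilon> > 0"
    from L_cont[OF x this, of \<theta> y] obtain \<delta> where d: "\<delta> > 0" "\<And>\<theta>' x' y'. x' \<in> X \<Longrightarrow> dist \<theta>' \<theta> < \<delta> \<Longrightarrow> dX x' x < \<delta> \<Longrightarrow> dist y' y < \<delta> \<Longrightarrow> \<bar>L \<theta>' x' y' - L \<theta> x y\<bar> < \<epsilon>" by blast
    show "\<exists>\<delta>>0. \<forall>y'\<in>UNIV. dist y' y < \<delta> \<longrightarrow> dist (L \<theta> x y') (L \<theta> x y) < \<epsilon>"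
      by (rule exI[of _ \<delta>]) (use d(1) d(2)[OF x, of \<theta>] in \<open>auto simp: dist_real_def dX_def\<close>)
  qed
  then show "L \<theta> x \<in> borel_measurable borel" by (rule borel_measurable_continuous_onI)
next
  fix x and y :: 'y and \<epsilon> :: real assume x: "x \<in> X" and "\<epsilon> > 0"
  from L_cont[OF this, of \<theta> y] obtain \<delta> where d: "\<delta> > 0" "\<And>\<theta>' x' y'. x' \<in> X \<Longrightarrow> dist \<theta>' \<theta> < \<delta> \<Longrightarrow> dX x' x < \<delta> \<Longrightarrow> dist y' y < \<delta> \<Longrightarrow> \<bar>L \<theta>' x' y' - L \<theta> x y\<bar> < \<epsilon>" by blast
  show "\<exists>\<delta>>0. \<forall>x'\<in>X. dX x' x < \<delta> \<longrightarrow> \<bar>L \<theta> x' y - L \<theta> x y\<bar> < \<epsilon>"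
    by (rule exI[of _ \<delta>]) (use d(1) d(2)[of _ \<theta> y] in auto)
qed

lemma L_measurable: "(\<lambda>x. L \<theta> x y) \<in> borel_measurable XM"
  using measurable_compose[OF _ L_joint, of "\<lambda>x. (x, y)" XM \<theta>] by simp

lemma G_joint: "(\<lambda>z. G \<theta> (fst z) (snd z)) \<in> borel_measurable (XM \<Otimes>\<^sub>M borel)"
proof -
  have "(\<lambda>z. f \<theta> (fst z)) \<in> borel_measurable (XM \<Otimes>\<^sub>M (borel :: 'y measure))"
    by (rule measurable_compose[OF measurable_fst f_measurable])
  then show ?thesis unfolding G_def F_def using L_joint[of \<theta>] by measurable
qed

text \<open>The extended integral of \<open>\<rho> \<delta>\<close> may be infinite for large
  \<open>\<delta>\<close>; being small near zero gives integrability as well.\<close>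

lemma \<rho>_small:
  assumes "\<epsilon> > 0"
  shows "\<exists>\<delta>>0. integrable \<nu> (\<rho> \<delta>) \<and> (\<integral>y. \<rho> \<delta> y \<partial>\<nu>) < \<epsilon>"
proof -
  have "eventually (\<lambda>\<delta>. (\<integral>\<^sup>+ y. ennreal (\<rho> \<delta> y) \<partial>\<nu>) < ennreal \<epsilon>) (at_right 0)"
    using \<rho>_lim assms by (intro order_tendstoD(2)) auto
  then obtain c where c: "c > 0" "\<And>\<delta>. 0 < \<delta> \<Longrightarrow> \<delta> < c \<Longrightarrow> (\<integral>\<^sup>+ y. ennreal (\<rho> \<delta> y) \<partial>\<nu>) < ennreal \<epsilon>"
    unfolding eventually_at_right_field by auto
  define \<delta> where "\<delta> = c / 2"
  have d: "\<delta> > 0" "\<delta> < c" using c(1) by (simp_all add: \<delta>_def)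
  have m: "\<rho> \<delta> \<in> borel_measurable \<nu>" using \<rho>_meas[OF d(1)] by (simp cong: measurable_cong_sets add: sets_nu)
  have nn: "0 \<le> \<rho> \<delta> y" for y using \<rho>_pos[OF d(1), of y] by simp
  have i: "integrable \<nu> (\<rho> \<delta>)"
    by (rule integrableI_nonneg[OF m]) (use nn order_less_trans[OF c(2)[OF d] ennreal_less_top] in auto)
  have "ennreal (\<integral>y. \<rho> \<delta> y \<partial>\<nu>) < ennreal \<epsilon>" using c(2)[OF d] nn_integral_eq_integral[OF i] nn by simp
  then have "(\<integral>y. \<rho> \<delta> y \<partial>\<nu>) < \<epsilon>" using nn by (subst (asm) ennreal_less_iff) (auto intro: integral_nonneg_AE)
  then show ?thesis using d i by blast
qed

lemma pressure_system_exists: "\<exists>b e. \<forall>\<theta>. pressure_system X \<nu> T (G \<theta>) b e"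
proof -
  obtain B C where C: "0 \<le> C" and FB: "\<And>\<theta> x. x \<in> X \<Longrightarrow> \<bar>F \<theta> x\<bar> \<le> B"
    and FC: "\<And>\<theta> x z. x \<in> X \<Longrightarrow> z \<in> X \<Longrightarrow> \<bar>F \<theta> x - F \<theta> z\<bar> \<le> C * dX x z powr r"
    using F_uniform_bounds by blast
  \<comment> \<open>Both \<open>2 * Lstar\<close> and \<open>\<rho>\<close> bound the variation of
    the loss. The first makes the minimum integrable for every \<open>M\<close>, the second makes
    its mean tend to zero.\<close>
  define m where "m M y = min (2 * Lstar y) (\<rho> ((1/2) ^ M) y)" for M :: nat and y
  define e where "e M y = m M y + C * ((1/2) powr r) ^ M" for M y
  have hp: "(1/2::real) ^ M > 0" for M by simp
  have m0: "0 \<le> m M y" for M y using Lstar_nonneg[of y] \<rho>_pos[OF hp, of M y] by (simp add: m_def)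
  have \<rho>m: "\<rho> ((1/2) ^ M) \<in> borel_measurable \<nu>" for M using \<rho>_meas[OF hp, of M] by (simp cong: measurable_cong_sets add: sets_nu)
  have m_int: "integrable \<nu> (m M)" for M
  proof (rule Bochner_Integration.integrable_bound)
    show "integrable \<nu> (\<lambda>y. 2 * Lstar y)" using Lstar_int by simp
    show "m M \<in> borel_measurable \<nu>" unfolding m_def using Lstar_int \<rho>m by measurable
    show "AE y in \<nu>. norm (m M y) \<le> norm (2 * Lstar y)"
      using m0 by (intro AE_I2) (auto simp: m_def)
  qed
  have m_lim: "(\<lambda>M. \<integral>y. m M y \<partial>\<nu>) \<longlonglongrightarrow> 0"
  proof -
    have h0: "(\<lambda>M. (1/2::real) ^ M) \<longlonglongrightarrow> 0" by (rule LIMSEQ_realpow_zero) auto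
    have "filterlim (\<lambda>M. (1/2::real) ^ M) (at_right 0) sequentially"
      by (rule tendsto_imp_filterlim_at_right[OF h0]) auto
    from filterlim_compose[OF \<rho>_lim this]
    have r0: "(\<lambda>M. \<integral>\<^sup>+ y. ennreal (\<rho> ((1/2) ^ M) y) \<partial>\<nu>) \<longlonglongrightarrow> 0" .
    have "(\<lambda>M. ennreal (\<integral>y. m M y \<partial>\<nu>)) \<longlonglongrightarrow> 0"
    proof (rule tendsto_sandwich[OF _ _ tendsto_const r0])
      have "ennreal (\<integral>y. m M y \<partial>\<nu>) \<le> (\<integral>\<^sup>+ y. ennreal (\<rho> ((1/2) ^ M) y) \<partial>\<nu>)" for M
      proof -
        have "ennreal (\<integral>y. m M y \<partial>\<nu>) = (\<integral>\<^sup>+ y. ennreal (m M y) \<partial>\<nu>)"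
          by (rule nn_integral_eq_integral[symmetric]) (use m_int m0 in auto)
        also have "\<dots> \<le> (\<integral>\<^sup>+ y. ennreal (\<rho> ((1/2) ^ M) y) \<partial>\<nu>)"
          by (intro nn_integral_mono ennreal_leI) (simp add: m_def)
        finally show ?thesis .
      qed
      then show "eventually (\<lambda>M. ennreal (\<integral>y. m M y \<partial>\<nu>) \<le> (\<integral>\<^sup>+ y. ennreal (\<rho> ((1/2) ^ M) y) \<partial>\<nu>)) sequentially" by simp
    qed simp
    then show ?thesis by (subst (asm) ennreal_tendsto_0_iff) (use m0 in \<open>auto intro: integral_nonneg_AE\<close>)
  qed
  have q: "0 \<le> (1/2::real) powr r" "(1/2::real) powr r < 1" using powr_less_mono2[of r "1/2" 1] r_pos by auto
  have "pressure_system X \<nu> T (G \<theta>) (\<lambda>y. B + Lstar y) e" for \<theta>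
  proof unfold_locales
    show "(\<lambda>z. G \<theta> (fst z) (snd z)) \<in> borel_measurable (XM \<Otimes>\<^sub>M borel)" by (rule G_joint)
    show "\<bar>G \<theta> x y\<bar> \<le> B + Lstar y" if "x \<in> X" for x y
      using FB[OF that, of \<theta>] Lstar_bound[OF that, of \<theta> y] unfolding G_def by linarith
    show "integrable \<nu> (\<lambda>y. B + Lstar y)" using Lstar_int by simp
    show "integrable \<nu> (e M)" for M unfolding e_def using m_int by simp
    show "0 \<le> e M y" for M y using m0[of M y] C q by (simp add: e_def)
    show "\<bar>G \<theta> x y - G \<theta> z y\<bar> \<le> e M y" if x: "x \<in> X" "z \<in> X" "cen M x = cen M z" for M x z y
    proof -
      note d = dX_cen[OF x(3)]
      have "dX x z powr r \<le> ((1/2) ^ M) powr r" using d r_pos by (intro powr_mono2) auto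
      then have "C * dX x z powr r \<le> C * ((1/2) powr r) ^ M" unfolding half_power_powr using C by (rule mult_left_mono)
      then have "\<bar>F \<theta> x - F \<theta> z\<bar> \<le> C * ((1/2) powr r) ^ M" using FC[OF x(1,2), of \<theta>] by linarith
      moreover have "\<bar>L \<theta> x y - L \<theta> z y\<bar> \<le> m M y"
        using \<rho>_bound[OF hp x(1,2), of \<theta> \<theta> M y] d Lstar_bound[OF x(1), of \<theta> y] Lstar_bound[OF x(2), of \<theta> y]
        by (simp add: m_def)
      ultimately show ?thesis unfolding G_def e_def by linarith
    qed
    have "(\<lambda>M. (\<integral>y. m M y \<partial>\<nu>) + C * ((1/2) powr r) ^ M) \<longlonglongrightarrow> 0 + C * 0"
      by (intro tendsto_intros m_lim LIMSEQ_realpow_zero q)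
    then show "(\<lambda>M. \<integral>y. e M y \<partial>\<nu>) \<longlonglongrightarrow> 0" unfolding e_def using m_int prob_space by simp
  qed
  then show ?thesis by blast
qed

definition fiber_pressure :: "'p \<Rightarrow> real" where "fiber_pressure \<theta> = pressure_system.pstar X \<nu> T (G \<theta>)"

text \<open>Together with \<open>log_partition\<close> a copy of \<open>Gn\<close> and
  \<open>logZ\<close> outside their locale, so that different parameters can occur in one
  statement.\<close>

definition G_sum :: "'p \<Rightarrow> nat \<Rightarrow> (int \<Rightarrow> 'a) \<Rightarrow> 'y \<Rightarrow> real" where
  "G_sum \<theta> n x y = (\<Sum>k<n. G \<theta> ((shift ^^ k) x) ((T ^^ k) y))"

definition log_partition :: "'p \<Rightarrow> nat \<Rightarrow> 'y \<Rightarrow> real" where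
  "log_partition \<theta> n y = ln (\<Sum>w\<in>W n. exp (G_sum \<theta> n (rep w) y))"

lemma log_partition_limit: "AE y in \<nu>. (\<lambda>n. log_partition \<theta> n y / n) \<longlonglongrightarrow> fiber_pressure \<theta>"
proof -
  obtain b e where "\<And>\<theta>. pressure_system X \<nu> T (G \<theta>) b e" using pressure_system_exists by blast
  then interpret S: pressure_system X \<nu> T "G \<theta>" b e .
  have "log_partition \<theta> = S.logZ" by (simp add: fun_eq_iff log_partition_def S.logZ_def G_sum_def S.Gn_def)
  then show ?thesis using S.logZ_limit(2) by (simp add: fiber_pressure_def)
qed

lemma rate_V_eq: "rate_V X \<nu> T f L \<theta> = - fiber_pressure \<theta>"
proof -
  obtain b e where "\<And>\<theta>. pressure_system X \<nu> T (G \<theta>) b e" using pressure_system_exists by blast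
  then interpret S: pressure_system X \<nu> T "G \<theta>" b e .
  obtain B where B: "\<And>x. x \<in> X \<Longrightarrow> \<bar>f \<theta> x\<bar> \<le> B" using f_holder[of \<theta>] unfolding holder_def by blast
  show ?thesis unfolding rate_V_def fiber_pressure_def
    by (rule S.rate_value[where B = B]) (use B f_measurable in \<open>auto simp: G_def F_def P_def\<close>)
qed

text \<open>Both pressures are limits at one common generic point, where the difference of the log
  partition functions is at most a Birkhoff sum of \<open>h\<close>.\<close>

lemma fiber_pressure_close:
  assumes "\<And>x y. x \<in> X \<Longrightarrow> \<bar>G \<theta> x y - G \<theta>' x y\<bar> \<le> h y" and h: "integrable \<nu> h"
  shows "\<bar>fiber_pressure \<theta> - fiber_pressure \<theta>'\<bar> \<le> (\<integral>y. h y \<partial>\<nu>)"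
proof -
  have diff: "\<bar>log_partition \<theta> n y - log_partition \<theta>' n y\<bar> \<le> birkhoff_sum T h n y" for n y
    unfolding log_partition_def
  proof (rule ln_sum_exp_diff)
    fix w assume "w \<in> W n"
    then show "\<bar>G_sum \<theta> n (rep w) y - G_sum \<theta>' n (rep w) y\<bar> \<le> birkhoff_sum T h n y"
      unfolding G_sum_def birkhoff_sum_def sum_subtractf[symmetric]
      by (intro order_trans[OF sum_abs sum_mono] assms(1)) (simp add: rep)
  qed auto
  have "AE y in \<nu>. \<bar>fiber_pressure \<theta> - fiber_pressure \<theta>'\<bar> \<le> (\<integral>y. h y \<partial>\<nu>)"
    using log_partition_limit[of \<theta>] log_partition_limit[of \<theta>'] birkhoff[OF h]
  proof eventually_elim
    case (elim y)
    show ?case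
    proof (rule LIMSEQ_le)
      show "(\<lambda>n. \<bar>log_partition \<theta> n y / n - log_partition \<theta>' n y / n\<bar>) \<longlonglongrightarrow> \<bar>fiber_pressure \<theta> - fiber_pressure \<theta>'\<bar>"
        using elim by (intro tendsto_intros)
      show "\<exists>N. \<forall>n\<ge>N. \<bar>log_partition \<theta> n y / n - log_partition \<theta>' n y / n\<bar> \<le> birkhoff_sum T h n y / n"
      proof (intro exI allI impI)
        fix n :: nat
        have "\<bar>log_partition \<theta> n y / n - log_partition \<theta>' n y / n\<bar> = \<bar>log_partition \<theta> n y - log_partition \<theta>' n y\<bar> / n"
          by (simp add: diff_divide_distrib[symmetric])
        also have "\<dots> \<le> birkhoff_sum T h n y / n" using diff by (rule divide_right_mono) simp
        finally show "\<bar>log_partition \<theta> n y / n - log_partition \<theta>' n y / n\<bar> \<le> birkhoff_sum T h n y / n" .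
      qed
    qed (rule elim)
  qed
  then show ?thesis by simp
qed

lemma fiber_pressure_continuous: "continuous_on UNIV fiber_pressure"
proof (unfold continuous_on_iff, intro ballI allI impI)
  fix \<theta> :: 'p and \<epsilon> :: real assume e: "\<epsilon> > 0"
  obtain \<delta>1 where d1: "\<delta>1 > 0" "integrable \<nu> (\<rho> \<delta>1)" "(\<integral>y. \<rho> \<delta>1 y \<partial>\<nu>) < \<epsilon> / 2" using \<rho>_small[of "\<epsilon> / 2"] e by auto
  obtain \<delta>2 where d2: "\<delta>2 > 0" "\<And>\<theta>' x. dist \<theta>' \<theta> < \<delta>2 \<Longrightarrow> x \<in> X \<Longrightarrow> \<bar>F \<theta>' x - F \<theta> x\<bar> \<le> \<epsilon> / 2"
    using F_near[of "\<epsilon> / 2" \<theta>] e by auto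
  show "\<exists>d>0. \<forall>\<theta>'\<in>UNIV. dist \<theta>' \<theta> < d \<longrightarrow> dist (fiber_pressure \<theta>') (fiber_pressure \<theta>) < \<epsilon>"
  proof (intro exI[of _ "min \<delta>1 \<delta>2"] conjI ballI impI)
    fix \<theta>' assume d: "dist \<theta>' \<theta> < min \<delta>1 \<delta>2"
    have "\<bar>fiber_pressure \<theta>' - fiber_pressure \<theta>\<bar> \<le> (\<integral>y. \<epsilon> / 2 + \<rho> \<delta>1 y \<partial>\<nu>)"
    proof (rule fiber_pressure_close)
      fix x y assume x: "x \<in> X"
      have "\<bar>L \<theta>' x y - L \<theta> x y\<bar> \<le> \<rho> \<delta>1 y" using d by (intro \<rho>_bound[OF d1(1) x x]) (simp add: dX_def d1(1) less_imp_le)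
      moreover have "\<bar>F \<theta>' x - F \<theta> x\<bar> \<le> \<epsilon> / 2" using d by (intro d2(2)[OF _ x]) simp
      ultimately show "\<bar>G \<theta>' x y - G \<theta> x y\<bar> \<le> \<epsilon> / 2 + \<rho> \<delta>1 y" unfolding G_def by linarith
    qed (use d1(2) in simp)
    also have "\<dots> < \<epsilon>" using d1(2,3) prob_space by simp
    finally show "dist (fiber_pressure \<theta>') (fiber_pressure \<theta>) < \<epsilon>" by (simp add: dist_real_def)
  qed (use d1 d2 in simp)
qed

lemma integral_pre:
  fixes c :: "'a list \<Rightarrow> real"
  shows "integrable (\<mu> \<theta>) (\<lambda>x. c (pre n x))"
    and "(\<integral>x. c (pre n x) \<partial>\<mu> \<theta>) = (\<Sum>w\<in>W n. c w * measure (\<mu> \<theta>) (cyl X (rep w) n))"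
proof -
  interpret m: prob_space "\<mu> \<theta>" by (rule mu_prob)
  have eq: "c (pre n x) = (\<Sum>w\<in>W n. c w * indicator (cyl X (rep w) n) x)" if x: "x \<in> X" for x
  proof -
    have "(\<Sum>w\<in>W n. c w * indicator (cyl X (rep w) n) x) = (\<Sum>w\<in>W n. if w = pre n x then c w else 0)"
      by (rule sum.cong) (use x in \<open>auto simp: cyl_eq rep(2) indicator_def\<close>)
    then show ?thesis using x by (simp add: sum.delta)
  qed
  have i: "integrable (\<mu> \<theta>) (\<lambda>x. \<Sum>w\<in>W n. c w * indicator (cyl X (rep w) n) x)"
    using cyl_sets by (intro Bochner_Integration.integrable_sum) (auto simp: m.emeasure_eq_measure)
  show "integrable (\<mu> \<theta>) (\<lambda>x. c (pre n x))"
    using i by (subst Bochner_Integration.integrable_cong[OF refl eq]) simp_all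
  have cylX: "cyl X z n \<inter> X = cyl X z n" for z by (auto simp: cyl_eq)
  have "(\<integral>x. c (pre n x) \<partial>\<mu> \<theta>) = (\<integral>x. (\<Sum>w\<in>W n. c w * indicator (cyl X (rep w) n) x) \<partial>\<mu> \<theta>)"
    by (rule Bochner_Integration.integral_cong[OF refl eq]) simp
  also have "\<dots> = (\<Sum>w\<in>W n. c w * measure (\<mu> \<theta>) (cyl X (rep w) n \<inter> X))"
    using cyl_sets by (subst Bochner_Integration.integral_sum) (auto simp: m.emeasure_eq_measure)
  also have "\<dots> = (\<Sum>w\<in>W n. c w * measure (\<mu> \<theta>) (cyl X (rep w) n))"
    by (simp only: cylX)
  finally show "(\<integral>x. c (pre n x) \<partial>\<mu> \<theta>) = (\<Sum>w\<in>W n. c w * measure (\<mu> \<theta>) (cyl X (rep w) n))" .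
qed

text \<open>Bounds the change of the accumulated loss when the point moves inside its cylinder of
  length \<open>n\<close> and the parameter moves by at most \<open>\<delta>\<close>, provided
  windows of radius \<open>M\<close> have size at most \<open>\<delta>\<close>.\<close>

definition comparison_error :: "real \<Rightarrow> nat \<Rightarrow> nat \<Rightarrow> 'y \<Rightarrow> real" where
  "comparison_error \<delta> M n y = birkhoff_sum T (\<rho> \<delta>) n y +
     2 * (birkhoff_sum T Lstar M y + (birkhoff_sum T Lstar n y - birkhoff_sum T Lstar (n - M) y))"

lemma comparison_error_limit:
  assumes "integrable \<nu> (\<rho> \<delta>)"
  shows "AE y in \<nu>. (\<lambda>n. comparison_error \<delta> M n y / n) \<longlonglongrightarrow> (\<integral>y. \<rho> \<delta> y \<partial>\<nu>)"
  using birkhoff[OF assms] birkhoff_tail[OF Lstar_int, of M]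
proof eventually_elim
  case (elim y)
  have "(\<lambda>n. birkhoff_sum T Lstar M y / real n) \<longlonglongrightarrow> 0"
    by (intro tendsto_divide_0[OF tendsto_const] filterlim_at_top_imp_at_infinity filterlim_real_sequentially)
  then have "(\<lambda>n. birkhoff_sum T (\<rho> \<delta>) n y / n + 2 * (birkhoff_sum T Lstar M y / n + (birkhoff_sum T Lstar n y - birkhoff_sum T Lstar (n - M) y) / n))
      \<longlonglongrightarrow> (\<integral>y. \<rho> \<delta> y \<partial>\<nu>) + 2 * (0 + 0)"
    by (intro tendsto_intros elim)
  then show ?case by (simp add: comparison_error_def add_divide_distrib)
qed

definition likelihood :: "'p \<Rightarrow> nat \<Rightarrow> 'y \<Rightarrow> real" where
  "likelihood \<theta> n y = (\<integral>x. exp (- loss_n L T n \<theta> x y) \<partial>\<mu> \<theta>)"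

text \<open>The loss is nearly constant on cylinders, and by the Gibbs property their masses are
  exponentials of \<open>ergodic_sum (F \<theta>) n\<close> up to \<open>A\<close>; this turns the
  likelihood of \<open>\<theta>\<close> into the partition function of a nearby
  \<open>\<theta>0\<close>.\<close>

lemma likelihood_bounds:
  assumes A: "A \<ge> 1" "\<And>x n. x \<in> X \<Longrightarrow> measure (\<mu> \<theta>) (cyl X x n) \<le> A * exp (ergodic_sum (F \<theta>) n x)"
     "\<And>x n. x \<in> X \<Longrightarrow> exp (ergodic_sum (F \<theta>) n x) \<le> A * measure (\<mu> \<theta>) (cyl X x n)"
    and \<delta>: "\<delta> > 0" "(1/2) ^ M \<le> \<delta>" "dist \<theta> \<theta>0 \<le> \<delta>" and \<epsilon>: "\<And>x. x \<in> X \<Longrightarrow> \<bar>F \<theta> x - F \<theta>0 x\<bar> \<le> \<epsilon>"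
  shows "likelihood \<theta> n y \<le> A * exp (log_partition \<theta>0 n y + (n * \<epsilon> + comparison_error \<delta> M n y))"
    and "exp (log_partition \<theta>0 n y - (n * \<epsilon> + comparison_error \<delta> M n y)) \<le> A * likelihood \<theta> n y"
proof -
  interpret m: prob_space "\<mu> \<theta>" by (rule mu_prob)
  let ?R = "n * \<epsilon> + comparison_error \<delta> M n y"
  \<comment> \<open>Chosen so that adding \<open>ergodic_sum (F \<theta>) n (rep w)\<close>, the
    exponent of the cylinder mass, gives exactly \<open>G_sum \<theta>0 n (rep w) y\<close>. It
    differs from the negative loss by the change of \<open>F\<close> and the change of the
    loss.\<close>
  let ?c = "\<lambda>w. G_sum \<theta>0 n (rep w) y - ergodic_sum (F \<theta>) n (rep w)"
  have close: "\<bar>- loss_n L T n \<theta> x y - ?c (pre n x)\<bar> \<le> ?R" if x: "x \<in> X" for x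
  proof -
    define z where "z = rep (pre n x)"
    have z: "z \<in> X" "pre n z = pre n x" unfolding z_def using rep[OF pre_W[OF x]] by auto
    let ?dF = "\<lambda>k. F \<theta> ((shift ^^ k) z) - F \<theta>0 ((shift ^^ k) z)"
    let ?dL = "\<lambda>k. L \<theta>0 ((shift ^^ k) z) ((T ^^ k) y) - L \<theta> ((shift ^^ k) x) ((T ^^ k) y)"
    have eq: "- loss_n L T n \<theta> x y - ?c (pre n x) = (\<Sum>k<n. ?dF k) + (\<Sum>k<n. ?dL k)"
      unfolding z_def[symmetric] loss_n_def G_sum_def ergodic_sum_def G_def
      by (simp add: sum_subtractf)
    have F_le: "\<bar>\<Sum>k<n. ?dF k\<bar> \<le> n * \<epsilon>"
      by (rule order_trans[OF sum_abs], rule order_trans[OF sum_mono[where g = "\<lambda>_. \<epsilon>"]]) (use \<epsilon> z in auto)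
    have L_le: "(\<Sum>k<n. \<bar>?dL k\<bar>) \<le> comparison_error \<delta> M n y"
      unfolding comparison_error_def
    proof (rule boundary_sum_bound)
      show "0 \<le> \<rho> \<delta> y" for y using \<rho>_pos[OF \<delta>(1), of y] by simp
      show "\<bar>?dL k\<bar> \<le> 2 * Lstar ((T ^^ k) y)" for k
        using Lstar_bound[of "(shift ^^ k) z" \<theta>0 "(T ^^ k) y"] Lstar_bound[of "(shift ^^ k) x" \<theta> "(T ^^ k) y"] x z by simp
      fix k assume k: "M \<le> k" "k + M < n"
      then have "cen M ((shift ^^ k) z) = cen M ((shift ^^ k) x)" using z by (simp add: funpow_shift cen_from_pre)
      from order_trans[OF dX_cen[OF this] \<delta>(2)] have "dX ((shift ^^ k) z) ((shift ^^ k) x) \<le> \<delta>" .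
      then show "\<bar>?dL k\<bar> \<le> \<rho> \<delta> ((T ^^ k) y)" using x z \<delta>(3) by (intro \<rho>_bound[OF \<delta>(1)]) (auto simp: dist_commute)
    qed (rule Lstar_nonneg)
    have "\<bar>\<Sum>k<n. ?dL k\<bar> \<le> comparison_error \<delta> M n y" by (rule order_trans[OF sum_abs L_le])
    then show ?thesis unfolding eq using F_le by (rule order_trans[OF abs_triangle_ineq add_mono[rotated]])
  qed
  have meas: "(\<lambda>x. exp (- loss_n L T n \<theta> x y)) \<in> borel_measurable (\<mu> \<theta>)"
  proof -
    have "(\<lambda>x. loss_n L T n \<theta> x y) \<in> borel_measurable XM" unfolding loss_n_def
      by (intro borel_measurable_sum measurable_compose[OF funpow_shift_measurable L_measurable])
    then show ?thesis by (simp cong: measurable_cong_sets add: sets_mu)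
  qed
  have up: "exp (- loss_n L T n \<theta> x y) \<le> exp (?c (pre n x) + ?R)" if "x \<in> X" for x using close[OF that] by simp
  have lo: "exp (?c (pre n x) - ?R) \<le> exp (- loss_n L T n \<theta> x y)" if "x \<in> X" for x using close[OF that] by simp
  have iu: "integrable (\<mu> \<theta>) (\<lambda>x. exp (?c (pre n x) + ?R))" and il: "integrable (\<mu> \<theta>) (\<lambda>x. exp (?c (pre n x) - ?R))"
    using integral_pre(1)[where c = "\<lambda>w. exp (?c w + ?R)"] integral_pre(1)[where c = "\<lambda>w. exp (?c w - ?R)"] by auto
  have ii: "integrable (\<mu> \<theta>) (\<lambda>x. exp (- loss_n L T n \<theta> x y))"
    by (rule Bochner_Integration.integrable_bound[OF iu meas]) (use up in \<open>auto intro!: AE_I2\<close>)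
  have S: "exp (log_partition \<theta>0 n y) = (\<Sum>w\<in>W n. exp (G_sum \<theta>0 n (rep w) y))"
    unfolding log_partition_def by (rule exp_ln) (rule sum_pos, auto)
  have "likelihood \<theta> n y \<le> (\<integral>x. exp (?c (pre n x) + ?R) \<partial>\<mu> \<theta>)"
    unfolding likelihood_def by (rule integral_mono[OF ii iu]) (use up in simp)
  also have "\<dots> = (\<Sum>w\<in>W n. exp (?c w + ?R) * measure (\<mu> \<theta>) (cyl X (rep w) n))" by (rule integral_pre(2))
  also have "\<dots> \<le> (\<Sum>w\<in>W n. exp (?c w + ?R) * (A * exp (ergodic_sum (F \<theta>) n (rep w))))"
    by (intro sum_mono mult_left_mono A(2)) (auto simp: rep)
  also have "\<dots> = (\<Sum>w\<in>W n. (A * exp ?R) * exp (G_sum \<theta>0 n (rep w) y))"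
    by (intro sum.cong refl) (simp add: exp_add exp_diff)
  also have "\<dots> = A * exp (log_partition \<theta>0 n y + ?R)" by (simp only: sum_distrib_left[symmetric] S[symmetric] exp_add mult.commute mult.left_commute)
  finally show "likelihood \<theta> n y \<le> A * exp (log_partition \<theta>0 n y + ?R)" .
  have "exp (log_partition \<theta>0 n y - ?R) = (\<Sum>w\<in>W n. exp (?c w - ?R) * exp (ergodic_sum (F \<theta>) n (rep w)))"
    unfolding exp_diff[of "log_partition \<theta>0 n y"] S sum_divide_distrib by (intro sum.cong refl) (simp add: exp_diff)
  also have "\<dots> \<le> (\<Sum>w\<in>W n. exp (?c w - ?R) * (A * measure (\<mu> \<theta>) (cyl X (rep w) n)))"
    by (intro sum_mono mult_left_mono A(3)) (auto simp: rep)
  also have "\<dots> = A * (\<Sum>w\<in>W n. exp (?c w - ?R) * measure (\<mu> \<theta>) (cyl X (rep w) n))"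
    unfolding sum_distrib_left by (intro sum.cong refl) simp
  also have "(\<Sum>w\<in>W n. exp (?c w - ?R) * measure (\<mu> \<theta>) (cyl X (rep w) n)) = (\<integral>x. exp (?c (pre n x) - ?R) \<partial>\<mu> \<theta>)"
    by (rule integral_pre(2)[symmetric])
  also have "A * (\<integral>x. exp (?c (pre n x) - ?R) \<partial>\<mu> \<theta>) \<le> A * likelihood \<theta> n y"
    unfolding likelihood_def by (rule mult_left_mono[OF integral_mono[OF il ii]]) (use lo A(1) in auto)
  finally show "exp (log_partition \<theta>0 n y - ?R) \<le> A * likelihood \<theta> n y" .
qed

theorem posterior_converges:
  assumes \<pi>0: "prob_space \<pi>0" "sets \<pi>0 = sets borel"
    and full: "\<And>W. open W \<Longrightarrow> W \<noteq> {} \<Longrightarrow> emeasure \<pi>0 W > 0"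
    and U: "open U" and U_min: "{\<theta>. \<forall>\<theta>'. rate_V X \<nu> T f L \<theta> \<le> rate_V X \<nu> T f L \<theta>'} \<subseteq> U"
  shows "AE y in \<nu>. (\<lambda>n. posterior \<pi>0 \<mu> L T n (- U) y) \<longlonglongrightarrow> 0"
proof (cases "- U = {}")
  case True
  then show ?thesis by (simp add: posterior_def)
next
  case False
  interpret p: prob_space \<pi>0 by (rule \<pi>0)
  obtain A where A: "A \<ge> 1" "\<And>\<theta> x n. x \<in> X \<Longrightarrow> measure (\<mu> \<theta>) (cyl X x n) \<le> A * exp (ergodic_sum (F \<theta>) n x)"
     "\<And>\<theta> x n. x \<in> X \<Longrightarrow> exp (ergodic_sum (F \<theta>) n x) \<le> A * measure (\<mu> \<theta>) (cyl X x n)"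
    using uniform_gibbs_constant by blast
  have cU: "compact (- U)" using compact_Int_closed[OF \<Theta>_compact, of "- U"] U by (simp add: closed_Compl)
  obtain \<theta>m where \<theta>m: "\<And>\<theta>. fiber_pressure \<theta> \<le> fiber_pressure \<theta>m"
    using continuous_attains_sup[OF \<Theta>_compact _ fiber_pressure_continuous] by auto
  obtain \<theta>u where \<theta>u: "\<theta>u \<in> - U" "\<And>\<theta>. \<theta> \<in> - U \<Longrightarrow> fiber_pressure \<theta> \<le> fiber_pressure \<theta>u"
    using continuous_attains_sup[OF cU False continuous_on_subset[OF fiber_pressure_continuous]] by auto
  have "fiber_pressure \<theta>u < fiber_pressure \<theta>m"
  proof (rule ccontr)
    assume "\<not> fiber_pressure \<theta>u < fiber_pressure \<theta>m"
    then have "fiber_pressure \<theta> \<le> fiber_pressure \<theta>u" for \<theta> using \<theta>m[of \<theta>] by linarith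
    then have "\<theta>u \<in> {\<theta>. \<forall>\<theta>'. rate_V X \<nu> T f L \<theta> \<le> rate_V X \<nu> T f L \<theta>'}" by (simp add: rate_V_eq)
    then show False using U_min \<theta>u(1) by blast
  qed
  \<comment> \<open>The limit of the log partition function, the change of \<open>F\<close> and the
    comparison error lose \<open>\<epsilon>\<close> each. So the numerator grows at rate at most the
    maximum over \<open>- U\<close> plus \<open>3 * \<epsilon>\<close>, the denominator at least at
    the global maximum minus \<open>3 * \<epsilon>\<close>; a gap of \<open>8 * \<epsilon>\<close>
    leaves decay at rate \<open>2 * \<epsilon>\<close>.\<close>
  define \<epsilon> where "\<epsilon> = (fiber_pressure \<theta>m - fiber_pressure \<theta>u) / 8"
  have e: "\<epsilon> > 0" and gap: "fiber_pressure \<theta>m = fiber_pressure \<theta>u + 8 * \<epsilon>" using \<open>fiber_pressure \<theta>u < fiber_pressure \<theta>m\<close> by (simp_all add: \<epsilon>_def field_simps)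
  obtain \<delta> where d: "\<delta> > 0" "integrable \<nu> (\<rho> \<delta>)" "(\<integral>y. \<rho> \<delta> y \<partial>\<nu>) < \<epsilon>" using \<rho>_small[OF e] by blast
  obtain M where M: "(1/2::real) ^ M < \<delta>" using real_arch_pow_inv[OF d(1), of "1/2"] by auto
  have "\<forall>\<theta>. \<exists>t>0. \<forall>\<theta>'. dist \<theta>' \<theta> < t \<longrightarrow> dist \<theta>' \<theta> \<le> \<delta> \<and> (\<forall>x\<in>X. \<bar>F \<theta>' x - F \<theta> x\<bar> \<le> \<epsilon>)"
  proof
    fix \<theta>
    obtain t where "t > 0" "\<And>\<theta>'. dist \<theta>' \<theta> < t \<Longrightarrow> (\<forall>x\<in>X. \<bar>F \<theta>' x - F \<theta> x\<bar> \<le> \<epsilon>)" using F_near[OF e, of \<theta>] by blast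
    then show "\<exists>t>0. \<forall>\<theta>'. dist \<theta>' \<theta> < t \<longrightarrow> dist \<theta>' \<theta> \<le> \<delta> \<and> (\<forall>x\<in>X. \<bar>F \<theta>' x - F \<theta> x\<bar> \<le> \<epsilon>)"
      using d(1) by (intro exI[of _ "min t \<delta>"]) auto
  qed
  from choice[OF this] obtain t where t: "\<And>\<theta>. t \<theta> > 0" "\<And>\<theta> \<theta>'. dist \<theta>' \<theta> < t \<theta> \<Longrightarrow> dist \<theta>' \<theta> \<le> \<delta>"
     "\<And>\<theta> \<theta>' x. dist \<theta>' \<theta> < t \<theta> \<Longrightarrow> x \<in> X \<Longrightarrow> \<bar>F \<theta>' x - F \<theta> x\<bar> \<le> \<epsilon>" by blast
  have cov: "- U \<subseteq> (\<Union>\<theta>\<in>- U. ball \<theta> (t \<theta>))" using t(1) by force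
  obtain D where D: "D \<subseteq> - U" "finite D" "- U \<subseteq> (\<Union>\<theta>\<in>D. ball \<theta> (t \<theta>))"
    by (rule compactE_image[OF cU _ cov]) auto
  let ?V = "ball \<theta>m (t \<theta>m)"
  define v where "v = measure \<pi>0 ?V"
  have V_sets: "?V \<in> sets \<pi>0" by (simp add: \<pi>0(2))
  have v: "v > 0"
  proof -
    have "emeasure \<pi>0 ?V > 0" using t(1)[of \<theta>m] by (intro full) auto
    then show ?thesis by (simp add: v_def p.emeasure_eq_measure)
  qed
  have "AE y in \<nu>. \<forall>\<theta>\<in>insert \<theta>m D. (\<lambda>n. log_partition \<theta> n y / n) \<longlonglongrightarrow> fiber_pressure \<theta>"
    using D(2) log_partition_limit by (intro AE_finite_allI) auto
  then show ?thesis using comparison_error_limit[OF d(2), of M]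
  proof eventually_elim
    case (elim y)
    have ev1: "eventually (\<lambda>n. comparison_error \<delta> M n y / n < \<epsilon>) sequentially" using elim(2) d(3) by (rule order_tendstoD(2))
    have ev2: "eventually (\<lambda>n. fiber_pressure \<theta>m - \<epsilon> < log_partition \<theta>m n y / n) sequentially"
      by (rule order_tendstoD(1)) (use elim(1) e in auto)
    have ev3: "eventually (\<lambda>n. \<forall>\<theta>\<in>D. log_partition \<theta> n y / n < fiber_pressure \<theta> + \<epsilon>) sequentially"
    proof (rule eventually_ball_finite[OF D(2)], rule ballI)
      fix \<theta> assume "\<theta> \<in> D"
      then show "eventually (\<lambda>n. log_partition \<theta> n y / n < fiber_pressure \<theta> + \<epsilon>) sequentially"
        by (intro order_tendstoD(2)) (use elim(1) e in auto)
    qed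
    have bound: "eventually (\<lambda>n. 0 \<le> posterior \<pi>0 \<mu> L T n (- U) y \<and> posterior \<pi>0 \<mu> L T n (- U) y \<le> A\<^sup>2 / v * exp (- 2 * \<epsilon>) ^ n) sequentially"
      using ev1 ev2 ev3 eventually_gt_at_top[of 0]
    proof eventually_elim
      case (elim n)
      let ?u = "A * exp (n * (fiber_pressure \<theta>u + 3 * \<epsilon>))" and ?l = "exp (n * (fiber_pressure \<theta>m - 3 * \<epsilon>)) / A"
      have R: "n * \<epsilon> + comparison_error \<delta> M n y \<le> 2 * (n * \<epsilon>)" using elim by (simp add: divide_less_eq mult.commute)
      have I0: "0 \<le> likelihood \<theta> n y" for \<theta> unfolding likelihood_def by simp
      have upper: "likelihood \<theta> n y \<le> ?u" if "\<theta> \<in> - U" for \<theta>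
      proof -
        obtain \<theta>0 where \<theta>0: "\<theta>0 \<in> D" "dist \<theta> \<theta>0 < t \<theta>0" using D(3) \<open>\<theta> \<in> - U\<close> by (auto simp: dist_commute)
        have "likelihood \<theta> n y \<le> A * exp (log_partition \<theta>0 n y + (n * \<epsilon> + comparison_error \<delta> M n y))"
          by (rule likelihood_bounds(1)[OF A(1) A(2) A(3) d(1) less_imp_le[OF M] t(2)[OF \<theta>0(2)] t(3)[OF \<theta>0(2)]])
        also have "\<dots> \<le> ?u"
        proof -
          have "log_partition \<theta>0 n y \<le> n * (fiber_pressure \<theta>0 + \<epsilon>)" using elim \<theta>0(1) by (auto simp: divide_less_eq mult.commute less_imp_le)
          also have "\<dots> \<le> n * (fiber_pressure \<theta>u + \<epsilon>)" using \<theta>u(2)[of \<theta>0] \<theta>0(1) D(1) by (intro mult_left_mono) auto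
          finally have "log_partition \<theta>0 n y + (n * \<epsilon> + comparison_error \<delta> M n y) \<le> n * (fiber_pressure \<theta>u + 3 * \<epsilon>)" using R by (simp add: algebra_simps)
          then show ?thesis using A(1) by (intro mult_left_mono) auto
        qed
        finally show ?thesis .
      qed
      have lower: "?l \<le> likelihood \<theta> n y" if "\<theta> \<in> ?V" for \<theta>
      proof -
        have \<theta>: "dist \<theta> \<theta>m < t \<theta>m" using that by (simp add: dist_commute)
        have "n * (fiber_pressure \<theta>m - \<epsilon>) \<le> log_partition \<theta>m n y" using elim by (simp add: less_divide_eq mult.commute less_imp_le)
        then have "n * (fiber_pressure \<theta>m - 3 * \<epsilon>) \<le> log_partition \<theta>m n y - (n * \<epsilon> + comparison_error \<delta> M n y)" using R by (simp add: algebra_simps)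
        then have "exp (n * (fiber_pressure \<theta>m - 3 * \<epsilon>)) \<le> exp (log_partition \<theta>m n y - (n * \<epsilon> + comparison_error \<delta> M n y))" by simp
        also have "\<dots> \<le> A * likelihood \<theta> n y"
          by (rule likelihood_bounds(2)[OF A(1) A(2) A(3) d(1) less_imp_le[OF M] t(2)[OF \<theta>] t(3)[OF \<theta>]])
        finally show ?thesis using A(1) by (simp add: divide_le_eq mult.commute)
      qed
      let ?N = "\<integral>\<theta>. indicator (- U) \<theta> * likelihood \<theta> n y \<partial>\<pi>0"
      have post: "posterior \<pi>0 \<mu> L T n (- U) y = ?N / (\<integral>\<theta>. likelihood \<theta> n y \<partial>\<pi>0)"
        unfolding posterior_def Zn_def likelihood_def ..
      have N: "0 \<le> ?N" "?N \<le> ?u"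
      proof -
        show "0 \<le> ?N" using I0 by (intro integral_nonneg_AE AE_I2) simp
        have u0: "0 \<le> ?u" using A(1) by simp
        \<comment> \<open>The likelihood is not known to be measurable in \<theta>; if the integrand
          is not integrable, the integral is \<open>0\<close> by convention.\<close>
        show "?N \<le> ?u"
        proof (cases "integrable \<pi>0 (\<lambda>\<theta>. indicator (- U) \<theta> * likelihood \<theta> n y)")
          case True
          have "?N \<le> (\<integral>\<theta>. ?u \<partial>\<pi>0)"
            by (rule integral_mono[OF True]) (use upper u0 in \<open>auto simp: indicator_def\<close>)
          then show ?thesis using p.prob_space by simp
        qed (use u0 in \<open>simp add: not_integrable_integral_eq\<close>)
      qed
      show ?case
      proof (cases "integrable \<pi>0 (\<lambda>\<theta>. likelihood \<theta> n y)")
        case False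
        \<comment> \<open>both integrals of a non-integrable function and division by zero give \<open>0\<close>\<close>
        then show ?thesis using A(1) v unfolding post by (simp add: not_integrable_integral_eq)
      next
        case True
        have l0: "0 < ?l" using A(1) by simp
        \<comment> \<open>The normalising integral is bounded below by its part over the ball around
          the maximiser, whose prior mass \<open>v\<close> is positive by full support.\<close>
        have "v * ?l = (\<integral>\<theta>. indicator ?V \<theta> * ?l \<partial>\<pi>0)" using V_sets by (simp add: v_def)
        also have "\<dots> \<le> (\<integral>\<theta>. likelihood \<theta> n y \<partial>\<pi>0)"
        proof (rule integral_mono[OF _ True])
          show "integrable \<pi>0 (\<lambda>\<theta>. indicator ?V \<theta> * ?l)" using V_sets by (simp add: p.emeasure_eq_measure)
          show "indicator ?V \<theta> * ?l \<le> likelihood \<theta> n y" for \<theta> using lower I0 by (auto simp: indicator_def simp del: mem_ball)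
        qed
        finally have Zl: "v * ?l \<le> (\<integral>\<theta>. likelihood \<theta> n y \<partial>\<pi>0)" .
        have "?N / (\<integral>\<theta>. likelihood \<theta> n y \<partial>\<pi>0) \<le> ?u / (v * ?l)"
          by (rule frac_le) (use N Zl v l0 A(1) in auto)
        also have "\<dots> = A\<^sup>2 / v * (exp (n * (fiber_pressure \<theta>u + 3 * \<epsilon>)) / exp (n * (fiber_pressure \<theta>m - 3 * \<epsilon>)))"
          by (simp add: power2_eq_square)
        also have "exp (n * (fiber_pressure \<theta>u + 3 * \<epsilon>)) / exp (n * (fiber_pressure \<theta>m - 3 * \<epsilon>)) = exp (- 2 * \<epsilon>) ^ n"
          unfolding gap exp_diff[symmetric] exp_of_nat_mult[symmetric] by (simp add: algebra_simps)
        finally have "?N / (\<integral>\<theta>. likelihood \<theta> n y \<partial>\<pi>0) \<le> A\<^sup>2 / v * exp (- 2 * \<epsilon>) ^ n" .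
        moreover have "0 \<le> ?N / (\<integral>\<theta>. likelihood \<theta> n y \<partial>\<pi>0)"
          by (rule divide_nonneg_nonneg[OF N(1)]) (use I0 in \<open>auto intro: integral_nonneg_AE\<close>)
        ultimately show ?thesis unfolding post by simp
      qed
    qed
    have "(\<lambda>n. A\<^sup>2 / v * exp (- 2 * \<epsilon>) ^ n) \<longlonglongrightarrow> A\<^sup>2 / v * 0"
      using e by (intro tendsto_intros LIMSEQ_realpow_zero) auto
    then have lim: "(\<lambda>n. A\<^sup>2 / v * exp (- 2 * \<epsilon>) ^ n) \<longlonglongrightarrow> 0" by simp
    show ?case
      by (rule tendsto_sandwich[OF _ _ tendsto_const lim]) (use bound in \<open>auto elim: eventually_mono\<close>)
  qed
qed

end

theorem theorem1p2:
  fixes X :: "(int \<Rightarrow> 'a::finite) set"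
    and \<nu> :: "'y::polish_space measure" and T :: "'y \<Rightarrow> 'y"
    and f :: "'p::metric_space \<Rightarrow> (int \<Rightarrow> 'a) \<Rightarrow> real" and r :: real
    and \<mu> :: "'p \<Rightarrow> (int \<Rightarrow> 'a) measure"
    and \<pi>0 :: "'p measure"
    and L :: "'p \<Rightarrow> (int \<Rightarrow> 'a) \<Rightarrow> 'y \<Rightarrow> real"
    and Lstar :: "'y \<Rightarrow> real" and \<rho> :: "real \<Rightarrow> 'y \<Rightarrow> real"
    and U :: "'p set"
  assumes \<nu>_prob: "prob_space \<nu>" and \<nu>_sets: "sets \<nu> = sets borel"
    and T_meas: "T \<in> borel_measurable borel"
    and T_inv: "\<forall>A\<in>sets borel. measure \<nu> (T -` A) = measure \<nu> A"
    and T_ergodic: "\<forall>A\<in>sets borel. T -` A = A \<longrightarrow> measure \<nu> A = 0 \<or> measure \<nu> A = 1"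
    and X_SFT: "mixing_SFT X"
    and \<Theta>_compact: "compact (UNIV :: 'p set)"
    and f_reg: "regular_family r X f"
    and \<mu>_gibbs: "\<forall>\<theta>. gibbs_measure X (f \<theta>) (\<mu> \<theta>)"
    and L_cont: "\<forall>\<theta> x y. x \<in> X \<longrightarrow> (\<forall>\<epsilon>>0. \<exists>\<delta>>0. \<forall>\<theta>' x' y'. x' \<in> X \<and>
                 dist \<theta>' \<theta> < \<delta> \<and> dX x' x < \<delta> \<and> dist y' y < \<delta> \<longrightarrow>
                 \<bar>L \<theta>' x' y' - L \<theta> x y\<bar> < \<epsilon>)"
    and Lstar_meas: "Lstar \<in> borel_measurable borel"
    and Lstar_bound: "\<forall>\<theta> x y. x \<in> X \<longrightarrow> \<bar>L \<theta> x y\<bar> \<le> Lstar y"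
    and Lstar_int: "integrable \<nu> Lstar"
    and \<rho>_meas: "\<forall>\<delta>>0. \<rho> \<delta> \<in> borel_measurable borel"
    and \<rho>_pos: "\<forall>\<delta>>0. \<forall>y. \<rho> \<delta> y > 0"
    and \<rho>_bound: "\<forall>\<delta>>0. \<forall>\<theta> \<theta>' x x' y. x \<in> X \<and> x' \<in> X \<and>
                 max (dist \<theta> \<theta>') (dX x x') \<le> \<delta> \<longrightarrow> \<bar>L \<theta> x y - L \<theta>' x' y\<bar> \<le> \<rho> \<delta> y"
    and \<rho>_lim: "((\<lambda>\<delta>. \<integral>\<^sup>+ y. ennreal (\<rho> \<delta> y) \<partial>\<nu>) \<longlongrightarrow> 0) (at_right 0)"
    and \<pi>0_prob: "prob_space \<pi>0" and \<pi>0_sets: "sets \<pi>0 = sets borel"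
    and \<pi>0_full: "\<forall>W. open W \<and> W \<noteq> {} \<longrightarrow> emeasure \<pi>0 W > 0"
    and U_open: "open U"
    and U_min: "{\<theta>. \<forall>\<theta>'. rate_V X \<nu> T f L \<theta> \<le> rate_V X \<nu> T f L \<theta>'} \<subseteq> U"
  shows "AE y in \<nu>. ((\<lambda>n. posterior \<pi>0 \<mu> L T n (- U) y) \<longlonglongrightarrow> 0)"
proof -
  interpret prob_space \<nu> by (rule \<nu>_prob)
  interpret gibbs_posterior \<nu> T X f r \<mu> L Lstar \<rho>
  proof unfold_locales
    show "sets \<nu> = sets borel" "T \<in> borel_measurable borel" by fact+
    show "measure \<nu> (T -` A) = measure \<nu> A" if "A \<in> sets borel" for A using T_inv that by (rule bspec)
    show "measure \<nu> A = 0 \<or> measure \<nu> A = 1" if "A \<in> sets borel" "T -` A = A" for A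
      using bspec[OF T_ergodic that(1)] that(2) by (rule mp)
    show "mixing_SFT X" "compact (UNIV :: 'p set)" "regular_family r X f" "integrable \<nu> Lstar"
      "((\<lambda>\<delta>. \<integral>\<^sup>+ y. ennreal (\<rho> \<delta> y) \<partial>\<nu>) \<longlongrightarrow> 0) (at_right 0)" by fact+
    show "gibbs_measure X (f \<theta>) (\<mu> \<theta>)" for \<theta> using \<mu>_gibbs by (rule spec)
    show "\<exists>\<delta>>0. \<forall>\<theta>' x' y'. x' \<in> X \<and> dist \<theta>' \<theta> < \<delta> \<and> dX x' x < \<delta> \<and> dist y' y < \<delta> \<longrightarrow> \<bar>L \<theta>' x' y' - L \<theta> x y\<bar> < \<epsilon>"
      if "x \<in> X" "\<epsilon> > 0" for x \<epsilon> \<theta> y by (rule L_cont[rule_format, OF that])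
    show "\<bar>L \<theta> x y\<bar> \<le> Lstar y" if "x \<in> X" for x \<theta> y by (rule Lstar_bound[rule_format, OF that])
    show "\<rho> \<delta> \<in> borel_measurable borel" if "\<delta> > 0" for \<delta> by (rule \<rho>_meas[rule_format, OF that])
    show "\<rho> \<delta> y > 0" if "\<delta> > 0" for \<delta> y by (rule \<rho>_pos[rule_format, OF that])
    show "\<bar>L \<theta> x y - L \<theta>' x' y\<bar> \<le> \<rho> \<delta> y"
      if "\<delta> > 0" "x \<in> X" "x' \<in> X" "max (dist \<theta> \<theta>') (dX x x') \<le> \<delta>" for \<delta> x x' \<theta> \<theta>' y
      by (rule \<rho>_bound[rule_format, OF that(1) conjI[OF that(2) conjI[OF that(3,4)]]])
  qed
  show ?thesis
    by (rule posterior_converges[OF \<pi>0_prob \<pi>0_sets \<pi>0_full[rule_format, OF conjI] U_open U_min])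
qed

end
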